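(* Let $\theta$ be an irrational number, let $\gamma\in C(\mathbb{T})$ be a non-negative function and let $Y=\{z\in\mathbb{T}:\gamma(z)=0\}$. If $\mu$ is a complex regular Borel measure on $\mathbb{T}$ which satisfies $$\int_{\mathbb{T}}f(e^{-2\pi i\theta}z)\,d\mu(z)=\int_{\mathbb{T}}f(z)\,d\mu(z)$$ for all $f\in\widetilde{C_0(\mathbb{T}\setminus Y)}$, and $\sigma(f)=\int_{\mathbb{T}}f(z)\,d\mu(z)$ for $f\in C(\mathbb{T})$, then $\sigma\circ\Phi$ is a bounded tracial linear functional on $A_{\theta,\gamma}$. Conversely, every bounded tracial linear functional on $A_{\theta,\gamma}$ is given in this way.
   Context: $\mathbb{T}$ is the unit circle. $A_{\theta,\gamma}=C^*(x,w)$ is the universal unital $C^*$-algebra generated by elements $x,w$ subject to the relations $w^*w=ww^*=1$, $x^*x=\gamma(w)$, $xx^*=\gamma(e^{-2\pi i\theta}w)$, $xw=e^{-2\pi i\theta}wx$ (functions of the unitary $w$ are taken by continuous functional calculus). The spectrum of $w$ is $\mathbb{T}$, so $C^*(w)$ is identified with $C(\mathbb{T})$. For $t\in[0,1]$ let $\rho_t$ be the automorphism of $A_{\theta,\gamma}$ with $\rho_t(x)=e^{2\pi it}x$, $\rho_t(w)=w$; then $\Phi(a)=\int_0^1\rho_t(a)\,dt$ is a faithful conditional expectation of $A_{\theta,\gamma}$ onto $C^*(w)\cong C(\mathbb{T})$. $C_0(\mathbb{T}\setminus Y)$ is identified with the functions in $C(\mathbb{T})$ vanishing on $Y$, and $\widetilde{C_0(\mathbb{T}\setminus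 Y)}=C_0(\mathbb{T}\setminus Y)+\mathbb{C}1\subseteq C(\mathbb{T})$ is its unitization. A linear functional $\psi$ is tracial if $\psi(ab)=\psi(ba)$ for all $a,b$. *)

theory Defs
  imports "HOL-Analysis.Analysis" "HOL-Algebra.Module" "HOL-Algebra.Subrings"
begin

section \<open>Unital C*-algebras\<close>

text \<open>
  The algebra $A_{\theta,\gamma}$ depends on the parameters and its universal property quantifies
  over C*-algebras, so C*-algebras are structures with explicit carriers, extending the records of
  HOL-Algebra.
\<close>

definition complex_ring :: "complex ring" where
  "complex_ring = \<lparr>carrier = UNIV, mult = (*), one = 1, ring.zero = 0, add = (+)\<rparr>"

record 'a cstar = "(complex, 'a) module" +
  star :: "'a \<Rightarrow> 'a"
  nrm :: "'a \<Rightarrow> real"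

text \<open>The locale \<open>Metric_space\<close> requires non-negativity and symmetry off the carrier as well,
  hence the default value.\<close>

definition cdist :: "'a cstar \<Rightarrow> 'a \<Rightarrow> 'a \<Rightarrow> real" where
  "cdist A a b = (if a \<in> carrier A \<and> b \<in> carrier A then nrm A (a \<ominus>\<^bsub>A\<^esub> b) else 0)"

text \<open>The zero algebra is admitted.\<close>

locale unital_cstar_algebra =
  ring A + Module.module complex_ring A for A :: "'a cstar" (structure) +
  assumes mult_smult_left:
      "\<lbrakk>a \<in> carrier A; b \<in> carrier A\<rbrakk> \<Longrightarrow> (c \<odot> a) \<otimes> b = c \<odot> (a \<otimes> b)"
    and mult_smult_right:
      "\<lbrakk>a \<in> carrier A; b \<in> carrier A\<rbrakk> \<Longrightarrow> a \<otimes> (c \<odot> b) = c \<odot> (a \<otimes> b)"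
    and star_closed: "a \<in> carrier A \<Longrightarrow> star A a \<in> carrier A"
    and star_star: "a \<in> carrier A \<Longrightarrow> star A (star A a) = a"
    and star_add:
      "\<lbrakk>a \<in> carrier A; b \<in> carrier A\<rbrakk> \<Longrightarrow> star A (a \<oplus> b) = star A a \<oplus> star A b"
    and star_smult: "a \<in> carrier A \<Longrightarrow> star A (c \<odot> a) = cnj c \<odot> star A a"
    and star_mult:
      "\<lbrakk>a \<in> carrier A; b \<in> carrier A\<rbrakk> \<Longrightarrow> star A (a \<otimes> b) = star A b \<otimes> star A a"
    and nrm_nonneg: "a \<in> carrier A \<Longrightarrow> 0 \<le> nrm A a"
    and nrm_eq_0_iff: "a \<in> carrier A \<Longrightarrow> nrm A a = 0 \<longleftrightarrow> a = \<zero>"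
    and nrm_triangle:
      "\<lbrakk>a \<in> carrier A; b \<in> carrier A\<rbrakk> \<Longrightarrow> nrm A (a \<oplus> b) \<le> nrm A a + nrm A b"
    and nrm_smult: "a \<in> carrier A \<Longrightarrow> nrm A (c \<odot> a) = cmod c * nrm A a"
    and nrm_mult:
      "\<lbrakk>a \<in> carrier A; b \<in> carrier A\<rbrakk> \<Longrightarrow> nrm A (a \<otimes> b) \<le> nrm A a * nrm A b"
    and cstar_identity: "a \<in> carrier A \<Longrightarrow> nrm A (star A a \<otimes> a) = (nrm A a)\<^sup>2"
    and complete: "Metric_space.mcomplete (carrier A) (cdist A)"

definition star_hom :: "'a cstar \<Rightarrow> 'b cstar \<Rightarrow> ('a \<Rightarrow> 'b) \<Rightarrow> bool" where
  "star_hom A B h \<longleftrightarrow>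
     h \<in> ring_hom A B \<and>
     (\<forall>c. \<forall>a\<in>carrier A. h (c \<odot>\<^bsub>A\<^esub> a) = c \<odot>\<^bsub>B\<^esub> h a) \<and>
     (\<forall>a\<in>carrier A. h (star A a) = star B (h a))"

definition cstar_subalgebra :: "'a cstar \<Rightarrow> 'a set \<Rightarrow> bool" where
  "cstar_subalgebra A D \<longleftrightarrow>
     subring D A \<and>
     (\<forall>c. \<forall>a\<in>D. c \<odot>\<^bsub>A\<^esub> a \<in> D) \<and>
     (\<forall>a\<in>D. star A a \<in> D) \<and>
     closedin (Metric_space.mtopology (carrier A) (cdist A)) D"

definition cstar_generated :: "'a cstar \<Rightarrow> 'a set \<Rightarrow> 'a set" where
  "cstar_generated A S = \<Inter>{D. cstar_subalgebra A D \<and> S \<subseteq> D}"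


section \<open>Continuous functional calculus\<close>

definition C_alg :: "complex set \<Rightarrow> (complex \<Rightarrow> complex) cstar" where
  "C_alg K = \<lparr>
     carrier = {f \<in> extensional K. continuous_on K f},
     mult = (\<lambda>f g. \<lambda>z\<in>K. f z * g z),
     one = (\<lambda>z\<in>K. 1),
     ring.zero = (\<lambda>z\<in>K. 0),
     add = (\<lambda>f g. \<lambda>z\<in>K. f z + g z),
     smult = (\<lambda>c f. \<lambda>z\<in>K. c * f z),
     star = (\<lambda>f. \<lambda>z\<in>K. cnj (f z)),
     nrm = (\<lambda>f. Sup (insert 0 ((\<lambda>z. cmod (f z)) ` K)))\<rparr>"

definition cspectrum :: "'a cstar \<Rightarrow> 'a \<Rightarrow> complex set" where
  "cspectrum A a = {c. a \<ominus>\<^bsub>A\<^esub> (c \<odot>\<^bsub>A\<^esub> \<one>\<^bsub>A\<^esub>) \<notin> Units A}"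

text \<open>For a normal element \<open>a\<close> and a function \<open>f\<close> continuous on its spectrum, this is \<open>f(a)\<close>:
  the image of \<open>f\<close> under the unique unital *-homomorphism from the continuous functions on the
  spectrum that maps the identity function to \<open>a\<close>.\<close>

definition cfc :: "'a cstar \<Rightarrow> 'a \<Rightarrow> (complex \<Rightarrow> complex) \<Rightarrow> 'a" where
  "cfc A a f = (THE b. \<exists>h. star_hom (C_alg (cspectrum A a)) A h \<and>
                           h (\<lambda>z\<in>cspectrum A a. z) = a \<and>
                           h (restrict f (cspectrum A a)) = b)"


section \<open>The algebra $A_{\theta,\gamma}$\<close>

abbreviation circle :: "complex set" where
  "circle \<equiv> sphere 0 1"

abbreviation rot :: "real \<Rightarrow> complex" where
  "rot \<theta> \<equiv> exp (- 2 * of_real pi * \<i> * of_real \<theta>)"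

definition A_relations ::
    "real \<Rightarrow> (complex \<Rightarrow> real) \<Rightarrow> 'a cstar \<Rightarrow> 'a \<Rightarrow> 'a \<Rightarrow> bool" where
  "A_relations \<theta> \<gamma> B x w \<longleftrightarrow>
     x \<in> carrier B \<and> w \<in> carrier B \<and>
     star B w \<otimes>\<^bsub>B\<^esub> w = \<one>\<^bsub>B\<^esub> \<and> w \<otimes>\<^bsub>B\<^esub> star B w = \<one>\<^bsub>B\<^esub> \<and>
     star B x \<otimes>\<^bsub>B\<^esub> x = cfc B w (\<lambda>z. of_real (\<gamma> z)) \<and>
     x \<otimes>\<^bsub>B\<^esub> star B x = cfc B (rot \<theta> \<odot>\<^bsub>B\<^esub> w) (\<lambda>z. of_real (\<gamma> z)) \<and>
     x \<otimes>\<^bsub>B\<^esub> w = rot \<theta> \<odot>\<^bsub>B\<^esub> (w \<otimes>\<^bsub>B\<^esub> x)"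

text \<open>
  \<open>A\<close> is the universal unital C*-algebra generated by \<open>x\<close> and \<open>w\<close> subject to the relations.  HOL
  cannot quantify over all types inside a formula, so the test algebras \<open>B\<close> have their carriers in
  the type \<open>nat \<Rightarrow> complex\<close>, of cardinality continuum.  This is no restriction: a C*-algebra generated
  by two elements is separable, so it has at most that cardinality and is isomorphic to one on a
  subset of this type, and an arbitrary \<open>B\<close> may be replaced by its C*-subalgebra generated by
  \<open>x'\<close> and \<open>w'\<close>.
\<close>

definition is_A ::
    "real \<Rightarrow> (complex \<Rightarrow> real) \<Rightarrow> 'a cstar \<Rightarrow> 'a \<Rightarrow> 'a \<Rightarrow> bool" where
  "is_A \<theta> \<gamma> A x w \<longleftrightarrow>
     unital_cstar_algebra A \<and>
     A_relations \<theta> \<gamma> A x w \<and>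
     cstar_generated A {x, w} = carrier A \<and>
     (\<forall>(B :: (nat \<Rightarrow> complex) cstar) x' w'.
        unital_cstar_algebra B \<and> A_relations \<theta> \<gamma> B x' w' \<longrightarrow>
        (\<exists>h. star_hom A B h \<and> h x = x' \<and> h w = w'))"


section \<open>The conditional expectation\<close>

definition gauge_aut :: "'a cstar \<Rightarrow> 'a \<Rightarrow> 'a \<Rightarrow> real \<Rightarrow> 'a \<Rightarrow> 'a" where
  "gauge_aut A x w t = (THE r. r \<in> extensional (carrier A) \<and>
     star_hom A A r \<and> bij_betw r (carrier A) (carrier A) \<and>
     r x = exp (2 * of_real pi * \<i> * of_real t) \<odot>\<^bsub>A\<^esub> x \<and> r w = w)"

text \<open>Riemann integral over $[0,1]$ in norm.\<close>

definition has_integral01 :: "'a cstar \<Rightarrow> (real \<Rightarrow> 'a) \<Rightarrow> 'a \<Rightarrow> bool" where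
  "has_integral01 A g b \<longleftrightarrow> b \<in> carrier A \<and>
     (\<forall>e>0. \<exists>d>0. \<forall>p. p tagged_division_of {0..1} \<and> (\<lambda>t. ball t d) fine p \<longrightarrow>
        nrm A (finsum A (\<lambda>(t, K). complex_of_real (measure lborel K) \<odot>\<^bsub>A\<^esub> g t) p \<ominus>\<^bsub>A\<^esub> b) < e)"

definition cond_exp :: "'a cstar \<Rightarrow> 'a \<Rightarrow> 'a \<Rightarrow> 'a \<Rightarrow> 'a" where
  "cond_exp A x w a = (THE b. has_integral01 A (\<lambda>t. gauge_aut A x w t a) b)"

text \<open>The identification of $C^*(w)$ with $C(\mathbb{T})$: the inverse of $f \mapsto f(w)$.\<close>

definition to_function :: "'a cstar \<Rightarrow> 'a \<Rightarrow> 'a \<Rightarrow> complex \<Rightarrow> complex" where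
  "to_function A w b = (THE f. f \<in> carrier (C_alg circle) \<and> cfc A w f = b)"

definition bounded_tracial_functional :: "'a cstar \<Rightarrow> ('a \<Rightarrow> complex) \<Rightarrow> bool" where
  "bounded_tracial_functional A \<psi> \<longleftrightarrow>
     (\<forall>a\<in>carrier A. \<forall>b\<in>carrier A. \<psi> (a \<oplus>\<^bsub>A\<^esub> b) = \<psi> a + \<psi> b) \<and>
     (\<forall>c. \<forall>a\<in>carrier A. \<psi> (c \<odot>\<^bsub>A\<^esub> a) = c * \<psi> a) \<and>
     (\<exists>C. \<forall>a\<in>carrier A. cmod (\<psi> a) \<le> C * nrm A a) \<and>
     (\<forall>a\<in>carrier A. \<forall>b\<in>carrier A. \<psi> (a \<otimes>\<^bsub>A\<^esub> b) = \<psi> (b \<otimes>\<^bsub>A\<^esub> a))"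


section \<open>Complex measures\<close>

text \<open>The library has no complex measures.  Here \<open>M\<close> only supplies the space and the
  $\sigma$-algebra, and a complex measure is a set function whose values off \<open>sets M\<close> are
  irrelevant.\<close>

definition complex_measure :: "'s measure \<Rightarrow> ('s set \<Rightarrow> complex) \<Rightarrow> bool" where
  "complex_measure M \<mu> \<longleftrightarrow>
     (\<forall>F :: nat \<Rightarrow> 's set. range F \<subseteq> sets M \<and> disjoint_family F \<longrightarrow>
        (\<lambda>n. \<mu> (F n)) sums \<mu> (\<Union>n. F n))"

definition total_variation :: "'s measure \<Rightarrow> ('s set \<Rightarrow> complex) \<Rightarrow> 's set \<Rightarrow> ennreal" where
  "total_variation M \<mu> E =
     (SUP F \<in> {F :: nat \<Rightarrow> 's set. range F \<subseteq> sets M \<and> disjoint_family F \<and> (\<Union>n. F n) = E}.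
        \<Sum>n. ennreal (cmod (\<mu> (F n))))"

text \<open>The positive part $\lambda^+(E) = \sup\{\lambda(B) : B \subseteq E\}$ of the Jordan
  decomposition of a real measure; the negative part is the positive part of $-\lambda$.\<close>

definition jordan_pos :: "'s measure \<Rightarrow> ('s set \<Rightarrow> real) \<Rightarrow> 's measure" where
  "jordan_pos M \<nu> =
     measure_of (space M) (sets M) (\<lambda>E. SUP B \<in> {B \<in> sets M. B \<subseteq> E}. ennreal (\<nu> B))"

definition complex_integral :: "'s measure \<Rightarrow> ('s set \<Rightarrow> complex) \<Rightarrow> ('s \<Rightarrow> complex) \<Rightarrow> complex" where
  "complex_integral M \<mu> f =
     (integral\<^sup>L (jordan_pos M (\<lambda>E. Re (\<mu> E))) f - integral\<^sup>L (jordan_pos M (\<lambda>E. - Re (\<mu> E))) f) +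
     \<i> * (integral\<^sup>L (jordan_pos M (\<lambda>E. Im (\<mu> E))) f - integral\<^sup>L (jordan_pos M (\<lambda>E. - Im (\<mu> E))) f)"

abbreviation circle_borel :: "complex measure" where
  "circle_borel \<equiv> restrict_space borel circle"

definition regular_complex_measure :: "(complex set \<Rightarrow> complex) \<Rightarrow> bool" where
  "regular_complex_measure \<mu> \<longleftrightarrow>
     complex_measure circle_borel \<mu> \<and>
     (\<forall>E\<in>sets circle_borel.
        total_variation circle_borel \<mu> E =
          (INF U\<in>{U. openin (top_of_set circle) U \<and> E \<subseteq> U}. total_variation circle_borel \<mu> U) \<and>
        total_variation circle_borel \<mu> E =
          (SUP K\<in>{K. compact K \<and> K \<subseteq> E}. total_variation circle_borel \<mu> K))"

definition C0_unitization :: "complex set \<Rightarrow> (complex \<Rightarrow> complex) set" where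
  "C0_unitization Y =
     {\<lambda>z. g z + c | g c. continuous_on circle g \<and> (\<forall>z\<in>Y. g z = 0)}"

definition invariant_on_unitization ::
    "real \<Rightarrow> complex set \<Rightarrow> (complex set \<Rightarrow> complex) \<Rightarrow> bool" where
  "invariant_on_unitization \<theta> Y \<mu> \<longleftrightarrow>
     (\<forall>f\<in>C0_unitization Y.
        complex_integral circle_borel \<mu> (\<lambda>z. f (rot \<theta> * z)) = complex_integral circle_borel \<mu> f)"

end

theory Submission
  imports Defs "HOL-Probability.Probability"
begin

text \<open>
  Let \<open>T a\<close> be the function on the circle that corresponds to the conditional expectation of \<open>a\<close>.
  The elements \<open>f(w) x\<^sup>k\<close> and \<open>f(w) (x\<^sup>*)\<^sup>k\<close> span a dense subspace, and \<open>T\<close> annihilates those with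
  \<open>k > 0\<close>.  Hence traciality of \<open>\<sigma> \<circ> T\<close> need only be checked against the generators \<open>w\<close>, \<open>x\<close> and
  \<open>x\<^sup>*\<close>.  As \<open>x\<^sup>* x = \<gamma>(w)\<close> and \<open>x f(w) = f(q w) x\<close> with \<open>q = exp (- 2 \<pi> i \<theta>)\<close>, this amounts to
  \<open>\<sigma> ((f \<gamma>)(q \<cdot>)) = \<sigma> (f \<gamma>)\<close>, and the multiples of \<open>\<gamma>\<close> are dense in the functions that vanish on \<open>Y\<close>.
  Conversely, a trace \<open>\<psi>\<close> satisfies \<open>\<psi>(a) = \<psi>(w a w\<^sup>*)\<close>, which is \<open>q\<^sup>n \<psi>(a)\<close> up to the sign of \<open>n\<close>
  if \<open>a\<close> has degree \<open>n\<close>; as \<open>\<theta>\<close> is irrational, \<open>\<psi>\<close> vanishes in non-zero degree, so \<open>\<psi>\<close> is determined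
  by its restriction to the functions of \<open>w\<close>, which is given by a measure by the Riesz representation theorem.

  The gauge automorphisms come from the universal property.  That \<open>f \<mapsto> f(w)\<close> is isometric is
  seen in a representation by weighted shifts on the square-summable sequences over an orbit of
  the rotation.
\<close>

section \<open>Unital C*-algebras\<close>

text \<open>Two circularities shape the proof. The relations are stated with \<open>cfc\<close>,
  which lives on the spectrum of \<open>w\<close>, and that this spectrum is the circle is seen only
  in a concrete model. So \<open>fc\<close> is built for every unitary on the whole circle, from a
  norm bound that does not mention the spectrum, and is matched with \<open>cfc\<close> once the
  spectrum is known. Moreover, the universal property speaks only of algebras inside
  \<open>nat \<Rightarrow> complex\<close>; the operator algebra and \<open>A\<close> itself are
  carried there by injections, given by matrix coefficients and by distances to a countable dense
  set. Star-homomorphisms come without continuity. Contractivity has to be derived, which is the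
  purpose of the square roots and unitaries. The isometry of the calculus is needed three times: for
  the spectrum of \<open>w\<close>, for inverting the calculus in \<open>to_function\<close>, and
  for the closedness of its range, through which the conditional expectation extends from monomials
  to limits. Integrals against complex measures are defined by Jordan parts. They are compared with
  other representations through linear combinations of finite measures that vanish on all
  sets.\<close>

context unital_cstar_algebra
begin

text \<open>The interpretation of the scalar ring shadows the ring facts about the algebra itself, so
  these are declared anew.\<close>

lemma ring_A: "ring A" and monoid_A: "Group.monoid A" and semiring_A: "semiring A"
  and abelian_group_A: "abelian_group A" and abelian_monoid_A: "abelian_monoid A"
  by unfold_locales

lemmas m_assoc = monoid.m_assoc[OF monoid_A]
  and m_closed = monoid.m_closed[OF monoid_A]
  and one_closed = monoid.one_closed[OF monoid_A]
  and l_one = monoid.l_one[OF monoid_A]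
  and r_one = monoid.r_one[OF monoid_A]
  and l_distr = semiring.l_distr[OF semiring_A]
  and r_distr = semiring.r_distr[OF semiring_A]
  and l_null = semiring.l_null[OF semiring_A]
  and r_null = semiring.r_null[OF semiring_A]
  and a_assoc = abelian_monoid.a_assoc[OF abelian_monoid_A]
  and a_comm = abelian_monoid.a_comm[OF abelian_monoid_A]
  and a_lcomm = abelian_monoid.a_lcomm[OF abelian_monoid_A]
  and a_closed = abelian_monoid.a_closed[OF abelian_monoid_A]
  and zero_closed = abelian_monoid.zero_closed[OF abelian_monoid_A]
  and r_neg = abelian_group.r_neg[OF abelian_group_A]
  and l_neg = abelian_group.l_neg[OF abelian_group_A]
  and finsum_insert = abelian_monoid.finsum_insert[OF abelian_monoid_A]
  and finsum_closed = abelian_monoid.finsum_closed[OF abelian_monoid_A]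
  and minus_equality = abelian_group.minus_equality[OF abelian_group_A]

lemmas a_ac = a_assoc a_comm a_lcomm

lemma scalar_closed [simp, intro]: "a \<in> carrier A \<Longrightarrow> c \<odot> a \<in> carrier A"
  using smult_closed[of c a] by (simp add: complex_ring_def)

lemma scalar_add_left: "a \<in> carrier A \<Longrightarrow> (c + d) \<odot> a = c \<odot> a \<oplus> d \<odot> a"
  using smult_l_distr[of c d a] by (simp add: complex_ring_def)

lemma scalar_add_right:
  "\<lbrakk>a \<in> carrier A; b \<in> carrier A\<rbrakk> \<Longrightarrow> c \<odot> (a \<oplus> b) = c \<odot> a \<oplus> c \<odot> b"
  using smult_r_distr[of c a b] by (simp add: complex_ring_def)

lemma scalar_mult: "a \<in> carrier A \<Longrightarrow> c \<odot> (d \<odot> a) = (c * d) \<odot> a"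
  using smult_assoc1[of c d a] by (simp add: complex_ring_def)

lemma scalar_one [simp]: "a \<in> carrier A \<Longrightarrow> 1 \<odot> a = a"
  using smult_one[of a] by (simp add: complex_ring_def)

lemma scalar_zero_left [simp]: "a \<in> carrier A \<Longrightarrow> 0 \<odot> a = \<zero>"
  using smult_l_null[of a] by (simp add: complex_ring_def)

lemma scalar_zero_right [simp]: "c \<odot> \<zero> = \<zero>"
  using smult_r_null[of c] by (simp add: complex_ring_def)

lemma scalar_uminus: "a \<in> carrier A \<Longrightarrow> (- c) \<odot> a = \<ominus> (c \<odot> a)"
  by (metis minus_equality scalar_closed scalar_add_left left_minus scalar_zero_left)

lemma minus_eq_scalar: "\<lbrakk>a \<in> carrier A; b \<in> carrier A\<rbrakk> \<Longrightarrow> a \<ominus> b = a \<oplus> (-1) \<odot> b"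
  by (simp add: scalar_uminus a_minus_def)

lemma uminus_eq_scalar: "a \<in> carrier A \<Longrightarrow> \<ominus> a = (-1) \<odot> a"
  by (simp add: scalar_uminus)

lemma scalar_minus_right:
  "\<lbrakk>a \<in> carrier A; b \<in> carrier A\<rbrakk> \<Longrightarrow> c \<odot> (a \<ominus> b) = c \<odot> a \<ominus> c \<odot> b"
  by (simp add: minus_eq_scalar scalar_add_right scalar_mult)

lemma scalar_minus_left: "a \<in> carrier A \<Longrightarrow> (c - d) \<odot> a = c \<odot> a \<ominus> d \<odot> a"
  using scalar_add_left[of a c "- d"] by (simp add: scalar_uminus a_minus_def)

lemmas star_closed' [simp, intro] = star_closed
lemmas star_star' [simp] = star_star

lemma star_zero [simp]: "star A \<zero> = \<zero>"
  by (metis star_smult complex_cnj_zero scalar_zero_left zero_closed star_closed)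

lemma star_one [simp]: "star A \<one> = \<one>"
  by (metis star_closed star_mult star_star l_one one_closed r_one)

lemma star_minus:
  "\<lbrakk>a \<in> carrier A; b \<in> carrier A\<rbrakk> \<Longrightarrow> star A (a \<ominus> b) = star A a \<ominus> star A b"
  by (simp add: minus_eq_scalar star_add star_smult)

lemma nrm_zero [simp]: "nrm A \<zero> = 0"
  by (simp add: nrm_eq_0_iff)

text \<open>The C*-identity and submultiplicativity give one inequality after cancelling a norm; the
  other is the same inequality for \<open>star A a\<close>.\<close>

lemma nrm_star [simp]:
  assumes a: "a \<in> carrier A"
  shows "nrm A (star A a) = nrm A a"
proof -
  have le: "nrm A b \<le> nrm A (star A b)" if b: "b \<in> carrier A" for b
  proof (cases "nrm A b = 0")
    case False
    have "nrm A b * nrm A b \<le> nrm A (star A b) * nrm A b"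
      using cstar_identity[OF b] nrm_mult[of "star A b" b] b by (simp add: power2_eq_square)
    then show ?thesis using False nrm_nonneg[OF b] by simp
  qed (use b nrm_nonneg in simp)
  show ?thesis using le[OF a] le[of "star A a"] a by simp
qed

text \<open>As \<open>\<one>\<close> equals \<open>star A \<one> \<otimes> \<one>\<close>, its norm
  is its own square. Only an inequality is claimed because the norm is 0 in the zero
  algebra.\<close>

lemma nrm_one_le: "nrm A \<one> \<le> 1"
proof -
  have "nrm A \<one> = (nrm A \<one>)\<^sup>2" using cstar_identity[of \<one>] by simp
  then show ?thesis by (metis nrm_nonneg one_closed power2_eq_square mult_cancel_left1 order_refl zero_le_one)
qed

lemma nrm_minus_commute:
  assumes "a \<in> carrier A" "b \<in> carrier A"
  shows "nrm A (a \<ominus> b) = nrm A (b \<ominus> a)"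
proof -
  have "b \<ominus> a = (-1) \<odot> (a \<ominus> b)"
    using assms by (simp add: minus_eq_scalar scalar_add_right scalar_mult a_comm)
  then show ?thesis using assms by (simp add: nrm_smult)
qed

lemma diff_split:
  assumes "a \<in> carrier A" "b \<in> carrier A" "c \<in> carrier A"
  shows "a \<ominus> c = (a \<ominus> b) \<oplus> (b \<ominus> c)"
proof -
  have "(a \<ominus> b) \<oplus> (b \<ominus> c) = a \<oplus> (\<ominus> b \<oplus> b) \<oplus> \<ominus> c"
    using assms by (simp add: a_minus_def a_assoc del: l_neg)
  then show ?thesis using assms by (simp add: a_minus_def l_neg)
qed

lemma add_minus_cancel:
  assumes "a \<in> carrier A" "b \<in> carrier A"
  shows "(a \<oplus> b) \<ominus> a = b"
  using assms by (simp add: a_minus_def a_comm[of a b] a_assoc r_neg)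

lemma nrm_triangle_diff:
  assumes "a \<in> carrier A" "b \<in> carrier A" "c \<in> carrier A"
  shows "nrm A (a \<ominus> c) \<le> nrm A (a \<ominus> b) + nrm A (b \<ominus> c)"
  using nrm_triangle[of "a \<ominus> b" "b \<ominus> c"] diff_split[OF assms] assms by simp

lemma minus_zero [simp]: "a \<in> carrier A \<Longrightarrow> a \<ominus> \<zero> = a"
  by (simp add: a_minus_def)

lemma minus_self [simp]: "a \<in> carrier A \<Longrightarrow> a \<ominus> a = \<zero>"
  by (simp add: a_minus_def r_neg)

lemma nrm_le_diff:
  assumes "a \<in> carrier A" "b \<in> carrier A"
  shows "nrm A a \<le> nrm A (a \<ominus> b) + nrm A b"
  using nrm_triangle_diff[of a b \<zero>] assms by simp

lemma eq_iff_nrm: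
  assumes "a \<in> carrier A" "b \<in> carrier A"
  shows "a = b \<longleftrightarrow> nrm A (a \<ominus> b) = 0"
  using assms by (simp add: nrm_eq_0_iff)

lemma add_minus_add:
  assumes "a \<in> carrier A" "b \<in> carrier A" "a' \<in> carrier A" "b' \<in> carrier A"
  shows "(a \<oplus> b) \<ominus> (a' \<oplus> b') = (a \<ominus> a') \<oplus> (b \<ominus> b')"
proof -
  have "(a \<oplus> b) \<oplus> ((-1) \<odot> a' \<oplus> (-1) \<odot> b') = (a \<oplus> (-1) \<odot> a') \<oplus> (b \<oplus> (-1) \<odot> b')"
    using assms by (metis a_assoc a_closed a_lcomm scalar_closed)
  then show ?thesis using assms by (simp add: minus_eq_scalar scalar_add_right)
qed

lemma nrm_add_minus_add:
  assumes "a \<in> carrier A" "b \<in> carrier A" "a' \<in> carrier A" "b' \<in> carrier A"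
  shows "nrm A ((a \<oplus> b) \<ominus> (a' \<oplus> b')) \<le> nrm A (a \<ominus> a') + nrm A (b \<ominus> b')"
  using add_minus_add[OF assms] nrm_triangle[of "a \<ominus> a'" "b \<ominus> b'"] assms by simp

lemma mult_minus_left:
  assumes "a \<in> carrier A" "b \<in> carrier A" "c \<in> carrier A"
  shows "(a \<ominus> b) \<otimes> c = a \<otimes> c \<ominus> b \<otimes> c"
  using assms by (simp add: minus_eq_scalar l_distr mult_smult_left)

lemma mult_minus_right:
  assumes "a \<in> carrier A" "b \<in> carrier A" "c \<in> carrier A"
  shows "c \<otimes> (a \<ominus> b) = c \<otimes> a \<ominus> c \<otimes> b"
  using assms by (simp add: minus_eq_scalar r_distr mult_smult_right)

lemma mult_minus_mult:
  assumes "a \<in> carrier A" "b \<in> carrier A" "a' \<in> carrier A" "b' \<in> carrier A"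
  shows "a \<otimes> b \<ominus> a' \<otimes> b' = a \<otimes> (b \<ominus> b') \<oplus> (a \<ominus> a') \<otimes> b'"
  using assms diff_split[of "a \<otimes> b" "a \<otimes> b'" "a' \<otimes> b'"]
  by (simp add: mult_minus_left mult_minus_right)

lemma nrm_mult_minus_mult:
  assumes "a \<in> carrier A" "b \<in> carrier A" "a' \<in> carrier A" "b' \<in> carrier A"
  shows "nrm A (a \<otimes> b \<ominus> a' \<otimes> b') \<le> nrm A a * nrm A (b \<ominus> b') + nrm A (a \<ominus> a') * nrm A b'"
proof -
  have "nrm A (a \<otimes> b \<ominus> a' \<otimes> b') \<le> nrm A (a \<otimes> (b \<ominus> b')) + nrm A ((a \<ominus> a') \<otimes> b')"
    using assms nrm_triangle by (simp add: mult_minus_mult)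
  also have "\<dots> \<le> nrm A a * nrm A (b \<ominus> b') + nrm A (a \<ominus> a') * nrm A b'"
    using assms by (intro add_mono nrm_mult) auto
  finally show ?thesis .
qed

lemma nrm_finsum_le:
  assumes "finite I" "\<And>i. i \<in> I \<Longrightarrow> f i \<in> carrier A"
  shows "nrm A (finsum A f I) \<le> (\<Sum>i\<in>I. nrm A (f i))"
  using assms
proof (induction I rule: finite_induct)
  case (insert i I)
  have "nrm A (finsum A f (insert i I)) = nrm A (f i \<oplus> finsum A f I)"
    using insert by (subst finsum_insert) auto
  also have "\<dots> \<le> nrm A (f i) + nrm A (finsum A f I)"
    using insert by (intro nrm_triangle finsum_closed) auto
  finally show ?case using insert by auto
qed simp

subsection \<open>Limits\<close>

text \<open>Membership in the carrier is built in, so that limits can be manipulated without side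
  conditions.\<close>

definition conv :: "(nat \<Rightarrow> 'a) \<Rightarrow> 'a \<Rightarrow> bool" where
  "conv s a \<longleftrightarrow> (\<forall>n. s n \<in> carrier A) \<and> a \<in> carrier A \<and> (\<lambda>n. nrm A (s n \<ominus> a)) \<longlonglongrightarrow> 0"

lemma convD: "conv s a \<Longrightarrow> s n \<in> carrier A" "conv s a \<Longrightarrow> a \<in> carrier A"
  "conv s a \<Longrightarrow> (\<lambda>n. nrm A (s n \<ominus> a)) \<longlonglongrightarrow> 0"
  by (auto simp: conv_def)

lemma conv_approx:
  assumes "conv s a" "e > 0"
  shows "\<exists>n. nrm A (a \<ominus> s n) < e"
proof -
  have "\<forall>\<^sub>F n in sequentially. nrm A (s n \<ominus> a) < e"
    by (rule order_tendstoD(2)[OF convD(3)[OF assms(1)] assms(2)])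
  then obtain n where "nrm A (s n \<ominus> a) < e" using eventually_happens' sequentially_bot by blast
  then show ?thesis using nrm_minus_commute[OF convD(1,2)[OF assms(1)], of n] by auto
qed

lemma convI_bound:
  assumes "\<And>n. s n \<in> carrier A" "a \<in> carrier A"
    "\<And>n. nrm A (s n \<ominus> a) \<le> g n" "g \<longlonglongrightarrow> 0"
  shows "conv s a"
  unfolding conv_def
proof (intro conjI allI)
  show "(\<lambda>n. nrm A (s n \<ominus> a)) \<longlonglongrightarrow> 0"
    by (rule tendsto_sandwich[OF _ _ tendsto_const assms(4)]) (use assms nrm_nonneg in auto)
qed (use assms in auto)

lemma convI_approx:
  assumes "a \<in> carrier A" "\<And>n. s n \<in> carrier A" "\<And>n. nrm A (a \<ominus> s n) < inverse (real (Suc n))"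
  shows "conv s a"
  by (rule convI_bound[OF assms(2,1) _ LIMSEQ_inverse_real_of_nat])
    (metis assms less_imp_le nrm_minus_commute)

lemma conv_const [intro]: "a \<in> carrier A \<Longrightarrow> conv (\<lambda>_. a) a"
  by (simp add: conv_def)

lemma conv_add:
  assumes "conv s a" "conv t b"
  shows "conv (\<lambda>n. s n \<oplus> t n) (a \<oplus> b)"
proof (rule convI_bound)
  show "(\<lambda>n. nrm A (s n \<ominus> a) + nrm A (t n \<ominus> b)) \<longlonglongrightarrow> 0"
    using tendsto_add[OF convD(3)[OF assms(1)] convD(3)[OF assms(2)]] by simp
qed (use assms convD nrm_add_minus_add in auto)

lemma conv_nrm:
  assumes "conv s a"
  shows "(\<lambda>n. nrm A (s n)) \<longlonglongrightarrow> nrm A a"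
proof (rule Lim_null_comparison[THEN LIM_zero_cancel])
  show "\<forall>\<^sub>F n in sequentially. norm (nrm A (s n) - nrm A a) \<le> nrm A (s n \<ominus> a)"
  proof (rule always_eventually, rule)
    fix n
    note c = convD(1,2)[OF assms]
    show "norm (nrm A (s n) - nrm A a) \<le> nrm A (s n \<ominus> a)"
      using nrm_le_diff[of "s n" a] nrm_le_diff[of a "s n"] nrm_minus_commute[of a "s n"] c by simp
  qed
qed (use assms convD in blast)

lemma conv_mult:
  assumes "conv s a" "conv t b"
  shows "conv (\<lambda>n. s n \<otimes> t n) (a \<otimes> b)"
proof (rule convI_bound)
  show "(\<lambda>n. nrm A (s n) * nrm A (t n \<ominus> b) + nrm A (s n \<ominus> a) * nrm A b) \<longlonglongrightarrow> 0"
    using tendsto_add[OF tendsto_mult[OF conv_nrm[OF assms(1)] convD(3)[OF assms(2)]]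
        tendsto_mult[OF convD(3)[OF assms(1)] tendsto_const[of "nrm A b"]]] by simp
qed (use assms convD nrm_mult_minus_mult in auto)

lemma conv_smult:
  assumes "conv s a"
  shows "conv (\<lambda>n. c \<odot> s n) (c \<odot> a)"
proof (rule convI_bound)
  show "(\<lambda>n. cmod c * nrm A (s n \<ominus> a)) \<longlonglongrightarrow> 0"
    using tendsto_mult[OF tendsto_const[of "cmod c"] convD(3)[OF assms]] by simp
qed (use assms convD in \<open>auto simp: nrm_smult simp flip: scalar_minus_right\<close>)

lemma conv_minus: "conv s a \<Longrightarrow> conv t b \<Longrightarrow> conv (\<lambda>n. s n \<ominus> t n) (a \<ominus> b)"
  using conv_add[OF _ conv_smult[of t b "-1"]] convD by (simp add: minus_eq_scalar)

lemma conv_star: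
  assumes "conv s a"
  shows "conv (\<lambda>n. star A (s n)) (star A a)"
proof (rule convI_bound)
  show "(\<lambda>n. nrm A (s n \<ominus> a)) \<longlonglongrightarrow> 0" using convD(3)[OF assms] .
qed (use assms convD in \<open>auto simp flip: star_minus\<close>)

lemma conv_unique:
  assumes "conv s a" "conv s b"
  shows "a = b"
proof -
  have "conv (\<lambda>n. s n \<ominus> s n) (a \<ominus> b)" using assms by (intro conv_minus)
  then have "(\<lambda>n. 0) \<longlonglongrightarrow> nrm A (a \<ominus> b)"
    using conv_nrm convD(1)[OF assms(1)] by fastforce
  then have "nrm A (a \<ominus> b) = 0" by (simp add: LIMSEQ_const_iff)
  then show ?thesis using eq_iff_nrm convD assms by blast
qed

lemma Metric_space_cdist: "Metric_space (carrier A) (cdist A)"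
proof
  fix a b c
  show "0 \<le> cdist A a b" by (simp add: cdist_def nrm_nonneg)
  show "cdist A a b = cdist A b a" by (simp add: cdist_def nrm_minus_commute)
  assume a: "a \<in> carrier A" and b: "b \<in> carrier A"
  then show "(cdist A a b = 0) = (a = b)" by (simp add: cdist_def flip: eq_iff_nrm)
  assume "c \<in> carrier A"
  with a b show "cdist A a c \<le> cdist A a b + cdist A b c"
    by (simp add: cdist_def nrm_triangle_diff)
qed

lemma limitin_iff_conv:
  assumes "\<And>n. s n \<in> carrier A"
  shows "limitin (Metric_space.mtopology (carrier A) (cdist A)) s a sequentially \<longleftrightarrow> conv s a"
proof -
  interpret M: Metric_space "carrier A" "cdist A" by (rule Metric_space_cdist)
  show ?thesis
    using assms nrm_nonneg
    by (auto simp: M.limit_metric_sequentially conv_def LIMSEQ_iff cdist_def)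
qed

lemma closedin_iff_conv:
  "closedin (Metric_space.mtopology (carrier A) (cdist A)) D \<longleftrightarrow>
     D \<subseteq> carrier A \<and> (\<forall>s a. (\<forall>n. s n \<in> D) \<and> conv s a \<longrightarrow> a \<in> D)"
proof -
  interpret M: Metric_space "carrier A" "cdist A" by (rule Metric_space_cdist)
  have "range s \<subseteq> D \<and> limitin M.mtopology s a sequentially \<longleftrightarrow> (\<forall>n. s n \<in> D) \<and> conv s a"
    if "D \<subseteq> carrier A" for s a
    using limitin_iff_conv[of s a] that by (auto simp: image_subset_iff subset_iff)
  then show ?thesis
    unfolding M.metric_closedin_iff_sequentially_closed by (intro conj_cong refl) simp
qed

lemma Cauchy_conv:
  assumes "\<And>n. s n \<in> carrier A"
    and "\<And>e. e > 0 \<Longrightarrow> \<exists>N. \<forall>m\<ge>N. \<forall>n\<ge>N. nrm A (s m \<ominus> s n) < e"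
  shows "\<exists>a. conv s a"
proof -
  interpret M: Metric_space "carrier A" "cdist A" by (rule Metric_space_cdist)
  have "M.MCauchy s"
    unfolding M.MCauchy_def using assms by (auto simp: cdist_def)
  then obtain a where "limitin M.mtopology s a sequentially"
    using complete unfolding M.mcomplete_def by blast
  then show ?thesis using limitin_iff_conv assms by blast
qed

text \<open>Completeness in the form used for fixed-point iterations: telescoping leaves a geometric
  tail.\<close>

lemma geometric_conv:
  assumes s: "\<And>n. s n \<in> carrier A"
    and le: "\<And>n. nrm A (s (Suc n) \<ominus> s n) \<le> C * k ^ n" and k: "0 \<le> k" "k < 1"
  shows "\<exists>a. conv s a"
proof (rule Cauchy_conv[OF s])
  have C: "0 \<le> C" using le[of 0] nrm_nonneg[of "s 1 \<ominus> s 0"] s by simp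
  have tail: "nrm A (s (n + m) \<ominus> s n) \<le> C * k ^ n / (1 - k)" for n m
  proof -
    have "nrm A (s (n + m) \<ominus> s n) \<le> (\<Sum>i<m. C * k ^ (n + i))"
    proof (induction m)
      case (Suc m)
      have "nrm A (s (n + Suc m) \<ominus> s n) \<le> nrm A (s (Suc (n + m)) \<ominus> s (n + m)) + nrm A (s (n + m) \<ominus> s n)"
        using nrm_triangle_diff s by simp
      then show ?case using Suc le[of "n + m"] by simp
    qed (simp add: s)
    also have "\<dots> = C * k ^ n * (\<Sum>i<m. k ^ i)"
      by (simp add: sum_distrib_left power_add mult.assoc)
    also have "\<dots> \<le> C * k ^ n * (1 / (1 - k))"
    proof (intro mult_left_mono)
      have "(\<Sum>i<m. k ^ i) = (1 - k ^ m) / (1 - k)"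
        using k by (simp add: sum_gp_strict)
      then show "(\<Sum>i<m. k ^ i) \<le> 1 / (1 - k)"
        using k by (simp add: divide_right_mono)
    qed (use C k in simp)
    finally show ?thesis by simp
  qed
  fix e :: real
  assume e: "e > 0"
  have "(\<lambda>n. C * k ^ n / (1 - k)) \<longlonglongrightarrow> C * 0 / (1 - k)"
    by (intro tendsto_intros LIMSEQ_realpow_zero k) (use k in auto)
  then have "\<forall>\<^sub>F n in sequentially. C * k ^ n / (1 - k) < e / 2"
    using e by (intro order_tendstoD(2)[where y = 0]) auto
  then obtain N where N: "C * k ^ N / (1 - k) < e / 2"
    using eventually_sequentially by auto
  have "nrm A (s m \<ominus> s n) < e" if "m \<ge> N" "n \<ge> N" for m n
  proof -
    have *: "nrm A (s j \<ominus> s N) < e / 2" if "j \<ge> N" for j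
      using le_less_trans[OF tail[of N "j - N"] N] that by simp
    have "nrm A (s m \<ominus> s n) \<le> nrm A (s m \<ominus> s N) + nrm A (s N \<ominus> s n)"
      using nrm_triangle_diff s by simp
    then show ?thesis using *[OF that(1)] *[OF that(2)] nrm_minus_commute[OF s s, of N n] by linarith
  qed
  then show "\<exists>N. \<forall>m\<ge>N. \<forall>n\<ge>N. nrm A (s m \<ominus> s n) < e" by blast
qed

subsection \<open>Generated subalgebras\<close>

text \<open>The elements with property \<open>P\<close> form a C*-subalgebra containing
  \<open>S\<close>; negatives, which a subring needs, are multiples by -1, and closedness is the
  case \<open>lim\<close>.\<close>

lemma cstar_generated_induct [consumes 3, case_names gen one add mult star smult lim]:
  assumes gen: "cstar_generated A S = carrier A" and S: "S \<subseteq> carrier A" and a: "a \<in> carrier A"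
    and P: "\<And>a. a \<in> S \<Longrightarrow> P a" "P \<one>"
      "\<And>a b. \<lbrakk>a \<in> carrier A; b \<in> carrier A; P a; P b\<rbrakk> \<Longrightarrow> P (a \<oplus> b)"
      "\<And>a b. \<lbrakk>a \<in> carrier A; b \<in> carrier A; P a; P b\<rbrakk> \<Longrightarrow> P (a \<otimes> b)"
      "\<And>a. \<lbrakk>a \<in> carrier A; P a\<rbrakk> \<Longrightarrow> P (star A a)"
      "\<And>c a. \<lbrakk>a \<in> carrier A; P a\<rbrakk> \<Longrightarrow> P (c \<odot> a)"
      "\<And>s a. \<lbrakk>conv s a; \<And>n. P (s n)\<rbrakk> \<Longrightarrow> P a"
  shows "P a"
proof -
  let ?D = "{a \<in> carrier A. P a}"
  have um: "P (\<ominus> a)" if "a \<in> carrier A" "P a" for a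
    using P(6)[of a "-1"] that by (simp add: uminus_eq_scalar)
  have "subring ?D A"
    by (rule ring.subringI[OF ring_A]) (use P um m_closed one_closed a_closed in auto)
  then have "cstar_subalgebra A ?D"
    unfolding cstar_subalgebra_def closedin_iff_conv
    using P convD by (auto)
  then have "carrier A \<subseteq> ?D"
    using gen S P(1) unfolding cstar_generated_def by blast
  then show ?thesis using a by blast
qed

text \<open>Scalar multiples only have to be approximable from \<open>M\<close>. This admits a
  countable \<open>M\<close>, with scalars restricted to the complex rationals.\<close>

lemma dense_generated:
  assumes gen: "cstar_generated A S = carrier A" and a: "a \<in> carrier A"
    and M: "M \<subseteq> carrier A" "S \<subseteq> M" "\<one> \<in> M"
      "\<And>a b. \<lbrakk>a \<in> M; b \<in> M\<rbrakk> \<Longrightarrow> a \<oplus> b \<in> M"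
      "\<And>a b. \<lbrakk>a \<in> M; b \<in> M\<rbrakk> \<Longrightarrow> a \<otimes> b \<in> M"
      "\<And>a. a \<in> M \<Longrightarrow> star A a \<in> M"
      "\<And>c a e. \<lbrakk>a \<in> M; e > 0\<rbrakk> \<Longrightarrow> \<exists>b\<in>M. nrm A (c \<odot> a \<ominus> b) < e"
  shows "\<exists>s. (\<forall>n. s n \<in> M) \<and> conv s a"
proof -
  define P where "P a \<longleftrightarrow> (\<exists>s. (\<forall>n. s n \<in> M) \<and> conv s a)" for a
  \<comment> \<open>\<open>PI\<close> and \<open>PD\<close> trade being a limit of elements of
    \<open>M\<close> for epsilon-approximation, in which scalar multiples and limits of limits need
    no diagonal sequences.\<close>
  have PI: "P a" if "a \<in> carrier A" "\<And>e. e > 0 \<Longrightarrow> \<exists>b\<in>M. nrm A (a \<ominus> b) < e" for a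
  proof -
    have "\<forall>n. \<exists>b. b \<in> M \<and> nrm A (a \<ominus> b) < inverse (real (Suc n))" using that by (simp add: Bex_def)
    from choice[OF this] obtain s where s: "\<forall>n. s n \<in> M \<and> nrm A (a \<ominus> s n) < inverse (real (Suc n))" ..
    then have "conv s a" using that(1) M(1) by (intro convI_approx) auto
    then show ?thesis unfolding P_def using s by (intro exI[of _ s]) simp
  qed
  have PD: "\<exists>b\<in>M. nrm A (a \<ominus> b) < e" if "P a" "e > 0" for a e
  proof -
    obtain s where s: "\<And>n. s n \<in> M" "conv s a" using \<open>P a\<close> unfolding P_def by auto
    then show ?thesis using conv_approx[OF s(2) \<open>e > 0\<close>] by blast
  qed
  have Pin: "P b" if "b \<in> M" for b
    unfolding P_def using that M(1) by (intro exI[of _ "\<lambda>_. b"]) auto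
  have S: "S \<subseteq> carrier A" using M by blast
  have "P a" using gen S a
  proof (induction rule: cstar_generated_induct)
    case (add a b)
    then obtain s t where "\<And>n. s n \<in> M" "conv s a" "\<And>n. t n \<in> M" "conv t b"
      unfolding P_def by auto
    then show ?case unfolding P_def by (intro exI[of _ "\<lambda>n. s n \<oplus> t n"] conjI conv_add) (auto intro: M(4))
  next
    case (mult a b)
    then obtain s t where "\<And>n. s n \<in> M" "conv s a" "\<And>n. t n \<in> M" "conv t b"
      unfolding P_def by auto
    then show ?case unfolding P_def by (intro exI[of _ "\<lambda>n. s n \<otimes> t n"] conjI conv_mult) (auto intro: M(5))
  next
    case (star a)
    then obtain s where "\<And>n. s n \<in> M" "conv s a" unfolding P_def by auto
    then show ?case unfolding P_def by (intro exI[of _ "\<lambda>n. star A (s n)"] conjI conv_star) (auto intro: M(6))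
  next
    case (smult c a)
    show ?case
    proof (rule PI)
      fix e :: real assume e: "e > 0"
      have "e / (2 * (cmod c + 1)) > 0" using e by (simp add: add_nonneg_pos)
      from PD[OF \<open>P a\<close> this] obtain b where b: "b \<in> M" "nrm A (a \<ominus> b) < e / (2 * (cmod c + 1))" by blast
      obtain b' where b': "b' \<in> M" "nrm A (c \<odot> b \<ominus> b') < e / 2" using M(7)[OF b(1), of "e / 2"] e by auto
      have bc: "b \<in> carrier A" "b' \<in> carrier A" using b b' M(1) by auto
      have "nrm A (c \<odot> a \<ominus> b') \<le> nrm A (c \<odot> a \<ominus> c \<odot> b) + nrm A (c \<odot> b \<ominus> b')"
        using smult bc by (intro nrm_triangle_diff) auto
      also have "nrm A (c \<odot> a \<ominus> c \<odot> b) = cmod c * nrm A (a \<ominus> b)"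
        using smult bc by (simp add: nrm_smult flip: scalar_minus_right)
      also have "cmod c * nrm A (a \<ominus> b) \<le> (cmod c + 1) * (e / (2 * (cmod c + 1)))"
        using b(2) smult bc nrm_nonneg[of "a \<ominus> b"] by (intro mult_mono) auto
      also have "\<dots> = e / 2"
      proof -
        have "cmod c + 1 > 0" by (simp add: add_nonneg_pos)
        then show ?thesis by (simp add: divide_simps)
      qed
      finally show "\<exists>b\<in>M. nrm A (c \<odot> a \<ominus> b) < e" using b' by (intro bexI[of _ b']) auto
    qed (use smult in auto)
  next
    case (lim s a)
    show ?case
    proof (rule PI)
      fix e :: real assume e: "e > 0"
      obtain n where n: "nrm A (a \<ominus> s n) < e / 2"
        using conv_approx[OF lim(1), of "e / 2"] e by auto
      obtain b where b: "b \<in> M" "nrm A (s n \<ominus> b) < e / 2" using PD[OF lim(2), of "e/2" n] e by auto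
      have "nrm A (a \<ominus> b) \<le> nrm A (a \<ominus> s n) + nrm A (s n \<ominus> b)"
        using lim convD b M(1) by (intro nrm_triangle_diff) auto
      then show "\<exists>b\<in>M. nrm A (a \<ominus> b) < e"
        using b n by (intro bexI[of _ b]) auto
    qed (use lim convD in auto)
  qed (use Pin M in auto)
  then show ?thesis unfolding P_def .
qed

subsection \<open>Unitaries and square roots\<close>

lemma nrm_unitary_le:
  assumes "u \<in> carrier A" "star A u \<otimes> u = \<one>"
  shows "nrm A u \<le> 1"
proof -
  have "(nrm A u)\<^sup>2 \<le> 1" using cstar_identity[OF assms(1)] assms(2) nrm_one_le by simp
  then show ?thesis using abs_square_le_1 by force
qed

text \<open>The square root is \<open>1 - r\<close>, where \<open>r\<close> is the fixed point of the contraction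
  \<open>r \<mapsto> (a\<^sup>2 + r\<^sup>2) / 2\<close> on a ball of radius less than one.\<close>

lemma self_adjoint_sqrt:
  assumes a: "a \<in> carrier A" "star A a = a" "nrm A a < 1"
  shows "\<exists>s\<in>carrier A. star A s = s \<and> s \<otimes> a = a \<otimes> s \<and> s \<otimes> s = \<one> \<ominus> a \<otimes> a"
proof -
  define q where "q = (nrm A a)\<^sup>2"
  have q: "0 \<le> q" "q < 1" using a nrm_nonneg[OF a(1)] by (auto simp: q_def abs_square_less_1)
  \<comment> \<open>The smaller root of \<open>k\<^sup>2 - 2 * k + q = 0\<close>. It makes
    \<open>F\<close> map the ball of radius \<open>k\<close> into itself, and \<open>k < 1\<close>
    is also the contraction constant there.\<close>
  define k where "k = 1 - sqrt (1 - q)"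
  have k: "0 \<le> k" "k < 1" using q by (auto simp: k_def)
  have kk: "(q + k * k) / 2 = k"
  proof -
    have "sqrt (1 - q) * sqrt (1 - q) = 1 - q" using q by simp
    then have "q + k * k = 2 * k" unfolding k_def by argo
    then show ?thesis by simp
  qed
  define F where "F r = (1/2) \<odot> (a \<otimes> a \<oplus> r \<otimes> r)" for r
  \<comment> \<open>Self-adjointness and commutation with \<open>a\<close> are carried along the
    iteration because both are wanted for the limit.\<close>
  define R where "R = {r \<in> carrier A. star A r = r \<and> r \<otimes> a = a \<otimes> r \<and> nrm A r \<le> k}"
  have FR: "F r \<in> R" if r: "r \<in> R" for r
  proof -
    have r': "r \<in> carrier A" "star A r = r" "r \<otimes> a = a \<otimes> r" "nrm A r \<le> k" using r R_def by auto
    have "r \<otimes> r \<otimes> a = a \<otimes> (r \<otimes> r)" using r' a by (metis m_assoc)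
    then have "F r \<otimes> a = a \<otimes> F r"
      using r' a by (simp add: F_def mult_smult_left mult_smult_right l_distr r_distr m_assoc)
    moreover have "nrm A (F r) \<le> k"
    proof -
      have "nrm A (F r) = nrm A (a \<otimes> a \<oplus> r \<otimes> r) / 2" using r' a by (simp add: F_def nrm_smult)
      also have "nrm A (a \<otimes> a \<oplus> r \<otimes> r) \<le> nrm A (a \<otimes> a) + nrm A (r \<otimes> r)"
        using r' a by (simp add: nrm_triangle)
      also have "\<dots> \<le> nrm A a * nrm A a + nrm A r * nrm A r"
        using r' a by (intro add_mono nrm_mult) auto
      also have "\<dots> \<le> q + k * k"
        using r' k nrm_nonneg by (auto simp: q_def power2_eq_square intro!: mult_mono)
      finally show ?thesis using kk by simp
    qed
    ultimately show ?thesis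
      using r' a by (simp add: R_def F_def star_smult star_add star_mult)
  qed
  define r where "r n = (F ^^ n) \<zero>" for n
  have rR: "r n \<in> R" for n
    by (induction n) (use FR k a in \<open>auto simp: r_def R_def\<close>)
  then have rc: "r n \<in> carrier A" "nrm A (r n) \<le> k" for n by (auto simp: R_def)
  have step: "r (Suc n) = F (r n)" for n by (simp add: r_def)
  have contr: "nrm A (F x \<ominus> F y) \<le> k * nrm A (x \<ominus> y)" if "x \<in> R" "y \<in> R" for x y
  proof -
    have x: "x \<in> carrier A" "nrm A x \<le> k" and y: "y \<in> carrier A" "nrm A y \<le> k"
      using that by (auto simp: R_def)
    have "F x \<ominus> F y = (1/2) \<odot> (x \<otimes> x \<ominus> y \<otimes> y)"
      using x y a by (simp add: F_def flip: scalar_minus_right) (simp add: add_minus_add)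
    then have "nrm A (F x \<ominus> F y) = nrm A (x \<otimes> x \<ominus> y \<otimes> y) / 2" using x y by (simp add: nrm_smult)
    also have "\<dots> \<le> (nrm A x * nrm A (x \<ominus> y) + nrm A (x \<ominus> y) * nrm A y) / 2"
      using nrm_mult_minus_mult x y by simp
    also have "\<dots> \<le> (k * nrm A (x \<ominus> y) + nrm A (x \<ominus> y) * k) / 2"
      using x y nrm_nonneg[of "x \<ominus> y"] by (intro divide_right_mono add_mono mult_left_mono mult_right_mono) auto
    finally show ?thesis by simp
  qed
  have "nrm A (r (Suc n) \<ominus> r n) \<le> nrm A (r 1) * k ^ n" for n
  proof (induction n)
    case 0
    then show ?case using rc by (simp add: r_def F_def a)
  next
    case (Suc n)
    have "nrm A (r (Suc (Suc n)) \<ominus> r (Suc n)) \<le> k * nrm A (r (Suc n) \<ominus> r n)"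
      using contr[OF rR rR] step by metis
    also have "\<dots> \<le> k * (nrm A (r 1) * k ^ n)" using Suc k by (intro mult_left_mono) auto
    finally show ?case by (simp add: mult_ac)
  qed
  from geometric_conv[OF rc(1) this k] obtain t where t: "conv r t" by blast
  have tc: "t \<in> carrier A" using t convD by blast
  have "conv (\<lambda>n. r (Suc n)) t" using t LIMSEQ_Suc by (auto simp: conv_def)
  moreover have "conv (\<lambda>n. r (Suc n)) (F t)"
    unfolding step F_def using a t by (intro conv_smult conv_add conv_mult conv_const) auto
  ultimately have tF: "t = F t" using conv_unique by blast
  have "conv r (star A t)" using conv_star[OF t] rR by (simp add: R_def)
  then have ts: "star A t = t" using conv_unique t by blast
  have "conv (\<lambda>n. r n \<otimes> a) (t \<otimes> a)" using t a by (intro conv_mult conv_const)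
  moreover have "conv (\<lambda>n. a \<otimes> r n) (a \<otimes> t)" using t a by (intro conv_mult conv_const)
  ultimately have ta: "t \<otimes> a = a \<otimes> t" using rR conv_unique by (simp add: R_def)
  have "t \<oplus> t = a \<otimes> a \<oplus> t \<otimes> t"
  proof -
    have "t \<oplus> t = 2 \<odot> t" using tc scalar_add_left[of t 1 1] by simp
    also have "\<dots> = 2 \<odot> F t" using tF by simp
    also have "\<dots> = a \<otimes> a \<oplus> t \<otimes> t" using tc a by (simp add: F_def scalar_mult)
    finally show ?thesis .
  qed
  then have tt: "t \<otimes> t = t \<oplus> t \<ominus> a \<otimes> a"
    using add_minus_cancel[of "a \<otimes> a" "t \<otimes> t"] tc a by simp
  have "(\<one> \<ominus> t) \<otimes> (\<one> \<ominus> t) = \<one> \<ominus> t \<ominus> (t \<ominus> t \<otimes> t)"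
    using tc by (simp add: mult_minus_left mult_minus_right)
  also have "\<dots> = \<one> \<ominus> a \<otimes> a"
    unfolding tt using tc a(1) by algebra
  finally show ?thesis
    using tc a ts ta
    by (intro bexI[of _ "\<one> \<ominus> t"]) (auto simp: star_minus mult_minus_left mult_minus_right)
qed

text \<open>With \<open>s\<close> the square root of \<open>\<one> \<ominus> a \<otimes> a\<close>,
  take \<open>u = a \<oplus> \<i> \<odot> s\<close>. The cross terms of
  \<open>star A u \<otimes> u\<close> cancel because \<open>s\<close> commutes with
  \<open>a\<close>.\<close>

lemma self_adjoint_is_Re_unitary:
  assumes a: "a \<in> carrier A" "star A a = a" "nrm A a < 1"
  shows "\<exists>u\<in>carrier A. star A u \<otimes> u = \<one> \<and> a = (1/2) \<odot> (u \<oplus> star A u)"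
proof -
  obtain s where s: "s \<in> carrier A" "star A s = s" "s \<otimes> a = a \<otimes> s" "s \<otimes> s = \<one> \<ominus> a \<otimes> a"
    using self_adjoint_sqrt[OF a] by blast
  let ?u = "a \<oplus> \<i> \<odot> s"
  have su: "star A ?u = a \<oplus> (-\<i>) \<odot> s" using a s by (simp add: star_add star_smult)
  have "star A ?u \<otimes> ?u = a \<otimes> a \<oplus> s \<otimes> s \<oplus> (\<i> \<odot> (a \<otimes> s) \<oplus> (-\<i>) \<odot> (a \<otimes> s))"
    unfolding su using a(1) s(1-3)
    by (simp add: l_distr r_distr mult_smult_left mult_smult_right scalar_mult scalar_add_right a_ac)
  also have "\<dots> = \<one>"
    using a s by (simp flip: scalar_add_left) (simp add: a_minus_def a_ac r_neg)
  finally have 1: "star A ?u \<otimes> ?u = \<one>" .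
  have "?u \<oplus> star A ?u = (a \<oplus> a) \<oplus> (\<i> \<odot> s \<oplus> (-\<i>) \<odot> s)"
    unfolding su using a s by (simp add: a_ac)
  also have "\<dots> = 2 \<odot> a" using a s scalar_add_left[of a 1 1] by (simp flip: scalar_add_left)
  finally have "(1/2) \<odot> (?u \<oplus> star A ?u) = a" using a s by (simp add: scalar_mult)
  with 1 show ?thesis using a s by (intro bexI[of _ ?u]) auto
qed

end

section \<open>Star-homomorphisms and their automatic contractivity\<close>

lemma star_homD:
  assumes "star_hom A B h"
  shows "\<And>a. a \<in> carrier A \<Longrightarrow> h a \<in> carrier B"
    "\<And>a b. \<lbrakk>a \<in> carrier A; b \<in> carrier A\<rbrakk> \<Longrightarrow> h (a \<oplus>\<^bsub>A\<^esub> b) = h a \<oplus>\<^bsub>B\<^esub> h b"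
    "\<And>a b. \<lbrakk>a \<in> carrier A; b \<in> carrier A\<rbrakk> \<Longrightarrow> h (a \<otimes>\<^bsub>A\<^esub> b) = h a \<otimes>\<^bsub>B\<^esub> h b"
    "h \<one>\<^bsub>A\<^esub> = \<one>\<^bsub>B\<^esub>"
    "\<And>c a. a \<in> carrier A \<Longrightarrow> h (c \<odot>\<^bsub>A\<^esub> a) = c \<odot>\<^bsub>B\<^esub> h a"
    "\<And>a. a \<in> carrier A \<Longrightarrow> h (star A a) = star B (h a)"
  using assms by (auto simp: star_hom_def ring_hom_def)

lemma star_homI:
  assumes "\<And>a. a \<in> carrier A \<Longrightarrow> h a \<in> carrier B"
    "\<And>a b. \<lbrakk>a \<in> carrier A; b \<in> carrier A\<rbrakk> \<Longrightarrow> h (a \<oplus>\<^bsub>A\<^esub> b) = h a \<oplus>\<^bsub>B\<^esub> h b"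
    "\<And>a b. \<lbrakk>a \<in> carrier A; b \<in> carrier A\<rbrakk> \<Longrightarrow> h (a \<otimes>\<^bsub>A\<^esub> b) = h a \<otimes>\<^bsub>B\<^esub> h b"
    "h \<one>\<^bsub>A\<^esub> = \<one>\<^bsub>B\<^esub>"
    "\<And>c a. a \<in> carrier A \<Longrightarrow> h (c \<odot>\<^bsub>A\<^esub> a) = c \<odot>\<^bsub>B\<^esub> h a"
    "\<And>a. a \<in> carrier A \<Longrightarrow> h (star A a) = star B (h a)"
  shows "star_hom A B h"
  using assms by (auto simp: star_hom_def ring_hom_def)

lemma star_hom_compose:
  assumes "star_hom A B h" "star_hom B C k"
  shows "star_hom A C (k \<circ> h)"
  by (rule star_homI) (simp_all add: star_homD[OF assms(1)] star_homD[OF assms(2)])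

lemma star_hom_id: "star_hom A A (\<lambda>a. a)"
  by (rule star_homI) auto

lemma star_hom_minus:
  assumes "unital_cstar_algebra A" "unital_cstar_algebra B" "star_hom A B h"
    and "a \<in> carrier A" "b \<in> carrier A"
  shows "h (a \<ominus>\<^bsub>A\<^esub> b) = h a \<ominus>\<^bsub>B\<^esub> h b"
proof -
  interpret A: unital_cstar_algebra A by fact
  interpret B: unital_cstar_algebra B by fact
  show ?thesis
    using assms(4,5) by (simp add: A.minus_eq_scalar B.minus_eq_scalar star_homD[OF assms(3)])
qed

text \<open>A star-homomorphism maps unitaries to unitaries, and self-adjoint elements of the open
  unit ball are real parts of unitaries.\<close>

lemma star_hom_contractive:
  assumes "unital_cstar_algebra A" "unital_cstar_algebra B" "star_hom A B h" and a: "a \<in> carrier A"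
  shows "nrm B (h a) \<le> nrm A a"
proof -
  interpret A: unital_cstar_algebra A by fact
  interpret B: unital_cstar_algebra B by fact
  note h = star_homD[OF assms(3)]
  have unit_ball: "nrm B (h b) \<le> 1" if b: "b \<in> carrier A" "star A b = b" "nrm A b < 1" for b
  proof -
    obtain u where u: "u \<in> carrier A" "star A u \<otimes>\<^bsub>A\<^esub> u = \<one>\<^bsub>A\<^esub>" "b = (1/2) \<odot>\<^bsub>A\<^esub> (u \<oplus>\<^bsub>A\<^esub> star A u)"
      using A.self_adjoint_is_Re_unitary[OF b] by blast
    have "star B (h u) \<otimes>\<^bsub>B\<^esub> h u = \<one>\<^bsub>B\<^esub>" using u h by (metis A.star_closed)
    then have nu: "nrm B (h u) \<le> 1" using B.nrm_unitary_le u h by blast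
    have "h b = (1/2) \<odot>\<^bsub>B\<^esub> (h u \<oplus>\<^bsub>B\<^esub> star B (h u))" using u by (simp add: h)
    then have "nrm B (h b) = nrm B (h u \<oplus>\<^bsub>B\<^esub> star B (h u)) / 2"
      using u h by (simp add: B.nrm_smult)
    also have "\<dots> \<le> 1" using B.nrm_triangle[of "h u" "star B (h u)"] nu u h by simp
    finally show ?thesis .
  qed
  \<comment> \<open>Rescaling by \<open>r\<close>, slightly more than the norm, brings
    \<open>b\<close> into the open unit ball, where \<open>unit_ball\<close> applies.\<close>
  have sa: "nrm B (h b) \<le> nrm A b" if b: "b \<in> carrier A" "star A b = b" for b
  proof (rule field_le_epsilon)
    fix e :: real assume e: "e > 0"
    define r where "r = nrm A b + e"
    have r: "r > 0" using e A.nrm_nonneg[OF b(1)] by (simp add: r_def)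
    let ?c = "complex_of_real (1 / r)"
    have "nrm A b < r" using e by (simp add: r_def)
    then have "nrm A (?c \<odot>\<^bsub>A\<^esub> b) < 1" using r b by (simp add: A.nrm_smult norm_divide)
    then have "nrm B (h (?c \<odot>\<^bsub>A\<^esub> b)) \<le> 1" using b by (intro unit_ball) (auto simp: A.star_smult)
    then have "nrm B (h b) / r \<le> 1" using b h r by (simp add: B.nrm_smult norm_divide)
    then show "nrm B (h b) \<le> nrm A b + e" using r by (simp add: r_def)
  qed
  \<comment> \<open>The C*-identity reduces the general case to the self-adjoint element
    \<open>star A a \<otimes> a\<close>.\<close>
  have "(nrm B (h a))\<^sup>2 = nrm B (h (star A a \<otimes>\<^bsub>A\<^esub> a))"
    using a h B.cstar_identity[of "h a"] by simp
  also have "\<dots> \<le> nrm A (star A a \<otimes>\<^bsub>A\<^esub> a)" using a by (intro sa) (auto simp: A.star_mult)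
  also have "\<dots> = (nrm A a)\<^sup>2" using A.cstar_identity a by simp
  finally show ?thesis using A.nrm_nonneg[OF a] by (rule power2_le_imp_le)
qed

lemma star_hom_conv:
  assumes "unital_cstar_algebra A" "unital_cstar_algebra B" "star_hom A B h"
    and s: "unital_cstar_algebra.conv A s a"
  shows "unital_cstar_algebra.conv B (\<lambda>n. h (s n)) (h a)"
proof -
  interpret A: unital_cstar_algebra A by fact
  interpret B: unital_cstar_algebra B by fact
  note h = star_homD[OF assms(3)]
  show ?thesis
  proof (rule B.convI_bound[OF _ _ _ A.convD(3)[OF s]])
    show "nrm B (h (s n) \<ominus>\<^bsub>B\<^esub> h a) \<le> nrm A (s n \<ominus>\<^bsub>A\<^esub> a)" for n
      using star_hom_contractive[OF assms(1-3), of "s n \<ominus>\<^bsub>A\<^esub> a"]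
        star_hom_minus[OF assms(1-3), of "s n" a] A.convD[OF s] by simp
  qed (use h A.convD[OF s] in auto)
qed

text \<open>The elements on which both homomorphisms agree form a closed subalgebra; contractivity
  gives the closedness.\<close>

lemma star_hom_unique:
  assumes "unital_cstar_algebra A" "unital_cstar_algebra B" "star_hom A B h" "star_hom A B k"
    and "cstar_generated A S = carrier A" "S \<subseteq> carrier A" "\<And>a. a \<in> S \<Longrightarrow> h a = k a"
    and "a \<in> carrier A"
  shows "h a = k a"
proof -
  interpret A: unital_cstar_algebra A by fact
  interpret B: unital_cstar_algebra B by fact
  note h = star_homD[OF assms(3)] and k = star_homD[OF assms(4)]
  from assms(5,6,8) show ?thesis
  proof (induction rule: A.cstar_generated_induct)
    case (lim s a)
    then show ?case
      using star_hom_conv[OF assms(1-3) lim(1)] star_hom_conv[OF assms(1,2,4) lim(1)] B.conv_unique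
      by simp
  qed (simp_all add: h k assms(7))
qed

section \<open>Functional calculus of a unitary\<close>

text \<open>Orthogonality of the characters of the circle. It serves both for the coefficients of
  polynomials and for averaging over the gauge action.\<close>

lemma has_integral_cis:
  "((\<lambda>t. cis (2 * pi * of_int n * t)) has_integral (if n = 0 then 1 else 0)) {0..1::real}"
proof (cases "n = 0")
  case True
  then show ?thesis using has_integral_const_real[of "1::complex" 0 1] by simp
next
  case False
  define k where "k = 2 * pi * real_of_int n"
  have k: "k \<noteq> 0" using False by (simp add: k_def)
  have "((\<lambda>t. cis (k * t)) has_integral (cis (k * 1) / (\<i> * k) - cis (k * 0) / (\<i> * k))) {0..1}"
  proof (rule fundamental_theorem_of_calculus)
    fix t :: real
    have "((\<lambda>z. exp (\<i> * k * z) / (\<i> * k)) has_field_derivative exp (\<i> * k * of_real t)) (at (of_real t))"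
      using k by (auto intro!: derivative_eq_intros)
    from has_vector_derivative_real_field[OF this, of "{0..1}"] show "((\<lambda>t. cis (k * t) / (\<i> * k)) has_vector_derivative cis (k * t)) (at t within {0..1})"
      by (simp add: cis_conv_exp mult.assoc)
  qed simp
  moreover have "cis (k * 1) = 1" unfolding k_def using cis_multiple_2pi[of "of_int n"] by simp
  ultimately show ?thesis using False by (simp add: k_def)
qed

text \<open>By orthogonality of the characters, the coefficient is the mean over the circle of
  \<open>poly p z\<close> divided by \<open>z ^ i\<close>.\<close>

lemma coeff_le_sup_circle:
  fixes p :: "complex poly"
  assumes C: "\<And>z. z \<in> circle \<Longrightarrow> cmod (poly p z) \<le> C"
  shows "cmod (Polynomial.coeff p i) \<le> C"
proof -
  define e where "e n t = cis (2 * pi * of_int n * t)" for n :: int and t :: real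
  have e_add: "e (m + n) t = e m t * e n t" for m n t
    by (simp add: e_def cis_mult algebra_simps)
  have e_pow: "e 1 t ^ k = e (int k) t" for k t
    by (induction k) (simp_all add: e_def cis_mult algebra_simps)
  have "((\<lambda>t. \<Sum>k\<le>Polynomial.degree p. Polynomial.coeff p k * e (int k - int i) t) has_integral
      (\<Sum>k\<le>Polynomial.degree p. Polynomial.coeff p k * (if int k - int i = 0 then 1 else 0))) {0..1}"
    unfolding e_def
    by (intro has_integral_sum has_integral_mult_right has_integral_cis finite_atMost)
  moreover have "(\<Sum>k\<le>Polynomial.degree p. Polynomial.coeff p k * (if int k - int i = 0 then 1 else 0)) = Polynomial.coeff p i"
    by (simp add: if_distrib coeff_eq_0 cong: if_cong)
  moreover have "(\<Sum>k\<le>Polynomial.degree p. Polynomial.coeff p k * e (int k - int i) t) = poly p (e 1 t) * e (- int i) t" for t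
    by (simp add: poly_altdef e_pow sum_distrib_right mult.assoc flip: e_add)
  ultimately have I: "((\<lambda>t. poly p (e 1 t) * e (- int i) t) has_integral Polynomial.coeff p i) {0..1}"
    by simp
  have "cmod (Polynomial.coeff p i) \<le> C * measure lborel {0..1::real}"
  proof (rule has_integral_bound_real[where S = "{}", OF _ _ I])
    show "0 \<le> C" using order_trans[OF norm_ge_zero C[of 1]] by simp
    show "cmod (poly p (e 1 t) * e (- int i) t) \<le> C" for t
      using C[of "e 1 t"] by (simp add: norm_mult e_def)
  qed simp
  then show ?thesis by simp
qed

text \<open>If \<open>C < b\<close>, dividing by \<open>b ^ n\<close> bounds 1 by
  \<open>(n * D + 1) * (C / b) ^ n\<close>, which tends to 0. Only powers of two are asked for
  because these are the exponents for which the C*-identity gives the norm of a power.\<close>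

lemma geometric_beats_linear:
  fixes b C D :: real
  assumes C: "C \<ge> 0" and le: "\<And>k::nat. b ^ (2 ^ k) \<le> (real (2 ^ k) * D + 1) * C ^ (2 ^ k)"
  shows "b \<le> C"
proof (rule ccontr)
  assume "\<not> b \<le> C"
  then have bC: "C < b" by simp
  define x where "x = C / b"
  have x: "0 \<le> x" "x < 1" using bC C by (auto simp: x_def)
  have "1 \<le> real (2 ^ k) * x ^ (2 ^ k) * D + x ^ (2 ^ k)" for k
  proof -
    have "b ^ (2 ^ k) > 0" using bC C by simp
    then have "1 \<le> (real (2 ^ k) * D + 1) * C ^ (2 ^ k) / b ^ (2 ^ k)"
      using le[of k] by simp
    also have "\<dots> = (real (2 ^ k) * D + 1) * x ^ (2 ^ k)" by (simp add: x_def power_divide)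
    finally show ?thesis by (simp add: algebra_simps)
  qed
  moreover have "(\<lambda>k. real (2 ^ k) * x ^ (2 ^ k) * D + x ^ (2 ^ k)) \<longlonglongrightarrow> 0 * D + 0"
  proof (intro tendsto_intros)
    have sm: "strict_mono (\<lambda>k. 2 ^ k :: nat)" by (simp add: strict_mono_def)
    show "(\<lambda>k. real (2 ^ k) * x ^ (2 ^ k)) \<longlonglongrightarrow> 0"
      using LIMSEQ_subseq_LIMSEQ[OF powser_times_n_limit_0 sm, of x] x by (simp add: o_def)
    show "(\<lambda>k. x ^ (2 ^ k)) \<longlonglongrightarrow> 0"
      using LIMSEQ_subseq_LIMSEQ[OF LIMSEQ_realpow_zero sm, of x] x by (simp add: o_def)
  qed
  ultimately have "1 \<le> (0::real)" using LIMSEQ_le_const by fastforce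
  then show False by simp
qed

context unital_cstar_algebra
begin

lemmas nat_pow_closed' [simp, intro] = monoid.nat_pow_closed[OF monoid_A]
  and nat_pow_mult' = monoid.nat_pow_mult[OF monoid_A]
  and pow_mult_distrib' = monoid.pow_mult_distrib[OF monoid_A]
  and nat_pow_Suc2' = monoid.nat_pow_Suc2[OF monoid_A]

section \<open>Norms of powers of normal elements\<close>

lemma star_pow: "a \<in> carrier A \<Longrightarrow> star A (a [^] n) = star A a [^] (n::nat)"
  by (induction n) (auto simp: star_mult simp flip: nat_pow_Suc2')

text \<open>The C*-identity squares the norm whenever the exponent doubles.\<close>

lemma nrm_pow_self_adjoint:
  assumes "s \<in> carrier A" "star A s = s"
  shows "nrm A (s [^] (2 ^ k :: nat)) = nrm A s ^ (2 ^ k)"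
proof (induction k)
  case (Suc k)
  let ?t = "s [^] (2 ^ k :: nat)"
  have "s [^] (2 ^ Suc k :: nat) = star A ?t \<otimes> ?t"
    using assms by (simp add: star_pow nat_pow_mult' mult_2)
  then show ?case
    using Suc assms by (simp add: cstar_identity power_mult[symmetric] mult.commute)
qed (use assms in simp)

text \<open>Reduces to the self-adjoint element \<open>star A b \<otimes> b\<close>; normality lets
  the powers of this product be split into powers of its factors.\<close>

lemma nrm_pow_normal:
  assumes b: "b \<in> carrier A" "star A b \<otimes> b = b \<otimes> star A b"
  shows "nrm A (b [^] (2 ^ k :: nat)) = nrm A b ^ (2 ^ k)"
proof -
  let ?n = "2 ^ k :: nat"
  have "(nrm A (b [^] ?n))\<^sup>2 = nrm A (star A b [^] ?n \<otimes> b [^] ?n)"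
    using b by (simp add: star_pow flip: cstar_identity)
  also have "\<dots> = nrm A ((star A b \<otimes> b) [^] ?n)"
    using pow_mult_distrib'[OF b(2)] b(1) by simp
  also have "\<dots> = nrm A (star A b \<otimes> b) ^ ?n"
    using b by (intro nrm_pow_self_adjoint) (auto simp: star_mult)
  also have "\<dots> = (nrm A b ^ ?n)\<^sup>2"
    by (simp only: cstar_identity[OF b(1)] mult.commute flip: power_mult)
  finally show ?thesis using b nrm_nonneg by (simp add: power2_eq_iff_nonneg)
qed

definition unitary :: "'a \<Rightarrow> bool" where
  "unitary u \<longleftrightarrow> u \<in> carrier A \<and> star A u \<otimes> u = \<one> \<and> u \<otimes> star A u = \<one>"

lemma unitaryD:
  assumes "unitary u"
  shows "u \<in> carrier A" "star A u \<otimes> u = \<one>" "u \<otimes> star A u = \<one>"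
  using assms by (auto simp: unitary_def)

subsection \<open>Trigonometric polynomials in a unitary\<close>

text \<open>A relation and not a map: one function on the circle can be written in several ways in
  \<open>z\<close> and \<open>cnj z\<close>, and that all of them give the same element follows from
  the norm bound \<open>nrm_trig_le\<close>.\<close>

inductive trig :: "'a \<Rightarrow> (complex \<Rightarrow> complex) \<Rightarrow> 'a \<Rightarrow> bool" for u :: 'a where
  trig_const: "trig u (\<lambda>z. c) (c \<odot> \<one>)"
| trig_ident: "trig u (\<lambda>z. z) u"
| trig_cnj: "trig u cnj (star A u)"
| trig_add: "trig u f a \<Longrightarrow> trig u g b \<Longrightarrow> trig u (\<lambda>z. f z + g z) (a \<oplus> b)"
| trig_mult: "trig u f a \<Longrightarrow> trig u g b \<Longrightarrow> trig u (\<lambda>z. f z * g z) (a \<otimes> b)"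

lemma trig_closed: "trig u f a \<Longrightarrow> u \<in> carrier A \<Longrightarrow> a \<in> carrier A"
  by (induction rule: trig.induct) (auto intro: m_closed a_closed one_closed)

lemma trig_star:
  "trig u f a \<Longrightarrow> u \<in> carrier A \<Longrightarrow> trig u (\<lambda>z. cnj (f z)) (star A a)"
proof (induction rule: trig.induct)
  case (trig_const c)
  then show ?case using trig.trig_const[of u "cnj c"] by (simp add: star_smult one_closed)
next
  case (trig_mult f a g b)
  then show ?case
    using trig.trig_mult[of u "\<lambda>z. cnj (g z)" "star A b" "\<lambda>z. cnj (f z)" "star A a"]
    by (simp add: star_mult trig_closed mult.commute)
next
  case (trig_add f a g b)
  then show ?case
    using trig.trig_add[of u "\<lambda>z. cnj (f z)" "star A a" "\<lambda>z. cnj (g z)" "star A b"]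
    by (simp add: star_add trig_closed)
qed (auto intro: trig.intros)

lemma trig_scalar: "trig u f a \<Longrightarrow> u \<in> carrier A \<Longrightarrow> trig u (\<lambda>z. c * f z) (c \<odot> a)"
  using trig_mult[OF trig_const[of u c], of f a] trig_closed[of u f a]
  by (simp add: mult_smult_left one_closed l_one)

lemma trig_minus:
  "\<lbrakk>trig u f a; trig u g b; u \<in> carrier A\<rbrakk> \<Longrightarrow> trig u (\<lambda>z. f z - g z) (a \<ominus> b)"
  using trig_add[of u f a "\<lambda>z. -1 * g z" "(-1) \<odot> b"] trig_scalar[of u g b "-1"]
    trig_closed[of u f a] trig_closed[of u g b]
  by (simp add: minus_eq_scalar)

lemma trig_commute_generators:
  assumes "trig u f a" "u \<in> carrier A" "x \<in> carrier A" "x \<otimes> u = u \<otimes> x" "x \<otimes> star A u = star A u \<otimes> x"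
  shows "x \<otimes> a = a \<otimes> x"
  using assms
proof (induction rule: trig.induct)
  case (trig_const c)
  then show ?case by (simp add: mult_smult_left mult_smult_right one_closed l_one r_one)
next
  case (trig_add f a g b)
  then show ?case by (simp add: l_distr r_distr trig_closed)
next
  case (trig_mult f a g b)
  then have c: "a \<in> carrier A" "b \<in> carrier A" by (auto simp: trig_closed)
  have "x \<otimes> (a \<otimes> b) = a \<otimes> x \<otimes> b" using trig_mult c by (simp flip: m_assoc)
  also have "\<dots> = a \<otimes> b \<otimes> x" using trig_mult c by (simp add: m_assoc)
  finally show ?case .
qed auto

text \<open>Commutation spreads in two rounds: \<open>b\<close> commutes with the generators
  \<open>u\<close> and \<open>star A u\<close>, hence with everything built from them.\<close>

lemma trig_commute:
  assumes "unitary u" "trig u f a" "trig u g b"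
  shows "a \<otimes> b = b \<otimes> a"
proof -
  note u = unitaryD[OF assms(1)]
  have ua: "u \<otimes> b = b \<otimes> u" using u by (intro trig_commute_generators[OF assms(3)]) auto
  have "star A u \<otimes> b = b \<otimes> star A u" using u by (intro trig_commute_generators[OF assms(3)]) auto
  then have "b \<otimes> a = a \<otimes> b"
    using u ua assms trig_closed by (intro trig_commute_generators[OF assms(2)]) auto
  then show ?thesis ..
qed

text \<open>Horner's scheme, so that the algebraic laws follow by induction over
  \<open>pCons\<close>.\<close>

definition peval :: "'a \<Rightarrow> complex poly \<Rightarrow> 'a" where
  "peval u p = fold_coeffs (\<lambda>c r. c \<odot> \<one> \<oplus> u \<otimes> r) p \<zero>"

lemma peval_0 [simp]: "peval u 0 = \<zero>"
  by (simp add: peval_def)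

lemma peval_pCons: "u \<in> carrier A \<Longrightarrow> peval u (pCons c p) = c \<odot> \<one> \<oplus> u \<otimes> peval u p"
  by (cases "p = 0 \<and> c = 0") (auto simp: peval_def one_closed)

lemma trig_peval: "u \<in> carrier A \<Longrightarrow> trig u (poly p) (peval u p)"
proof (induction p rule: pCons_induct)
  case 0
  show ?case using trig_const[of u 0] by (simp add: one_closed)
next
  case (pCons c p)
  then show ?case
    using trig_add[OF trig_const[of u c] trig_mult[OF trig_ident[of u], of "poly p" "peval u p"]]
    by (simp add: peval_pCons)
qed

lemma peval_closed [simp]: "u \<in> carrier A \<Longrightarrow> peval u p \<in> carrier A"
  using trig_peval trig_closed by blast

lemma peval_add: "u \<in> carrier A \<Longrightarrow> peval u (p + q) = peval u p \<oplus> peval u q"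
proof (induction p q rule: poly_induct2)
  case (pCons c p d q)
  then show ?case
    by (simp add: peval_pCons scalar_add_left r_distr one_closed m_closed a_closed a_assoc a_comm a_lcomm)
qed simp

lemma peval_smult: "u \<in> carrier A \<Longrightarrow> peval u (Polynomial.smult c p) = c \<odot> peval u p"
  by (induction p rule: pCons_induct)
    (simp_all add: peval_pCons scalar_add_right scalar_mult mult_smult_right one_closed m_closed)

lemma peval_mult: "u \<in> carrier A \<Longrightarrow> peval u (p * q) = peval u p \<otimes> peval u q"
  by (induction p rule: pCons_induct)
    (simp_all add: peval_pCons peval_add peval_smult l_distr mult_smult_left one_closed m_closed
      m_assoc l_one)

lemma peval_X: "u \<in> carrier A \<Longrightarrow> peval u [:0, 1:] = u"
  by (simp add: peval_pCons one_closed m_closed r_one)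

lemma peval_one: "u \<in> carrier A \<Longrightarrow> peval u 1 = \<one>"
  by (simp add: peval_pCons one_pCons one_closed m_closed)

lemma peval_pow: "u \<in> carrier A \<Longrightarrow> peval u (p ^ n) = peval u p [^] n"
  by (induction n) (simp_all add: peval_one peval_mult flip: nat_pow_Suc2')

text \<open>A crude bound with one summand per coefficient. The lost factor is linear in the degree
  and disappears when the bound is applied to high powers of a polynomial.\<close>

lemma nrm_peval_le:
  assumes u: "u \<in> carrier A" "nrm A u \<le> 1" and M: "\<And>i. cmod (Polynomial.coeff p i) \<le> M"
  shows "nrm A (peval u p) \<le> real (length (coeffs p)) * M"
  using M
proof (induction p rule: pCons_induct)
  case (pCons c p)
  have c: "cmod c \<le> M" using pCons.prems[of 0] by simp
  have p: "nrm A (peval u p) \<le> real (length (coeffs p)) * M"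
    using pCons.prems[of "Suc _"] by (intro pCons.IH) simp
  have "nrm A (peval u (pCons c p)) \<le> nrm A (c \<odot> \<one>) + nrm A (u \<otimes> peval u p)"
    using u by (simp add: peval_pCons nrm_triangle one_closed m_closed)
  also have "nrm A (c \<odot> \<one>) \<le> M * 1"
    using c nrm_one_le nrm_nonneg[OF one_closed]
    by (simp only: nrm_smult one_closed) (intro mult_mono, auto intro: order_trans[OF norm_ge_zero])
  also have "nrm A (u \<otimes> peval u p) \<le> 1 * nrm A (peval u p)"
    using u nrm_nonneg[of "peval u p"]
    by (intro order_trans[OF nrm_mult] mult_right_mono) auto
  finally show ?case
    using p pCons.hyps by (simp add: cCons_def algebra_simps)
qed simp

lemma star_unitary_cancel:
  fixes d e :: nat
  assumes "unitary u"
  shows "star A u [^] (d + e) \<otimes> u [^] e = star A u [^] d"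
proof (induction e)
  case (Suc e)
  note u = unitaryD[OF assms]
  have "star A u [^] (d + Suc e) \<otimes> u [^] Suc e = star A u [^] (d + e) \<otimes> (star A u \<otimes> u) \<otimes> u [^] e"
    unfolding add_Suc_right nat_pow_Suc2'[OF u(1), of e] using u(1) by (simp add: m_assoc m_closed)
  then show ?case using Suc u by (simp add: r_one)
qed (use unitaryD[OF assms] in \<open>simp add: r_one\<close>)

text \<open>On the circle \<open>cnj z\<close> inverts \<open>z\<close>, so a Laurent polynomial is
  an ordinary polynomial divided by a power of \<open>z\<close>, and likewise for a unitary and its
  adjoint. The factor in front is harmless in norm estimates.\<close>

lemma trig_representation:
  assumes u: "unitary u" and "trig u f a"
  shows "\<exists>d p. (\<forall>z\<in>circle. f z = cnj z ^ d * poly p z) \<and> a = star A u [^] d \<otimes> peval u p"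
  using assms(2)
proof (induction rule: trig.induct)
  case (trig_const c)
  show ?case using unitaryD[OF u]
    by (intro exI[of _ 0] exI[of _ "[:c:]"]) (simp add: peval_pCons one_closed m_closed l_one)
next
  case trig_ident
  show ?case using unitaryD[OF u]
    by (intro exI[of _ 0] exI[of _ "[:0, 1:]"]) (simp add: peval_X l_one)
next
  case trig_cnj
  show ?case using unitaryD[OF u]
    by (intro exI[of _ 1] exI[of _ 1]) (simp add: peval_one l_one r_one)
next
  case (trig_add f a g b)
  note uc = unitaryD[OF u]
  obtain d p where p: "\<And>z. z \<in> circle \<Longrightarrow> f z = cnj z ^ d * poly p z" "a = star A u [^] d \<otimes> peval u p"
    using trig_add.IH(1) by blast
  obtain e q where q: "\<And>z. z \<in> circle \<Longrightarrow> g z = cnj z ^ e * poly q z" "b = star A u [^] e \<otimes> peval u q"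
    using trig_add.IH(2) by blast
  \<comment> \<open>The denominators \<open>z ^ d\<close> and \<open>z ^ e\<close> are brought to
    the common denominator \<open>z ^ (d + e)\<close>.\<close>
  let ?r = "[:0,1:] ^ e * p + [:0,1:] ^ d * q"
  have zz: "cnj z * z = 1" if "z \<in> circle" for z
    using that complex_norm_square[of z] by (simp add: mult.commute)
  have "f z + g z = cnj z ^ (d + e) * poly ?r z" if "z \<in> circle" for z
  proof -
    have "cnj z ^ (d + e) * poly ?r z = cnj z ^ d * (cnj z * z) ^ e * poly p z + cnj z ^ e * (cnj z * z) ^ d * poly q z"
      by (simp add: power_add power_mult_distrib algebra_simps)
    then show ?thesis using p(1) q(1) zz[OF that] that by simp
  qed
  moreover have "a \<oplus> b = star A u [^] (d + e) \<otimes> peval u ?r"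
  proof -
    have "star A u [^] (d + e) \<otimes> peval u ?r =
        star A u [^] (d + e) \<otimes> u [^] e \<otimes> peval u p \<oplus> star A u [^] (e + d) \<otimes> u [^] d \<otimes> peval u q"
      using uc(1)
      by (simp add: peval_add peval_mult peval_pow peval_X r_distr m_closed m_assoc add.commute a_comm)
    then show ?thesis using p(2) q(2) by (simp only: star_unitary_cancel[OF u])
  qed
  ultimately show ?case by blast
next
  case (trig_mult f a g b)
  note uc = unitaryD[OF u]
  obtain d p where p: "\<And>z. z \<in> circle \<Longrightarrow> f z = cnj z ^ d * poly p z" "a = star A u [^] d \<otimes> peval u p"
    using trig_mult.IH(1) by blast
  obtain e q where q: "\<And>z. z \<in> circle \<Longrightarrow> g z = cnj z ^ e * poly q z" "b = star A u [^] e \<otimes> peval u q"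
    using trig_mult.IH(2) by blast
  have "trig u (\<lambda>z. cnj z ^ e) (star A u [^] e)"
    using trig_star[OF trig_peval[of u "[:0,1:] ^ e"]] uc(1)
    by (simp add: peval_pow peval_X star_pow)
  then have comm: "peval u p \<otimes> star A u [^] e = star A u [^] e \<otimes> peval u p"
    using trig_commute u trig_peval uc(1) by blast
  have "a \<otimes> b = star A u [^] d \<otimes> (peval u p \<otimes> star A u [^] e) \<otimes> peval u q"
    using p(2) q(2) uc(1) by (simp add: m_assoc m_closed)
  also have "\<dots> = star A u [^] (d + e) \<otimes> peval u (p * q)"
    unfolding comm using uc(1) by (simp add: peval_mult m_assoc m_closed flip: nat_pow_mult')
  finally have "a \<otimes> b = star A u [^] (d + e) \<otimes> peval u (p * q)" .
  moreover have "\<forall>z\<in>circle. f z * g z = cnj z ^ (d + e) * poly (p * q) z"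
    using p(1) q(1) by (simp add: power_add)
  ultimately show ?case by blast
qed

text \<open>As \<open>\<parallel>b\<^sup>n\<parallel> = \<parallel>b\<parallel>\<^sup>n\<close> for a normal element \<open>b\<close> and powers \<open>n\<close> of two, a bound of
  \<open>\<parallel>p(u)\<parallel>\<close> that loses a factor linear in the degree of \<open>p\<close> suffices.\<close>

lemma nrm_trig_le:
  assumes u: "unitary u" and t: "trig u f a" and C: "\<And>z. z \<in> circle \<Longrightarrow> cmod (f z) \<le> C"
  shows "nrm A a \<le> C"
proof -
  note uc = unitaryD[OF u]
  have nu: "nrm A u \<le> 1" using nrm_unitary_le uc by blast
  obtain d p where p: "\<And>z. z \<in> circle \<Longrightarrow> f z = cnj z ^ d * poly p z" "a = star A u [^] d \<otimes> peval u p"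
    using trig_representation[OF u t] by blast
  let ?b = "peval u p"
  have C0: "0 \<le> C" using order_trans[OF norm_ge_zero C[of 1]] by simp
  have pC: "cmod (poly p z) \<le> C" if "z \<in> circle" for z
    using C[OF that] p(1)[OF that] that by (simp add: norm_mult norm_power)
  have le: "nrm A ?b ^ (2 ^ k) \<le> (real (2 ^ k) * Polynomial.degree p + 1) * C ^ (2 ^ k)" for k
  proof -
    let ?n = "2 ^ k :: nat"
    have "star A ?b \<otimes> ?b = ?b \<otimes> star A ?b"
      using trig_commute[OF u trig_star[OF trig_peval] trig_peval] uc(1) by simp
    then have "nrm A ?b ^ ?n = nrm A (peval u (p ^ ?n))"
      using nrm_pow_normal[of ?b k] uc(1) by (simp add: peval_pow)
    also have "\<dots> \<le> real (length (coeffs (p ^ ?n))) * C ^ ?n"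
    proof (intro nrm_peval_le coeff_le_sup_circle uc(1) nu)
      show "cmod (poly (p ^ ?n) z) \<le> C ^ ?n" if "z \<in> circle" for z
        using pC[OF that] by (simp add: norm_power power_mono)
    qed
    also have "\<dots> \<le> (real ?n * Polynomial.degree p + 1) * C ^ ?n"
    proof (intro mult_right_mono)
      have "length (coeffs (p ^ ?n)) \<le> Polynomial.degree (p ^ ?n) + 1"
        by (simp add: coeffs_def)
      also have "Polynomial.degree (p ^ ?n) \<le> Polynomial.degree p * ?n" by (rule degree_power_le)
      finally have "length (coeffs (p ^ ?n)) \<le> ?n * Polynomial.degree p + 1" by (simp add: mult.commute)
      then have "real (length (coeffs (p ^ ?n))) \<le> real (?n * Polynomial.degree p + 1)" by (rule of_nat_mono)
      then show "real (length (coeffs (p ^ ?n))) \<le> real ?n * Polynomial.degree p + 1" by simp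
    qed (use C0 in simp)
    finally show ?thesis by simp
  qed
  have "star A (u [^] d) \<otimes> (u [^] d) = \<one>"
    using star_unitary_cancel[OF u, of 0 d] uc(1) by (simp add: star_pow)
  then have "nrm A (star A u [^] d) \<le> 1"
    using nrm_unitary_le[of "u [^] d"] uc(1) by (simp flip: star_pow)
  then have "nrm A a \<le> 1 * nrm A ?b"
    unfolding p(2) using uc(1) nrm_nonneg[of ?b]
    by (intro order_trans[OF nrm_mult] mult_right_mono) auto
  also have "\<dots> \<le> C" using geometric_beats_linear[OF C0 le] by simp
  finally show ?thesis .
qed

end

context unital_cstar_algebra
begin

subsection \<open>Extension from trigonometric polynomials to continuous functions\<close>

text \<open>Real polynomial functions are built from real linear forms, and a real linear form
  \<open>f\<close> on the plane is a combination of \<open>z\<close> and \<open>cnj z\<close>, with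
  coefficient \<open>(f 1 - \<i> * f \<i>) / 2\<close> and its conjugate.\<close>

lemma trig_real_polynomial:
  assumes u: "unitary u" and "real_polynomial_function r"
  shows "\<exists>a. trig u (\<lambda>z. of_real (r z)) a"
  using assms(2)
proof (induction rule: real_polynomial_function.induct)
  case (linear f)
  note uc = unitaryD[OF u]
  have f: "f z = Re z * f 1 + Im z * f \<i>" for z
  proof -
    interpret bounded_linear f by fact
    have "z = Re z *\<^sub>R 1 + Im z *\<^sub>R \<i>" by (simp add: complex_eq_iff)
    then have "f z = f (Re z *\<^sub>R 1 + Im z *\<^sub>R \<i>)" by (rule arg_cong)
    then show ?thesis by (simp only: add scaleR real_scaleR_def)
  qed
  have "of_real (f z) = ((f 1 - \<i> * f \<i>) / 2) * z + ((f 1 + \<i> * f \<i>) / 2) * cnj z" for z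
  proof -
    have "complex_of_real (f z) = of_real (2 * Re z) * (of_real (f 1) / 2) + (of_real (2 * Im z) * \<i>) * (- \<i> * f \<i> / 2)"
      by (subst f) simp
    also have "\<dots> = (z + cnj z) * (of_real (f 1) / 2) + (z - cnj z) * (- \<i> * f \<i> / 2)"
      by (simp only: complex_add_cnj complex_diff_cnj)
    finally show ?thesis by (simp add: algebra_simps add_divide_distrib diff_divide_distrib)
  qed
  then have eq: "(\<lambda>z. complex_of_real (f z)) = (\<lambda>z. ((f 1 - \<i> * f \<i>) / 2) * z + ((f 1 + \<i> * f \<i>) / 2) * cnj z)"
    by (rule ext)
  show ?case
    unfolding eq
    by (rule exI, rule trig_add, rule trig_scalar, rule trig_ident, rule uc(1),
        rule trig_scalar, rule trig_cnj, rule uc(1))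
next
  case (const c)
  show ?case using trig_const[of u "of_real c"] by blast
next
  case (add f g)
  then obtain a b where "trig u (\<lambda>z. of_real (f z)) a" "trig u (\<lambda>z. of_real (g z)) b" by blast
  from trig_add[OF this] show ?case by auto
next
  case (mult f g)
  then obtain a b where "trig u (\<lambda>z. of_real (f z)) a" "trig u (\<lambda>z. of_real (g z)) b" by blast
  from trig_mult[OF this] show ?case by auto
qed

lemma trig_dense:
  assumes u: "unitary u" and f: "continuous_on circle f" and e: "e > 0"
  shows "\<exists>g a. trig u g a \<and> (\<forall>z\<in>circle. cmod (f z - g z) < e)"
proof -
  obtain g where g: "polynomial_function g" "\<forall>z\<in>circle. cmod (f z - g z) < e"
    using Stone_Weierstrass_polynomial_function[OF _ f e] by auto
  have "real_polynomial_function (Re \<circ> g)" "real_polynomial_function (Im \<circ> g)"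
    using g(1) unfolding polynomial_function_def by (auto intro: bounded_linear_Re bounded_linear_Im)
  then obtain a b where "trig u (\<lambda>z. of_real ((Re \<circ> g) z)) a" "trig u (\<lambda>z. of_real ((Im \<circ> g) z)) b"
    using trig_real_polynomial[OF u] by blast
  from trig_add[OF this(1) trig_scalar[OF this(2), of \<i>]] unitaryD(1)[OF u]
  have "trig u g (a \<oplus> \<i> \<odot> b)" by (simp flip: complex_eq)
  with g(2) show ?thesis by blast
qed

definition fc_rel :: "'a \<Rightarrow> (complex \<Rightarrow> complex) \<Rightarrow> 'a \<Rightarrow> bool" where
  "fc_rel u f a \<longleftrightarrow> continuous_on circle f \<and>
     (\<exists>F s. (\<forall>n. trig u (F n) (s n)) \<and> uniform_limit circle F f sequentially \<and> conv s a)"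

lemma fc_relI:
  assumes "continuous_on circle f" "\<And>n. trig u (F n) (s n)" "uniform_limit circle F f sequentially"
    "conv s a"
  shows "fc_rel u f a"
  unfolding fc_rel_def using assms by (intro conjI exI[of _ F] exI[of _ s]) auto

lemma fc_relE:
  assumes "fc_rel u f a"
  obtains F s where "continuous_on circle f" "\<And>n. trig u (F n) (s n)"
    "uniform_limit circle F f sequentially" "conv s a"
  using assms unfolding fc_rel_def by auto

lemma trig_continuous: "trig u f a \<Longrightarrow> continuous_on S f"
  by (induction rule: trig.induct) (auto intro!: continuous_intros)

lemma fc_rel_trig: "trig u f a \<Longrightarrow> u \<in> carrier A \<Longrightarrow> fc_rel u f a"
  by (rule fc_relI[where F = "\<lambda>_. f" and s = "\<lambda>_. a"])
    (auto intro: trig_continuous trig_closed uniform_limit_const)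

lemma fc_rel_closed: "fc_rel u f a \<Longrightarrow> a \<in> carrier A"
  by (auto elim!: fc_relE intro: convD)

text \<open>By the norm bound, a uniformly convergent sequence of trigonometric polynomials yields a
  Cauchy sequence of elements.\<close>

lemma fc_rel_exists:
  assumes u: "unitary u" and f: "continuous_on circle f"
  shows "\<exists>a. fc_rel u f a"
proof -
  note uc = unitaryD(1)[OF u]
  let ?e = "\<lambda>n::nat. inverse (real (Suc n))"
  have "\<forall>n. \<exists>ga. trig u (fst ga) (snd ga) \<and> (\<forall>z\<in>circle. cmod (f z - fst ga z) < ?e n)"
    using trig_dense[OF u f] by simp
  from choice[OF this] obtain ga where ga:
    "\<And>n. trig u (fst (ga n)) (snd (ga n))" "\<And>n z. z \<in> circle \<Longrightarrow> cmod (f z - fst (ga n) z) < ?e n"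
    by blast
  define F s where "F n = fst (ga n)" and "s n = snd (ga n)" for n
  have F: "trig u (F n) (s n)" "z \<in> circle \<Longrightarrow> cmod (f z - F n z) < ?e n" for n z
    using ga by (auto simp: F_def s_def)
  have sc: "s n \<in> carrier A" for n using F(1) uc trig_closed by blast
  have ul: "uniform_limit circle F f sequentially"
  proof (rule uniform_limitI)
    fix e :: real assume "e > 0"
    with LIMSEQ_inverse_real_of_nat have "\<forall>\<^sub>F n in sequentially. ?e n < e"
      by (rule order_tendstoD)
    then show "\<forall>\<^sub>F n in sequentially. \<forall>z\<in>circle. dist (F n z) (f z) < e"
      by (rule eventually_mono) (metis F(2) dist_norm dist_commute less_trans)
  qed
  have "\<exists>a. conv s a"
  proof (rule Cauchy_conv[OF sc])
    fix e :: real assume "e > 0"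
    with LIMSEQ_inverse_real_of_nat have "\<forall>\<^sub>F n in sequentially. ?e n < e / 3"
      by (intro order_tendstoD(2)) auto
    then obtain N where N: "\<And>n. n \<ge> N \<Longrightarrow> ?e n < e / 3"
      unfolding eventually_sequentially by blast
    have "nrm A (s m \<ominus> s n) < e" if "m \<ge> N" "n \<ge> N" for m n
    proof -
      have "nrm A (s m \<ominus> s n) \<le> 2 * e / 3"
      proof (rule nrm_trig_le[OF u trig_minus[OF F(1) F(1) uc]])
        fix z assume z: "z \<in> circle"
        have "cmod (F m z - F n z) \<le> cmod (f z - F n z) + cmod (f z - F m z)"
          using norm_triangle_ineq4[of "f z - F n z" "f z - F m z"] by simp
        then show "cmod (F m z - F n z) \<le> 2 * e / 3"
          using F(2)[OF z, of m] F(2)[OF z, of n] N[OF that(1)] N[OF that(2)] by simp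
      qed
      then show ?thesis using \<open>e > 0\<close> by simp
    qed
    then show "\<exists>N. \<forall>m\<ge>N. \<forall>n\<ge>N. nrm A (s m \<ominus> s n) < e" by blast
  qed
  then obtain a where "conv s a" ..
  with fc_relI[OF f F(1) ul] show ?thesis by blast
qed

lemma bounded_image_circle: "continuous_on circle f \<Longrightarrow> bounded (f ` circle)"
  by (intro compact_imp_bounded compact_continuous_image) auto

lemma fc_rel_add:
  assumes "fc_rel u f a" "fc_rel u g b"
  shows "fc_rel u (\<lambda>z. f z + g z) (a \<oplus> b)"
proof -
  obtain F s where F: "continuous_on circle f" "\<And>n. trig u (F n) (s n)"
    "uniform_limit circle F f sequentially" "conv s a" using assms(1) unfolding fc_rel_def by auto
  obtain G t where G: "continuous_on circle g" "\<And>n. trig u (G n) (t n)"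
    "uniform_limit circle G g sequentially" "conv t b" using assms(2) unfolding fc_rel_def by auto
  show ?thesis
    by (rule fc_relI[OF _ trig_add[OF F(2) G(2)] uniform_limit_add[OF F(3) G(3)] conv_add[OF F(4) G(4)]])
      (intro continuous_intros F G)
qed

lemma fc_rel_mult:
  assumes "fc_rel u f a" "fc_rel u g b"
  shows "fc_rel u (\<lambda>z. f z * g z) (a \<otimes> b)"
proof -
  obtain F s where F: "continuous_on circle f" "\<And>n. trig u (F n) (s n)"
    "uniform_limit circle F f sequentially" "conv s a" using assms(1) unfolding fc_rel_def by auto
  obtain G t where G: "continuous_on circle g" "\<And>n. trig u (G n) (t n)"
    "uniform_limit circle G g sequentially" "conv t b" using assms(2) unfolding fc_rel_def by auto
  show ?thesis
    by (rule fc_relI[OF _ trig_mult[OF F(2) G(2)]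
          uniform_lim_mult[OF F(3) G(3) bounded_image_circle[OF F(1)] bounded_image_circle[OF G(1)]]
          conv_mult[OF F(4) G(4)]])
      (intro continuous_intros F G)
qed

lemma fc_rel_star:
  assumes "fc_rel u f a" "u \<in> carrier A"
  shows "fc_rel u (\<lambda>z. cnj (f z)) (star A a)"
proof -
  obtain F s where F: "continuous_on circle f" "\<And>n. trig u (F n) (s n)"
    "uniform_limit circle F f sequentially" "conv s a" using assms(1) unfolding fc_rel_def by auto
  show ?thesis
    by (rule fc_relI[OF _ trig_star[OF F(2) assms(2)]
          bounded_linear.uniform_limit[OF bounded_linear_cnj F(3)] conv_star[OF F(4)]])
      (intro continuous_intros F)
qed

lemma fc_rel_nrm_le:
  assumes u: "unitary u" and a: "fc_rel u f a" and C: "\<And>z. z \<in> circle \<Longrightarrow> cmod (f z) \<le> C"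
  shows "nrm A a \<le> C"
proof (rule field_le_epsilon)
  fix e :: real assume e: "e > 0"
  obtain F s where F: "\<And>n. trig u (F n) (s n)"
    "uniform_limit circle F f sequentially" "conv s a" using a unfolding fc_rel_def by auto
  have "\<forall>\<^sub>F n in sequentially. nrm A (s n) \<le> C + e"
    using uniform_limitD[OF F(2) e]
  proof (rule eventually_mono)
    fix n assume n: "\<forall>z\<in>circle. dist (F n z) (f z) < e"
    show "nrm A (s n) \<le> C + e"
    proof (rule nrm_trig_le[OF u F(1)])
      fix z assume z: "z \<in> circle"
      have "cmod (F n z) \<le> cmod (f z) + dist (F n z) (f z)"
        using norm_triangle_ineq[of "f z" "F n z - f z"] by (simp add: dist_norm)
      then show "cmod (F n z) \<le> C + e" using C[OF z] n z by fastforce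
    qed
  qed
  then show "nrm A a \<le> C + e"
    by (rule tendsto_upperbound[OF conv_nrm[OF F(3)]]) simp
qed

text \<open>The difference of \<open>a\<close> and \<open>b\<close> is related to a function that
  vanishes on the circle, so its norm is at most 0.\<close>

lemma fc_rel_unique:
  assumes u: "unitary u" and "fc_rel u f a" "fc_rel u g b" and fg: "\<And>z. z \<in> circle \<Longrightarrow> f z = g z"
  shows "a = b"
proof -
  note c = fc_rel_closed[OF assms(2)] fc_rel_closed[OF assms(3)]
  have "fc_rel u (\<lambda>z. f z + (-1) * g z) (a \<oplus> ((-1) \<odot> \<one>) \<otimes> b)"
    using assms(2,3) fc_rel_trig[OF trig_const] unitaryD(1)[OF u]
    by (intro fc_rel_add fc_rel_mult) auto
  then have "nrm A (a \<oplus> ((-1) \<odot> \<one>) \<otimes> b) \<le> 0"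
    by (rule fc_rel_nrm_le[OF u]) (simp add: fg)
  then have "nrm A (a \<ominus> b) \<le> 0"
    using c by (simp add: minus_eq_scalar mult_smult_left one_closed l_one)
  then show ?thesis
    using c nrm_nonneg[of "a \<ominus> b"] by (subst eq_iff_nrm) auto
qed

text \<open>A functional calculus with functions on the whole circle, available for every unitary
  whatever its spectrum. It agrees with \<open>cfc\<close> if the spectrum is the circle.\<close>

definition fc :: "'a \<Rightarrow> (complex \<Rightarrow> complex) \<Rightarrow> 'a" where
  "fc u f = (THE a. fc_rel u f a)"

lemma fc_rel_fc: "unitary u \<Longrightarrow> continuous_on circle f \<Longrightarrow> fc_rel u f (fc u f)"
  unfolding fc_def by (rule theI') (metis fc_rel_exists fc_rel_unique)

lemma fc_eqI: "unitary u \<Longrightarrow> fc_rel u f a \<Longrightarrow> fc u f = a"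
  using fc_rel_unique[of u f "fc u f" f a] fc_rel_fc[of u f] by (auto elim: fc_relE)

lemma fc_closed [simp]: "unitary u \<Longrightarrow> continuous_on circle f \<Longrightarrow> fc u f \<in> carrier A"
  using fc_rel_fc fc_rel_closed by blast

lemma fc_cong:
  assumes "unitary u" "continuous_on circle f" "\<And>z. z \<in> circle \<Longrightarrow> f z = g z"
  shows "fc u f = fc u g"
proof -
  have g: "continuous_on circle g" by (rule continuous_on_eq[OF assms(2,3)])
  show ?thesis
    by (rule fc_rel_unique[OF assms(1) fc_rel_fc[OF assms(1,2)] fc_rel_fc[OF assms(1) g] assms(3)])
qed

lemma fc_trig: "unitary u \<Longrightarrow> trig u f a \<Longrightarrow> fc u f = a"
  by (intro fc_eqI fc_rel_trig) (auto dest: unitaryD)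

lemma fc_add:
  "\<lbrakk>unitary u; continuous_on circle f; continuous_on circle g\<rbrakk> \<Longrightarrow> fc u (\<lambda>z. f z + g z) = fc u f \<oplus> fc u g"
  by (intro fc_eqI fc_rel_add fc_rel_fc)

lemma fc_mult:
  "\<lbrakk>unitary u; continuous_on circle f; continuous_on circle g\<rbrakk> \<Longrightarrow> fc u (\<lambda>z. f z * g z) = fc u f \<otimes> fc u g"
  by (intro fc_eqI fc_rel_mult fc_rel_fc)

lemma fc_star:
  "\<lbrakk>unitary u; continuous_on circle f\<rbrakk> \<Longrightarrow> fc u (\<lambda>z. cnj (f z)) = star A (fc u f)"
  by (intro fc_eqI fc_rel_star fc_rel_fc) (auto dest: unitaryD)

lemma fc_const: "unitary u \<Longrightarrow> fc u (\<lambda>z. c) = c \<odot> \<one>"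
  by (intro fc_trig trig_const)

lemma fc_one: "unitary u \<Longrightarrow> fc u (\<lambda>z. 1) = \<one>"
  by (simp add: fc_const one_closed)

lemma fc_ident: "unitary u \<Longrightarrow> fc u (\<lambda>z. z) = u"
  by (intro fc_trig trig_ident)

lemma fc_scalar:
  "\<lbrakk>unitary u; continuous_on circle f\<rbrakk> \<Longrightarrow> fc u (\<lambda>z. c * f z) = c \<odot> fc u f"
  using fc_mult[of u "\<lambda>z. c" f] by (simp add: fc_const mult_smult_left one_closed l_one)

lemma fc_minus:
  "\<lbrakk>unitary u; continuous_on circle f; continuous_on circle g\<rbrakk> \<Longrightarrow> fc u (\<lambda>z. f z - g z) = fc u f \<ominus> fc u g"
  using fc_add[of u f "\<lambda>z. -1 * g z"] fc_scalar[of u g "-1"]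
  by (simp add: minus_eq_scalar continuous_on_minus)

lemma fc_nrm_le:
  assumes "unitary u" "continuous_on circle f" "\<And>z. z \<in> circle \<Longrightarrow> cmod (f z) \<le> C"
  shows "nrm A (fc u f) \<le> C"
  using fc_rel_nrm_le[OF assms(1) fc_rel_fc] assms by blast

lemma fc_conv:
  assumes u: "unitary u" and c: "\<And>n. continuous_on circle (F n)" and l: "uniform_limit circle F f sequentially"
  shows "conv (\<lambda>n. fc u (F n)) (fc u f)"
proof -
  have f: "continuous_on circle f"
    by (rule uniform_limit_theorem[OF _ l]) (use c in auto)
  show ?thesis
    unfolding conv_def
  proof (intro conjI allI)
    show "(\<lambda>n. nrm A (fc u (F n) \<ominus> fc u f)) \<longlonglongrightarrow> 0"
    proof (rule tendstoI)
      fix e :: real assume "e > 0"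
      then have "e / 2 > 0" by simp
      from uniform_limitD[OF l this]
      show "\<forall>\<^sub>F n in sequentially. dist (nrm A (fc u (F n) \<ominus> fc u f)) 0 < e"
      proof (rule eventually_mono)
        fix n assume n: "\<forall>z\<in>circle. dist (F n z) (f z) < e / 2"
        have "nrm A (fc u (\<lambda>z. F n z - f z)) \<le> e / 2"
          using n by (intro fc_nrm_le u continuous_intros c f) (auto simp: dist_norm less_imp_le)
        then show "dist (nrm A (fc u (F n) \<ominus> fc u f)) 0 < e"
          using u c f nrm_nonneg[of "fc u (F n) \<ominus> fc u f"] \<open>e > 0\<close> by (simp add: fc_minus)
      qed
    qed
  qed (use u c f in auto)
qed

lemma fc_in_trig_closure:
  assumes "unitary u" "continuous_on circle f"
  obtains F s where "\<And>n. trig u (F n) (s n)" "uniform_limit circle F f sequentially" "conv s (fc u f)"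
  using fc_rel_fc[OF assms] that unfolding fc_rel_def by auto

text \<open>Passing \<open>x\<close> through a trigonometric polynomial replaces \<open>u\<close> by
  \<open>v\<close>, generator by generator; continuity of the product does the rest. With
  \<open>v\<close> a rotation of \<open>u\<close> this moves \<open>x\<close> past functions of
  \<open>w\<close>.\<close>

lemma fc_intertwine:
  assumes u: "unitary u" and v: "unitary v" and x: "x \<in> carrier A"
    and 1: "x \<otimes> u = v \<otimes> x" and 2: "x \<otimes> star A u = star A v \<otimes> x" and f: "continuous_on circle f"
  shows "x \<otimes> fc u f = fc v f \<otimes> x"
proof -
  note uc = unitaryD(1)[OF u] and vc = unitaryD(1)[OF v]
  have *: "x \<otimes> fc u g = fc v g \<otimes> x" if "trig u g a" for g a
  proof -
    have "\<exists>b. trig v g b \<and> x \<otimes> a = b \<otimes> x" using that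
    proof (induction rule: trig.induct)
      case (trig_const c)
      show ?case using x
        by (intro exI[of _ "c \<odot> \<one>"] conjI trig.trig_const)
          (simp add: mult_smult_left mult_smult_right one_closed l_one r_one)
    next
      case (trig_add f a g b)
      then obtain a' b' where "trig v f a'" "x \<otimes> a = a' \<otimes> x" "trig v g b'" "x \<otimes> b = b' \<otimes> x" by blast
      then show ?case using trig_add.hyps x uc vc
        by (intro exI[of _ "a' \<oplus> b'"] conjI trig.trig_add) (simp_all add: l_distr r_distr trig_closed)
    next
      case (trig_mult f a g b)
      then obtain a' b' where *: "trig v f a'" "x \<otimes> a = a' \<otimes> x" "trig v g b'" "x \<otimes> b = b' \<otimes> x" by blast
      note c = trig_closed[OF trig_mult.hyps(1) uc] trig_closed[OF trig_mult.hyps(2) uc]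
        trig_closed[OF *(1) vc] trig_closed[OF *(3) vc]
      have "x \<otimes> (a \<otimes> b) = a' \<otimes> (x \<otimes> b)" using c x by (simp add: *(2) m_assoc flip: m_assoc[of x])
      also have "\<dots> = a' \<otimes> b' \<otimes> x" using c x *(4) by (simp add: m_assoc)
      finally show ?case using * by (intro exI[of _ "a' \<otimes> b'"] conjI trig.trig_mult)
    qed (use 1 2 trig.intros in blast)+
    then show ?thesis using fc_trig u v that by metis
  qed
  obtain F s where F: "\<And>n. trig u (F n) (s n)" "uniform_limit circle F f sequentially"
    using fc_in_trig_closure[OF u f] by blast
  have Fc: "continuous_on circle (F n)" for n using F(1) trig_continuous by blast
  have "conv (\<lambda>n. x \<otimes> fc u (F n)) (x \<otimes> fc u f)"
    by (intro conv_mult conv_const x fc_conv u Fc F)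
  moreover have "conv (\<lambda>n. fc v (F n) \<otimes> x) (fc v f \<otimes> x)"
    by (intro conv_mult conv_const x fc_conv v Fc F)
  ultimately show ?thesis using conv_unique *[OF F(1)] by simp
qed

subsection \<open>Homomorphisms on the continuous functions on the circle\<close>

lemma carrier_C_alg: "f \<in> carrier (C_alg K) \<longleftrightarrow> f \<in> extensional K \<and> continuous_on K f"
  by (simp add: C_alg_def)

lemma restrict_in_C_alg: "continuous_on K f \<Longrightarrow> restrict f K \<in> carrier (C_alg K)"
  by (simp add: C_alg_def)

lemma star_hom_fc: "unitary u \<Longrightarrow> star_hom (C_alg circle) A (fc u)"
proof (rule star_homI)
  assume u: "unitary u"
  show "fc u \<one>\<^bsub>C_alg circle\<^esub> = \<one>"
    using fc_cong[OF u, of "\<lambda>z. 1" "\<lambda>z\<in>circle. 1"] u by (simp add: C_alg_def fc_one)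
  fix f g c assume f: "f \<in> carrier (C_alg circle)"
  then have fc: "continuous_on circle f" by (simp add: carrier_C_alg)
  show "fc u f \<in> carrier A" using u fc by simp
  show "fc u (c \<odot>\<^bsub>C_alg circle\<^esub> f) = c \<odot> fc u f"
    using fc_cong[OF u, of "\<lambda>z. c * f z" "\<lambda>z\<in>circle. c * f z"] u fc
    by (simp add: C_alg_def fc_scalar continuous_on_mult_left)
  show "fc u (star (C_alg circle) f) = star A (fc u f)"
    using fc_cong[OF u, of "\<lambda>z. cnj (f z)" "\<lambda>z\<in>circle. cnj (f z)"] u fc
    by (simp add: C_alg_def fc_star continuous_on_cnj)
  assume "g \<in> carrier (C_alg circle)"
  then have gc: "continuous_on circle g" by (simp add: carrier_C_alg)
  show "fc u (f \<oplus>\<^bsub>C_alg circle\<^esub> g) = fc u f \<oplus> fc u g"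
    using fc_cong[OF u, of "\<lambda>z. f z + g z" "\<lambda>z\<in>circle. f z + g z"] u fc gc
    by (simp add: C_alg_def fc_add continuous_on_add)
  show "fc u (f \<otimes>\<^bsub>C_alg circle\<^esub> g) = fc u f \<otimes> fc u g"
    using fc_cong[OF u, of "\<lambda>z. f z * g z" "\<lambda>z\<in>circle. f z * g z"] u fc gc
    by (simp add: C_alg_def fc_mult continuous_on_mult)
qed

text \<open>The elements of \<open>C_alg\<close> are extensional functions. Composing with
  \<open>restrict\<close> makes the homomorphism laws usable for ordinary lambda terms.\<close>

lemma star_hom_C_alg:
  assumes h: "star_hom (C_alg circle) A h"
  defines "k \<equiv> \<lambda>f. h (restrict f circle)"
  assumes f: "continuous_on circle f" and g: "continuous_on circle g"
  shows "k f \<in> carrier A" "k (\<lambda>z. f z + g z) = k f \<oplus> k g" "k (\<lambda>z. f z * g z) = k f \<otimes> k g"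
    "k (\<lambda>z. 1) = \<one>" "k (\<lambda>z. c * f z) = c \<odot> k f" "k (\<lambda>z. cnj (f z)) = star A (k f)"
proof -
  note H = star_homD[OF h] and r = restrict_in_C_alg[OF f] restrict_in_C_alg[OF g]
  show "k f \<in> carrier A" unfolding k_def using H(1) r by blast
  show "k (\<lambda>z. f z + g z) = k f \<oplus> k g"
    using H(2)[OF r] by (simp add: k_def C_alg_def cong: restrict_cong)
  show "k (\<lambda>z. f z * g z) = k f \<otimes> k g"
    using H(3)[OF r] by (simp add: k_def C_alg_def cong: restrict_cong)
  show "k (\<lambda>z. 1) = \<one>" using H(4) by (simp add: k_def C_alg_def)
  show "k (\<lambda>z. c * f z) = c \<odot> k f"
    using H(5)[OF r(1), of c] by (simp add: k_def C_alg_def cong: restrict_cong)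
  show "k (\<lambda>z. cnj (f z)) = star A (k f)"
    using H(6)[OF r(1)] by (simp add: k_def C_alg_def cong: restrict_cong)
qed

text \<open>A real function with values in \<open>[-1,1]\<close> is the real part of the unitary
  \<open>f + \<i> sqrt (1 - f\<^sup>2)\<close>.\<close>

lemma star_hom_C_alg_bounded:
  assumes h: "star_hom (C_alg circle) A h" and f: "continuous_on circle f"
    and C: "\<And>z. z \<in> circle \<Longrightarrow> cmod (f z) \<le> C"
  shows "nrm A (h (restrict f circle)) \<le> 2 * C"
proof -
  define k where "k f = h (restrict f circle)" for f
  note K = star_hom_C_alg[OF h, folded k_def]
  have ball: "nrm A (k (\<lambda>z. of_real (g z))) \<le> 1"
    if g: "continuous_on circle g" "\<And>z. z \<in> circle \<Longrightarrow> \<bar>g z\<bar> \<le> 1" for g :: "complex \<Rightarrow> real"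
  proof -
    define v where "v z = Complex (g z) (sqrt (1 - (g z)\<^sup>2))" for z
    have v: "continuous_on circle v"
      unfolding v_def Complex_eq by (intro continuous_intros g)
    have vv: "cnj (v z) * v z = 1" if "z \<in> circle" for z
    proof -
      have "(g z)\<^sup>2 \<le> 1" using g(2)[OF that] by (simp add: abs_square_le_1)
      then show ?thesis by (simp add: v_def complex_eq_iff power2_eq_square)
    qed
    have "star A (k v) \<otimes> k v = k (\<lambda>z. cnj (v z) * v z)"
      using v by (subst K(3)[of "\<lambda>z. cnj (v z)" v]) (auto intro: continuous_intros simp: K(6)[of v v])
    also have "\<dots> = k (\<lambda>z. 1)" unfolding k_def using vv by (simp cong: restrict_cong)
    finally have "nrm A (k v) \<le> 1" using nrm_unitary_le[of "k v"] K(4)[OF v v] K(1)[OF v v] by simp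
    have "k (\<lambda>z. of_real (g z)) = k (\<lambda>z. (1/2) * (v z + cnj (v z)))"
      by (simp add: v_def complex_add_cnj)
    also have "\<dots> = (1/2) \<odot> (k v \<oplus> star A (k v))"
      using v continuous_on_cnj[OF v] continuous_on_add[OF v continuous_on_cnj[OF v]]
      by (simp only: K(5)[where g = v] K(2) K(6)[where g = v])
    finally have "nrm A (k (\<lambda>z. of_real (g z))) = nrm A (k v \<oplus> star A (k v)) / 2"
      using K(1)[OF v v] by (simp add: nrm_smult a_closed)
    also have "\<dots> \<le> 1" using nrm_triangle[of "k v" "star A (k v)"] K(1)[OF v v] \<open>nrm A (k v) \<le> 1\<close> by simp
    finally show ?thesis .
  qed
  have real: "nrm A (k (\<lambda>z. of_real (g z))) \<le> C"
    if g: "continuous_on circle g" "\<And>z. z \<in> circle \<Longrightarrow> \<bar>g z\<bar> \<le> C" for g :: "complex \<Rightarrow> real"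
  proof (rule field_le_epsilon)
    fix e :: real assume "e > 0"
    moreover have "0 \<le> C" using order_trans[OF abs_ge_zero g(2)[of 1]] by simp
    ultimately have Ce: "C + e > 0" by simp
    have cg: "continuous_on circle (\<lambda>z. g z / (C + e))" by (intro continuous_intros g) (use Ce in auto)
    note cg' = continuous_on_of_real[where ?'a = complex, OF cg]
    have le1: "nrm A (k (\<lambda>z. of_real (g z / (C + e)))) \<le> 1"
      using cg
    proof (rule ball)
      fix z assume "z \<in> circle"
      then have "\<bar>g z\<bar> \<le> C + e" using g(2) \<open>e > 0\<close> by fastforce
      then show "\<bar>g z / (C + e)\<bar> \<le> 1" using Ce by simp
    qed
    have "k (\<lambda>z. of_real (g z)) = k (\<lambda>z. of_real (C + e) * of_real (g z / (C + e)))"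
    proof (intro arg_cong[where f = k] ext)
      show "complex_of_real (g z) = of_real (C + e) * of_real (g z / (C + e))" for z
        unfolding of_real_mult[symmetric] using Ce by simp
    qed
    also have "\<dots> = of_real (C + e) \<odot> k (\<lambda>z. of_real (g z / (C + e)))"
      by (rule K(5)[OF cg' cg'])
    finally have eq: "k (\<lambda>z. of_real (g z)) = of_real (C + e) \<odot> k (\<lambda>z. of_real (g z / (C + e)))" .
    have "k (\<lambda>z. of_real (g z / (C + e))) \<in> carrier A"
      by (rule K(1)[OF cg' cg'])
    then have "nrm A (k (\<lambda>z. of_real (g z))) = (C + e) * nrm A (k (\<lambda>z. of_real (g z / (C + e))))"
      unfolding eq using Ce by (simp only: nrm_smult norm_of_real abs_of_pos)
    also have "\<dots> \<le> (C + e) * 1" using le1 Ce by (intro mult_left_mono) auto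
    finally show "nrm A (k (\<lambda>z. of_real (g z))) \<le> C + e" by simp
  qed
  \<comment> \<open>Splitting into real and imaginary part costs the factor 2. It is harmless
    because the bound serves only as continuity.\<close>
  have cRe: "continuous_on circle (\<lambda>z. complex_of_real (Re (f z)))"
    and cIm: "continuous_on circle (\<lambda>z. complex_of_real (Im (f z)))"
    using f by (auto intro!: continuous_intros)
  have "k f = k (\<lambda>z. of_real (Re (f z)) + \<i> * of_real (Im (f z)))" by (simp flip: complex_eq)
  also have "\<dots> = k (\<lambda>z. of_real (Re (f z))) \<oplus> \<i> \<odot> k (\<lambda>z. of_real (Im (f z)))"
    using K(2)[OF cRe continuous_on_mult_left[OF cIm, of \<i>]] K(5)[OF cIm cIm, of \<i>] by simp
  finally have "nrm A (k f) \<le> nrm A (k (\<lambda>z. of_real (Re (f z)))) + nrm A (k (\<lambda>z. of_real (Im (f z))))"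
    using nrm_triangle[of "k (\<lambda>z. of_real (Re (f z)))" "\<i> \<odot> k (\<lambda>z. of_real (Im (f z)))"]
      K(1)[OF cRe cRe] K(1)[OF cIm cIm] by (simp add: nrm_smult)
  also have "\<dots> \<le> C + C"
    using f C by (intro add_mono real continuous_intros)
      (auto intro: order_trans[OF abs_Re_le_cmod] order_trans[OF abs_Im_le_cmod])
  finally show ?thesis by (simp add: k_def)
qed

text \<open>On trigonometric polynomials \<open>h\<close> is forced by its value at the identity
  function. Continuity of \<open>h\<close> is not assumed but comes from
  \<open>star_hom_C_alg_bounded\<close>, and density of these polynomials concludes.\<close>

lemma star_hom_C_alg_unique:
  assumes h: "star_hom (C_alg circle) A h" and hu: "h (\<lambda>z\<in>circle. z) = u"
  shows "unitary u" "continuous_on circle f \<Longrightarrow> h (restrict f circle) = fc u f"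
proof -
  define k where "k f = h (restrict f circle)" for f
  note K = star_hom_C_alg[OF h, folded k_def]
  have ku: "k (\<lambda>z. z) = u" using hu by (simp add: k_def)
  have kcu: "k cnj = star A u" using K(6)[of "\<lambda>z. z" "\<lambda>z. z"] ku by (simp add: continuous_on_id)
  have zz: "cnj z * z = 1" "z * cnj z = 1" if "z \<in> circle" for z
    using that complex_norm_square[of z] by (auto simp: mult.commute)
  have "k (\<lambda>z. cnj z * z) = \<one>" "k (\<lambda>z. z * cnj z) = \<one>"
    using K(4)[of "\<lambda>z. z" "\<lambda>z. z"] zz by (simp_all add: k_def continuous_on_id cong: restrict_cong)
  moreover have "k (\<lambda>z. cnj z * z) = star A u \<otimes> u" "k (\<lambda>z. z * cnj z) = u \<otimes> star A u"
    using K(3)[of cnj "\<lambda>z. z"] K(3)[of "\<lambda>z. z" cnj] ku kcu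
    by (simp_all add: continuous_on_id continuous_on_cnj)
  ultimately show u: "unitary u"
    using K(1)[of "\<lambda>z. z" "\<lambda>z. z"] ku by (simp add: unitary_def continuous_on_id)
  have kt: "k g = a" if "trig u g a" for g a
    using that
  proof (induction rule: trig.induct)
    case (trig_const c)
    then show ?case using K(4)[of "\<lambda>z. 1" "\<lambda>z. 1"] K(5)[of "\<lambda>z. 1" "\<lambda>z. 1" c] by (simp add: continuous_on_const)
  next
    case (trig_add f a g b)
    then show ?case using K(2)[of f g] by (simp add: trig_continuous)
  next
    case (trig_mult f a g b)
    then show ?case using K(3)[of f g] by (simp add: trig_continuous)
  qed (use ku kcu in auto)
  assume f: "continuous_on circle f"
  obtain F s where F: "\<And>n. trig u (F n) (s n)" "uniform_limit circle F f sequentially" "conv s (fc u f)"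
    using fc_in_trig_closure[OF u f] by blast
  have Fc: "continuous_on circle (F n)" for n using F(1) trig_continuous by blast
  have "conv s (k f)"
    unfolding conv_def
  proof (intro conjI allI)
    show "k f \<in> carrier A" using K(1)[OF f f] .
    show sc: "s n \<in> carrier A" for n using F(3) convD by blast
    show "(\<lambda>n. nrm A (s n \<ominus> k f)) \<longlonglongrightarrow> 0"
    proof (rule tendstoI)
      fix e :: real assume e: "e > 0"
      then have "e / 4 > 0" by simp
      from uniform_limitD[OF F(2) this]
      show "\<forall>\<^sub>F n in sequentially. dist (nrm A (s n \<ominus> k f)) 0 < e"
      proof (rule eventually_mono)
        fix n assume n: "\<forall>z\<in>circle. dist (F n z) (f z) < e / 4"
        have "s n \<ominus> k f = k (\<lambda>z. F n z + (-1) * f z)"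
          using K(2)[OF Fc continuous_on_mult_left[OF f, of "-1"]] K(5)[OF f f, of "-1"] kt[OF F(1)]
            sc K(1)[OF f f]
          by (simp add: minus_eq_scalar)
        moreover have "nrm A (k (\<lambda>z. F n z + (-1) * f z)) \<le> 2 * (e / 4)"
          unfolding k_def using n
          by (intro star_hom_C_alg_bounded[OF h] continuous_intros Fc f) (auto simp: dist_norm less_imp_le)
        ultimately have "nrm A (s n \<ominus> k f) \<le> e / 2" by simp
        moreover have "0 \<le> nrm A (s n \<ominus> k f)" using sc K(1)[OF f f] by (intro nrm_nonneg) simp
        ultimately show "dist (nrm A (s n \<ominus> k f)) 0 < e" using e by (simp add: dist_real_def)
      qed
    qed
  qed
  then show "h (restrict f circle) = fc u f" using conv_unique F(3) by (simp add: k_def)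
qed

subsection \<open>Spectrum\<close>

text \<open>For \<open>c\<close> off the circle the function \<open>1 / (z - c)\<close> is
  continuous on the circle, and its image inverts
  \<open>u \<ominus> c \<odot> \<one>\<close>.\<close>

lemma spectrum_unitary_subset:
  assumes u: "unitary u"
  shows "cspectrum A u \<subseteq> circle"
proof
  fix c assume c: "c \<in> cspectrum A u"
  show "c \<in> circle"
  proof (rule ccontr)
    assume nc: "c \<notin> circle"
    let ?v = "fc u (\<lambda>z. 1 / (z - c))"
    have cont: "continuous_on circle (\<lambda>z. 1 / (z - c))" "continuous_on circle (\<lambda>z. z - c)"
      using nc by (auto intro!: continuous_intros)
    have eq: "u \<ominus> c \<odot> \<one> = fc u (\<lambda>z. z - c)"
      using u by (simp add: fc_minus fc_ident fc_const continuous_on_id continuous_on_const)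
    have "(\<lambda>z. 1 / (z - c) * (z - c)) z = 1" "(\<lambda>z. (z - c) * (1 / (z - c))) z = 1" if "z \<in> circle" for z
      using that nc by auto
    then have "fc u (\<lambda>z. 1 / (z - c) * (z - c)) = \<one>" "fc u (\<lambda>z. (z - c) * (1 / (z - c))) = \<one>"
      using fc_cong[OF u continuous_on_mult[OF cont(1,2)], of "\<lambda>z. 1"]
        fc_cong[OF u continuous_on_mult[OF cont(2,1)], of "\<lambda>z. 1"] fc_one[OF u] by simp_all
    then have "?v \<otimes> (u \<ominus> c \<odot> \<one>) = \<one>" "(u \<ominus> c \<odot> \<one>) \<otimes> ?v = \<one>"
      unfolding eq using u cont by (simp_all only: fc_mult)
    then have "u \<ominus> c \<odot> \<one> \<in> Units A"
      unfolding Units_def using u cont unitaryD(1)[OF u] by (auto intro!: bexI[of _ ?v] simp: one_closed)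
    then show False using c by (simp add: cspectrum_def)
  qed
qed

text \<open>Suppose \<open>v\<close> inverts \<open>u \<ominus> c \<odot> \<one>\<close>, and let
  \<open>f z = 1 / (1 + k * cmod (z - c))\<close>. Then \<open>f c = 1\<close>, while
  \<open>(z - c) * f z\<close> is bounded by \<open>1 / k\<close>; so
  \<open>1 \<le> nrm A v / k\<close> for every positive \<open>k\<close>, which is absurd.\<close>

lemma in_spectrum_unitary:
  assumes u: "unitary u" and c: "c \<in> circle"
    and le: "\<And>f. continuous_on circle f \<Longrightarrow> cmod (f c) \<le> nrm A (fc u f)"
  shows "c \<in> cspectrum A u"
proof (rule ccontr)
  assume "c \<notin> cspectrum A u"
  then have "u \<ominus> c \<odot> \<one> \<in> Units A" by (simp add: cspectrum_def)
  then obtain v where v: "v \<in> carrier A" "v \<otimes> (u \<ominus> c \<odot> \<one>) = \<one>"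
    unfolding Units_def by blast
  have eq: "u \<ominus> c \<odot> \<one> = fc u (\<lambda>z. z - c)"
    using u by (simp add: fc_minus fc_ident fc_const continuous_on_id continuous_on_const)
  have "real k \<le> nrm A v" for k
  proof (cases "k = 0")
    case False
    let ?f = "\<lambda>z. 1 / complex_of_real (1 + k * cmod (z - c))"
    have pos: "1 + real k * cmod (z - c) > 0" for z by (simp add: add_pos_nonneg)
    then have "complex_of_real (1 + k * cmod (z - c)) \<noteq> 0" for z
      by (metis less_irrefl of_real_eq_0_iff)
    then have f: "continuous_on circle ?f" by (auto intro!: continuous_intros)
    have cz: "continuous_on circle (\<lambda>z. z - c)" by (intro continuous_intros)
    have "1 \<le> nrm A (fc u ?f)" using le[OF f] by simp
    also have "fc u ?f = v \<otimes> (fc u (\<lambda>z. z - c) \<otimes> fc u ?f)"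
      using v u f fc_closed[OF u, of "\<lambda>z. z - c"]
      by (simp add: l_one continuous_on_diff continuous_on_id continuous_on_const eq flip: m_assoc)
    also have "fc u (\<lambda>z. z - c) \<otimes> fc u ?f = fc u (\<lambda>z. (z - c) * ?f z)"
      by (rule fc_mult[OF u _ f, symmetric]) (intro continuous_intros)
    also have "nrm A (v \<otimes> fc u (\<lambda>z. (z - c) * ?f z)) \<le> nrm A v * nrm A (fc u (\<lambda>z. (z - c) * ?f z))"
      by (rule nrm_mult[OF v(1) fc_closed[OF u continuous_on_mult[OF cz f]]])
    also have "\<dots> \<le> nrm A v * (1 / k)"
    proof (intro mult_left_mono fc_nrm_le u continuous_on_mult f continuous_intros)
      fix z
      have "cmod ((z - c) * ?f z) = cmod (z - c) / (1 + k * cmod (z - c))"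
        using pos[of z] by (simp only: norm_mult norm_divide norm_of_real norm_one abs_of_pos) simp
      also have "\<dots> \<le> 1 / k" using pos[of z] False by (simp add: divide_simps)
      finally show "cmod ((z - c) * ?f z) \<le> 1 / k" .
    qed (use v nrm_nonneg in auto)
    finally show ?thesis using False by (simp add: divide_simps)
  qed (use v nrm_nonneg in simp)
  then show False using reals_Archimedean2[of "nrm A v"] by (meson not_le)
qed

text \<open>Uniqueness of homomorphisms on the circle leaves \<open>fc u f\<close> as the only
  candidate for the definite description in \<open>cfc\<close>.\<close>

lemma cfc_eq_fc:
  assumes u: "unitary u" and sp: "cspectrum A u = circle" and f: "continuous_on circle f"
  shows "cfc A u f = fc u f"
  unfolding cfc_def sp
proof (rule the_equality)
  have "fc u (restrict g circle) = fc u g" if "continuous_on circle g" for g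
    using fc_cong[OF u that, of "restrict g circle"] by simp
  then show "\<exists>h. star_hom (C_alg circle) A h \<and> h (\<lambda>z\<in>circle. z) = u \<and> h (restrict f circle) = fc u f"
    using star_hom_fc[OF u] f u by (intro exI[of _ "fc u"]) (simp add: fc_ident continuous_on_id)
next
  fix b assume "\<exists>h. star_hom (C_alg circle) A h \<and> h (\<lambda>z\<in>circle. z) = u \<and> h (restrict f circle) = b"
  then show "b = fc u f" using star_hom_C_alg_unique f by blast
qed

end

section \<open>Construction of C*-algebras\<close>

lemma cring_complex_ring: "cring complex_ring"
proof (rule cringI)
  show "abelian_group complex_ring"
  proof (rule abelian_groupI)
    show "\<exists>y\<in>carrier complex_ring. y \<oplus>\<^bsub>complex_ring\<^esub> x = \<zero>\<^bsub>complex_ring\<^esub>" for x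
      by (rule bexI[of _ "- x"]) (simp_all add: complex_ring_def)
  qed (simp_all add: complex_ring_def)
  show "comm_monoid complex_ring"
    by (rule comm_monoidI) (simp_all add: complex_ring_def)
qed (simp add: complex_ring_def algebra_simps)

text \<open>Differences are written \<open>a \<oplus> (-1) \<odot> b\<close>, since
  \<open>\<ominus>\<close> can be computed only after the group axioms have been derived.
  Completeness is stated in Cauchy form, so that no metric has to be set up by the user of the
  rule.\<close>

lemma unital_cstar_algebraI:
  fixes A :: "'a cstar" (structure)
  assumes closed: "\<And>a b. \<lbrakk>a \<in> carrier A; b \<in> carrier A\<rbrakk> \<Longrightarrow> a \<oplus> b \<in> carrier A" "\<zero> \<in> carrier A"
      "\<And>a b. \<lbrakk>a \<in> carrier A; b \<in> carrier A\<rbrakk> \<Longrightarrow> a \<otimes> b \<in> carrier A" "\<one> \<in> carrier A"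
      "\<And>c a. a \<in> carrier A \<Longrightarrow> c \<odot> a \<in> carrier A"
    and add: "\<And>a b c. \<lbrakk>a \<in> carrier A; b \<in> carrier A; c \<in> carrier A\<rbrakk> \<Longrightarrow> (a \<oplus> b) \<oplus> c = a \<oplus> (b \<oplus> c)"
      "\<And>a b. \<lbrakk>a \<in> carrier A; b \<in> carrier A\<rbrakk> \<Longrightarrow> a \<oplus> b = b \<oplus> a"
      "\<And>a. a \<in> carrier A \<Longrightarrow> \<zero> \<oplus> a = a"
    and mult: "\<And>a b c. \<lbrakk>a \<in> carrier A; b \<in> carrier A; c \<in> carrier A\<rbrakk> \<Longrightarrow> (a \<otimes> b) \<otimes> c = a \<otimes> (b \<otimes> c)"
      "\<And>a. a \<in> carrier A \<Longrightarrow> \<one> \<otimes> a = a" "\<And>a. a \<in> carrier A \<Longrightarrow> a \<otimes> \<one> = a"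
      "\<And>a b c. \<lbrakk>a \<in> carrier A; b \<in> carrier A; c \<in> carrier A\<rbrakk> \<Longrightarrow> (a \<oplus> b) \<otimes> c = a \<otimes> c \<oplus> b \<otimes> c"
      "\<And>a b c. \<lbrakk>a \<in> carrier A; b \<in> carrier A; c \<in> carrier A\<rbrakk> \<Longrightarrow> c \<otimes> (a \<oplus> b) = c \<otimes> a \<oplus> c \<otimes> b"
    and smult: "\<And>c d a. a \<in> carrier A \<Longrightarrow> (c + d) \<odot> a = c \<odot> a \<oplus> d \<odot> a"
      "\<And>c a b. \<lbrakk>a \<in> carrier A; b \<in> carrier A\<rbrakk> \<Longrightarrow> c \<odot> (a \<oplus> b) = c \<odot> a \<oplus> c \<odot> b"
      "\<And>c d a. a \<in> carrier A \<Longrightarrow> (c * d) \<odot> a = c \<odot> (d \<odot> a)"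
      "\<And>a. a \<in> carrier A \<Longrightarrow> 1 \<odot> a = a" "\<And>a. a \<in> carrier A \<Longrightarrow> 0 \<odot> a = \<zero>"
      "\<And>c a b. \<lbrakk>a \<in> carrier A; b \<in> carrier A\<rbrakk> \<Longrightarrow> (c \<odot> a) \<otimes> b = c \<odot> (a \<otimes> b)"
      "\<And>c a b. \<lbrakk>a \<in> carrier A; b \<in> carrier A\<rbrakk> \<Longrightarrow> a \<otimes> (c \<odot> b) = c \<odot> (a \<otimes> b)"
    and star: "\<And>a. a \<in> carrier A \<Longrightarrow> star A a \<in> carrier A"
      "\<And>a. a \<in> carrier A \<Longrightarrow> star A (star A a) = a"
      "\<And>a b. \<lbrakk>a \<in> carrier A; b \<in> carrier A\<rbrakk> \<Longrightarrow> star A (a \<oplus> b) = star A a \<oplus> star A b"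
      "\<And>c a. a \<in> carrier A \<Longrightarrow> star A (c \<odot> a) = cnj c \<odot> star A a"
      "\<And>a b. \<lbrakk>a \<in> carrier A; b \<in> carrier A\<rbrakk> \<Longrightarrow> star A (a \<otimes> b) = star A b \<otimes> star A a"
    and nrm: "\<And>a. a \<in> carrier A \<Longrightarrow> 0 \<le> nrm A a" "\<And>a. a \<in> carrier A \<Longrightarrow> nrm A a = 0 \<longleftrightarrow> a = \<zero>"
      "\<And>a b. \<lbrakk>a \<in> carrier A; b \<in> carrier A\<rbrakk> \<Longrightarrow> nrm A (a \<oplus> b) \<le> nrm A a + nrm A b"
      "\<And>c a. a \<in> carrier A \<Longrightarrow> nrm A (c \<odot> a) = cmod c * nrm A a"
      "\<And>a b. \<lbrakk>a \<in> carrier A; b \<in> carrier A\<rbrakk> \<Longrightarrow> nrm A (a \<otimes> b) \<le> nrm A a * nrm A b"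
      "\<And>a. a \<in> carrier A \<Longrightarrow> nrm A (star A a \<otimes> a) = (nrm A a)\<^sup>2"
    and complete: "\<And>s :: nat \<Rightarrow> 'a. \<lbrakk>\<And>n. s n \<in> carrier A;
        \<And>e. e > 0 \<Longrightarrow> \<exists>N. \<forall>m\<ge>N. \<forall>n\<ge>N. nrm A (s m \<oplus> (-1) \<odot> s n) < e\<rbrakk>
        \<Longrightarrow> \<exists>a\<in>carrier A. \<forall>e>0. \<exists>N. \<forall>n\<ge>N. nrm A (s n \<oplus> (-1) \<odot> a) < e"
  shows "unital_cstar_algebra A"
proof -
  have neg: "(-1) \<odot> a \<oplus> a = \<zero>" if "a \<in> carrier A" for a
    using smult(1)[OF that, of "-1" 1] that by (simp add: smult)
  have ag: "abelian_group A"
  proof (rule abelian_groupI)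
    show "\<exists>b\<in>carrier A. b \<oplus> a = \<zero>" if "a \<in> carrier A" for a
      using neg[OF that] closed(5)[OF that] by blast
  qed (fact closed(1) closed(2) add)+
  have ring: "ring A"
    by (rule ringI[OF ag]) (auto intro: monoidI simp: closed mult)
  have module: "Module.module complex_ring A"
    by (rule moduleI[OF cring_complex_ring ag]) (simp_all add: complex_ring_def closed smult)
  have minus: "a \<ominus> b = a \<oplus> (-1) \<odot> b" if "a \<in> carrier A" "b \<in> carrier A" for a b
    using abelian_group.minus_equality[OF ag neg[OF that(2)]] that closed
    by (simp add: a_minus_def)
  have cdist: "cdist A a b = nrm A (a \<oplus> (-1) \<odot> b)" if "a \<in> carrier A" "b \<in> carrier A" for a b
    using that by (simp add: cdist_def minus)
  have metric: "Metric_space (carrier A) (cdist A)"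
  proof
    fix a b c
    have comm: "cdist A a b = cdist A b a" if "a \<in> carrier A" "b \<in> carrier A" for a b
    proof -
      have "(-1) \<odot> (b \<oplus> (-1) \<odot> a) = a \<oplus> (-1) \<odot> b"
        using that by (simp add: smult closed add(2) flip: smult(3))
      then show ?thesis
        using nrm(4)[of "b \<oplus> (-1) \<odot> a" "-1"] that by (simp add: cdist closed)
    qed
    show "cdist A a b = cdist A b a" using comm by (auto simp: cdist_def)
    show "0 \<le> cdist A a b"
      using nrm(1) closed minus by (simp add: cdist_def)
    assume a: "a \<in> carrier A" and b: "b \<in> carrier A"
    show "(cdist A a b = 0) = (a = b)"
    proof
      assume "cdist A a b = 0"
      then have "a \<oplus> (-1) \<odot> b = \<zero>" using a b by (simp add: cdist nrm(2) closed)
      then have "(a \<oplus> (-1) \<odot> b) \<oplus> b = b" using b by (simp add: add)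
      moreover have "(a \<oplus> (-1) \<odot> b) \<oplus> b = a \<oplus> \<zero>"
        using add(1)[OF a closed(5)[OF b] b, of "-1"] neg[OF b] by simp
      moreover have "a \<oplus> \<zero> = a" using add(2)[OF a closed(2)] add(3)[OF a] by simp
      ultimately show "a = b" by simp
    next
      assume "a = b"
      then show "cdist A a b = 0"
        using a neg[OF a] add(2)[OF a closed(5)[OF a], of "-1"] by (simp add: cdist nrm(2) closed)
    qed
    assume c: "c \<in> carrier A"
    have "a \<oplus> (-1) \<odot> c = (a \<oplus> (-1) \<odot> b) \<oplus> (b \<oplus> (-1) \<odot> c)"
    proof -
      have "(a \<oplus> (-1) \<odot> b) \<oplus> (b \<oplus> (-1) \<odot> c) = a \<oplus> (((-1) \<odot> b \<oplus> b) \<oplus> (-1) \<odot> c)"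
        using a b c by (simp add: add(1) closed)
      then show ?thesis using a c neg[OF b] by (simp add: add(3) closed)
    qed
    then show "cdist A a c \<le> cdist A a b + cdist A b c"
      using nrm(3)[of "a \<oplus> (-1) \<odot> b" "b \<oplus> (-1) \<odot> c"] a b c by (simp add: cdist closed)
  qed
  interpret M: Metric_space "carrier A" "cdist A" by (rule metric)
  have "M.mcomplete"
    unfolding M.mcomplete_def
  proof (intro allI impI)
    fix s assume s: "M.MCauchy s"
    then have sc: "s n \<in> carrier A" for n unfolding M.MCauchy_def by auto
    have "\<exists>N. \<forall>m\<ge>N. \<forall>n\<ge>N. nrm A (s m \<oplus> (-1) \<odot> s n) < e" if "e > 0" for e
      using s that unfolding M.MCauchy_def by (simp add: cdist sc)
    with sc have "\<exists>a\<in>carrier A. \<forall>e>0. \<exists>N. \<forall>n\<ge>N. nrm A (s n \<oplus> (-1) \<odot> a) < e"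
      by (rule complete[of s])
    then obtain a where
      a: "a \<in> carrier A" "\<forall>e>0. \<exists>N. \<forall>n\<ge>N. nrm A (s n \<oplus> (-1) \<odot> a) < e" ..
    then have "limitin M.mtopology s a sequentially"
      by (simp add: M.limit_metric_sequentially sc cdist)
    then show "\<exists>a. limitin M.mtopology s a sequentially" ..
  qed
  then show ?thesis
    by (intro unital_cstar_algebra.intro unital_cstar_algebra_axioms.intro ring module)
      (simp_all add: smult star nrm)
qed

subsection \<open>Transport along an injection\<close>

text \<open>Its purpose is to move a C*-algebra along an injection into the type of the test
  algebras in \<open>is_A\<close>.\<close>

definition transport :: "('a \<Rightarrow> 'b) \<Rightarrow> 'a cstar \<Rightarrow> 'b cstar" where
  "transport f A = (let g = inv_into (carrier A) f in \<lparr>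
     carrier = f ` carrier A,
     mult = (\<lambda>x y. f (g x \<otimes>\<^bsub>A\<^esub> g y)),
     one = f \<one>\<^bsub>A\<^esub>,
     ring.zero = f \<zero>\<^bsub>A\<^esub>,
     add = (\<lambda>x y. f (g x \<oplus>\<^bsub>A\<^esub> g y)),
     smult = (\<lambda>c x. f (c \<odot>\<^bsub>A\<^esub> g x)),
     star = (\<lambda>x. f (star A (g x))),
     nrm = (\<lambda>x. nrm A (g x))\<rparr>)"

lemma transport_simps:
  assumes "inj_on f (carrier A)"
  shows "carrier (transport f A) = f ` carrier A"
    "\<lbrakk>a \<in> carrier A; b \<in> carrier A\<rbrakk> \<Longrightarrow> f a \<otimes>\<^bsub>transport f A\<^esub> f b = f (a \<otimes>\<^bsub>A\<^esub> b)"
    "\<lbrakk>a \<in> carrier A; b \<in> carrier A\<rbrakk> \<Longrightarrow> f a \<oplus>\<^bsub>transport f A\<^esub> f b = f (a \<oplus>\<^bsub>A\<^esub> b)"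
    "\<one>\<^bsub>transport f A\<^esub> = f \<one>\<^bsub>A\<^esub>" "\<zero>\<^bsub>transport f A\<^esub> = f \<zero>\<^bsub>A\<^esub>"
    "a \<in> carrier A \<Longrightarrow> c \<odot>\<^bsub>transport f A\<^esub> f a = f (c \<odot>\<^bsub>A\<^esub> a)"
    "a \<in> carrier A \<Longrightarrow> star (transport f A) (f a) = f (star A a)"
    "a \<in> carrier A \<Longrightarrow> nrm (transport f A) (f a) = nrm A a"
  using assms by (simp_all add: transport_def Let_def)

lemma unital_cstar_algebra_transport:
  fixes f :: "'a \<Rightarrow> 'b"
  assumes "unital_cstar_algebra A" and inj: "inj_on f (carrier A)"
  shows "unital_cstar_algebra (transport f A)"
proof -
  interpret A: unital_cstar_algebra A by fact
  note T = transport_simps[OF inj]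
  note cl = A.m_closed A.a_closed A.one_closed A.zero_closed
  show ?thesis
  proof (rule unital_cstar_algebraI)
    fix s :: "nat \<Rightarrow> 'b"
    assume s: "\<And>n. s n \<in> carrier (transport f A)"
      and C: "\<And>e. e > 0 \<Longrightarrow> \<exists>N. \<forall>m\<ge>N. \<forall>n\<ge>N.
        nrm (transport f A) (s m \<oplus>\<^bsub>transport f A\<^esub> (-1) \<odot>\<^bsub>transport f A\<^esub> s n) < e"
    define t where "t n = inv_into (carrier A) f (s n)" for n
    have t: "t n \<in> carrier A" "s n = f (t n)" for n
      using s[of n] by (simp_all add: t_def T(1) inv_into_into f_inv_into_f)
    have "\<exists>a. A.conv t a"
      using C by (intro A.Cauchy_conv t) (simp add: t T A.minus_eq_scalar cl)
    then obtain a where a: "A.conv t a" ..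
    then have ac: "a \<in> carrier A" by (rule A.convD)
    have "\<exists>N. \<forall>n\<ge>N. nrm A (t n \<ominus>\<^bsub>A\<^esub> a) < e" if "e > 0" for e
      using order_tendstoD(2)[OF A.convD(3)[OF a] that] by (simp add: eventually_sequentially)
    then show "\<exists>a\<in>carrier (transport f A). \<forall>e>0. \<exists>N. \<forall>n\<ge>N.
        nrm (transport f A) (s n \<oplus>\<^bsub>transport f A\<^esub> (-1) \<odot>\<^bsub>transport f A\<^esub> a) < e"
      using ac by (intro bexI[of _ "f a"]) (simp_all add: t T A.minus_eq_scalar cl)
  qed (auto simp: T cl A.a_assoc A.a_comm A.a_lcomm A.m_assoc A.l_one A.r_one A.l_distr A.r_distr
      A.scalar_add_left A.scalar_add_right A.scalar_mult A.mult_smult_left A.mult_smult_right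
      A.star_add A.star_smult A.star_mult A.nrm_nonneg A.nrm_eq_0_iff A.nrm_triangle A.nrm_smult
      A.nrm_mult A.cstar_identity inj_on_eq_iff[OF inj])
qed

lemma star_hom_transport:
  assumes "unital_cstar_algebra A" and inj: "inj_on f (carrier A)"
  shows "star_hom A (transport f A) f" "star_hom (transport f A) A (inv_into (carrier A) f)"
proof -
  interpret A: unital_cstar_algebra A by fact
  note cl = A.m_closed A.a_closed A.one_closed A.zero_closed
  show "star_hom A (transport f A) f"
    by (rule star_homI) (simp_all add: transport_simps[OF inj])
  show "star_hom (transport f A) A (inv_into (carrier A) f)"
    by (rule star_homI) (auto simp: transport_simps[OF inj] cl inj)
qed

subsection \<open>Functional calculus and homomorphisms\<close>

lemma star_hom_unitary:
  assumes "unital_cstar_algebra A" "unital_cstar_algebra B" "star_hom A B h"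
    and "unital_cstar_algebra.unitary A u"
  shows "unital_cstar_algebra.unitary B (h u)"
proof -
  interpret A: unital_cstar_algebra A by fact
  interpret B: unital_cstar_algebra B by fact
  note H = star_homD[OF assms(3)] and u = A.unitaryD[OF assms(4)]
  show ?thesis
    unfolding B.unitary_def using u H(3)[of "star A u" u] H(3)[of u "star A u"] by (simp add: H)
qed

text \<open>Both sides are star-homomorphisms in \<open>f\<close> that map the identity function to
  \<open>h u\<close>.\<close>

lemma star_hom_fc_commute:
  assumes "unital_cstar_algebra A" "unital_cstar_algebra B" and h: "star_hom A B h"
    and u: "unital_cstar_algebra.unitary A u" and f: "continuous_on circle f"
  shows "h (unital_cstar_algebra.fc A u f) = unital_cstar_algebra.fc B (h u) f"
proof -
  interpret A: unital_cstar_algebra A by fact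
  interpret B: unital_cstar_algebra B by fact
  have "star_hom (C_alg circle) B (h \<circ> A.fc u)"
    by (rule star_hom_compose[OF A.star_hom_fc[OF u] h])
  moreover have "A.fc u (restrict g circle) = A.fc u g" if "continuous_on circle g" for g
    using A.fc_cong[OF u that, of "restrict g circle"] by simp
  ultimately show ?thesis
    using B.star_hom_C_alg_unique(2)[of "h \<circ> A.fc u" "h u" f] f u
    by (simp add: continuous_on_id A.fc_ident)
qed

lemma star_hom_spectrum_subset:
  assumes "unital_cstar_algebra A" "unital_cstar_algebra B" and h: "star_hom A B h"
    and a: "a \<in> carrier A"
  shows "cspectrum B (h a) \<subseteq> cspectrum A a"
proof
  interpret A: unital_cstar_algebra A by fact
  interpret B: unital_cstar_algebra B by fact
  note H = star_homD[OF h]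
  fix c assume c: "c \<in> cspectrum B (h a)"
  show "c \<in> cspectrum A a"
  proof (rule ccontr)
    assume "c \<notin> cspectrum A a"
    then obtain v where v: "v \<in> carrier A" "v \<otimes>\<^bsub>A\<^esub> (a \<ominus>\<^bsub>A\<^esub> c \<odot>\<^bsub>A\<^esub> \<one>\<^bsub>A\<^esub>) = \<one>\<^bsub>A\<^esub>"
      "(a \<ominus>\<^bsub>A\<^esub> c \<odot>\<^bsub>A\<^esub> \<one>\<^bsub>A\<^esub>) \<otimes>\<^bsub>A\<^esub> v = \<one>\<^bsub>A\<^esub>"
      unfolding cspectrum_def Units_def using a by (auto simp: A.one_closed)
    have mc: "a \<ominus>\<^bsub>A\<^esub> c \<odot>\<^bsub>A\<^esub> \<one>\<^bsub>A\<^esub> \<in> carrier A" using a by (simp add: A.one_closed)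
    have hm: "h (a \<ominus>\<^bsub>A\<^esub> c \<odot>\<^bsub>A\<^esub> \<one>\<^bsub>A\<^esub>) = h a \<ominus>\<^bsub>B\<^esub> c \<odot>\<^bsub>B\<^esub> \<one>\<^bsub>B\<^esub>"
      using a by (simp add: star_hom_minus[OF assms(1-3)] H A.one_closed)
    have "h v \<otimes>\<^bsub>B\<^esub> (h a \<ominus>\<^bsub>B\<^esub> c \<odot>\<^bsub>B\<^esub> \<one>\<^bsub>B\<^esub>) = \<one>\<^bsub>B\<^esub>" "(h a \<ominus>\<^bsub>B\<^esub> c \<odot>\<^bsub>B\<^esub> \<one>\<^bsub>B\<^esub>) \<otimes>\<^bsub>B\<^esub> h v = \<one>\<^bsub>B\<^esub>"
      using H(3)[OF v(1) mc] H(3)[OF mc v(1)] v H(4) by (simp_all add: hm)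
    then have "h a \<ominus>\<^bsub>B\<^esub> c \<odot>\<^bsub>B\<^esub> \<one>\<^bsub>B\<^esub> \<in> Units B"
      unfolding Units_def using H(1)[OF v(1)] H(1)[OF mc] hm by auto
    then show False using c by (simp add: cspectrum_def)
  qed
qed

context unital_cstar_algebra
begin

section \<open>Rotating a unitary by a scalar of modulus one\<close>

lemma unitary_scalar:
  assumes "unitary u" "cmod c = 1"
  shows "unitary (c \<odot> u)"
proof -
  have "cnj c * c = 1" "c * cnj c = 1"
    using assms(2) complex_norm_square[of c] by (auto simp: mult.commute)
  then show ?thesis
    using unitaryD[OF assms(1)]
    by (simp add: unitary_def star_smult mult_smult_left mult_smult_right scalar_mult one_closed m_closed)
qed

lemma continuous_on_rotate:
  fixes f :: "complex \<Rightarrow> 'b::topological_space"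
  assumes "cmod c = 1" "continuous_on circle f"
  shows "continuous_on circle (\<lambda>z. f (c * z))"
  by (rule continuous_on_compose2[OF assms(2)])
    (use assms(1) in \<open>auto intro!: continuous_intros simp: norm_mult\<close>)

text \<open>The right-hand side is a star-homomorphism in \<open>f\<close> that maps the identity
  function to \<open>c \<odot> u\<close>, and such a homomorphism is unique.\<close>

lemma fc_rotate:
  assumes u: "unitary u" and c: "cmod c = 1" and f: "continuous_on circle f"
  shows "fc (c \<odot> u) f = fc u (\<lambda>z. f (c * z))"
proof -
  let ?h = "\<lambda>f. fc u (\<lambda>z. f (c * z))"
  have ct: "continuous_on circle (\<lambda>z. f (c * z))" if "f \<in> carrier (C_alg circle)" for f
    using that c by (intro continuous_on_rotate) (auto simp: carrier_C_alg)
  have cz: "c * z \<in> circle" if "z \<in> circle" for z using that c by (simp add: norm_mult)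
  have cong: "fc u (\<lambda>z. (\<lambda>z\<in>circle. g z) (c * z)) = fc u (\<lambda>z. g (c * z))"
    if "continuous_on circle (\<lambda>z. g (c * z))" for g
    using that cz by (intro fc_cong[OF u, symmetric]) auto
  have "star_hom (C_alg circle) A ?h"
  proof (rule star_homI)
    fix f g d assume f: "f \<in> carrier (C_alg circle)"
    show "?h f \<in> carrier A" using ct[OF f] u by simp
    show "?h (d \<odot>\<^bsub>C_alg circle\<^esub> f) = d \<odot> ?h f"
      using cong[of "\<lambda>z. d * f z"] ct[OF f] u
      by (simp add: C_alg_def fc_scalar continuous_on_mult_left)
    show "?h (star (C_alg circle) f) = star A (?h f)"
      using cong[of "\<lambda>z. cnj (f z)"] ct[OF f] u
      by (simp add: C_alg_def fc_star continuous_on_cnj)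
    assume g: "g \<in> carrier (C_alg circle)"
    show "?h (f \<oplus>\<^bsub>C_alg circle\<^esub> g) = ?h f \<oplus> ?h g"
      using cong[of "\<lambda>z. f z + g z"] ct[OF f] ct[OF g] u
      by (simp add: C_alg_def fc_add continuous_on_add)
    show "?h (f \<otimes>\<^bsub>C_alg circle\<^esub> g) = ?h f \<otimes> ?h g"
      using cong[of "\<lambda>z. f z * g z"] ct[OF f] ct[OF g] u
      by (simp add: C_alg_def fc_mult continuous_on_mult)
  next
    show "?h \<one>\<^bsub>C_alg circle\<^esub> = \<one>"
      using cong[of "\<lambda>z. 1"] u by (simp add: C_alg_def fc_one continuous_on_const)
  qed
  moreover have "?h (\<lambda>z\<in>circle. z) = c \<odot> u"
    using cong[of "\<lambda>z. z"] fc_scalar[OF u continuous_on_id, of c] u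
    by (simp add: fc_ident continuous_on_mult_left continuous_on_id)
  ultimately have "?h (restrict f circle) = fc (c \<odot> u) f"
    using star_hom_C_alg_unique(2) f by blast
  then show ?thesis
    using cong[of f] continuous_on_rotate[OF c f] by simp
qed

text \<open>Up to the invertible scalar \<open>c\<close>, the element
  \<open>c \<odot> u \<ominus> z \<odot> \<one>\<close> is
  \<open>u \<ominus> (z / c) \<odot> \<one>\<close>.\<close>

lemma spectrum_rotate:
  assumes u: "u \<in> carrier A" and c: "cmod c = 1" and sp: "cspectrum A u = circle" and "unitary u"
  shows "cspectrum A (c \<odot> u) = circle"
proof
  show "cspectrum A (c \<odot> u) \<subseteq> circle"
    by (rule spectrum_unitary_subset[OF unitary_scalar[OF assms(4) c]])
  show "circle \<subseteq> cspectrum A (c \<odot> u)"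
  proof
    fix z assume z: "z \<in> circle"
    have c0: "c \<noteq> 0" using c by auto
    show "z \<in> cspectrum A (c \<odot> u)"
    proof (rule ccontr)
      assume "z \<notin> cspectrum A (c \<odot> u)"
      then obtain v where v: "v \<in> carrier A" "v \<otimes> (c \<odot> u \<ominus> z \<odot> \<one>) = \<one>" "(c \<odot> u \<ominus> z \<odot> \<one>) \<otimes> v = \<one>"
        unfolding cspectrum_def Units_def using u by (auto simp: one_closed)
      have eq: "c \<odot> u \<ominus> z \<odot> \<one> = c \<odot> (u \<ominus> (z / c) \<odot> \<one>)"
        using u c0 by (simp add: scalar_minus_right scalar_mult one_closed)
      have mc: "u \<ominus> (z / c) \<odot> \<one> \<in> carrier A" using u by (simp add: one_closed)
      have "(c \<odot> v) \<otimes> (u \<ominus> (z / c) \<odot> \<one>) = \<one>" "(u \<ominus> (z / c) \<odot> \<one>) \<otimes> (c \<odot> v) = \<one>"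
        using v(2,3) mc v(1) unfolding eq by (simp_all add: mult_smult_left mult_smult_right)
      then have "u \<ominus> (z / c) \<odot> \<one> \<in> Units A"
        unfolding Units_def using mc v(1) by (auto intro!: bexI[of _ "c \<odot> v"])
      then have "z / c \<notin> cspectrum A u" by (simp add: cspectrum_def)
      then show False using sp z c by (simp add: norm_divide)
    qed
  qed
qed

lemma norm_rot [simp]: "cmod (rot \<theta>) = 1"
  by (simp add: norm_exp_eq_Re)

text \<open>Removes \<open>cfc\<close> from the relations. The spectrum of the rotated unitary is
  the circle as well, so both instances of the calculus become functions of the same
  \<open>w\<close>.\<close>

lemma A_relations_iff:
  assumes sp: "cspectrum A w = circle" and g: "continuous_on circle \<gamma>"
  shows "A_relations \<theta> \<gamma> A x w \<longleftrightarrow> x \<in> carrier A \<and> unitary w \<and>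
    star A x \<otimes> x = fc w (\<lambda>z. of_real (\<gamma> z)) \<and>
    x \<otimes> star A x = fc w (\<lambda>z. of_real (\<gamma> (rot \<theta> * z))) \<and>
    x \<otimes> w = rot \<theta> \<odot> (w \<otimes> x)"
proof (cases "unitary w")
  case True
  have g': "continuous_on circle (\<lambda>z. complex_of_real (\<gamma> z))" using g by (intro continuous_intros)
  show ?thesis
    using True unitaryD[OF True] cfc_eq_fc[OF True sp g']
      cfc_eq_fc[OF unitary_scalar[OF True] spectrum_rotate[OF _ _ sp True] g', of "rot \<theta>"]
      fc_rotate[OF True _ g', of "rot \<theta>"]
    by (simp add: A_relations_def)
qed (auto simp: A_relations_def unitary_def)

end

text \<open>As \<open>k\<close> undoes \<open>h\<close>, the spectra of \<open>w\<close> and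
  \<open>h w\<close> include each other. The relations in both algebras can then be read with
  \<open>fc\<close>, which homomorphisms respect.\<close>

lemma A_relations_transfer:
  assumes A: "unital_cstar_algebra A" and B: "unital_cstar_algebra B"
    and h: "star_hom A B h" and k: "star_hom B A k" and kh: "\<And>a. a \<in> carrier A \<Longrightarrow> k (h a) = a"
    and sp: "cspectrum A w = circle" and g: "continuous_on circle \<gamma>" and r: "A_relations \<theta> \<gamma> A x w"
  shows "A_relations \<theta> \<gamma> B (h x) (h w)" "cspectrum B (h w) = circle"
proof -
  interpret A: unital_cstar_algebra A by fact
  interpret B: unital_cstar_algebra B by fact
  note H = star_homD[OF h]
  note R = r[unfolded A.A_relations_iff[OF sp g]]
  have w: "w \<in> carrier A" using R A.unitaryD by blast
  have g': "continuous_on circle (\<lambda>z. complex_of_real (\<gamma> z))" using g by (intro continuous_intros)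
  have g'': "continuous_on circle (\<lambda>z. complex_of_real (\<gamma> (rot \<theta> * z)))"
    by (rule A.continuous_on_rotate[OF A.norm_rot g'])
  show sp': "cspectrum B (h w) = circle"
    using star_hom_spectrum_subset[OF A B h w] star_hom_spectrum_subset[OF B A k H(1)[OF w]] kh[OF w] sp
    by simp
  show "A_relations \<theta> \<gamma> B (h x) (h w)"
    unfolding B.A_relations_iff[OF sp' g]
    using R w star_hom_unitary[OF A B h, of w] star_hom_fc_commute[OF A B h _ g', of w]
      star_hom_fc_commute[OF A B h _ g'', of w] H(3)[of x w] H(3)[of w x] H(3)[of x "star A x"]
      H(3)[of "star A x" x]
    by (simp add: H A.m_closed)
qed

subsection \<open>Separability\<close>

text \<open>Expressions in the two generators with complex rational scalars: countably many, yet
  with dense values. \<open>Gen True\<close> stands for \<open>x\<close> and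
  \<open>Gen False\<close> for \<open>w\<close>.\<close>

datatype cexpr = One | Gen bool | Add cexpr cexpr | Mul cexpr cexpr | Star cexpr | Scale rat rat cexpr

instance cexpr :: countable
  by countable_datatype

primrec ceval :: "'a cstar \<Rightarrow> 'a \<Rightarrow> 'a \<Rightarrow> cexpr \<Rightarrow> 'a" where
  "ceval A x w One = \<one>\<^bsub>A\<^esub>"
| "ceval A x w (Gen b) = (if b then x else w)"
| "ceval A x w (Add d e) = ceval A x w d \<oplus>\<^bsub>A\<^esub> ceval A x w e"
| "ceval A x w (Mul d e) = ceval A x w d \<otimes>\<^bsub>A\<^esub> ceval A x w e"
| "ceval A x w (Star e) = star A (ceval A x w e)"
| "ceval A x w (Scale p q e) = Complex (of_rat p) (of_rat q) \<odot>\<^bsub>A\<^esub> ceval A x w e"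

lemma complex_rational_approx:
  assumes "e > 0"
  shows "\<exists>p q. cmod (c - Complex (of_rat p) (of_rat q)) < e"
proof -
  obtain p where p: "Re c < of_rat p" "of_rat p < Re c + e / 2" using of_rat_dense[of "Re c" "Re c + e/2"] assms by auto
  obtain q where q: "Im c < of_rat q" "of_rat q < Im c + e / 2" using of_rat_dense[of "Im c" "Im c + e/2"] assms by auto
  have "cmod (c - Complex (of_rat p) (of_rat q)) \<le> \<bar>Re c - of_rat p\<bar> + \<bar>Im c - of_rat q\<bar>"
    using cmod_le[of "c - Complex (of_rat p) (of_rat q)"] by simp
  also have "\<dots> < e" using p q by simp
  finally show ?thesis by blast
qed

text \<open>An element is determined by its distances to a countable dense set; the sequence of
  these distances is the injection.\<close>

lemma (in unital_cstar_algebra) generated_by_two_inj: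
  assumes gen: "cstar_generated A {x, w} = carrier A" and xw: "x \<in> carrier A" "w \<in> carrier A"
  shows "\<exists>f :: 'a \<Rightarrow> nat \<Rightarrow> complex. inj_on f (carrier A)"
proof -
  let ?v = "ceval A x w"
  have vc: "?v e \<in> carrier A" for e
    by (induction e) (use xw in \<open>auto simp: one_closed m_closed a_closed\<close>)
  have dense: "\<exists>s. (\<forall>n. s n \<in> range ?v) \<and> conv s a" if a: "a \<in> carrier A" for a
    using gen a
  proof (rule dense_generated)
    fix b c assume "b \<in> range ?v" "c \<in> range ?v"
    then obtain d e where "b = ?v d" "c = ?v e" by auto
    then show "b \<oplus> c \<in> range ?v" "b \<otimes> c \<in> range ?v"
      by (auto intro: range_eqI[of _ _ "Add d e"] range_eqI[of _ _ "Mul d e"])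
  next
    fix b assume "b \<in> range ?v"
    then obtain d where d: "b = ?v d" by auto
    then show "star A b \<in> range ?v" by (auto intro: range_eqI[of _ _ "Star d"])
    fix c and e :: real assume "e > 0"
    then have "e / (nrm A b + 1) > 0" using nrm_nonneg vc d by (simp add: add_nonneg_pos)
    from complex_rational_approx[OF this, of c] obtain p q
      where pq: "cmod (c - Complex (of_rat p) (of_rat q)) < e / (nrm A b + 1)" by blast
    let ?q = "Complex (of_rat p) (of_rat q)"
    have "nrm A (c \<odot> b \<ominus> ?q \<odot> b) = cmod (c - ?q) * nrm A b"
      using vc d by (simp add: nrm_smult flip: scalar_minus_left)
    also have "\<dots> \<le> cmod (c - ?q) * (nrm A b + 1)" by (intro mult_left_mono) auto
    also have "\<dots> < e" using pq nrm_nonneg[OF vc, of d] d by (simp add: pos_less_divide_eq add_nonneg_pos)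
    finally show "\<exists>b'\<in>range ?v. nrm A (c \<odot> b \<ominus> b') < e"
      using d by (intro bexI[of _ "?q \<odot> b"]) (auto intro: range_eqI[of _ _ "Scale p q d"])
  next
    show "{x, w} \<subseteq> range ?v" by (auto intro: range_eqI[of _ _ "Gen True"] range_eqI[of _ _ "Gen False"])
    show "\<one> \<in> range ?v" by (auto intro: range_eqI[of _ _ One])
  qed (use vc in auto)
  let ?f = "\<lambda>a n. complex_of_real (nrm A (?v (from_nat n) \<ominus> a))"
  have "inj_on ?f (carrier A)"
  proof (rule inj_onI)
    fix a b assume a: "a \<in> carrier A" and b: "b \<in> carrier A" and eq: "?f a = ?f b"
    have eq': "nrm A (?v e \<ominus> a) = nrm A (?v e \<ominus> b)" for e
      using fun_cong[OF eq, of "to_nat e"] by simp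
    obtain s where s: "\<forall>n. s n \<in> range ?v" "conv s a" using dense[OF a] by auto
    have "nrm A (s n \<ominus> a) = nrm A (s n \<ominus> b)" for n
    proof -
      obtain e where "s n = ?v e" using s(1) by blast
      then show ?thesis by (simp add: eq')
    qed
    then have "conv s b" using s(2) b by (simp add: conv_def)
    then show "a = b" using conv_unique s(2) by simp
  qed
  then show ?thesis by blast
qed

section \<open>The Hilbert space of square-summable sequences\<close>

text \<open>Indices are integers because the shift must be invertible: on one-sided sequences the
  relation for \<open>x\<close> times its adjoint would fail at the first index unless \<gamma>
  vanishes at the corresponding point.\<close>

typedef ell2 = "{f :: int \<Rightarrow> complex. (\<lambda>i. (cmod (f i))\<^sup>2) summable_on UNIV}"
  morphisms ecoord Abs_ell2
  by (rule exI[of _ "\<lambda>_. 0"]) simp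

setup_lifting type_definition_ell2

lemma ecoord_summable: "(\<lambda>i. (cmod (ecoord x i))\<^sup>2) summable_on UNIV"
  using ecoord[of x] by simp

lemma ell2_eqI: "(\<And>i. ecoord x i = ecoord y i) \<Longrightarrow> x = y"
  by (metis ecoord_inject ext)

section \<open>Closure properties of square-summability\<close>

lemma summable_square_add:
  fixes f g :: "int \<Rightarrow> complex"
  assumes "(\<lambda>i. (cmod (f i))\<^sup>2) summable_on UNIV" "(\<lambda>i. (cmod (g i))\<^sup>2) summable_on UNIV"
  shows "(\<lambda>i. (cmod (f i + g i))\<^sup>2) summable_on UNIV"
proof (rule summable_on_comparison_test)
  show "(\<lambda>i. 2 * (cmod (f i))\<^sup>2 + 2 * (cmod (g i))\<^sup>2) summable_on UNIV"
    by (intro summable_on_add summable_on_cmult_right assms)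
  fix i
  have "(cmod (f i + g i))\<^sup>2 \<le> (cmod (f i) + cmod (g i))\<^sup>2"
    by (intro power_mono norm_triangle_ineq) auto
  also have "\<dots> \<le> 2 * (cmod (f i))\<^sup>2 + 2 * (cmod (g i))\<^sup>2"
    using sum_squares_bound[of "cmod (f i)" "cmod (g i)"] by (simp add: power2_sum)
  finally show "(cmod (f i + g i))\<^sup>2 \<le> 2 * (cmod (f i))\<^sup>2 + 2 * (cmod (g i))\<^sup>2" .
qed auto

lemma summable_square_mult:
  fixes d f :: "int \<Rightarrow> complex"
  assumes f: "(\<lambda>i. (cmod (f i))\<^sup>2) summable_on UNIV" and d: "\<And>i. cmod (d i) \<le> C"
  shows "(\<lambda>i. (cmod (d i * f i))\<^sup>2) summable_on UNIV"
proof (rule summable_on_comparison_test)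
  show "(\<lambda>i. C\<^sup>2 * (cmod (f i))\<^sup>2) summable_on UNIV" by (intro summable_on_cmult_right f)
  show "(cmod (d i * f i))\<^sup>2 \<le> C\<^sup>2 * (cmod (f i))\<^sup>2" for i
    using d[of i] by (simp add: norm_mult power_mult_distrib mult_right_mono power_mono)
qed auto

lemma summable_square_shift:
  fixes f :: "int \<Rightarrow> complex"
  assumes "(\<lambda>i. (cmod (f i))\<^sup>2) summable_on UNIV"
  shows "(\<lambda>i. (cmod (f (i + k)))\<^sup>2) summable_on UNIV"
  using summable_on_reindex_bij_betw[OF bij_plus_right[of k], of "\<lambda>i. (cmod (f i))\<^sup>2"] assms by simp

lemma summable_inner:
  fixes f g :: "int \<Rightarrow> complex"
  assumes "(\<lambda>i. (cmod (f i))\<^sup>2) summable_on UNIV" "(\<lambda>i. (cmod (g i))\<^sup>2) summable_on UNIV"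
  shows "(\<lambda>i. inner (f i) (g i)) summable_on UNIV"
proof -
  have "(\<lambda>i. norm (inner (f i) (g i))) summable_on UNIV"
  proof (rule summable_on_comparison_test)
    show "(\<lambda>i. (cmod (f i))\<^sup>2 + (cmod (g i))\<^sup>2) summable_on UNIV"
      by (intro summable_on_add assms)
    fix i
    have "norm (inner (f i) (g i)) \<le> cmod (f i) * cmod (g i)"
      using Cauchy_Schwarz_ineq2[of "f i" "g i"] by simp
    also have "\<dots> \<le> (cmod (f i))\<^sup>2 + (cmod (g i))\<^sup>2"
    proof -
      have "0 \<le> cmod (f i) * cmod (g i)" by simp
      then show ?thesis using sum_squares_bound[of "cmod (f i)" "cmod (g i)"] by linarith
    qed
    finally show "norm (inner (f i) (g i)) \<le> (cmod (f i))\<^sup>2 + (cmod (g i))\<^sup>2" .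
  qed auto
  then show ?thesis by (rule abs_summable_summable)
qed

instantiation ell2 :: real_vector
begin

lift_definition zero_ell2 :: ell2 is "\<lambda>_. 0" by simp
lift_definition plus_ell2 :: "ell2 \<Rightarrow> ell2 \<Rightarrow> ell2" is "\<lambda>f g i. f i + g i"
  by (rule summable_square_add)
lift_definition uminus_ell2 :: "ell2 \<Rightarrow> ell2" is "\<lambda>f i. - f i" by simp
lift_definition minus_ell2 :: "ell2 \<Rightarrow> ell2 \<Rightarrow> ell2" is "\<lambda>f g i. f i - g i"
  using summable_square_add[of _ "\<lambda>i. - _ i"] by fastforce
lift_definition scaleR_ell2 :: "real \<Rightarrow> ell2 \<Rightarrow> ell2" is "\<lambda>r f i. r *\<^sub>R f i"
  using summable_square_mult[of _ "\<lambda>_. complex_of_real _"] by (fastforce simp: scaleR_conv_of_real)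
instance
  by standard (transfer, simp add: algebra_simps fun_eq_iff)+

end

instantiation ell2 :: real_inner
begin

lift_definition inner_ell2 :: "ell2 \<Rightarrow> ell2 \<Rightarrow> real" is "\<lambda>f g. \<Sum>\<^sub>\<infinity>i. inner (f i) (g i)" .
definition "norm_ell2 (x :: ell2) = sqrt (inner x x)"
definition "sgn_ell2 (x :: ell2) = x /\<^sub>R norm x"
definition "dist_ell2 (x :: ell2) y = norm (x - y)"
definition "uniformity_ell2 = (INF e\<in>{0 <..}. principal {(x :: ell2, y). dist x y < e})"
definition "open_ell2 (U :: ell2 set) \<longleftrightarrow> (\<forall>x\<in>U. \<forall>\<^sub>F (x', y) in uniformity. x' = x \<longrightarrow> y \<in> U)"

instance
proof
  fix x y z :: ell2 and a b :: real and U :: "ell2 set"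
  show "sgn x = x /\<^sub>R norm x" "dist x y = norm (x - y)" "norm x = sqrt (inner x x)"
    "uniformity = (INF e\<in>{0 <..}. principal {(x :: ell2, y). dist x y < e})"
    "open U \<longleftrightarrow> (\<forall>x\<in>U. \<forall>\<^sub>F (x', y) in uniformity. x' = x \<longrightarrow> y \<in> U)"
    by (simp_all only: sgn_ell2_def dist_ell2_def norm_ell2_def uniformity_ell2_def open_ell2_def)
  show "inner x y = inner y x" by transfer (simp add: inner_commute)
  show "inner (x + y) z = inner x z + inner y z"
    by transfer (simp add: inner_add_left infsum_add summable_inner)
  show "inner (a *\<^sub>R x) y = a * inner x y" by transfer (simp add: infsum_cmult_right')
  show "0 \<le> inner x x" by transfer (simp add: infsum_nonneg)
  show "inner x x = 0 \<longleftrightarrow> x = 0"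
  proof
    show "inner x x = 0 \<Longrightarrow> x = 0"
    proof (transfer, rule ext)
      fix f :: "int \<Rightarrow> complex" and i
      assume "(\<lambda>i. (cmod (f i))\<^sup>2) summable_on UNIV" "(\<Sum>\<^sub>\<infinity>i. inner (f i) (f i)) = 0"
      then have "inner (f i) (f i) = 0"
        by (intro nonneg_infsum_le_0D[where f = "\<lambda>i. inner (f i) (f i)" and A = UNIV]) (auto simp: dot_square_norm)
      then show "f i = 0" by simp
    qed
  qed (transfer, simp)
qed

end

lemma norm_ell2_square: "(norm x)\<^sup>2 = (\<Sum>\<^sub>\<infinity>i. (cmod (ecoord x i))\<^sup>2)" for x :: ell2
  unfolding power2_norm_eq_inner by transfer (simp add: dot_square_norm)

lemma ecoord_simps [simp]:
  "ecoord (x + y) i = ecoord x i + ecoord y i" "ecoord (x - y) i = ecoord x i - ecoord y i"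
  "ecoord 0 i = 0" "ecoord (a *\<^sub>R x) i = a *\<^sub>R ecoord x i" "ecoord (- x) i = - ecoord x i"
  by (transfer, simp)+

lemma sum_ecoord_le_norm: "finite F \<Longrightarrow> (\<Sum>i\<in>F. (cmod (ecoord x i))\<^sup>2) \<le> (norm x)\<^sup>2"
  unfolding norm_ell2_square by (intro finite_sum_le_infsum ecoord_summable) auto

lemma ecoord_le_norm: "cmod (ecoord x i) \<le> norm x"
  using sum_ecoord_le_norm[of "{i}" x] by (simp add: power2_le_iff_abs_le)

text \<open>The limit is taken coordinatewise. Bounds on finite partial sums survive it, and they
  yield both square-summability of the limit and convergence in norm.\<close>

instance ell2 :: complete_space
proof
  fix X :: "nat \<Rightarrow> ell2" assume X: "Cauchy X"
  define L where "L i = lim (\<lambda>n. ecoord (X n) i)" for i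
  have L: "(\<lambda>n. ecoord (X n) i) \<longlonglongrightarrow> L i" for i
  proof -
    have "Cauchy (\<lambda>n. ecoord (X n) i)"
    proof (rule metric_CauchyI)
      fix e :: real assume "e > 0"
      then obtain M where "\<And>m n. m \<ge> M \<Longrightarrow> n \<ge> M \<Longrightarrow> dist (X m) (X n) < e"
        using metric_CauchyD[OF X] by blast
      moreover have "dist (ecoord (X m) i) (ecoord (X n) i) \<le> dist (X m) (X n)" for m n
        using ecoord_le_norm[of "X m - X n" i] by (simp add: dist_norm)
      ultimately show "\<exists>M. \<forall>m\<ge>M. \<forall>n\<ge>M. dist (ecoord (X m) i) (ecoord (X n) i) < e"
        by (meson le_less_trans)
    qed
    then show ?thesis unfolding L_def by (simp add: Cauchy_convergent_iff convergent_LIMSEQ_iff)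
  qed
  have bound: "(\<Sum>i\<in>F. (cmod (ecoord (X n) i - L i))\<^sup>2) \<le> e\<^sup>2"
    if M: "\<And>m n. m \<ge> M \<Longrightarrow> n \<ge> M \<Longrightarrow> dist (X m) (X n) < e" and "n \<ge> M" "finite F" "e > 0" for e M n F
  proof (rule tendsto_upperbound)
    show "((\<lambda>m. \<Sum>i\<in>F. (cmod (ecoord (X n) i - ecoord (X m) i))\<^sup>2) \<longlongrightarrow>
        (\<Sum>i\<in>F. (cmod (ecoord (X n) i - L i))\<^sup>2)) sequentially"
      by (intro tendsto_intros L)
    show "\<forall>\<^sub>F m in sequentially. (\<Sum>i\<in>F. (cmod (ecoord (X n) i - ecoord (X m) i))\<^sup>2) \<le> e\<^sup>2"
    proof (rule eventually_sequentiallyI)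
      fix m assume "m \<ge> M"
      then have "(norm (X n - X m))\<^sup>2 \<le> e\<^sup>2"
        using M[of n m] \<open>n \<ge> M\<close> \<open>e > 0\<close> by (intro power_mono) (auto simp: dist_norm)
      then show "(\<Sum>i\<in>F. (cmod (ecoord (X n) i - ecoord (X m) i))\<^sup>2) \<le> e\<^sup>2"
        using sum_ecoord_le_norm[OF \<open>finite F\<close>, of "X n - X m"] by simp
    qed
  qed simp
  have summ: "(\<lambda>i. (cmod (ecoord (X n) i - L i))\<^sup>2) summable_on UNIV"
    if "\<And>m n. m \<ge> M \<Longrightarrow> n \<ge> M \<Longrightarrow> dist (X m) (X n) < e" "n \<ge> M" "e > 0" for e M n
    using bound[OF that(1,2) _ that(3)]
    by (intro nonneg_bdd_above_summable_on bdd_aboveI2[where M = "e\<^sup>2"]) auto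
  obtain M where M: "\<And>m n. m \<ge> M \<Longrightarrow> n \<ge> M \<Longrightarrow> dist (X m) (X n) < 1"
    using metric_CauchyD[OF X, of 1] by auto
  have "(\<lambda>i. (cmod (ecoord (X M) i - L i))\<^sup>2) summable_on UNIV"
    by (rule summ[OF M]) auto
  then have "(\<lambda>i. (cmod (- (ecoord (X M) i - L i)))\<^sup>2) summable_on UNIV"
    by (simp only: norm_minus_cancel)
  from summable_square_add[OF ecoord_summable[of "X M"] this] have Ls: "(\<lambda>i. (cmod (L i))\<^sup>2) summable_on UNIV" by simp
  define l where "l = Abs_ell2 L"
  have l: "ecoord l i = L i" for i using Ls by (simp add: l_def Abs_ell2_inverse)
  have "X \<longlonglongrightarrow> l"
  proof (rule metric_LIMSEQ_I)
    fix e :: real assume e: "e > 0"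
    then obtain M where M: "\<And>m n. m \<ge> M \<Longrightarrow> n \<ge> M \<Longrightarrow> dist (X m) (X n) < e / 2"
      using metric_CauchyD[OF X, of "e / 2"] by auto
    have "dist (X n) l < e" if "n \<ge> M" for n
    proof -
      have "(norm (X n - l))\<^sup>2 \<le> (e / 2)\<^sup>2"
        unfolding norm_ell2_square using e summ[OF M that] bound[OF M that]
        by (intro infsum_le_finite_sums) (simp_all add: l)
      then have "norm (X n - l) \<le> e / 2" using e by (simp add: power2_le_iff_abs_le)
      then show ?thesis using e by (simp add: dist_norm)
    qed
    then show "\<exists>no. \<forall>n\<ge>no. dist (X n) l < e" by blast
  qed
  then show "convergent X" by (rule convergentI)
qed

instance ell2 :: banach ..

subsection \<open>Weighted shifts\<close>

text \<open>Weights are attached to the target index. Diagonal operators have \<open>k = 0\<close>,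
  and \<open>k = - 1\<close> moves the basis vector with index \<open>n\<close> to index
  \<open>n + 1\<close>. Meaningful for bounded \<open>d\<close> only.\<close>

definition wshift :: "(int \<Rightarrow> complex) \<Rightarrow> int \<Rightarrow> ell2 \<Rightarrow>\<^sub>L ell2" where
  "wshift d k = Blinfun (\<lambda>x. Abs_ell2 (\<lambda>i. d i * ecoord x (i + k)))"

lemma norm_ell2_le:
  assumes "\<And>i. cmod (ecoord y i) \<le> C * cmod (ecoord x (i + k))" "0 \<le> C"
  shows "norm y \<le> C * norm x"
proof -
  have "(norm y)\<^sup>2 \<le> (\<Sum>\<^sub>\<infinity>i. C\<^sup>2 * (cmod (ecoord x (i + k)))\<^sup>2)"
    unfolding norm_ell2_square
  proof (rule infsum_mono[OF ecoord_summable])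
    show "(\<lambda>i. C\<^sup>2 * (cmod (ecoord x (i + k)))\<^sup>2) summable_on UNIV"
      by (intro summable_on_cmult_right summable_square_shift ecoord_summable)
    show "(cmod (ecoord y i))\<^sup>2 \<le> C\<^sup>2 * (cmod (ecoord x (i + k)))\<^sup>2" for i
      using power_mono[OF assms(1)[of i], of 2] by (simp add: power_mult_distrib)
  qed
  also have "\<dots> = (C * norm x)\<^sup>2"
    using infsum_reindex_bij_betw[OF bij_plus_right[of k], of "\<lambda>i. (cmod (ecoord x i))\<^sup>2"]
    by (simp add: infsum_cmult_right' power_mult_distrib norm_ell2_square)
  finally show ?thesis using assms(2) by (simp add: power2_le_iff_abs_le)
qed

lemma ecoord_wshift:
  assumes "\<And>i. cmod (d i) \<le> C"
  shows "ecoord (wshift d k x) i = d i * ecoord x (i + k)"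
proof -
  define g where "g x = Abs_ell2 (\<lambda>i. d i * ecoord x (i + k))" for x
  have f: "ecoord (g x) i = d i * ecoord x (i + k)" for x i
    using summable_square_mult[OF summable_square_shift[OF ecoord_summable[of x], of k] assms]
    by (simp add: g_def Abs_ell2_inverse)
  have "0 \<le> C" using order_trans[OF norm_ge_zero assms] .
  have "bounded_linear g"
  proof (rule bounded_linear_intro[where K = C])
    show "norm (g x) \<le> norm x * C" for x
      using norm_ell2_le[of "g x" C x k] \<open>0 \<le> C\<close> assms
      by (simp add: f norm_mult mult_right_mono mult.commute)
  qed (auto intro!: ell2_eqI simp: f algebra_simps)
  moreover have "wshift d k = Blinfun g" by (simp add: wshift_def g_def[abs_def])
  ultimately show ?thesis by (simp add: bounded_linear_Blinfun_apply f)
qed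

definition unit_vec :: "int \<Rightarrow> ell2" where
  "unit_vec m = Abs_ell2 (\<lambda>j. if j = m then 1 else 0)"

lemma ecoord_unit_vec [simp]: "ecoord (unit_vec m) j = (if j = m then 1 else 0)"
proof -
  have "(\<lambda>j. (cmod (if j = m then 1 else 0))\<^sup>2) summable_on UNIV \<longleftrightarrow> (\<lambda>_. 1 :: real) summable_on {m}"
    by (rule summable_on_cong_neutral) auto
  then have "(\<lambda>j. (cmod (if j = m then 1 else 0))\<^sup>2) summable_on UNIV" by simp
  then show ?thesis unfolding unit_vec_def by (subst Abs_ell2_inverse) auto
qed

lemma norm_wshift_ge:
  assumes "\<And>i. cmod (d i) \<le> C"
  shows "cmod (d i) \<le> norm (wshift d 0)"
proof -
  let ?e = "unit_vec i"
  have "(norm ?e)\<^sup>2 = (\<Sum>\<^sub>\<infinity>j\<in>{i}. 1)"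
    unfolding norm_ell2_square by (rule infsum_cong_neutral) auto
  then have "norm ?e = 1" using power2_eq_iff_nonneg[of "norm ?e" 1] by simp
  have "cmod (d i) = cmod (ecoord (wshift d 0 ?e) i)"
    by (simp add: ecoord_wshift[OF assms])
  also have "\<dots> \<le> norm (wshift d 0 ?e)" by (rule ecoord_le_norm)
  also have "\<dots> \<le> norm (wshift d 0)" using norm_blinfun[of "wshift d 0" ?e] \<open>norm ?e = 1\<close> by simp
  finally show ?thesis .
qed

lemma inner_ell2_alt: "inner x y = (\<Sum>\<^sub>\<infinity>i. inner (ecoord x i) (ecoord y i))" for x y :: ell2
  by transfer simp

subsection \<open>Adjointable operators\<close>

text \<open>On \<open>ell2\<close> the inner product is the real part of the usual complex one. For
  operators that are linear over the complex numbers, the real adjoint is the complex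
  adjoint.\<close>

definition adj :: "('h::real_inner \<Rightarrow>\<^sub>L 'h) \<Rightarrow> ('h \<Rightarrow>\<^sub>L 'h) \<Rightarrow> bool" where
  "adj T S \<longleftrightarrow> (\<forall>x y. inner (T x) y = inner x (S y))"

lemma adjD: "adj T S \<Longrightarrow> inner (T x) y = inner x (S y)"
  by (simp add: adj_def)

lemma adj_sym: "adj T S \<Longrightarrow> adj S T"
  by (simp add: adj_def inner_commute)

lemma adj_unique:
  assumes "adj T S" "adj T S'"
  shows "S = S'"
proof (rule blinfun_eqI)
  fix y
  have "inner x (S y) = inner x (S' y)" for x
    using adjD[OF assms(1), of x y] adjD[OF assms(2), of x y] by simp
  then have "inner (S y - S' y) (S y - S' y) = 0" by (simp add: inner_diff_right)
  then show "S y = S' y" by simp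
qed

lemma norm_adj_le:
  assumes "adj T S"
  shows "norm S \<le> norm T"
proof (rule norm_blinfun_bound)
  fix y
  have "norm (S y) * norm (S y) = inner (T (S y)) y"
    using adjD[OF assms, of "S y" y] by (simp add: norm_eq_sqrt_inner)
  also have "\<dots> \<le> norm (T (S y)) * norm y" by (rule norm_cauchy_schwarz)
  also have "\<dots> \<le> norm T * norm (S y) * norm y" by (intro mult_right_mono norm_blinfun) auto
  finally have "norm (S y) * norm (S y) \<le> norm (S y) * (norm T * norm y)" by (simp add: mult_ac)
  then show "norm (S y) \<le> norm T * norm y"
    by (cases "norm (S y) = 0") (auto simp: mult_le_cancel_left)
qed simp

lemma norm_adj: "adj T S \<Longrightarrow> norm S = norm T"
  using norm_adj_le[of T S] norm_adj_le[OF adj_sym, of T S] by simp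

lemma norm_adj_compose:
  assumes "adj T S"
  shows "norm (S o\<^sub>L T) = (norm T)\<^sup>2"
proof (rule antisym)
  show "norm (S o\<^sub>L T) \<le> (norm T)\<^sup>2"
    using norm_blinfun_compose[of S T] norm_adj[OF assms] by (simp add: power2_eq_square)
  have "norm T \<le> sqrt (norm (S o\<^sub>L T))"
  proof (rule norm_blinfun_bound)
    fix x
    have "(norm (T x))\<^sup>2 = inner x (S (T x))"
      using adjD[OF assms, of x "T x"] by (simp add: power2_norm_eq_inner)
    also have "\<dots> \<le> norm x * norm ((S o\<^sub>L T) x)" using norm_cauchy_schwarz[of x "S (T x)"] by simp
    also have "\<dots> \<le> norm x * (norm (S o\<^sub>L T) * norm x)" by (intro mult_left_mono norm_blinfun) auto
    also have "\<dots> = (sqrt (norm (S o\<^sub>L T)) * norm x)\<^sup>2" by (simp add: power_mult_distrib power2_eq_square)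
    finally show "norm (T x) \<le> sqrt (norm (S o\<^sub>L T)) * norm x" by (rule power2_le_imp_le) simp
  qed simp
  then have "(norm T)\<^sup>2 \<le> (sqrt (norm (S o\<^sub>L T)))\<^sup>2" by (rule power_mono) simp
  then show "(norm T)\<^sup>2 \<le> norm (S o\<^sub>L T)" by simp
qed

lemma adj_add: "adj T S \<Longrightarrow> adj T' S' \<Longrightarrow> adj (T + T') (S + S')"
  by (simp add: adj_def blinfun.add_left inner_add_left inner_add_right)

lemma adj_scaleR: "adj T S \<Longrightarrow> adj (r *\<^sub>R T) (r *\<^sub>R S)"
  by (simp add: adj_def blinfun.scaleR_left)

lemma adj_minus: "adj T S \<Longrightarrow> adj T' S' \<Longrightarrow> adj (T - T') (S - S')"
  by (simp add: adj_def blinfun.diff_left inner_diff_left inner_diff_right)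

lemma adj_compose: "adj T S \<Longrightarrow> adj T' S' \<Longrightarrow> adj (T o\<^sub>L T') (S' o\<^sub>L S)"
  by (simp add: adj_def)

lemma adj_id: "adj id_blinfun id_blinfun"
  by (simp add: adj_def)

lemma adj_wshift:
  assumes d: "\<And>i. cmod (d i) \<le> C"
  shows "adj (wshift d k) (wshift (\<lambda>i. cnj (d (i - k))) (- k))"
  unfolding adj_def
proof (intro allI)
  fix x y
  have d': "cmod (cnj (d (i - k))) \<le> C" for i using d by simp
  have ic: "inner (c * a) b = inner a (cnj c * b)" for a b c :: complex
    by (simp add: inner_complex_def algebra_simps)
  have "inner (wshift d k x) y = (\<Sum>\<^sub>\<infinity>i. inner (ecoord x (i + k)) (cnj (d i) * ecoord y i))"
    unfolding inner_ell2_alt by (simp add: ecoord_wshift[OF d] ic)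
  also have "\<dots> = inner x (wshift (\<lambda>i. cnj (d (i - k))) (- k) y)"
    unfolding inner_ell2_alt
    using infsum_reindex_bij_betw[OF bij_plus_right[of k],
        of "\<lambda>i. inner (ecoord x i) (ecoord (wshift (\<lambda>i. cnj (d (i - k))) (- k) y) i)"]
    by (simp add: ecoord_wshift[OF d'])
  finally show "inner (wshift d k x) y = inner x (wshift (\<lambda>i. cnj (d (i - k))) (- k) y)" .
qed

lemma wshift_compose:
  assumes d: "\<And>i. cmod (d i) \<le> C" and e: "\<And>i. cmod (e i) \<le> D"
  shows "wshift d k o\<^sub>L wshift e l = wshift (\<lambda>i. d i * e (i + k)) (k + l)"
proof (intro blinfun_eqI ell2_eqI)
  fix x i
  have de: "cmod (d i * e (i + k)) \<le> C * D" for i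
    unfolding norm_mult by (intro mult_mono d e order_trans[OF norm_ge_zero d]) auto
  show "ecoord ((wshift d k o\<^sub>L wshift e l) x) i = ecoord (wshift (\<lambda>i. d i * e (i + k)) (k + l) x) i"
    by (simp add: ecoord_wshift[OF d] ecoord_wshift[OF e] ecoord_wshift[OF de] add.assoc)
qed

lemma wshift_add:
  assumes d: "\<And>i. cmod (d i) \<le> C" and e: "\<And>i. cmod (e i) \<le> D"
  shows "wshift (\<lambda>i. d i + e i) k = wshift d k + wshift e k"
proof (intro blinfun_eqI ell2_eqI)
  fix x i
  have de: "cmod (d i + e i) \<le> C + D" for i by (intro norm_triangle_le add_mono d e)
  show "ecoord (wshift (\<lambda>i. d i + e i) k x) i = ecoord ((wshift d k + wshift e k) x) i"
    by (simp add: ecoord_wshift[OF d] ecoord_wshift[OF e] ecoord_wshift[OF de] blinfun.add_left distrib_right)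
qed

text \<open>Bounded linear maps of the library are linear over the reals.  Those that commute with
  multiplication by the imaginary unit are linear over the complex numbers.\<close>

definition imul :: "ell2 \<Rightarrow>\<^sub>L ell2" where
  "imul = wshift (\<lambda>_. \<i>) 0"

lemma ecoord_imul [simp]: "ecoord (imul x) i = \<i> * ecoord x i"
  unfolding imul_def by (subst ecoord_wshift[where C = 1]) auto

lemma adj_imul: "adj imul (- imul)"
proof -
  have "wshift (\<lambda>i. cnj \<i>) (- 0) = - imul"
  proof (intro blinfun_eqI ell2_eqI)
    show "ecoord (wshift (\<lambda>i. cnj \<i>) (- 0) x) i = ecoord ((- imul) x) i" for x i
      by (subst ecoord_wshift[where C = 1]) (auto simp: blinfun.minus_left)
  qed
  then show ?thesis using adj_wshift[of "\<lambda>_. \<i>" 1 0] by (simp add: imul_def)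
qed

definition cscale :: "complex \<Rightarrow> (ell2 \<Rightarrow>\<^sub>L ell2) \<Rightarrow> ell2 \<Rightarrow>\<^sub>L ell2" where
  "cscale c T = Re c *\<^sub>R T + Im c *\<^sub>R (imul o\<^sub>L T)"

lemma ecoord_cscale [simp]: "ecoord (cscale c T x) i = c * ecoord (T x) i"
proof -
  have "c * z = Re c *\<^sub>R z + Im c *\<^sub>R (\<i> * z)" for z by (simp add: complex_eq_iff)
  then show ?thesis by (simp add: cscale_def blinfun.add_left blinfun.scaleR_left)
qed

text \<open>The existence of an adjoint is part of the carrier instead of being derived for all
  bounded operators. Weighted shifts have explicit adjoints, and the property passes to norm
  limits.\<close>

definition op_alg :: "(ell2 \<Rightarrow>\<^sub>L ell2) cstar" where
  "op_alg = \<lparr>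
     carrier = {T. T o\<^sub>L imul = imul o\<^sub>L T \<and> (\<exists>S. adj T S)},
     mult = (o\<^sub>L),
     one = id_blinfun,
     ring.zero = 0,
     add = (+),
     smult = cscale,
     star = (\<lambda>T. THE S. adj T S),
     nrm = norm\<rparr>"

lemma op_alg_star: "adj T S \<Longrightarrow> star op_alg T = S"
  unfolding op_alg_def by (auto intro!: the_equality dest: adj_unique)

text \<open>The adjoint of \<open>imul\<close> is \<open>- imul\<close>, so taking adjoints turns
  the commutation relation of \<open>T\<close> into that of \<open>S\<close>.\<close>

lemma adj_commute_imul:
  assumes "adj T S" "T o\<^sub>L imul = imul o\<^sub>L T"
  shows "S o\<^sub>L imul = imul o\<^sub>L S"
proof -
  have "adj (T o\<^sub>L imul) (- imul o\<^sub>L S)" "adj (imul o\<^sub>L T) (S o\<^sub>L - imul)"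
    using adj_compose[OF assms(1) adj_imul] adj_compose[OF adj_imul assms(1)] by auto
  then have "- imul o\<^sub>L S = S o\<^sub>L - imul" using assms(2) adj_unique by metis
  then have "- (imul o\<^sub>L S) x = - (S o\<^sub>L imul) x" for x
    by (metis blinfun.minus_left blinfun.minus_right blinfun_apply_blinfun_compose)
  then show ?thesis by (intro blinfun_eqI) (simp add: blinfun.minus_left)
qed

lemma op_alg_carrier: "T \<in> carrier op_alg \<longleftrightarrow> T o\<^sub>L imul = imul o\<^sub>L T \<and> (\<exists>S. adj T S)"
  by (simp add: op_alg_def)

lemma adj_star: "T \<in> carrier op_alg \<Longrightarrow> adj T (star op_alg T)"
  using op_alg_star by (auto simp: op_alg_carrier)

lemma star_in_op_alg: "T \<in> carrier op_alg \<Longrightarrow> star op_alg T \<in> carrier op_alg"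
  using adj_star[of T] adj_sym[of T] adj_commute_imul[of T] by (auto simp: op_alg_carrier)

lemma adj_cscale:
  assumes "adj T S" "S o\<^sub>L imul = imul o\<^sub>L S"
  shows "adj (cscale c T) (cscale (cnj c) S)"
proof -
  have "adj (imul o\<^sub>L T) (S o\<^sub>L - imul)" by (rule adj_compose[OF adj_imul assms(1)])
  moreover have "S o\<^sub>L - imul = - (imul o\<^sub>L S)"
    using assms(2) by (intro blinfun_eqI)
      (metis blinfun.minus_left blinfun.minus_right blinfun_apply_blinfun_compose)
  ultimately have "adj (Re c *\<^sub>R T + Im c *\<^sub>R (imul o\<^sub>L T)) (Re c *\<^sub>R S + Im c *\<^sub>R (- (imul o\<^sub>L S)))"
    using assms(1) by (intro adj_add adj_scaleR) auto
  then show ?thesis by (simp add: cscale_def)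
qed

lemma norm_cscale: "norm (cscale c T) = cmod c * norm T"
proof -
  have pt: "norm (cscale c T x) = cmod c * norm (T x)" for c T x
  proof (rule antisym)
    show "norm (cscale c T x) \<le> cmod c * norm (T x)"
      using norm_ell2_le[of "cscale c T x" "cmod c" "T x" 0] by (simp add: norm_mult)
    show "cmod c * norm (T x) \<le> norm (cscale c T x)"
    proof (cases "c = 0")
      case False
      have "norm (T x) \<le> inverse (cmod c) * norm (cscale c T x)"
      proof (rule norm_ell2_le[where k = 0])
        show "cmod (ecoord (T x) i) \<le> inverse (cmod c) * cmod (ecoord (cscale c T x) (i + 0))" for i
          using False by (simp add: norm_mult flip: mult.assoc)
      qed simp
      then show ?thesis using False by (simp add: field_simps)
    qed simp
  qed
  show ?thesis
  proof (rule antisym)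
    show "norm (cscale c T) \<le> cmod c * norm T"
    proof (rule norm_blinfun_bound)
      show "norm (cscale c T x) \<le> cmod c * norm T * norm x" for x
        using mult_left_mono[OF norm_blinfun[of T x], of "cmod c"] by (simp add: pt mult.assoc)
    qed simp
    show "cmod c * norm T \<le> norm (cscale c T)"
    proof (cases "c = 0")
      case False
      have "norm T \<le> norm (cscale c T) / cmod c"
      proof (rule norm_blinfun_bound)
        show "norm (T x) \<le> norm (cscale c T) / cmod c * norm x" for x
          using norm_blinfun[of "cscale c T" x] False by (simp add: pt field_simps)
      qed simp
      then show ?thesis using False by (simp add: field_simps)
    qed simp
  qed
qed

lemma imul_cscale_commute: "T o\<^sub>L imul = imul o\<^sub>L T \<Longrightarrow> cscale c T o\<^sub>L imul = imul o\<^sub>L cscale c T"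
proof (intro blinfun_eqI ell2_eqI)
  fix x i
  assume "T o\<^sub>L imul = imul o\<^sub>L T"
  then have "T (imul x) = imul (T x)" by (metis blinfun_apply_blinfun_compose)
  then show "ecoord ((cscale c T o\<^sub>L imul) x) i = ecoord ((imul o\<^sub>L cscale c T) x) i" by simp
qed

lemma cscale_compose_right:
  assumes "T o\<^sub>L imul = imul o\<^sub>L T"
  shows "T o\<^sub>L cscale c S = cscale c (T o\<^sub>L S)"
proof (intro blinfun_eqI ell2_eqI)
  fix x i
  have "T (imul y) = imul (T y)" for y using assms by (metis blinfun_apply_blinfun_compose)
  then have "T (cscale c S x) = cscale c (T o\<^sub>L S) x"
    by (simp add: cscale_def blinfun.add_left blinfun.scaleR_left blinfun.add_right blinfun.scaleR_right)
  then show "ecoord ((T o\<^sub>L cscale c S) x) i = ecoord (cscale c (T o\<^sub>L S) x) i" by simp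
qed

lemma minus_eq_cscale: "T + cscale (-1) S = T - S"
  by (simp add: cscale_def)

lemma unital_cstar_op_alg: "unital_cstar_algebra op_alg"
proof (rule unital_cstar_algebraI)
  note defs = op_alg_def
  fix a b c :: "ell2 \<Rightarrow>\<^sub>L ell2" and z z' :: complex
  have fields: "mult op_alg = (o\<^sub>L)" "one op_alg = id_blinfun" "ring.zero op_alg = 0" "add op_alg = (+)"
    "smult op_alg = cscale" "nrm op_alg = norm"
    by (simp_all add: op_alg_def)
  have "adj (0 :: ell2 \<Rightarrow>\<^sub>L ell2) 0" by (simp add: adj_def)
  then show "\<zero>\<^bsub>op_alg\<^esub> \<in> carrier op_alg"
    by (auto simp: op_alg_carrier fields blinfun.zero_right intro!: blinfun_eqI)
  show "\<one>\<^bsub>op_alg\<^esub> \<in> carrier op_alg"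
    using adj_id by (auto simp: op_alg_carrier fields intro!: blinfun_eqI)
  assume a: "a \<in> carrier op_alg"
  have a': "a o\<^sub>L imul = imul o\<^sub>L a" using a by (simp add: op_alg_carrier)
  have sa: "star op_alg a o\<^sub>L imul = imul o\<^sub>L star op_alg a"
    using star_in_op_alg[OF a] by (simp add: op_alg_carrier)
  show "z \<odot>\<^bsub>op_alg\<^esub> a \<in> carrier op_alg"
    using imul_cscale_commute[OF a'] adj_cscale[OF adj_star[OF a] sa] by (auto simp: op_alg_carrier fields)
  show "\<zero>\<^bsub>op_alg\<^esub> \<oplus>\<^bsub>op_alg\<^esub> a = a" "\<one>\<^bsub>op_alg\<^esub> \<otimes>\<^bsub>op_alg\<^esub> a = a" "a \<otimes>\<^bsub>op_alg\<^esub> \<one>\<^bsub>op_alg\<^esub> = a"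
    by (auto simp: fields intro: blinfun_eqI)
  show "(z + z') \<odot>\<^bsub>op_alg\<^esub> a = z \<odot>\<^bsub>op_alg\<^esub> a \<oplus>\<^bsub>op_alg\<^esub> z' \<odot>\<^bsub>op_alg\<^esub> a"
    "(z * z') \<odot>\<^bsub>op_alg\<^esub> a = z \<odot>\<^bsub>op_alg\<^esub> (z' \<odot>\<^bsub>op_alg\<^esub> a)"
    "1 \<odot>\<^bsub>op_alg\<^esub> a = a" "0 \<odot>\<^bsub>op_alg\<^esub> a = \<zero>\<^bsub>op_alg\<^esub>"
    by (auto simp: fields blinfun.add_left distrib_right mult.assoc intro!: blinfun_eqI ell2_eqI)
  show "star op_alg a \<in> carrier op_alg" by (rule star_in_op_alg[OF a])
  show "star op_alg (star op_alg a) = a" by (rule op_alg_star[OF adj_sym[OF adj_star[OF a]]])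
  show "star op_alg (z \<odot>\<^bsub>op_alg\<^esub> a) = cnj z \<odot>\<^bsub>op_alg\<^esub> star op_alg a"
    unfolding fields by (rule op_alg_star[OF adj_cscale[OF adj_star[OF a] sa]])
  show "0 \<le> nrm op_alg a" "nrm op_alg a = 0 \<longleftrightarrow> a = \<zero>\<^bsub>op_alg\<^esub>"
    "nrm op_alg (z \<odot>\<^bsub>op_alg\<^esub> a) = cmod z * nrm op_alg a"
    by (simp_all add: fields norm_cscale)
  show "nrm op_alg (star op_alg a \<otimes>\<^bsub>op_alg\<^esub> a) = (nrm op_alg a)\<^sup>2"
    unfolding fields by (rule norm_adj_compose[OF adj_star[OF a]])
  assume b: "b \<in> carrier op_alg"
  have b': "b o\<^sub>L imul = imul o\<^sub>L b" using b by (simp add: op_alg_carrier)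
  note ab = adj_add[OF adj_star[OF a] adj_star[OF b]] adj_compose[OF adj_star[OF a] adj_star[OF b]]
  have comm: "a (imul x) = imul (a x)" "b (imul x) = imul (b x)" for x
    using a' b' by (metis blinfun_apply_blinfun_compose)+
  show "a \<oplus>\<^bsub>op_alg\<^esub> b \<in> carrier op_alg" "a \<otimes>\<^bsub>op_alg\<^esub> b \<in> carrier op_alg"
    using ab by (auto simp: op_alg_carrier fields blinfun.add_left blinfun.add_right comm intro!: blinfun_eqI)
  show "a \<oplus>\<^bsub>op_alg\<^esub> b = b \<oplus>\<^bsub>op_alg\<^esub> a" by (simp add: fields)
  show "z \<odot>\<^bsub>op_alg\<^esub> (a \<oplus>\<^bsub>op_alg\<^esub> b) = z \<odot>\<^bsub>op_alg\<^esub> a \<oplus>\<^bsub>op_alg\<^esub> z \<odot>\<^bsub>op_alg\<^esub> b"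
    "(z \<odot>\<^bsub>op_alg\<^esub> a) \<otimes>\<^bsub>op_alg\<^esub> b = z \<odot>\<^bsub>op_alg\<^esub> (a \<otimes>\<^bsub>op_alg\<^esub> b)"
    by (auto simp: fields blinfun.add_left distrib_left intro!: blinfun_eqI ell2_eqI)
  show "a \<otimes>\<^bsub>op_alg\<^esub> (z \<odot>\<^bsub>op_alg\<^esub> b) = z \<odot>\<^bsub>op_alg\<^esub> (a \<otimes>\<^bsub>op_alg\<^esub> b)"
    unfolding fields by (rule cscale_compose_right[OF a'])
  show "star op_alg (a \<oplus>\<^bsub>op_alg\<^esub> b) = star op_alg a \<oplus>\<^bsub>op_alg\<^esub> star op_alg b"
    "star op_alg (a \<otimes>\<^bsub>op_alg\<^esub> b) = star op_alg b \<otimes>\<^bsub>op_alg\<^esub> star op_alg a"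
    unfolding fields by (rule op_alg_star[OF ab(1)] op_alg_star[OF ab(2)])+
  show "nrm op_alg (a \<oplus>\<^bsub>op_alg\<^esub> b) \<le> nrm op_alg a + nrm op_alg b"
    "nrm op_alg (a \<otimes>\<^bsub>op_alg\<^esub> b) \<le> nrm op_alg a * nrm op_alg b"
    unfolding fields by (rule norm_triangle_ineq norm_blinfun_compose)+
  assume c: "c \<in> carrier op_alg"
  show "(a \<oplus>\<^bsub>op_alg\<^esub> b) \<oplus>\<^bsub>op_alg\<^esub> c = a \<oplus>\<^bsub>op_alg\<^esub> (b \<oplus>\<^bsub>op_alg\<^esub> c)"
    "(a \<otimes>\<^bsub>op_alg\<^esub> b) \<otimes>\<^bsub>op_alg\<^esub> c = a \<otimes>\<^bsub>op_alg\<^esub> (b \<otimes>\<^bsub>op_alg\<^esub> c)"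
    "(a \<oplus>\<^bsub>op_alg\<^esub> b) \<otimes>\<^bsub>op_alg\<^esub> c = a \<otimes>\<^bsub>op_alg\<^esub> c \<oplus>\<^bsub>op_alg\<^esub> b \<otimes>\<^bsub>op_alg\<^esub> c"
    "c \<otimes>\<^bsub>op_alg\<^esub> (a \<oplus>\<^bsub>op_alg\<^esub> b) = c \<otimes>\<^bsub>op_alg\<^esub> a \<oplus>\<^bsub>op_alg\<^esub> c \<otimes>\<^bsub>op_alg\<^esub> b"
    by (auto simp: fields blinfun.add_left blinfun.add_right add.assoc intro!: blinfun_eqI)
next
  fix s :: "nat \<Rightarrow> ell2 \<Rightarrow>\<^sub>L ell2"
  have fields: "add op_alg = (+)" "smult op_alg = cscale" "nrm op_alg = norm"
    by (simp_all add: op_alg_def)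
  assume s: "\<And>n. s n \<in> carrier op_alg"
    and C: "\<And>e. e > 0 \<Longrightarrow> \<exists>N. \<forall>m\<ge>N. \<forall>n\<ge>N. nrm op_alg (s m \<oplus>\<^bsub>op_alg\<^esub> (-1) \<odot>\<^bsub>op_alg\<^esub> s n) < e"
  define t where "t n = star op_alg (s n)" for n
  have st: "adj (s n) (t n)" for n unfolding t_def by (rule adj_star[OF s])
  have Cs: "Cauchy s"
    by (rule metric_CauchyI) (use C in \<open>simp add: fields minus_eq_cscale dist_norm\<close>)
  \<comment> \<open>Adjoints preserve the norm of differences, so they converge along with the
    operators, and their limit is the adjoint of the limit.\<close>
  have "dist (t m) (t n) = dist (s m) (s n)" for m n
    unfolding dist_norm by (rule norm_adj[OF adj_minus[OF st st]])
  then have "Cauchy t" using Cs by (simp add: Cauchy_def)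
  from Cauchy_convergent[OF this] Cauchy_convergent[OF Cs] obtain T S where
    lim: "s \<longlonglongrightarrow> T" "t \<longlonglongrightarrow> S" by (auto simp: convergent_def)
  have sl: "(\<lambda>n. s n x) \<longlonglongrightarrow> T x" and tl: "(\<lambda>n. t n x) \<longlonglongrightarrow> S x" for x
    using lim by (auto intro!: tendsto_intros)
  have "adj T S"
    unfolding adj_def
  proof (intro allI)
    fix x y
    have "(\<lambda>n. inner (s n x) y) \<longlonglongrightarrow> inner (T x) y" by (intro tendsto_intros sl)
    moreover have "(\<lambda>n. inner (s n x) y) \<longlonglongrightarrow> inner x (S y)"
      unfolding adjD[OF st] by (intro tendsto_intros tl)
    ultimately show "inner (T x) y = inner x (S y)" by (rule LIMSEQ_unique)
  qed
  moreover have "T o\<^sub>L imul = imul o\<^sub>L T"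
  proof (rule blinfun_eqI)
    fix x
    have "s n (imul x) = imul (s n x)" for n
      using s[of n] by (metis blinfun_apply_blinfun_compose op_alg_carrier)
    then have "(\<lambda>n. s n (imul x)) \<longlonglongrightarrow> imul (T x)"
      by (simp add: sl blinfun.tendsto[OF tendsto_const])
    then show "(T o\<^sub>L imul) x = (imul o\<^sub>L T) x"
      using LIMSEQ_unique[OF sl] by simp
  qed
  ultimately have "T \<in> carrier op_alg" by (auto simp: op_alg_carrier)
  moreover have "\<exists>N. \<forall>n\<ge>N. nrm op_alg (s n \<oplus>\<^bsub>op_alg\<^esub> (-1) \<odot>\<^bsub>op_alg\<^esub> T) < e" if "e > 0" for e
    using metric_LIMSEQ_D[OF lim(1) that] by (simp add: fields minus_eq_cscale dist_norm)
  ultimately show "\<exists>a\<in>carrier op_alg. \<forall>e>0. \<exists>N. \<forall>n\<ge>N.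
      nrm op_alg (s n \<oplus>\<^bsub>op_alg\<^esub> (-1) \<odot>\<^bsub>op_alg\<^esub> a) < e" by blast
qed

lemma wshift_in_op_alg:
  assumes d: "\<And>i. cmod (d i) \<le> C"
  shows "wshift d k \<in> carrier op_alg"
proof -
  have "wshift d k o\<^sub>L imul = imul o\<^sub>L wshift d k"
    by (intro blinfun_eqI ell2_eqI) (simp add: ecoord_wshift[OF d])
  moreover have "adj (wshift d k) (wshift (\<lambda>i. cnj (d (i - k))) (- k))" by (rule adj_wshift[OF d])
  ultimately show ?thesis by (auto simp: op_alg_carrier)
qed

lemma star_wshift:
  assumes d: "\<And>i. cmod (d i) \<le> C"
  shows "star op_alg (wshift d k) = wshift (\<lambda>i. cnj (d (i - k))) (- k)"
  by (rule op_alg_star[OF adj_wshift[OF d]])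

lemma cscale_wshift:
  assumes d: "\<And>i. cmod (d i) \<le> C"
  shows "cscale c (wshift d k) = wshift (\<lambda>i. c * d i) k"
proof (intro blinfun_eqI ell2_eqI)
  have cd: "cmod (c * d i) \<le> cmod c * C" for i by (simp add: norm_mult d mult_left_mono)
  show "ecoord (cscale c (wshift d k) x) i = ecoord (wshift (\<lambda>i. c * d i) k x) i" for x i
    by (simp add: ecoord_wshift[OF d] ecoord_wshift[OF cd] mult.assoc)
qed

lemma inner_unit_vec: "inner x (unit_vec n) = Re (ecoord x n)"
proof -
  have "inner x (unit_vec n) = (\<Sum>\<^sub>\<infinity>i\<in>{n}. Re (ecoord x i))"
    unfolding inner_ell2_alt by (rule infsum_cong_neutral) (auto simp: inner_complex_def)
  then show ?thesis by simp
qed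

lemma inner_imul_unit_vec: "inner x (imul (unit_vec n)) = Im (ecoord x n)"
proof -
  have "inner x (imul (unit_vec n)) = (\<Sum>\<^sub>\<infinity>i\<in>{n}. Im (ecoord x i))"
    unfolding inner_ell2_alt by (rule infsum_cong_neutral) (auto simp: inner_complex_def)
  then show ?thesis by simp
qed

definition op_matrix :: "(ell2 \<Rightarrow>\<^sub>L ell2) \<Rightarrow> nat \<Rightarrow> complex" where
  "op_matrix T k = (case from_nat k of (m, n) \<Rightarrow> ecoord (T (unit_vec m)) n)"

text \<open>The matrix determines the adjoint on the unit vectors; pairing with
  \<open>unit_vec n\<close> and \<open>imul (unit_vec n)\<close> gives real and imaginary parts.
  Each coordinate of \<open>T x\<close> is read off from inner products of \<open>x\<close> with
  such adjoint vectors, so \<open>T\<close> is recovered without approximating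
  \<open>x\<close>.\<close>

lemma inj_op_matrix: "inj_on op_matrix (carrier op_alg)"
proof (rule inj_onI)
  fix T T' assume T: "T \<in> carrier op_alg" and T': "T' \<in> carrier op_alg" and eq: "op_matrix T = op_matrix T'"
  have m: "ecoord (T (unit_vec m)) n = ecoord (T' (unit_vec m)) n" for m n
    using fun_cong[OF eq, of "to_nat (m, n)"] by (simp add: op_matrix_def)
  let ?S = "star op_alg T" and ?S' = "star op_alg T'"
  note a = adjD[OF adj_star[OF T]] and a' = adjD[OF adj_star[OF T']]
  have comm: "U (imul y) = imul (U y)" if "U \<in> carrier op_alg" for U y
    using that by (metis blinfun_apply_blinfun_compose op_alg_carrier)
  have S: "?S (unit_vec n) = ?S' (unit_vec n)" for n
  proof (rule ell2_eqI, rule complex_eqI)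
    fix m
    have "Re (ecoord (?S (unit_vec n)) m) = Re (ecoord (T (unit_vec m)) n)"
      unfolding inner_unit_vec[symmetric] by (subst inner_commute) (simp add: a)
    moreover have "Re (ecoord (?S' (unit_vec n)) m) = Re (ecoord (T' (unit_vec m)) n)"
      unfolding inner_unit_vec[symmetric] by (subst inner_commute) (simp add: a')
    ultimately show "Re (ecoord (?S (unit_vec n)) m) = Re (ecoord (?S' (unit_vec n)) m)"
      using m by simp
    have "Im (ecoord (?S (unit_vec n)) m) = Re (ecoord (T (imul (unit_vec m))) n)"
      unfolding inner_unit_vec[symmetric] inner_imul_unit_vec[symmetric] by (subst inner_commute) (simp add: a)
    moreover have "Im (ecoord (?S' (unit_vec n)) m) = Re (ecoord (T' (imul (unit_vec m))) n)"
      unfolding inner_unit_vec[symmetric] inner_imul_unit_vec[symmetric] by (subst inner_commute) (simp add: a')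
    ultimately show "Im (ecoord (?S (unit_vec n)) m) = Im (ecoord (?S' (unit_vec n)) m)"
      using m by (simp add: comm T T')
  qed
  show "T = T'"
  proof (intro blinfun_eqI ell2_eqI complex_eqI)
    fix x n
    show "Re (ecoord (T x) n) = Re (ecoord (T' x) n)"
      unfolding inner_unit_vec[symmetric] by (simp add: a a' S)
    show "Im (ecoord (T x) n) = Im (ecoord (T' x) n)"
      unfolding inner_imul_unit_vec[symmetric]
      by (simp add: a a' S comm star_in_op_alg T T')
  qed
qed

subsection \<open>A representation of the relations\<close>

text \<open>On the basis vector with index \<open>n\<close>, the operator \<open>w\<close> acts by the point \<open>orbit \<theta> n\<close> of the
  orbit of \<open>1\<close>, and \<open>x\<close> is a weighted shift to the index \<open>n + 1\<close>.  As the orbit is dense, the norm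
  of \<open>f(w)\<close> is the supremum norm of \<open>f\<close>.\<close>

definition orbit :: "real \<Rightarrow> int \<Rightarrow> complex" where
  "orbit \<theta> n = cis (2 * pi * \<theta> * of_int n)"

lemma rot_cis: "rot \<theta> = cis (- 2 * pi * \<theta>)"
  by (simp add: cis_conv_exp mult_ac)

lemma rot_orbit: "rot \<theta> * orbit \<theta> n = orbit \<theta> (n - 1)"
  unfolding rot_cis orbit_def cis_mult by (simp add: algebra_simps)

lemma orbit_in_circle [simp]: "cmod (orbit \<theta> n) = 1"
  by (simp add: orbit_def)

text \<open>By Kronecker's theorem the fractional parts of the multiples of \<theta> are dense in
  the unit interval, so the points of the orbit with non-negative index already suffice.\<close>

lemma orbit_dense_bound:
  assumes \<theta>: "\<theta> \<notin> \<rat>" and f: "continuous_on circle f" and N: "\<And>n. cmod (f (orbit \<theta> n)) \<le> N"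
    and c: "c \<in> circle"
  shows "cmod (f c) \<le> N"
proof -
  define \<alpha> where "\<alpha> = frac (Arg c / (2 * pi))"
  have cis_frac: "cis (2 * pi * frac t) = cis (2 * pi * t)" for t
  proof -
    have "cis (2 * pi * t) = cis (2 * pi * frac t) * cis (2 * pi * of_int \<lfloor>t\<rfloor>)"
      by (simp add: cis_mult frac_def algebra_simps del: cis_multiple_2pi)
    then show ?thesis by simp
  qed
  have "cis (2 * pi * \<alpha>) = cis (Arg c)" by (simp add: \<alpha>_def cis_frac)
  also have "\<dots> = c" using c cis_Arg[of c] by (cases "c = 0") (auto simp: sgn_div_norm)
  finally have c_eq: "c = cis (2 * pi * \<alpha>)" by simp
  have "\<alpha> \<in> closure (range (\<lambda>n. frac (real n * \<theta>)))"
    unfolding Kronecker_approx_1[OF \<theta>] using frac_lt_1[of "Arg c / (2 * pi)"] by (auto simp: \<alpha>_def)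
  then obtain t where t: "\<And>n. t n \<in> range (\<lambda>n. frac (real n * \<theta>))" "t \<longlonglongrightarrow> \<alpha>"
    unfolding closure_sequential by blast
  have cont: "continuous_on UNIV (\<lambda>s. f (cis (2 * pi * s)))"
    by (rule continuous_on_compose2[OF f]) (auto intro!: continuous_intros)
  have "(\<lambda>n. f (cis (2 * pi * t n))) \<longlonglongrightarrow> f (cis (2 * pi * \<alpha>))"
    using cont t(2) by (simp add: continuous_on_sequentially comp_def)
  then have "(\<lambda>n. cmod (f (cis (2 * pi * t n)))) \<longlonglongrightarrow> cmod (f c)"
    unfolding c_eq by (rule tendsto_norm)
  moreover have "cmod (f (cis (2 * pi * t n))) \<le> N" for n
  proof -
    obtain k where "t n = frac (real k * \<theta>)" using t(1)[of n] by blast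
    then have "cis (2 * pi * t n) = orbit \<theta> (int k)"
      using cis_frac[of "real k * \<theta>"] by (simp add: orbit_def mult_ac)
    then show ?thesis using N by simp
  qed
  ultimately show ?thesis using LIMSEQ_le_const2 by blast
qed

lemma op_alg_sel:
  "mult op_alg = (o\<^sub>L)" "one op_alg = id_blinfun" "add op_alg = (+)"
  "smult op_alg = cscale" "nrm op_alg = norm"
  by (simp_all add: op_alg_def)

lemma circle_bound:
  fixes f :: "complex \<Rightarrow> complex"
  assumes "continuous_on circle f"
  shows "\<exists>C. \<forall>z\<in>circle. cmod (f z) \<le> C"
  using compact_imp_bounded[OF compact_continuous_image[OF assms compact_sphere]] unfolding bounded_iff by auto

lemma star_hom_diagonal:
  "star_hom (C_alg circle) op_alg (\<lambda>f. wshift (\<lambda>i. f (orbit \<theta> i)) 0)"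
proof (rule star_homI)
  have "wshift (\<lambda>i. 1) 0 = id_blinfun"
    by (intro blinfun_eqI ell2_eqI) (subst ecoord_wshift[where C = 1], auto)
  then show "wshift (\<lambda>i. \<one>\<^bsub>C_alg circle\<^esub> (orbit \<theta> i)) 0 = \<one>\<^bsub>op_alg\<^esub>"
    by (simp add: C_alg_def op_alg_sel)
  fix f g c assume f: "f \<in> carrier (C_alg circle)"
  then obtain C where "\<forall>z\<in>circle. cmod (f z) \<le> C"
    using circle_bound[of f] unital_cstar_algebra.carrier_C_alg[OF unital_cstar_op_alg] by blast
  then have fb: "cmod (f (orbit \<theta> i)) \<le> C" for i by simp
  show "wshift (\<lambda>i. f (orbit \<theta> i)) 0 \<in> carrier op_alg" by (rule wshift_in_op_alg[OF fb])
  show "wshift (\<lambda>i. (c \<odot>\<^bsub>C_alg circle\<^esub> f) (orbit \<theta> i)) 0 = c \<odot>\<^bsub>op_alg\<^esub> wshift (\<lambda>i. f (orbit \<theta> i)) 0"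
    by (simp add: op_alg_sel cscale_wshift[OF fb] C_alg_def)
  show "wshift (\<lambda>i. star (C_alg circle) f (orbit \<theta> i)) 0 = star op_alg (wshift (\<lambda>i. f (orbit \<theta> i)) 0)"
    by (simp add: star_wshift[OF fb] C_alg_def)
  assume g: "g \<in> carrier (C_alg circle)"
  then obtain D where "\<forall>z\<in>circle. cmod (g z) \<le> D"
    using circle_bound[of g] unital_cstar_algebra.carrier_C_alg[OF unital_cstar_op_alg] by blast
  then have gb: "cmod (g (orbit \<theta> i)) \<le> D" for i by simp
  show "wshift (\<lambda>i. (f \<oplus>\<^bsub>C_alg circle\<^esub> g) (orbit \<theta> i)) 0 =
      wshift (\<lambda>i. f (orbit \<theta> i)) 0 \<oplus>\<^bsub>op_alg\<^esub> wshift (\<lambda>i. g (orbit \<theta> i)) 0"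
    by (simp add: op_alg_sel wshift_add[OF fb gb, symmetric] C_alg_def)
  show "wshift (\<lambda>i. (f \<otimes>\<^bsub>C_alg circle\<^esub> g) (orbit \<theta> i)) 0 =
      wshift (\<lambda>i. f (orbit \<theta> i)) 0 \<otimes>\<^bsub>op_alg\<^esub> wshift (\<lambda>i. g (orbit \<theta> i)) 0"
    by (simp add: op_alg_sel wshift_compose[OF fb gb] C_alg_def)
qed

text \<open>The weight of \<open>x\<close> at target index \<open>i\<close> is the square root of
  \<gamma> at the source point with index \<open>i - 1\<close>. Hence the adjoint of
  \<open>x\<close> times \<open>x\<close> acts at index \<open>i\<close> by \<gamma> at
  \<open>orbit \<theta> i\<close>, and the opposite product by \<gamma> at
  \<open>orbit \<theta> (i - 1)\<close>, which is
  \<open>rot \<theta> * orbit \<theta> i\<close>.\<close>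

lemma op_alg_representation:
  fixes \<gamma> :: "complex \<Rightarrow> real"
  assumes \<theta>: "\<theta> \<notin> \<rat>" and \<gamma>: "continuous_on circle \<gamma>" "\<And>z. z \<in> circle \<Longrightarrow> 0 \<le> \<gamma> z"
  defines "w \<equiv> wshift (orbit \<theta>) 0"
    and "x \<equiv> wshift (\<lambda>i. of_real (sqrt (\<gamma> (orbit \<theta> (i - 1))))) (- 1)"
  shows "unital_cstar_algebra.unitary op_alg w" "cspectrum op_alg w = circle" "A_relations \<theta> \<gamma> op_alg x w"
    "\<And>f c. continuous_on circle f \<Longrightarrow> c \<in> circle \<Longrightarrow> cmod (f c) \<le> nrm op_alg (unital_cstar_algebra.fc op_alg w f)"
proof -
  interpret op_alg: unital_cstar_algebra op_alg by (rule unital_cstar_op_alg)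
  have hw: "wshift (\<lambda>i. (\<lambda>z\<in>circle. z) (orbit \<theta> i)) 0 = w" by (simp add: w_def)
  note u = op_alg.star_hom_C_alg_unique[OF star_hom_diagonal[of \<theta>] hw]
  show un: "op_alg.unitary w" by (rule u(1))
  \<comment> \<open>The diagonal operators form a star-homomorphism that maps the identity function
    to \<open>w\<close>; by uniqueness it is the functional calculus.\<close>
  have fc: "op_alg.fc w f = wshift (\<lambda>i. f (orbit \<theta> i)) 0" if "continuous_on circle f" for f
    using u(2)[OF that] by simp
  show le: "cmod (f c) \<le> nrm op_alg (op_alg.fc w f)" if f: "continuous_on circle f" "c \<in> circle" for f c
  proof (rule orbit_dense_bound[OF \<theta> f(1) _ f(2)])
    obtain C where C: "\<And>z. z \<in> circle \<Longrightarrow> cmod (f z) \<le> C" using circle_bound[OF f(1)] by blast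
    show "cmod (f (orbit \<theta> n)) \<le> nrm op_alg (op_alg.fc w f)" for n
      unfolding fc[OF f(1)] op_alg_sel by (rule norm_wshift_ge[where C = C]) (simp add: C)
  qed
  show sp: "cspectrum op_alg w = circle"
    using op_alg.spectrum_unitary_subset[OF un] op_alg.in_spectrum_unitary[OF un _ le] by blast
  define g where "g i = complex_of_real (sqrt (\<gamma> (orbit \<theta> i)))" for i
  have gc: "continuous_on circle (\<lambda>z. complex_of_real (\<gamma> z))" by (intro continuous_intros \<gamma>)
  have gc': "continuous_on circle (\<lambda>z. complex_of_real (\<gamma> (rot \<theta> * z)))"
    by (rule op_alg.continuous_on_rotate[OF op_alg.norm_rot gc])
  have "continuous_on circle (\<lambda>z. complex_of_real (sqrt (\<gamma> z)))" by (intro continuous_intros \<gamma>)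
  then obtain C where C: "\<And>z. z \<in> circle \<Longrightarrow> cmod (of_real (sqrt (\<gamma> z))) \<le> C" using circle_bound by blast
  have gC: "cmod (g i) \<le> C" for i unfolding g_def by (rule C) simp
  have gC': "cmod (g (i - 1)) \<le> C" for i by (rule gC)
  have oC: "cmod (orbit \<theta> i) \<le> 1" for i by simp
  have gg: "g i * g i = of_real (\<gamma> (orbit \<theta> i))" for i
    using \<gamma>(2)[of "orbit \<theta> i"] by (simp add: g_def flip: of_real_mult)
  have x: "x = wshift (\<lambda>i. g (i - 1)) (- 1)" by (simp add: x_def g_def)
  have sx: "star op_alg x = wshift g 1"
    unfolding x star_wshift[OF gC'] by (simp add: g_def[abs_def])
  have xw: "x o\<^sub>L w = wshift (\<lambda>i. g (i - 1) * orbit \<theta> (i - 1)) (- 1)"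
    unfolding x w_def by (subst wshift_compose[OF gC' oC]) simp
  have wx: "w o\<^sub>L x = wshift (\<lambda>i. orbit \<theta> i * g (i - 1)) (- 1)"
    unfolding x w_def by (subst wshift_compose[OF oC gC']) simp
  have b: "cmod (orbit \<theta> i * g (i - 1)) \<le> C" for i using gC[of "i - 1"] by (simp add: norm_mult)
  show "A_relations \<theta> \<gamma> op_alg x w"
    unfolding op_alg.A_relations_iff[OF sp \<gamma>(1)]
  proof (intro conjI un)
    show "x \<in> carrier op_alg" unfolding x by (rule wshift_in_op_alg[OF gC'])
    show "star op_alg x \<otimes>\<^bsub>op_alg\<^esub> x = op_alg.fc w (\<lambda>z. of_real (\<gamma> z))"
      unfolding sx fc[OF gc] unfolding x op_alg_sel wshift_compose[OF gC gC'] by (simp add: gg)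
    show "x \<otimes>\<^bsub>op_alg\<^esub> star op_alg x = op_alg.fc w (\<lambda>z. of_real (\<gamma> (rot \<theta> * z)))"
      unfolding sx fc[OF gc'] unfolding x op_alg_sel wshift_compose[OF gC' gC] rot_orbit by (simp add: gg)
    show "x \<otimes>\<^bsub>op_alg\<^esub> w = rot \<theta> \<odot>\<^bsub>op_alg\<^esub> (w \<otimes>\<^bsub>op_alg\<^esub> x)"
      unfolding op_alg_sel xw wx cscale_wshift[OF b] mult.assoc[symmetric] rot_orbit by (simp add: mult.commute)
  qed
qed

text \<open>The operator algebra, moved by its matrix coefficients into the type over which
  \<open>is_A\<close> quantifies.\<close>

lemma test_algebra:
  fixes \<gamma> :: "complex \<Rightarrow> real"
  assumes \<theta>: "\<theta> \<notin> \<rat>" and \<gamma>: "continuous_on circle \<gamma>" "\<And>z. z \<in> circle \<Longrightarrow> 0 \<le> \<gamma> z"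
  shows "\<exists>(B :: (nat \<Rightarrow> complex) cstar) x w. unital_cstar_algebra B \<and> A_relations \<theta> \<gamma> B x w \<and>
    (\<forall>f c. continuous_on circle f \<longrightarrow> c \<in> circle \<longrightarrow>
       cmod (f c) \<le> nrm B (unital_cstar_algebra.fc B w f))"
proof -
  interpret op_alg: unital_cstar_algebra op_alg by (rule unital_cstar_op_alg)
  let ?w = "wshift (orbit \<theta>) 0" and ?x = "wshift (\<lambda>i. of_real (sqrt (\<gamma> (orbit \<theta> (i - 1))))) (- 1)"
  let ?F = "op_matrix" and ?B = "transport op_matrix op_alg"
  note R = op_alg_representation[OF \<theta> \<gamma>]
  have B: "unital_cstar_algebra ?B"
    by (rule unital_cstar_algebra_transport[OF unital_cstar_op_alg inj_op_matrix])
  note F = star_hom_transport[OF unital_cstar_op_alg inj_op_matrix]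
  have "A_relations \<theta> \<gamma> ?B (?F ?x) (?F ?w)"
    by (rule A_relations_transfer(1)[OF unital_cstar_op_alg B F _ R(2) \<gamma>(1) R(3)])
      (simp_all add: inj_op_matrix)
  moreover have "cmod (f c) \<le> nrm ?B (unital_cstar_algebra.fc ?B (?F ?w) f)"
    if "continuous_on circle f" "c \<in> circle" for f c
  proof -
    have "unital_cstar_algebra.fc ?B (?F ?w) f = ?F (op_alg.fc ?w f)"
      by (rule star_hom_fc_commute[OF unital_cstar_op_alg B F(1) R(1) that(1), symmetric])
    then show ?thesis
      using R(4)[OF _ that] op_alg.fc_closed[OF R(1) that(1)]
      by (simp add: transport_simps[OF inj_op_matrix])
  qed
  ultimately show ?thesis using B by blast
qed

section \<open>The universal algebra\<close>

locale universal_rotation_algebra = unital_cstar_algebra A for A :: "'a cstar" (structure) +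
  fixes \<theta> :: real and \<gamma> :: "complex \<Rightarrow> real" and x w :: 'a
  assumes irrational: "\<theta> \<notin> \<rat>"
    and gamma_cont: "continuous_on circle \<gamma>"
    and gamma_nonneg: "z \<in> circle \<Longrightarrow> 0 \<le> \<gamma> z"
    and universal: "is_A \<theta> \<gamma> A x w"
begin

lemma A_cstar: "unital_cstar_algebra A" by unfold_locales

lemma relations: "A_relations \<theta> \<gamma> A x w"
  and generated: "cstar_generated A {x, w} = carrier A"
  using universal by (auto simp: is_A_def)

lemma universal_property:
  fixes B :: "(nat \<Rightarrow> complex) cstar"
  assumes "unital_cstar_algebra B" "A_relations \<theta> \<gamma> B x' w'"
  shows "\<exists>h. star_hom A B h \<and> h x = x' \<and> h w = w'"
  using universal assms unfolding is_A_def by blast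

lemma x_closed [simp]: "x \<in> carrier A" and w_closed [simp]: "w \<in> carrier A"
  and unitary_w [simp]: "unitary w"
  using relations by (auto simp: A_relations_def unitary_def)

abbreviation J :: "(complex \<Rightarrow> complex) \<Rightarrow> 'a" where
  "J \<equiv> fc w"

text \<open>The homomorphism into the test algebra is contractive and commutes with the functional
  calculus, so the lower bound valid there holds in \<open>A\<close>.\<close>

lemma J_isometric:
  assumes f: "continuous_on circle f" and c: "c \<in> circle"
  shows "cmod (f c) \<le> nrm A (J f)"
proof -
  obtain B :: "(nat \<Rightarrow> complex) cstar" and x' w' where B: "unital_cstar_algebra B"
    "A_relations \<theta> \<gamma> B x' w'" "cmod (f c) \<le> nrm B (unital_cstar_algebra.fc B w' f)"
    using test_algebra[OF irrational gamma_cont gamma_nonneg] f c by blast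
  obtain h where h: "star_hom A B h" "h w = w'" using universal_property[OF B(1,2)] by blast
  have "unital_cstar_algebra.fc B w' f = h (J f)"
    using star_hom_fc_commute[OF A_cstar B(1) h(1) unitary_w f] h(2) by simp
  then show ?thesis
    using B(3) star_hom_contractive[OF A_cstar B(1) h(1) fc_closed[OF unitary_w f]] by simp
qed

lemma spectrum_w: "cspectrum A w = circle"
  using spectrum_unitary_subset[OF unitary_w] in_spectrum_unitary[OF unitary_w _ J_isometric] by blast

lemma J_inject:
  assumes "continuous_on circle f" "continuous_on circle g" "J f = J g" "z \<in> circle"
  shows "f z = g z"
proof -
  have "cmod (f z - g z) \<le> nrm A (J (\<lambda>z. f z - g z))"
    using assms by (intro J_isometric continuous_intros)
  also have "\<dots> = 0" using assms by (simp add: fc_minus)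
  finally show ?thesis by simp
qed

section \<open>Commutation of \<open>x\<close> with the functions of \<open>w\<close>\<close>

definition q :: complex where
  "q = rot \<theta>"

lemma norm_q [simp]: "cmod q = 1"
  by (simp only: q_def norm_rot)

lemma q_cnj: "cnj q * q = 1" "q * cnj q = 1"
  using complex_norm_square[of q] by (simp_all add: mult.commute)

lemma star_x_x: "star A x \<otimes> x = J (\<lambda>z. of_real (\<gamma> z))"
  and x_star_x: "x \<otimes> star A x = J (\<lambda>z. of_real (\<gamma> (q * z)))"
  and x_w: "x \<otimes> w = q \<odot> (w \<otimes> x)"
  using relations A_relations_iff[OF spectrum_w gamma_cont] unfolding q_def by auto

lemma gamma_cont': "continuous_on circle (\<lambda>z. complex_of_real (\<gamma> z))"
  by (intro continuous_intros gamma_cont)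

lemma gamma_rot_cont: "continuous_on circle (\<lambda>z. complex_of_real (\<gamma> (q * z)))"
  by (rule continuous_on_rotate[OF norm_q gamma_cont'])

text \<open>The relation says that \<open>x\<close> intertwines \<open>w\<close> with
  \<open>q \<odot> w\<close>. Cancelling unitaries gives the same for their adjoints, and
  \<open>fc_intertwine\<close> extends it to all functions.\<close>

lemma x_J:
  assumes f: "continuous_on circle f"
  shows "x \<otimes> J f = J (\<lambda>z. f (q * z)) \<otimes> x"
proof -
  let ?v = "q \<odot> w"
  have v: "unitary ?v" by (rule unitary_scalar[OF unitary_w norm_q])
  note uw = unitaryD[OF unitary_w] and uv = unitaryD[OF v]
  have 1: "x \<otimes> w = ?v \<otimes> x" by (simp add: x_w mult_smult_left)
  have "x \<otimes> star A w = star A ?v \<otimes> (?v \<otimes> x) \<otimes> star A w"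
    using uv uw by (simp add: l_one flip: m_assoc)
  also have "\<dots> = star A ?v \<otimes> x"
    unfolding 1[symmetric] using uv(1) uw by (simp add: m_assoc m_closed r_one)
  finally have 2: "x \<otimes> star A w = star A ?v \<otimes> x" .
  have "x \<otimes> J f = fc ?v f \<otimes> x"
    by (rule fc_intertwine[OF unitary_w v x_closed 1 2 f])
  then show ?thesis by (simp add: fc_rotate[OF unitary_w norm_q f])
qed

lemma q_inverse: "cnj q * (q * z) = z" "q * (cnj q * z) = z"
  using q_cnj by (simp_all flip: mult.assoc)

lemma norm_cnj_q: "cmod (cnj q) = 1"
  by simp

text \<open>The adjoint of \<open>x_J\<close> for the function
  \<open>g z = cnj (f (cnj q * z))\<close>.\<close>

lemma star_x_J:
  assumes f: "continuous_on circle f"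
  shows "star A x \<otimes> J f = J (\<lambda>z. f (cnj q * z)) \<otimes> star A x"
proof -
  define g where "g z = cnj (f (cnj q * z))" for z
  have fr: "continuous_on circle (\<lambda>z. f (cnj q * z))"
    by (rule continuous_on_rotate[OF norm_cnj_q f])
  then have g: "continuous_on circle g" unfolding g_def by (rule continuous_on_cnj)
  have "star A (x \<otimes> J g) = star A (J (\<lambda>z. g (q * z)) \<otimes> x)" by (simp only: x_J[OF g])
  moreover have "(\<lambda>z. g (q * z)) = (\<lambda>z. cnj (f z))"
    unfolding g_def by (simp only: q_inverse)
  moreover have "star A (J g) = J (\<lambda>z. f (cnj q * z))"
    using fc_star[OF unitary_w g] by (simp add: g_def)
  moreover have "star A (J (\<lambda>z. cnj (f z))) = J f"
    using fc_star[OF unitary_w f] f by simp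
  ultimately show ?thesis
    using g f by (simp add: star_mult continuous_on_cnj)
qed

subsection \<open>Homogeneous elements\<close>

text \<open>Monomials of degree \<open>n\<close>, which the gauge automorphism at \<open>t\<close>
  multiplies by \<open>cis (2 * pi * n * t)\<close>. This is a relation because degree and form need
  not be unique; \<open>\<zero>\<close> has every degree.\<close>

definition mon :: "int \<Rightarrow> 'a \<Rightarrow> bool" where
  "mon n a \<longleftrightarrow> (\<exists>f k. continuous_on circle f \<and>
     (n = int k \<and> a = J f \<otimes> x [^] k \<or> n = - int k \<and> a = J f \<otimes> star A x [^] k))"

lemma mon_x_power: "continuous_on circle f \<Longrightarrow> mon (int k) (J f \<otimes> x [^] k)"
  unfolding mon_def by auto

lemma mon_star_x_power: "continuous_on circle f \<Longrightarrow> mon (- int k) (J f \<otimes> star A x [^] k)"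
  unfolding mon_def by auto

text \<open>The exponent \<open>Suc k\<close> in the second case makes the two cases exclude each
  other; exponent 0 belongs to the first.\<close>

lemma mon_cases:
  assumes "mon n a"
  obtains f k where "continuous_on circle f" "n = int k" "a = J f \<otimes> x [^] k"
  | f k where "continuous_on circle f" "n = - int (Suc k)" "a = J f \<otimes> star A x [^] Suc k"
proof -
  obtain f k where f: "continuous_on circle f"
    "n = int k \<and> a = J f \<otimes> x [^] k \<or> n = - int k \<and> a = J f \<otimes> star A x [^] k"
    using assms unfolding mon_def by auto
  show ?thesis
  proof (cases "n \<ge> 0")
    case True
    then have "n = int k \<and> a = J f \<otimes> x [^] k" using f(2) by auto
    then show ?thesis using that(1) f(1) by blast
  next
    case False
    then have n: "n = - int k" "a = J f \<otimes> star A x [^] k" using f(2) by auto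
    then obtain j where "k = Suc j" using False by (cases k) auto
    then show ?thesis using that(2) f(1) n by blast
  qed
qed

lemma mon_nonpos_cases:
  assumes "mon n a" "n \<le> 0"
  obtains f k where "continuous_on circle f" "n = - int k" "a = J f \<otimes> star A x [^] k"
  using assms unfolding mon_def by (auto simp: le_less)

lemma mon_closed: "mon n a \<Longrightarrow> a \<in> carrier A"
  unfolding mon_def by (auto intro: m_closed)

lemma x_power_J:
  assumes "continuous_on circle f"
  shows "\<exists>g. continuous_on circle g \<and> x [^] (k::nat) \<otimes> J f = J g \<otimes> x [^] k"
  using assms
proof (induction k arbitrary: f)
  case 0
  then show ?case by (intro exI[of _ f]) (simp add: l_one r_one)
next
  case (Suc k)
  let ?f = "\<lambda>z. f (q * z)"
  have f': "continuous_on circle ?f" by (rule continuous_on_rotate[OF norm_q Suc.prems])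
  obtain g where g: "continuous_on circle g" "x [^] k \<otimes> J ?f = J g \<otimes> x [^] k"
    using Suc.IH[OF f'] by blast
  have "x [^] Suc k \<otimes> J f = x [^] k \<otimes> (x \<otimes> J f)" using Suc.prems by (simp add: m_assoc)
  also have "\<dots> = x [^] k \<otimes> J ?f \<otimes> x" using Suc.prems f' by (simp add: x_J m_assoc)
  also have "\<dots> = J g \<otimes> x [^] Suc k" using g by (simp add: m_assoc)
  finally show ?case using g by blast
qed

lemma star_x_power_J:
  assumes "continuous_on circle f"
  shows "\<exists>g. continuous_on circle g \<and> star A x [^] (k::nat) \<otimes> J f = J g \<otimes> star A x [^] k"
  using assms
proof (induction k arbitrary: f)
  case 0
  then show ?case by (intro exI[of _ f]) (simp add: l_one r_one)
next
  case (Suc k)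
  let ?f = "\<lambda>z. f (cnj q * z)"
  have f': "continuous_on circle ?f" by (rule continuous_on_rotate[OF norm_cnj_q Suc.prems])
  obtain g where g: "continuous_on circle g" "star A x [^] k \<otimes> J ?f = J g \<otimes> star A x [^] k"
    using Suc.IH[OF f'] by blast
  have "star A x [^] Suc k \<otimes> J f = star A x [^] k \<otimes> (star A x \<otimes> J f)" using Suc.prems by (simp add: m_assoc)
  also have "\<dots> = star A x [^] k \<otimes> J ?f \<otimes> star A x"
    unfolding star_x_J[OF Suc.prems] using f' by (simp add: m_assoc)
  also have "\<dots> = J g \<otimes> star A x [^] Suc k" using g by (simp add: m_assoc)
  finally show ?case using g by blast
qed

lemma mon_mult_J:
  assumes "mon n a" "continuous_on circle g"
  shows "mon n (a \<otimes> J g)"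
  using assms(1)
proof (cases rule: mon_cases)
  case (1 f k)
  obtain h where h: "continuous_on circle h" "x [^] k \<otimes> J g = J h \<otimes> x [^] k"
    using x_power_J[OF assms(2)] by blast
  have "a \<otimes> J g = J (\<lambda>z. f z * h z) \<otimes> x [^] k"
    using 1 h assms(2) by (simp add: m_assoc fc_mult)
  then show ?thesis using mon_x_power[of "\<lambda>z. f z * h z" k] 1 h by (simp add: continuous_on_mult)
next
  case (2 f k)
  obtain h where h: "continuous_on circle h" "star A x [^] Suc k \<otimes> J g = J h \<otimes> star A x [^] Suc k"
    using star_x_power_J[OF assms(2)] by blast
  have "a \<otimes> J g = J (\<lambda>z. f z * h z) \<otimes> star A x [^] Suc k"
    using 2 h assms(2) by (simp add: m_assoc fc_mult del: nat_pow_Suc)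
  then show ?thesis using mon_star_x_power[of "\<lambda>z. f z * h z" "Suc k"] 2 h
    by (simp add: continuous_on_mult del: nat_pow_Suc)
qed

text \<open>In negative degree the new \<open>x\<close> meets a \<open>star A x\<close>. Their
  product is a function of \<open>w\<close>, which is moved to the front.\<close>

lemma mon_mult_x:
  assumes "mon n a"
  shows "mon (n + 1) (a \<otimes> x)"
  using assms
proof (cases rule: mon_cases)
  case (1 f k)
  then have "a \<otimes> x = J f \<otimes> x [^] Suc k" by (simp add: m_assoc)
  then show ?thesis using mon_x_power[of f "Suc k"] 1 by (simp add: add.commute)
next
  case (2 f k)
  have "a \<otimes> x = J f \<otimes> star A x [^] k \<otimes> J (\<lambda>z. of_real (\<gamma> z))"
    using 2 by (simp add: m_assoc m_closed star_x_x[symmetric])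
  then show ?thesis
    using mon_mult_J[OF mon_star_x_power[OF 2(1)] gamma_cont', of k] 2 by simp
qed

lemma mon_mult_star_x:
  assumes "mon n a"
  shows "mon (n - 1) (a \<otimes> star A x)"
proof (cases "n \<le> 0")
  case True
  then obtain f k where f: "continuous_on circle f" "n = - int k" "a = J f \<otimes> star A x [^] k"
    using mon_nonpos_cases[OF assms] by blast
  then have "a \<otimes> star A x = J f \<otimes> star A x [^] Suc k" by (simp add: m_assoc)
  moreover have "n - 1 = - int (Suc k)" using f(2) by simp
  ultimately show ?thesis using mon_star_x_power[OF f(1), of "Suc k"] by (simp only:)
next
  case False
  from assms show ?thesis
  proof (cases rule: mon_cases)
    case (1 f k)
    then obtain j where k: "k = Suc j" using False by (cases k) auto
    have "a \<otimes> star A x = J f \<otimes> x [^] j \<otimes> J (\<lambda>z. of_real (\<gamma> (q * z)))"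
      using 1 k by (simp add: m_assoc m_closed x_star_x[symmetric])
    then show ?thesis
      using mon_mult_J[OF mon_x_power[OF 1(1)] gamma_rot_cont, of j] 1 k by simp
  qed (use False in auto)
qed

text \<open>The factor \<open>b\<close> is appended letter by letter, beginning with its function of
  \<open>w\<close>.\<close>

lemma mon_mult:
  assumes a: "mon n a" and b: "mon m b"
  shows "mon (n + m) (a \<otimes> b)"
  using b
proof (cases rule: mon_cases)
  case (1 f k)
  note ac = mon_closed[OF a]
  have "mon (n + int j) (a \<otimes> (J f \<otimes> x [^] j))" for j
  proof (induction j)
    case 0
    then show ?case using mon_mult_J[OF a 1(1)] 1(1) by (simp add: r_one)
  next
    case (Suc j)
    have "a \<otimes> (J f \<otimes> x [^] Suc j) = a \<otimes> (J f \<otimes> x [^] j) \<otimes> x"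
      using ac 1(1) by (simp add: m_assoc m_closed)
    then show ?case using mon_mult_x[OF Suc] by (simp add: ac_simps)
  qed
  then show ?thesis using 1 by simp
next
  case (2 f k)
  note ac = mon_closed[OF a]
  have "mon (n - int j) (a \<otimes> (J f \<otimes> star A x [^] j))" for j
  proof (induction j)
    case 0
    then show ?case using mon_mult_J[OF a 2(1)] 2(1) by (simp add: r_one)
  next
    case (Suc j)
    have "a \<otimes> (J f \<otimes> star A x [^] Suc j) = a \<otimes> (J f \<otimes> star A x [^] j) \<otimes> star A x"
      using ac 2(1) by (simp add: m_assoc m_closed)
    then show ?case using mon_mult_star_x[OF Suc] by (simp add: algebra_simps)
  qed
  from this[of "Suc k"] show ?thesis unfolding 2(2,3) by (simp only: diff_conv_add_uminus)
qed

lemma mon_star: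
  assumes "mon n a"
  shows "mon (- n) (star A a)"
  using assms
proof (cases rule: mon_cases)
  case (1 f k)
  have cf: "continuous_on circle (\<lambda>z. cnj (f z))" using 1(1) by (rule continuous_on_cnj)
  obtain h where h: "continuous_on circle h"
    "star A x [^] k \<otimes> J (\<lambda>z. cnj (f z)) = J h \<otimes> star A x [^] k"
    using star_x_power_J[OF cf] by blast
  have "star A a = J h \<otimes> star A x [^] k"
    using 1 h(2) by (simp add: star_mult star_pow fc_star)
  then show ?thesis using mon_star_x_power[OF h(1)] 1 by simp
next
  case (2 f k)
  have cf: "continuous_on circle (\<lambda>z. cnj (f z))" using 2(1) by (rule continuous_on_cnj)
  obtain h where h: "continuous_on circle h"
    "x [^] Suc k \<otimes> J (\<lambda>z. cnj (f z)) = J h \<otimes> x [^] Suc k"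
    using x_power_J[OF cf] by blast
  have "star A (star A x [^] Suc k) = x [^] Suc k"
    using star_pow[of "star A x" "Suc k"] by (simp only: star_closed star_star x_closed)
  then have "star A a = J h \<otimes> x [^] Suc k"
    unfolding 2(3) h(2)[symmetric] fc_star[OF unitary_w 2(1)]
    using star_mult[OF fc_closed[OF unitary_w 2(1)], of "star A x [^] Suc k"] by simp
  moreover have "- n = int (Suc k)" using 2(2) by simp
  ultimately show ?thesis using mon_x_power[OF h(1), of "Suc k"] by (simp only:)
qed

lemma mon_J: "continuous_on circle f \<Longrightarrow> mon 0 (J f)"
  using mon_x_power[of f 0] by (simp add: r_one)

lemma mon_0E:
  assumes "mon 0 a"
  obtains f where "continuous_on circle f" "a = J f"
  using assms unfolding mon_def by (auto simp: r_one)

lemma mon_zero: "mon n \<zero>"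
proof -
  have J0: "J (\<lambda>z. 0) = \<zero>" by (simp add: fc_const one_closed)
  show ?thesis
  proof (cases n rule: int_cases2)
    case (nonneg k)
    then show ?thesis using mon_x_power[of "\<lambda>z. 0" k] by (simp add: J0 l_null)
  next
    case (nonpos k)
    then show ?thesis using mon_star_x_power[of "\<lambda>z. 0" k] by (simp add: J0 l_null)
  qed
qed

lemma mon_scalar: "mon n a \<Longrightarrow> mon n (c \<odot> a)"
  using mon_mult[of 0 "J (\<lambda>z. c)" n a] mon_J[of "\<lambda>z. c"] mon_closed[of n a]
  by (simp add: fc_const mult_smult_left one_closed l_one continuous_on_const)

lemma mon_gen: "mon 1 x" "mon 0 w" "mon 0 \<one>"
  using mon_x_power[of "\<lambda>z. 1" 1] mon_J[of "\<lambda>z. z"] mon_J[of "\<lambda>z. 1"]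
  by (simp_all add: fc_one fc_ident l_one continuous_on_const continuous_on_id)

inductive mspan :: "'a \<Rightarrow> bool" where
  mspan_zero: "mspan \<zero>"
| mspan_add: "mon n a \<Longrightarrow> mspan b \<Longrightarrow> mspan (a \<oplus> b)"

lemma mspan_closed: "mspan a \<Longrightarrow> a \<in> carrier A"
  by (induction rule: mspan.induct) (auto intro: mon_closed a_closed zero_closed)

lemma mspan_mon: "mon n a \<Longrightarrow> mspan a"
  using mspan_add[OF _ mspan_zero, of n a] mon_closed[of n a] by simp

lemma mspan_plus: "mspan a \<Longrightarrow> mspan b \<Longrightarrow> mspan (a \<oplus> b)"
proof (induction rule: mspan.induct)
  case mspan_zero
  then show ?case using mspan_closed by simp
next
  case (mspan_add n c a)
  then show ?case
    using mspan.mspan_add[of n c "a \<oplus> b"] mspan_closed mon_closed by (simp add: a_assoc)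
qed

lemma mspan_mon_mult: "mspan b \<Longrightarrow> mon n a \<Longrightarrow> mspan (a \<otimes> b)"
proof (induction rule: mspan.induct)
  case mspan_zero
  then show ?case using mon_closed mspan.mspan_zero by (simp add: r_null)
next
  case (mspan_add m c b)
  then show ?case
    using mspan.mspan_add[OF mon_mult[of n a m c], of "a \<otimes> b"] mspan_closed mon_closed
    by (simp add: r_distr)
qed

lemma mspan_mult: "mspan a \<Longrightarrow> mspan b \<Longrightarrow> mspan (a \<otimes> b)"
proof (induction rule: mspan.induct)
  case mspan_zero
  then show ?case using mspan_closed mspan.mspan_zero by (simp add: l_null)
next
  case (mspan_add m c a)
  then show ?case
    using mspan_plus[OF mspan_mon_mult[of b m c], of "a \<otimes> b"] mspan_closed mon_closed
    by (simp add: l_distr)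
qed

lemma mspan_star: "mspan a \<Longrightarrow> mspan (star A a)"
proof (induction rule: mspan.induct)
  case (mspan_add n a b)
  then show ?case
    using mspan.mspan_add[OF mon_star[of n a], of "star A b"] mspan_closed mon_closed
    by (simp add: star_add)
qed (simp add: mspan_zero)

lemma mspan_scalar: "mspan a \<Longrightarrow> mspan (c \<odot> a)"
proof (induction rule: mspan.induct)
  case (mspan_add n a b)
  then show ?case
    using mspan.mspan_add[OF mon_scalar[of n a c], of "c \<odot> b"] mspan_closed mon_closed
    by (simp add: scalar_add_right)
qed (simp add: mspan_zero)

lemma mspan_dense:
  assumes "a \<in> carrier A"
  shows "\<exists>s. (\<forall>n. mspan (s n)) \<and> conv s a"
proof -
  have "\<exists>s. (\<forall>n. s n \<in> {a. mspan a}) \<and> conv s a"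
    using generated assms
  proof (rule dense_generated)
    show "\<exists>b\<in>{a. mspan a}. nrm A (c \<odot> a \<ominus> b) < e" if "a \<in> {a. mspan a}" "e > 0" for a c e
      using that mspan_scalar[of a c] mspan_closed[of a] by (intro bexI[of _ "c \<odot> a"]) auto
  qed (auto intro: mspan_closed mspan_plus mspan_mult mspan_star mspan_mon[OF mon_gen(1)]
      mspan_mon[OF mon_gen(2)] mspan_mon[OF mon_gen(3)])
  then show ?thesis by simp
qed

text \<open>Meant for assertions that are linear and continuous in \<open>a\<close>, such as those
  on the conditional expectation. They do not pass to products, which puts them out of reach of
  \<open>cstar_generated_induct\<close>.\<close>

lemma homogeneous_induct [consumes 1, case_names homogeneous add lim]:
  assumes a: "a \<in> carrier A"
    and mon: "\<And>n a. mon n a \<Longrightarrow> P a"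
    and add: "\<And>a b. \<lbrakk>a \<in> carrier A; b \<in> carrier A; P a; P b\<rbrakk> \<Longrightarrow> P (a \<oplus> b)"
    and lim: "\<And>s a. \<lbrakk>conv s a; \<And>n. P (s n)\<rbrakk> \<Longrightarrow> P a"
  shows "P a"
proof -
  have sp: "P b" if "mspan b" for b
    using that
  proof (induction rule: mspan.induct)
    case mspan_zero
    show ?case by (rule mon[OF mon_zero[of 0]])
  next
    case (mspan_add n a b)
    then show ?case using add mon mon_closed mspan_closed by simp
  qed
  obtain s where s: "\<forall>n. mspan (s n)" "conv s a" using mspan_dense[OF a] by auto
  show ?thesis by (rule lim[OF s(2)]) (use s(1) sp in simp)
qed

subsection \<open>The gauge action\<close>

abbreviation phase :: "real \<Rightarrow> complex" where
  "phase t \<equiv> exp (2 * of_real pi * \<i> * of_real t)"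

lemma phase_cis: "phase t = cis (2 * pi * t)"
  by (simp add: cis_conv_exp mult_ac)

lemma scalar_relations:
  assumes "cmod p = 1"
  shows "A_relations \<theta> \<gamma> A (p \<odot> x) w"
proof -
  have p: "cnj p * p = 1" "p * cnj p = 1"
    using assms complex_norm_square[of p] by (simp_all add: mult.commute)
  show ?thesis
    unfolding A_relations_iff[OF spectrum_w gamma_cont] q_def[symmetric]
    using star_x_x x_star_x x_w p gamma_cont' gamma_rot_cont
    by (simp add: star_smult mult_smult_left mult_smult_right scalar_mult m_closed mult.commute[of p q])
qed

lemma norm_phase: "cmod (phase t) = 1"
  unfolding phase_cis by simp

text \<open>The universal property does not reach \<open>A\<close> itself, whose elements may have
  another type. A copy of \<open>A\<close> in \<open>nat \<Rightarrow> complex\<close> serves as the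
  test algebra, and the inverse injection brings the homomorphism back.\<close>

lemma gauge_hom_exists: "\<exists>h. star_hom A A h \<and> h x = phase t \<odot> x \<and> h w = w"
proof -
  obtain f :: "'a \<Rightarrow> nat \<Rightarrow> complex" where inj: "inj_on f (carrier A)"
    using generated_by_two_inj[OF generated] by auto
  let ?B = "transport f A" and ?g = "inv_into (carrier A) f"
  have B: "unital_cstar_algebra ?B" by (rule unital_cstar_algebra_transport[OF A_cstar inj])
  note F = star_hom_transport[OF A_cstar inj]
  have "A_relations \<theta> \<gamma> ?B (f (phase t \<odot> x)) (f w)"
    by (rule A_relations_transfer(1)[OF A_cstar B F _ spectrum_w gamma_cont scalar_relations[OF norm_phase]])
      (simp add: inj)
  from universal_property[OF B this] obtain h where
    h: "star_hom A ?B h" "h x = f (phase t \<odot> x)" "h w = f w" by blast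
  then show ?thesis
    using star_hom_compose[OF h(1) F(2)] inj by (intro exI[of _ "?g \<circ> h"]) simp
qed

lemma star_hom_eqI:
  assumes "star_hom A A h" "star_hom A A k" "h x = k x" "h w = k w" "a \<in> carrier A"
  shows "h a = k a"
  by (rule star_hom_unique[OF A_cstar A_cstar assms(1,2) generated _ _ assms(5)]) (use assms in auto)

text \<open>The homomorphisms for \<open>t\<close> and \<open>- t\<close> are inverse to each other,
  since both compositions fix the generators. Uniqueness on the carrier and extensionality off it
  justify the definite description in \<open>gauge_aut\<close>.\<close>

lemma gauge_aut_props:
  shows "star_hom A A (gauge_aut A x w t)" "gauge_aut A x w t x = phase t \<odot> x" "gauge_aut A x w t w = w"
proof -
  let ?P = "\<lambda>r. r \<in> extensional (carrier A) \<and> star_hom A A r \<and> bij_betw r (carrier A) (carrier A) \<and>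
     r x = phase t \<odot> x \<and> r w = w"
  obtain h where h: "star_hom A A h" "h x = phase t \<odot> x" "h w = w" using gauge_hom_exists by blast
  obtain k where k: "star_hom A A k" "k x = phase (- t) \<odot> x" "k w = w" using gauge_hom_exists by blast
  have ph: "phase t * phase (- t) = 1" by (simp flip: exp_add)
  have kh: "k (h a) = a" if "a \<in> carrier A" for a
  proof -
    have "(k \<circ> h) a = (\<lambda>a. a) a"
      by (rule star_hom_eqI[OF star_hom_compose[OF h(1) k(1)] star_hom_id _ _ that])
        (use ph in \<open>simp_all add: h k star_homD[OF k(1)] scalar_mult\<close>)
    then show ?thesis by simp
  qed
  have hk: "h (k a) = a" if "a \<in> carrier A" for a
  proof -
    have "(h \<circ> k) a = (\<lambda>a. a) a"
      by (rule star_hom_eqI[OF star_hom_compose[OF k(1) h(1)] star_hom_id _ _ that])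
        (use ph in \<open>simp_all add: h k star_homD[OF h(1)] scalar_mult mult.commute\<close>)
    then show ?thesis by simp
  qed
  note H = star_homD[OF h(1)]
  have "bij_betw h (carrier A) (carrier A)"
    by (rule bij_betw_byWitness[where f' = k]) (use kh hk H(1) star_homD(1)[OF k(1)] in auto)
  moreover have "star_hom A A (restrict h (carrier A))"
    by (rule star_homI) (simp_all add: H a_closed m_closed one_closed)
  ultimately have ex: "?P (restrict h (carrier A))"
    using h by (simp cong: bij_betw_cong)
  have "?P (gauge_aut A x w t)"
    unfolding gauge_aut_def
  proof (rule theI[of ?P, OF ex])
    fix r assume r: "?P r"
    show "r = restrict h (carrier A)"
    proof (rule extensionalityI[of _ "carrier A"])
      show "r a = restrict h (carrier A) a" if "a \<in> carrier A" for a
        using star_hom_eqI[OF conjunct1[OF conjunct2[OF r]] h(1) _ _ that] r h that by simp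
    qed (use r in auto)
  qed
  then show "star_hom A A (gauge_aut A x w t)" "gauge_aut A x w t x = phase t \<odot> x"
    "gauge_aut A x w t w = w" by auto
qed

abbreviation \<rho> :: "real \<Rightarrow> 'a \<Rightarrow> 'a" where
  "\<rho> t \<equiv> gauge_aut A x w t"

lemmas \<rho>_hom = star_homD[OF gauge_aut_props(1)]

lemma nrm_\<rho>_le: "a \<in> carrier A \<Longrightarrow> nrm A (\<rho> t a) \<le> nrm A a"
  by (rule star_hom_contractive[OF A_cstar A_cstar gauge_aut_props(1)])

lemma \<rho>_J: "continuous_on circle f \<Longrightarrow> \<rho> t (J f) = J f"
  using star_hom_fc_commute[OF A_cstar A_cstar gauge_aut_props(1) unitary_w] gauge_aut_props(3) by simp

lemma scalar_pow: "a \<in> carrier A \<Longrightarrow> (c \<odot> a) [^] (k::nat) = c ^ k \<odot> a [^] k"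
  by (induction k) (simp_all add: one_closed mult_smult_left mult_smult_right scalar_mult m_closed)

lemma \<rho>_pow: "a \<in> carrier A \<Longrightarrow> \<rho> t (a [^] (k::nat)) = \<rho> t a [^] k"
  by (induction k) (simp_all add: \<rho>_hom)

lemma \<rho>_mon:
  assumes "mon n a"
  shows "\<rho> t a = cis (2 * pi * of_int n * t) \<odot> a"
  using assms
proof (cases rule: mon_cases)
  case (1 f k)
  have "phase t ^ k = cis (2 * pi * of_int n * t)"
    unfolding phase_cis 1(2) Complex.DeMoivre by (simp add: mult_ac)
  then show ?thesis
    using 1 by (simp add: \<rho>_hom \<rho>_J \<rho>_pow gauge_aut_props scalar_pow mult_smult_right)
next
  case (2 f k)
  have "cnj (phase t) ^ Suc k = cis (2 * pi * of_int n * t)"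
    unfolding phase_cis 2(2) cis_cnj Complex.DeMoivre by (simp add: algebra_simps)
  moreover have "\<rho> t a = J f \<otimes> (cnj (phase t) \<odot> star A x) [^] Suc k"
    unfolding 2(3) using 2(1)
    by (simp add: \<rho>_hom \<rho>_J \<rho>_pow gauge_aut_props star_smult del: nat_pow_Suc exp_cnj)
  moreover have "J f \<otimes> (c \<odot> star A x) [^] Suc k = c ^ Suc k \<odot> a" for c
    unfolding 2(3) scalar_pow[OF star_closed[OF x_closed]] using 2(1)
    by (intro mult_smult_right) auto
  ultimately show ?thesis by (simp only:)
qed

end

subsection \<open>Riemann sums\<close>

lemma tagged_division_measure:
  assumes "p tagged_division_of {0..1::real}"
  shows "(\<Sum>(t, K)\<in>p. measure lborel K) = 1"
  using additive_content_tagged_division[of p 0 1] assms by (simp add: cbox_interval)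

text \<open>One constant mesh \<open>d\<close> must serve for all tagged divisions, as
  \<open>has_integral01\<close> asks for a Riemann integral. Uniform continuity of \<open>g\<close>
  supplies it.\<close>

lemma Riemann_sum_uniform:
  fixes g :: "real \<Rightarrow> 'b::euclidean_space"
  assumes g: "continuous_on {0..1} g" and I: "(g has_integral I) {0..1}" and e: "e > 0"
  shows "\<exists>d>0. \<forall>p. p tagged_division_of {0..1} \<and> (\<lambda>t. ball t d) fine p \<longrightarrow>
    norm ((\<Sum>(t, K)\<in>p. measure lborel K *\<^sub>R g t) - I) \<le> e"
proof -
  have "uniformly_continuous_on {0..1} g" by (rule compact_uniformly_continuous[OF g]) simp
  then obtain d where d: "d > 0" "\<And>s t. \<lbrakk>s \<in> {0..1}; t \<in> {0..1}; dist s t < d\<rbrakk> \<Longrightarrow> dist (g s) (g t) < e"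
    unfolding uniformly_continuous_on_def using e by blast
  have "norm ((\<Sum>(t, K)\<in>p. measure lborel K *\<^sub>R g t) - I) \<le> e"
    if p: "p tagged_division_of {0..1}" and fine: "(\<lambda>t. ball t d) fine p" for p
  proof -
    have p': "p tagged_division_of (cbox 0 1)" using p by (simp add: cbox_interval)
    have gi: "g integrable_on (cbox 0 1)" using I by (auto simp: cbox_interval integrable_on_def)
    have I': "I = integral (cbox 0 1) g" using I by (simp add: cbox_interval integral_unique)
    have "I = (\<Sum>(t, K)\<in>p. integral K g)"
      unfolding I' by (rule integral_combine_tagged_division_topdown[OF gi p'])
    then have "(\<Sum>(t, K)\<in>p. measure lborel K *\<^sub>R g t) - I =
        (\<Sum>(t, K)\<in>p. measure lborel K *\<^sub>R g t - integral K g)"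
      by (simp add: sum_subtractf case_prod_unfold)
    also have "norm \<dots> \<le> (\<Sum>(t, K)\<in>p. e * measure lborel K)"
      unfolding case_prod_unfold
    proof (rule sum_norm_le, clarsimp)
      fix t K assume tK: "(t, K) \<in> p"
      from tagged_division_ofD(4)[OF p' tK] obtain a b where K: "K = cbox a b" by blast
      have sub: "K \<subseteq> {0..1}" "t \<in> K" using tagged_division_ofD(2,3)[OF p' tK] by (auto simp: cbox_interval)
      have near: "dist (g t) (g s) \<le> e" if "s \<in> K" for s
        using d(2)[of t s] sub that fine tK unfolding fine_def by fastforce
      have "((\<lambda>s. g t - g s) has_integral (measure lborel K *\<^sub>R g t - integral K g)) K"
        unfolding K by (intro has_integral_diff has_integral_const integrable_integral)
          (use Henstock_Kurzweil_Integration.integrable_subinterval[OF gi] sub K in \<open>auto simp: cbox_interval\<close>)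
      then show "norm (measure lborel K *\<^sub>R g t - integral K g) \<le> e * measure lborel K"
        unfolding K using near e K by (intro has_integral_bound[of e "\<lambda>s. g t - g s"]) (auto simp: dist_norm)
    qed
    also have "\<dots> = e * (\<Sum>(t, K)\<in>p. measure lborel K)"
      by (simp add: sum_distrib_left case_prod_unfold)
    finally show ?thesis using tagged_division_measure[OF p] by simp
  qed
  then show ?thesis using d(1) by blast
qed

context unital_cstar_algebra
begin

lemma finsum_scalar_right:
  assumes "finite p" "a \<in> carrier A"
  shows "finsum A (\<lambda>i. f i \<odot> a) p = (\<Sum>i\<in>p. f i) \<odot> a"
  using assms(1)
proof (induction p rule: finite_induct)
  case empty
  then show ?case using abelian_monoid.finsum_empty[OF abelian_monoid_A] assms by simp
next
  case (insert i p)
  then show ?case using assms(2) by (subst finsum_insert) (auto simp: scalar_add_left)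
qed

lemma finsum_add:
  assumes "finite p" "\<And>i. i \<in> p \<Longrightarrow> f i \<in> carrier A" "\<And>i. i \<in> p \<Longrightarrow> g i \<in> carrier A"
  shows "finsum A (\<lambda>i. f i \<oplus> g i) p = finsum A f p \<oplus> finsum A g p"
  using abelian_monoid.finsum_addf[OF abelian_monoid_A, of f p g] assms by auto

lemma finsum_scalar:
  assumes "finite p" "\<And>i. i \<in> p \<Longrightarrow> f i \<in> carrier A"
  shows "finsum A (\<lambda>i. c \<odot> f i) p = c \<odot> finsum A f p"
  using assms
proof (induction p rule: finite_induct)
  case empty
  then show ?case using abelian_monoid.finsum_empty[OF abelian_monoid_A] by simp
next
  case (insert i p)
  have "finsum A (\<lambda>i. c \<odot> f i) (insert i p) = c \<odot> f i \<oplus> finsum A (\<lambda>i. c \<odot> f i) p"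
    using insert by (intro finsum_insert) auto
  moreover have "finsum A f (insert i p) = f i \<oplus> finsum A f p"
    using insert by (intro finsum_insert) auto
  moreover have "finsum A f p \<in> carrier A" using insert by (intro finsum_closed) auto
  ultimately show ?case using insert by (simp add: scalar_add_right)
qed

end

context universal_rotation_algebra
begin

subsection \<open>The conditional expectation\<close>

definition rsum :: "'a \<Rightarrow> (real \<times> real set) set \<Rightarrow> 'a" where
  "rsum a p = finsum A (\<lambda>(t, K). complex_of_real (measure lborel K) \<odot> \<rho> t a) p"

lemma rsum_alt: "rsum a p = finsum A (\<lambda>i. complex_of_real (measure lborel (snd i)) \<odot> \<rho> (fst i) a) p"
  unfolding rsum_def by (simp add: case_prod_unfold)

lemma rsum_closed: "a \<in> carrier A \<Longrightarrow> rsum a p \<in> carrier A"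
  unfolding rsum_alt by (intro finsum_closed) (auto simp: \<rho>_hom)

lemma rsum_add:
  "\<lbrakk>a \<in> carrier A; b \<in> carrier A; finite p\<rbrakk> \<Longrightarrow> rsum (a \<oplus> b) p = rsum a p \<oplus> rsum b p"
  unfolding rsum_alt by (subst finsum_add[symmetric]) (auto simp: \<rho>_hom scalar_add_right)

lemma rsum_scalar:
  assumes "a \<in> carrier A" "finite p"
  shows "rsum (c \<odot> a) p = c \<odot> rsum a p"
  unfolding rsum_alt using assms
  by (subst finsum_scalar[symmetric]) (auto simp: \<rho>_hom scalar_mult mult.commute)

text \<open>The automorphisms are contractive and the lengths of the intervals add up to 1. That the
  bound is uniform in \<open>p\<close> is what limits in \<open>a\<close> require.\<close>

lemma nrm_rsum_le:
  assumes a: "a \<in> carrier A" and p: "p tagged_division_of {0..1}"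
  shows "nrm A (rsum a p) \<le> nrm A a"
proof -
  have fin: "finite p" using p by (rule tagged_division_of_finite)
  have "nrm A (rsum a p) \<le> (\<Sum>i\<in>p. nrm A (complex_of_real (measure lborel (snd i)) \<odot> \<rho> (fst i) a))"
    unfolding rsum_alt using a fin by (intro nrm_finsum_le) (auto simp: \<rho>_hom)
  also have "\<dots> \<le> (\<Sum>i\<in>p. measure lborel (snd i) * nrm A a)"
    using a by (intro sum_mono) (simp add: nrm_smult \<rho>_hom nrm_\<rho>_le mult_left_mono)
  also have "\<dots> = nrm A a"
    using tagged_division_measure[OF p] by (simp add: case_prod_unfold flip: sum_distrib_right)
  finally show ?thesis .
qed

text \<open>Averaging is kept as a relation until existence and uniqueness are established, because
  \<open>cond_exp\<close> is a definite description.\<close>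

definition CE :: "'a \<Rightarrow> 'a \<Rightarrow> bool" where
  "CE a b \<longleftrightarrow> has_integral01 A (\<lambda>t. \<rho> t a) b"

lemma CE_iff:
  "CE a b \<longleftrightarrow> b \<in> carrier A \<and> (\<forall>e>0. \<exists>d>0. \<forall>p. p tagged_division_of {0..1} \<and> (\<lambda>t. ball t d) fine p \<longrightarrow>
     nrm A (rsum a p \<ominus> b) < e)"
  by (simp add: CE_def has_integral01_def rsum_def)

lemma CE_closed: "CE a b \<Longrightarrow> b \<in> carrier A"
  by (simp add: CE_iff)

lemma CE_D:
  assumes "CE a b" "e > 0"
  obtains d where "d > 0" "\<And>p. \<lbrakk>p tagged_division_of {0..1}; (\<lambda>t. ball t d) fine p\<rbrakk> \<Longrightarrow> nrm A (rsum a p \<ominus> b) < e"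
  using assms unfolding CE_iff by blast

lemma fine_division: "d > 0 \<Longrightarrow> \<exists>p. p tagged_division_of {0..1::real} \<and> (\<lambda>t. ball t d) fine p"
  using fine_division_exists_real[OF gauge_ball, of d 0 1] by metis

lemma fine_ball_mono: "(\<lambda>t. ball t (min d d')) fine p \<Longrightarrow> (\<lambda>t::real. ball t d) fine p \<and> (\<lambda>t. ball t d') fine p"
  unfolding fine_def by fastforce

lemma CE_add:
  assumes a: "a \<in> carrier A" "a' \<in> carrier A" and ce: "CE a b" "CE a' b'"
  shows "CE (a \<oplus> a') (b \<oplus> b')"
  unfolding CE_iff
proof (intro conjI allI impI)
  note bc = CE_closed[OF ce(1)] CE_closed[OF ce(2)]
  show "b \<oplus> b' \<in> carrier A" using bc by (rule a_closed)
  fix e :: real assume "e > 0"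
  then have e2: "e / 2 > 0" by simp
  obtain d where d: "d > 0" "\<And>p. \<lbrakk>p tagged_division_of {0..1}; (\<lambda>t. ball t d) fine p\<rbrakk> \<Longrightarrow> nrm A (rsum a p \<ominus> b) < e / 2"
    using CE_D[OF ce(1) e2] by blast
  obtain d' where d': "d' > 0" "\<And>p. \<lbrakk>p tagged_division_of {0..1}; (\<lambda>t. ball t d') fine p\<rbrakk> \<Longrightarrow> nrm A (rsum a' p \<ominus> b') < e / 2"
    using CE_D[OF ce(2) e2] by blast
  have "nrm A (rsum (a \<oplus> a') p \<ominus> (b \<oplus> b')) < e"
    if p: "p tagged_division_of {0..1}" "(\<lambda>t. ball t (min d d')) fine p" for p
  proof -
    have fin: "finite p" using p(1) by (rule tagged_division_of_finite)
    have "nrm A (rsum a p \<ominus> b) < e / 2" "nrm A (rsum a' p \<ominus> b') < e / 2"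
      using fine_ball_mono[OF p(2)] d(2)[OF p(1)] d'(2)[OF p(1)] by simp_all
    then show ?thesis
      using nrm_add_minus_add[OF rsum_closed[OF a(1)] rsum_closed[OF a(2)] bc, of p p]
      by (simp add: rsum_add a fin)
  qed
  then show "\<exists>d>0. \<forall>p. p tagged_division_of {0..1} \<and> (\<lambda>t. ball t d) fine p \<longrightarrow>
      nrm A (rsum (a \<oplus> a') p \<ominus> (b \<oplus> b')) < e"
    using d(1) d'(1) by (intro exI[of _ "min d d'"]) auto
qed

lemma CE_scalar:
  assumes a: "a \<in> carrier A" and ce: "CE a b"
  shows "CE (c \<odot> a) (c \<odot> b)"
  unfolding CE_iff
proof (intro conjI allI impI)
  note bc = CE_closed[OF ce(1)]
  show "c \<odot> b \<in> carrier A" using bc by simp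
  fix e :: real assume "e > 0"
  then have e2: "e / (cmod c + 1) > 0" by (simp add: add_nonneg_pos)
  obtain d where d: "d > 0" "\<And>p. \<lbrakk>p tagged_division_of {0..1}; (\<lambda>t. ball t d) fine p\<rbrakk> \<Longrightarrow> nrm A (rsum a p \<ominus> b) < e / (cmod c + 1)"
    using CE_D[OF ce(1) e2] by blast
  have "nrm A (rsum (c \<odot> a) p \<ominus> c \<odot> b) < e"
    if p: "p tagged_division_of {0..1}" "(\<lambda>t. ball t d) fine p" for p
  proof -
    have fin: "finite p" using p(1) by (rule tagged_division_of_finite)
    have "nrm A (rsum (c \<odot> a) p \<ominus> c \<odot> b) = cmod c * nrm A (rsum a p \<ominus> b)"
      using a bc fin by (simp add: rsum_scalar nrm_smult rsum_closed flip: scalar_minus_right)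
    also have "\<dots> \<le> (cmod c + 1) * nrm A (rsum a p \<ominus> b)"
      using a bc nrm_nonneg[of "rsum a p \<ominus> b"] by (intro mult_right_mono) (auto simp: rsum_closed)
    also have "\<dots> < e"
      using d(2)[OF p] by (simp add: pos_less_divide_eq add_nonneg_pos mult.commute)
    finally show ?thesis .
  qed
  then show "\<exists>d>0. \<forall>p. p tagged_division_of {0..1} \<and> (\<lambda>t. ball t d) fine p \<longrightarrow>
      nrm A (rsum (c \<odot> a) p \<ominus> c \<odot> b) < e"
    using d(1) by (intro exI[of _ d]) auto
qed

lemma CE_nrm_le:
  assumes a: "a \<in> carrier A" and ce: "CE a b"
  shows "nrm A b \<le> nrm A a"
proof (rule field_le_epsilon)
  fix e :: real assume "e > 0"
  obtain d where d: "d > 0" "\<And>p. \<lbrakk>p tagged_division_of {0..1}; (\<lambda>t. ball t d) fine p\<rbrakk> \<Longrightarrow> nrm A (rsum a p \<ominus> b) < e"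
    using CE_D[OF ce \<open>e > 0\<close>] by blast
  obtain p where "p tagged_division_of {0..1::real} \<and> (\<lambda>t. ball t d) fine p"
    using fine_division[OF d(1)] ..
  then have p: "p tagged_division_of {0..1}" "(\<lambda>t. ball t d) fine p" by simp_all
  have "nrm A b \<le> nrm A (b \<ominus> rsum a p) + nrm A (rsum a p)"
    using a CE_closed[OF ce] by (intro nrm_le_diff) (auto simp: rsum_closed)
  then show "nrm A b \<le> nrm A a + e"
    using d(2)[OF p] nrm_rsum_le[OF a p(1)] nrm_minus_commute[OF CE_closed[OF ce] rsum_closed[OF a], of p]
    by linarith
qed

lemma CE_minus:
  assumes "a \<in> carrier A" "a' \<in> carrier A" "CE a b" "CE a' b'"
  shows "CE (a \<ominus> a') (b \<ominus> b')"
  using CE_add[OF assms(1) _ assms(3) CE_scalar[OF assms(2,4), of "-1"]] assms CE_closed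
  by (simp add: minus_eq_scalar)

text \<open>Contractivity applied to \<open>a \<ominus> a\<close>, which has the average
  \<open>b \<ominus> b'\<close>.\<close>

lemma CE_unique:
  assumes "a \<in> carrier A" "CE a b" "CE a b'"
  shows "b = b'"
proof -
  note c = CE_closed[OF assms(2)] CE_closed[OF assms(3)]
  have "nrm A (b \<ominus> b') \<le> nrm A (a \<ominus> a)"
    using assms by (intro CE_nrm_le CE_minus) auto
  then show ?thesis using assms(1) c nrm_nonneg[of "b \<ominus> b'"] by (subst eq_iff_nrm) auto
qed

text \<open>Riemann sums are contractive uniformly in the division, so one index \<open>n\<close>
  serves for all fine divisions and three errors of \<open>e / 3\<close> remain.\<close>

lemma CE_lim:
  assumes s: "conv s a" and b: "conv b b'" and ce: "\<And>n. CE (s n) (b n)"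
  shows "CE a b'"
  unfolding CE_iff
proof (intro conjI allI impI)
  note sc = convD(1,2)[OF s] and bc = convD(1,2)[OF b]
  show "b' \<in> carrier A" by (rule bc)
  fix e :: real assume "e > 0"
  then have e3: "e / 3 > 0" by simp
  have "\<forall>\<^sub>F n in sequentially. nrm A (s n \<ominus> a) < e / 3 \<and> nrm A (b n \<ominus> b') < e / 3"
    by (intro eventually_conj order_tendstoD(2)[OF convD(3)[OF s] e3] order_tendstoD(2)[OF convD(3)[OF b] e3])
  then obtain n where n: "nrm A (s n \<ominus> a) < e / 3" "nrm A (b n \<ominus> b') < e / 3"
    using eventually_happens' sequentially_bot by blast
  obtain d where d: "d > 0" "\<And>p. \<lbrakk>p tagged_division_of {0..1}; (\<lambda>t. ball t d) fine p\<rbrakk> \<Longrightarrow> nrm A (rsum (s n) p \<ominus> b n) < e / 3"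
    using CE_D[OF ce e3] by blast
  have "nrm A (rsum a p \<ominus> b') < e"
    if p: "p tagged_division_of {0..1}" "(\<lambda>t. ball t d) fine p" for p
  proof -
    have fin: "finite p" using p(1) by (rule tagged_division_of_finite)
    note rc = rsum_closed[OF sc(2), of p] rsum_closed[OF sc(1), of n p]
    have "rsum a p \<ominus> rsum (s n) p = rsum (a \<ominus> s n) p"
      using sc rc fin by (simp add: minus_eq_scalar rsum_add rsum_scalar)
    then have "nrm A (rsum a p \<ominus> rsum (s n) p) \<le> nrm A (a \<ominus> s n)"
      using nrm_rsum_le[OF _ p(1), of "a \<ominus> s n"] sc by simp
    moreover have "nrm A (rsum a p \<ominus> b') \<le> nrm A (rsum a p \<ominus> rsum (s n) p) + nrm A (rsum (s n) p \<ominus> b')"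
      using rc bc by (intro nrm_triangle_diff)
    moreover have "nrm A (rsum (s n) p \<ominus> b') \<le> nrm A (rsum (s n) p \<ominus> b n) + nrm A (b n \<ominus> b')"
      using rc bc by (intro nrm_triangle_diff)
    ultimately show ?thesis
      using n d(2)[OF p] nrm_minus_commute[OF sc(2) sc(1), of n] by linarith
  qed
  then show "\<exists>d>0. \<forall>p. p tagged_division_of {0..1} \<and> (\<lambda>t. ball t d) fine p \<longrightarrow> nrm A (rsum a p \<ominus> b') < e"
    using d(1) by (intro exI[of _ d]) auto
qed

text \<open>On a monomial the Riemann sums are scalar Riemann sums of a character times
  \<open>a\<close>, so the integral of the character decides.\<close>

lemma CE_mon:
  assumes "mon n a"
  shows "CE a (if n = 0 then a else \<zero>)"
proof -
  note ac = mon_closed[OF assms]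
  let ?\<delta> = "if n = 0 then 1 else 0 :: complex"
  let ?g = "\<lambda>t. cis (2 * pi * of_int n * t)"
  have rs: "rsum a p = (\<Sum>(t, K)\<in>p. measure lborel K *\<^sub>R ?g t) \<odot> a" if "finite p" for p
    unfolding rsum_alt using ac that
    by (simp add: \<rho>_mon[OF assms] scalar_mult finsum_scalar_right scaleR_conv_of_real case_prod_unfold)
  have "CE a (?\<delta> \<odot> a)"
    unfolding CE_iff
  proof (intro conjI allI impI)
    fix e :: real assume "e > 0"
    \<comment> \<open>The added 1 keeps the divisor positive for \<open>a = \<zero>\<close>; the
      factor 2 turns a non-strict estimate into a strict one.\<close>
    then have e': "e / (nrm A a + 1) / 2 > 0" using nrm_nonneg[OF ac] by (simp add: add_nonneg_pos)
    have "continuous_on {0..1} ?g" by (intro continuous_intros)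
    from Riemann_sum_uniform[OF this has_integral_cis e'] obtain d where d: "d > 0"
      "\<And>p. \<lbrakk>p tagged_division_of {0..1}; (\<lambda>t. ball t d) fine p\<rbrakk> \<Longrightarrow>
        cmod ((\<Sum>(t, K)\<in>p. measure lborel K *\<^sub>R ?g t) - ?\<delta>) \<le> e / (nrm A a + 1) / 2" by blast
    have "nrm A (rsum a p \<ominus> ?\<delta> \<odot> a) < e"
      if p: "p tagged_division_of {0..1}" "(\<lambda>t. ball t d) fine p" for p
    proof -
      have fin: "finite p" using p(1) by (rule tagged_division_of_finite)
      have "nrm A (rsum a p \<ominus> ?\<delta> \<odot> a) = cmod ((\<Sum>(t, K)\<in>p. measure lborel K *\<^sub>R ?g t) - ?\<delta>) * nrm A a"
        unfolding rs[OF fin] scalar_minus_left[OF ac, symmetric] nrm_smult[OF ac] ..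
      also have "\<dots> \<le> e / (nrm A a + 1) / 2 * (nrm A a + 1)"
        using d(2)[OF p] e' nrm_nonneg[OF ac] by (intro mult_mono) auto
      also have "\<dots> = e / 2"
      proof -
        have "nrm A a + 1 \<noteq> 0" using nrm_nonneg[OF ac] by linarith
        then show ?thesis by (simp add: field_simps)
      qed
      also have "\<dots> < e" using \<open>e > 0\<close> by simp
      finally show ?thesis .
    qed
    then show "\<exists>d>0. \<forall>p. p tagged_division_of {0..1} \<and> (\<lambda>t. ball t d) fine p \<longrightarrow> nrm A (rsum a p \<ominus> ?\<delta> \<odot> a) < e"
      using d(1) by (intro exI[of _ d]) auto
  qed (use ac in simp)
  moreover have "?\<delta> \<odot> a = (if n = 0 then a else \<zero>)" using ac by simp
  ultimately show ?thesis by simp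
qed

text \<open>The point is the limit case: the averages \<open>J (F n)\<close> are Cauchy by
  contractivity, so \<open>F\<close> is uniformly Cauchy by isometry of \<open>J\<close>, and the
  limit is again a function of \<open>w\<close>.\<close>

lemma CE_exists:
  assumes "a \<in> carrier A"
  shows "\<exists>f. continuous_on circle f \<and> CE a (J f)"
  using assms
proof (induction rule: homogeneous_induct)
  case (homogeneous n a)
  show ?case
  proof (cases "n = 0")
    case True
    then obtain f where "continuous_on circle f" "a = J f" using homogeneous mon_0E by blast
    then show ?thesis using CE_mon[OF homogeneous] True by (intro exI[of _ f]) simp
  next
    case False
    then show ?thesis using CE_mon[OF homogeneous]
      by (intro exI[of _ "\<lambda>z. 0"]) (simp add: fc_const one_closed continuous_on_const)
  qed
next
  case (add a b)
  then obtain f g where "continuous_on circle f" "CE a (J f)" "continuous_on circle g" "CE b (J g)" by blast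
  then show ?case
    using CE_add[of a b "J f" "J g"] add
    by (intro exI[of _ "\<lambda>z. f z + g z"]) (simp add: fc_add continuous_on_add)
next
  case (lim s a)
  have "\<forall>n. \<exists>f. continuous_on circle f \<and> CE (s n) (J f)" using lim by simp
  from choice[OF this] obtain F where F: "\<And>n. continuous_on circle (F n)" "\<And>n. CE (s n) (J (F n))" by auto
  note sc = convD(1,2)[OF lim(1)]
  have dist: "dist (F m z) (F n z) \<le> nrm A (s m \<ominus> a) + nrm A (s n \<ominus> a)" if "z \<in> circle" for m n z
  proof -
    have "dist (F m z) (F n z) \<le> nrm A (J (\<lambda>z. F m z - F n z))"
      unfolding dist_norm using that by (intro J_isometric[where c = z] continuous_intros F)
    also have "\<dots> = nrm A (J (F m) \<ominus> J (F n))" using F by (simp add: fc_minus)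
    also have "\<dots> \<le> nrm A (s m \<ominus> s n)" using F sc by (intro CE_nrm_le CE_minus) auto
    also have "\<dots> \<le> nrm A (s m \<ominus> a) + nrm A (a \<ominus> s n)" using sc by (intro nrm_triangle_diff)
    finally show ?thesis using nrm_minus_commute[OF sc(2) sc(1), of n] by simp
  qed
  have "uniformly_Cauchy_on circle F"
  proof (rule uniformly_Cauchy_onI)
    fix e :: real assume "e > 0"
    then have "\<forall>\<^sub>F n in sequentially. nrm A (s n \<ominus> a) < e / 2"
      by (intro order_tendstoD(2)[OF convD(3)[OF lim(1)]]) simp
    then obtain N where N: "\<And>n. n \<ge> N \<Longrightarrow> nrm A (s n \<ominus> a) < e / 2"
      unfolding eventually_sequentially by blast
    have "dist (F m z) (F n z) < e" if "z \<in> circle" "m \<ge> N" "n \<ge> N" for z m n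
      using dist[OF that(1), of m n] N[OF that(2)] N[OF that(3)] by linarith
    then show "\<exists>M. \<forall>z\<in>circle. \<forall>m\<ge>M. \<forall>n\<ge>M. dist (F m z) (F n z) < e" by blast
  qed
  then obtain f where f: "uniform_limit circle F f sequentially"
    using Cauchy_uniformly_convergent uniformly_convergent_on_def by blast
  have "continuous_on circle f"
    by (rule uniform_limit_theorem[OF _ f]) (use F in auto)
  moreover have "CE a (J f)"
    by (rule CE_lim[OF lim(1) fc_conv[OF unitary_w F(1) f] F(2)])
  ultimately show ?case by blast
qed

definition T :: "'a \<Rightarrow> complex \<Rightarrow> complex" where
  "T a = to_function A w (cond_exp A x w a)"

lemma T_eq:
  assumes a: "a \<in> carrier A" and f: "continuous_on circle f" and ce: "CE a (J f)"
  shows "T a = restrict f circle"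
proof -
  have "cond_exp A x w a = J f"
    unfolding cond_exp_def CE_def[symmetric]
    by (rule the_equality, rule ce) (rule CE_unique[OF a _ ce])
  moreover have "to_function A w (J f) = restrict f circle"
    unfolding to_function_def
  proof (rule the_equality)
    show "restrict f circle \<in> carrier (C_alg circle) \<and> cfc A w (restrict f circle) = J f"
      using restrict_in_C_alg[OF f] f fc_cong[OF unitary_w f, of "restrict f circle"]
        cfc_eq_fc[OF unitary_w spectrum_w, of "restrict f circle"]
      by (simp add: carrier_C_alg)
    fix g assume g: "g \<in> carrier (C_alg circle) \<and> cfc A w g = J f"
    then have gc: "continuous_on circle g" "g \<in> extensional circle" by (auto simp: carrier_C_alg)
    then have "J g = J f" using g cfc_eq_fc[OF unitary_w spectrum_w gc(1)] by simp
    show "g = restrict f circle"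
    proof (rule extensionalityI[OF gc(2)])
      show "g z = restrict f circle z" if "z \<in> circle" for z
        using J_inject[OF gc(1) f \<open>J g = J f\<close> that] that by simp
    qed simp
  qed
  ultimately show ?thesis by (simp add: T_def)
qed

lemma T_props:
  assumes "a \<in> carrier A"
  shows "continuous_on circle (T a)" "CE a (J (T a))"
proof -
  obtain f where f: "continuous_on circle f" "CE a (J f)" using CE_exists[OF assms] by blast
  note T = T_eq[OF assms f]
  show "continuous_on circle (T a)" using restrict_in_C_alg[OF f(1)] by (simp add: T carrier_C_alg)
  show "CE a (J (T a))" using f fc_cong[OF unitary_w f(1), of "restrict f circle"] by (simp add: T)
qed

lemma T_eqD:
  assumes "a \<in> carrier A" "continuous_on circle f" "CE a (J f)" "z \<in> circle"
  shows "T a z = f z"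
  using T_eq[OF assms(1-3)] assms(4) by simp

lemma T_add:
  assumes "a \<in> carrier A" "b \<in> carrier A" "z \<in> circle"
  shows "T (a \<oplus> b) z = T a z + T b z"
  using T_props[OF assms(1)] T_props[OF assms(2)] CE_add[OF assms(1,2)] assms
  by (intro T_eqD) (auto simp: fc_add intro: continuous_on_add)

lemma T_scalar:
  assumes "a \<in> carrier A" "z \<in> circle"
  shows "T (c \<odot> a) z = c * T a z"
  using T_props[OF assms(1)] CE_scalar[OF assms(1)] assms
  by (intro T_eqD) (auto simp: fc_scalar intro: continuous_on_mult_left)

lemma T_bound:
  assumes "a \<in> carrier A" "z \<in> circle"
  shows "cmod (T a z) \<le> nrm A a"
  using J_isometric[OF T_props(1)[OF assms(1)] assms(2)] CE_nrm_le[OF assms(1) T_props(2)[OF assms(1)]]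
  by linarith

lemma T_mon:
  assumes "mon n a" "n \<noteq> 0" "z \<in> circle"
  shows "T a z = 0"
  using CE_mon[OF assms(1)] assms mon_closed
  by (intro T_eqD) (auto simp: fc_const one_closed continuous_on_const)

lemma T_J:
  assumes "continuous_on circle f" "z \<in> circle"
  shows "T (J f) z = f z"
  using CE_mon[OF mon_J[OF assms(1)]] assms by (intro T_eqD) auto

end

section \<open>Traces\<close>

text \<open>Take \<open>h = f / (\<gamma> + r)\<close>, with error
  \<open>f * r / (\<gamma> + r)\<close>. Where \<open>cmod (f z) < e\<close> the error is at most
  \<open>e\<close>. The remaining set is compact, and \<gamma> is bounded away from zero on it, so a
  small \<open>r\<close> works there.\<close>

lemma approx_multiple:
  fixes f :: "complex \<Rightarrow> complex" and \<gamma> :: "complex \<Rightarrow> real"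
  assumes f: "continuous_on circle f" and \<gamma>: "continuous_on circle \<gamma>" "\<And>z. z \<in> circle \<Longrightarrow> 0 \<le> \<gamma> z"
    and zero: "\<And>z. z \<in> circle \<Longrightarrow> \<gamma> z = 0 \<Longrightarrow> f z = 0" and e: "e > 0"
  shows "\<exists>h. continuous_on circle h \<and> (\<forall>z\<in>circle. cmod (f z - h z * of_real (\<gamma> z)) \<le> e)"
proof -
  define K where "K = circle \<inter> (\<lambda>z. cmod (f z)) -` {e..}"
  have "closed K"
    unfolding K_def by (intro continuous_closed_preimage continuous_on_norm f) auto
  then have K: "compact K"
    using compact_Int_closed[of circle K] by (simp add: K_def Int_absorb1 inf.left_idem)
  show ?thesis
  proof (cases "K = {}")
    case True
    then have "cmod (f z) \<le> e" if "z \<in> circle" for z using that unfolding K_def by fastforce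
    then show ?thesis by (intro exI[of _ "\<lambda>z. 0"]) auto
  next
    case False
    have "continuous_on K \<gamma>" by (rule continuous_on_subset[OF \<gamma>(1)]) (simp add: K_def)
    from continuous_attains_inf[OF K False this] obtain k where k: "k \<in> K" "\<And>z. z \<in> K \<Longrightarrow> \<gamma> k \<le> \<gamma> z" by blast
    have kc: "k \<in> circle" and "f k \<noteq> 0" using k(1) e by (auto simp: K_def)
    then have "\<gamma> k \<noteq> 0" using zero by blast
    then have d: "\<gamma> k > 0" using \<gamma>(2)[OF kc] by simp
    obtain M where M: "\<forall>z\<in>circle. cmod (f z) \<le> M" using circle_bound[OF f] by blast
    have M0: "M \<ge> 0" using M kc norm_ge_zero order_trans by blast
    \<comment> \<open>With \<open>M\<close> bounding \<open>f\<close> and \<open>\<gamma> k\<close>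
      the minimum of \<gamma> on \<open>K\<close>, the error on \<open>K\<close> is at most
      \<open>M * r / \<gamma> k\<close>, hence at most \<open>e\<close>; the added 1 covers
      \<open>M = 0\<close>.\<close>
    define r where "r = e * \<gamma> k / (M + 1)"
    have r: "r > 0" using e d M0 by (simp add: r_def)
    have pos: "\<gamma> z + r > 0" if "z \<in> circle" for z using \<gamma>(2)[OF that] r by simp
    define h where "h z = f z / of_real (\<gamma> z + r)" for z
    have "continuous_on circle h"
      unfolding h_def
    proof (intro continuous_intros f \<gamma>(1) ballI)
      show "complex_of_real (\<gamma> z + r) \<noteq> 0" if "z \<in> circle" for z
        using pos[OF that] by (simp only: of_real_eq_0_iff)
    qed
    moreover have "cmod (f z - h z * of_real (\<gamma> z)) \<le> e" if z: "z \<in> circle" for z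
    proof -
      have "f z - h z * \<gamma> z = f z * of_real (r / (\<gamma> z + r))"
        using pos[OF z] by (simp add: h_def divide_simps flip: of_real_add) (simp add: algebra_simps)
      then have eq: "cmod (f z - h z * of_real (\<gamma> z)) = cmod (f z) * (r / (\<gamma> z + r))"
        using pos[OF z] r by (simp only: norm_mult norm_of_real) simp
      show ?thesis
      proof (cases "z \<in> K")
        case True
        have "cmod (f z) * (r / (\<gamma> z + r)) \<le> M * (r / \<gamma> k)"
          using M z k(2)[OF True] d r M0 by (intro mult_mono divide_left_mono) auto
        also have "\<dots> = e * (M / (M + 1))" using d M0 by (simp add: r_def)
        also have "\<dots> \<le> e * 1" using e M0 by (intro mult_left_mono) auto
        finally show ?thesis using eq by simp
      next
        case False
        then have "cmod (f z) \<le> e" using z unfolding K_def by auto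
        moreover have "r / (\<gamma> z + r) \<le> 1" using pos[OF z] \<gamma>(2)[OF z] by simp
        ultimately have "cmod (f z) * (r / (\<gamma> z + r)) \<le> e * 1"
          using e r pos[OF z] by (intro mult_mono) auto
        then show ?thesis using eq by simp
      qed
    qed
    ultimately show ?thesis by blast
  qed
qed

text \<open>Arguments are total functions of which only continuity on the circle is known. That
  values off the circle do not matter follows from the bound with \<open>M = 0\<close>, applied to a
  difference.\<close>

definition bounded_functional :: "((complex \<Rightarrow> complex) \<Rightarrow> complex) \<Rightarrow> bool" where
  "bounded_functional \<sigma> \<longleftrightarrow>
     (\<forall>f g. continuous_on circle f \<longrightarrow> continuous_on circle g \<longrightarrow> \<sigma> (\<lambda>z. f z + g z) = \<sigma> f + \<sigma> g) \<and>
     (\<forall>c f. continuous_on circle f \<longrightarrow> \<sigma> (\<lambda>z. c * f z) = c * \<sigma> f) \<and>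
     (\<exists>C. \<forall>f M. continuous_on circle f \<longrightarrow> (\<forall>z\<in>circle. cmod (f z) \<le> M) \<longrightarrow> cmod (\<sigma> f) \<le> C * M)"

context universal_rotation_algebra
begin

definition invariant :: "((complex \<Rightarrow> complex) \<Rightarrow> complex) \<Rightarrow> bool" where
  "invariant \<sigma> \<longleftrightarrow> (\<forall>f. continuous_on circle f \<longrightarrow> (\<forall>z\<in>circle. \<gamma> z = 0 \<longrightarrow> f z = 0) \<longrightarrow>
     \<sigma> (\<lambda>z. f (q * z)) = \<sigma> f)"

lemma mon_minus_one: "mon (-1) a \<Longrightarrow> \<exists>f. continuous_on circle f \<and> a = J f \<otimes> star A x"
  by (erule mon_cases) (auto simp: l_one)

lemma mon_one: "mon 1 a \<Longrightarrow> \<exists>f. continuous_on circle f \<and> a = J f \<otimes> x"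
  by (erule mon_cases) (auto simp: l_one)

text \<open>\<open>Z\<close> collects the elements that can be exchanged with every factor under the
  functional. It is a closed subspace and closed under products. Closure under adjoints is not
  evident, so \<open>star A x\<close> and \<open>star A w\<close> are checked too, and the final
  induction carries \<open>b\<close> together with \<open>star A b\<close>.\<close>

theorem bounded_tracial_of_invariant:
  assumes \<sigma>: "bounded_functional \<sigma>" and inv: "invariant \<sigma>"
  shows "bounded_tracial_functional A (\<lambda>a. \<sigma> (T a))"
proof -
  have add: "\<sigma> (\<lambda>z. f z + g z) = \<sigma> f + \<sigma> g" if "continuous_on circle f" "continuous_on circle g" for f g
    using \<sigma> that unfolding bounded_functional_def by blast
  have scal: "\<sigma> (\<lambda>z. c * f z) = c * \<sigma> f" if "continuous_on circle f" for c f
    using \<sigma> that unfolding bounded_functional_def by blast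
  obtain C where C: "\<And>f M. \<lbrakk>continuous_on circle f; \<forall>z\<in>circle. cmod (f z) \<le> M\<rbrakk> \<Longrightarrow> cmod (\<sigma> f) \<le> C * M"
    using \<sigma> unfolding bounded_functional_def by blast
  have cong: "\<sigma> f = \<sigma> g" if f: "continuous_on circle f" and fg: "\<And>z. z \<in> circle \<Longrightarrow> f z = g z" for f g
  proof -
    have g: "continuous_on circle g" by (rule continuous_on_eq[OF f fg])
    have "\<sigma> (\<lambda>z. f z + (-1) * g z) = \<sigma> f + (-1) * \<sigma> g"
      using add[OF f continuous_on_mult_left[OF g, of "-1"]] scal[OF g, of "-1"] by simp
    moreover have "cmod (\<sigma> (\<lambda>z. f z + (-1) * g z)) \<le> C * 0"
      by (rule C) (use fg in \<open>auto intro!: continuous_intros f g\<close>)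
    ultimately show ?thesis by simp
  qed
  define \<tau> where "\<tau> a = \<sigma> (T a)" for a
  have \<tau>_add: "\<tau> (a \<oplus> b) = \<tau> a + \<tau> b" if "a \<in> carrier A" "b \<in> carrier A" for a b
    unfolding \<tau>_def add[OF T_props(1)[OF that(1)] T_props(1)[OF that(2)], symmetric]
    using that by (intro cong T_props T_add a_closed)
  have \<tau>_scal: "\<tau> (c \<odot> a) = c * \<tau> a" if "a \<in> carrier A" for a c
    unfolding \<tau>_def scal[OF T_props(1)[OF that], symmetric]
    using that by (intro cong T_props T_scalar scalar_closed)
  have \<tau>_bound: "cmod (\<tau> a) \<le> C * nrm A a" if "a \<in> carrier A" for a
    unfolding \<tau>_def using T_bound[OF that] by (intro C T_props that ballI)
  have \<tau>_J: "\<tau> (J f) = \<sigma> f" if "continuous_on circle f" for f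
    unfolding \<tau>_def using that by (intro cong T_props T_J) auto
  have \<tau>_mon: "\<tau> a = 0" if "mon n a" "n \<noteq> 0" for n a
  proof -
    have "\<tau> a = \<sigma> (\<lambda>z. 0 * 0)"
      unfolding \<tau>_def using T_mon[OF that] mon_closed[OF that(1)] by (intro cong T_props) auto
    also have "\<dots> = 0" using scal[of "\<lambda>z. 0" 0] by (simp add: continuous_on_const)
    finally show ?thesis .
  qed
  have \<tau>_conv: "(\<lambda>n. \<tau> (s n)) \<longlonglongrightarrow> \<tau> a" if s: "conv s a" for s a
  proof -
    note sc = convD(1,2)[OF s]
    have "norm (\<tau> (s n) - \<tau> a) \<le> C * nrm A (s n \<ominus> a)" for n
    proof -
      have "\<tau> (s n) - \<tau> a = \<tau> (s n \<ominus> a)" using sc by (simp add: minus_eq_scalar \<tau>_add \<tau>_scal)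
      then show ?thesis using \<tau>_bound[of "s n \<ominus> a"] sc by simp
    qed
    moreover have "(\<lambda>n. C * nrm A (s n \<ominus> a)) \<longlonglongrightarrow> 0"
      using tendsto_mult[OF tendsto_const convD(3)[OF s], of C] by simp
    ultimately have "(\<lambda>n. \<tau> (s n) - \<tau> a) \<longlonglongrightarrow> 0"
      by (rule Lim_null_comparison[OF always_eventually, OF allI])
    then show ?thesis by (rule LIM_zero_cancel)
  qed
  define Z where "Z b \<longleftrightarrow> (\<forall>a\<in>carrier A. \<tau> (a \<otimes> b) = \<tau> (b \<otimes> a))" for b
  \<comment> \<open>For \<open>b\<close> of degree \<open>m\<close>, both products have non-zero
    degree unless \<open>a\<close> has degree \<open>- m\<close>, and \<tau> vanishes on them; one
    degree of \<open>a\<close> remains.\<close>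
  have ZI: "Z b" if b: "mon m b" and *: "\<And>a. mon (- m) a \<Longrightarrow> \<tau> (a \<otimes> b) = \<tau> (b \<otimes> a)" for m b
    unfolding Z_def
  proof
    note bc = mon_closed[OF b]
    fix a assume "a \<in> carrier A"
    then show "\<tau> (a \<otimes> b) = \<tau> (b \<otimes> a)"
    proof (induction rule: homogeneous_induct)
      case (homogeneous n a)
      show ?case
      proof (cases "n = - m")
        case False
        then have "n + m \<noteq> 0" "m + n \<noteq> 0" by auto
        then show ?thesis
          using \<tau>_mon[OF mon_mult[OF homogeneous b]] \<tau>_mon[OF mon_mult[OF b homogeneous]] by simp
      qed (use * homogeneous in simp)
    next
      case (add a a')
      then show ?case using bc by (simp add: l_distr r_distr \<tau>_add m_closed)
    next
      case (lim s a)
      note l = \<tau>_conv[OF conv_mult[OF lim(1) conv_const[OF bc]]]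
        and r = \<tau>_conv[OF conv_mult[OF conv_const[OF bc] lim(1)]]
      show ?case using LIMSEQ_unique[OF l] r lim(2) by simp
    qed
  qed
  \<comment> \<open>A multiple of \<gamma> vanishes where \<gamma> does, so the invariance
    hypothesis applies to it.\<close>
  have inv': "\<sigma> (\<lambda>z. f (q * z) * of_real (\<gamma> (q * z))) = \<sigma> (\<lambda>z. f z * of_real (\<gamma> z))"
    if f: "continuous_on circle f" for f
    using inv continuous_on_mult[OF f gamma_cont'] unfolding invariant_def by auto
  have Zx: "Z x"
  proof (rule ZI[OF mon_gen(1)])
    fix a assume "mon (- 1) a"
    then obtain f where f: "continuous_on circle f" "a = J f \<otimes> star A x" using mon_minus_one by blast
    have fq: "continuous_on circle (\<lambda>z. f (q * z))" by (rule continuous_on_rotate[OF norm_q f(1)])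
    have "a \<otimes> x = J (\<lambda>z. f z * of_real (\<gamma> z))"
      using f gamma_cont' by (simp add: m_assoc star_x_x fc_mult)
    moreover have "x \<otimes> a = J (\<lambda>z. f (q * z) * of_real (\<gamma> (q * z)))"
    proof -
      have "x \<otimes> a = (x \<otimes> J f) \<otimes> star A x" using f by (simp add: m_assoc)
      then show ?thesis
        using f(1) fq gamma_rot_cont by (simp add: x_J m_assoc x_star_x fc_mult)
    qed
    ultimately show "\<tau> (a \<otimes> x) = \<tau> (x \<otimes> a)"
      using inv'[OF f(1)] f(1) fq gamma_cont' gamma_rot_cont by (simp add: \<tau>_J continuous_on_mult)
  qed
  have Zsx: "Z (star A x)"
  proof (rule ZI[OF mon_star[OF mon_gen(1)]])
    fix a assume "mon (- (- 1)) a"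
    then obtain f where f: "continuous_on circle f" "a = J f \<otimes> x" using mon_one by auto
    let ?g = "\<lambda>z. f (cnj q * z)"
    have g: "continuous_on circle ?g" by (rule continuous_on_rotate[OF _ f(1)]) simp
    have "a \<otimes> star A x = J (\<lambda>z. f z * of_real (\<gamma> (q * z)))"
      using f gamma_rot_cont by (simp add: m_assoc x_star_x fc_mult)
    moreover have "star A x \<otimes> a = J (\<lambda>z. ?g z * of_real (\<gamma> z))"
    proof -
      have "star A x \<otimes> a = (star A x \<otimes> J f) \<otimes> x" using f by (simp add: m_assoc)
      then show ?thesis
        using f(1) g gamma_cont' by (simp add: star_x_J m_assoc star_x_x fc_mult)
    qed
    ultimately show "\<tau> (a \<otimes> star A x) = \<tau> (star A x \<otimes> a)"
      using inv'[OF g] f(1) g gamma_cont' gamma_rot_cont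
      by (simp add: \<tau>_J continuous_on_mult q_inverse)
  qed
  have ZJ: "Z (J g)" if g: "continuous_on circle g" for g
  proof (rule ZI[OF mon_J[OF g]])
    fix a assume "mon (- 0) a"
    then obtain f where f: "continuous_on circle f" "a = J f" using mon_0E by auto
    then show "\<tau> (a \<otimes> J g) = \<tau> (J g \<otimes> a)"
      using g fc_mult[OF unitary_w f(1) g] fc_mult[OF unitary_w g f(1)] by (simp add: mult.commute)
  qed
  have Zw: "Z w" "Z (star A w)"
    using ZJ[of "\<lambda>z. z"] ZJ[of "\<lambda>z. cnj z"] fc_star[OF unitary_w, of "\<lambda>z. z"]
    by (simp_all add: fc_ident continuous_on_id continuous_on_cnj)
  \<comment> \<open>By cyclic rotation: \<open>c\<close> is brought to the front as a single factor,
    then \<open>b\<close>.\<close>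
  have Zmult: "Z (b \<otimes> c)" if "b \<in> carrier A" "c \<in> carrier A" "Z b" "Z c" for b c
    unfolding Z_def
  proof
    fix a assume a: "a \<in> carrier A"
    have "\<tau> (a \<otimes> (b \<otimes> c)) = \<tau> ((a \<otimes> b) \<otimes> c)" using a that by (simp add: m_assoc)
    also have "\<dots> = \<tau> (c \<otimes> (a \<otimes> b))" by (rule that(4)[unfolded Z_def, rule_format, OF m_closed[OF a that(1)]])
    also have "\<dots> = \<tau> ((c \<otimes> a) \<otimes> b)" using a that by (simp add: m_assoc)
    also have "\<dots> = \<tau> (b \<otimes> (c \<otimes> a))" by (rule that(3)[unfolded Z_def, rule_format, OF m_closed[OF that(2) a]])
    finally show "\<tau> (a \<otimes> (b \<otimes> c)) = \<tau> ((b \<otimes> c) \<otimes> a)" using a that by (simp add: m_assoc)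
  qed
  have Zadd: "Z (b \<oplus> c)" if "b \<in> carrier A" "c \<in> carrier A" "Z b" "Z c" for b c
    using that unfolding Z_def by (simp add: l_distr r_distr \<tau>_add m_closed)
  have Zscal: "Z (d \<odot> b)" if "b \<in> carrier A" "Z b" for b d
    using that unfolding Z_def by (simp add: mult_smult_left mult_smult_right \<tau>_scal m_closed)
  have Zlim: "Z b" if s: "conv s b" and Zs: "\<And>n. Z (s n)" for s b
    unfolding Z_def
  proof
    fix a assume a: "a \<in> carrier A"
    note l = \<tau>_conv[OF conv_mult[OF conv_const[OF a] s]]
      and r = \<tau>_conv[OF conv_mult[OF s conv_const[OF a]]]
    have "\<tau> (a \<otimes> s n) = \<tau> (s n \<otimes> a)" for n using Zs a unfolding Z_def by simp
    then show "\<tau> (a \<otimes> b) = \<tau> (b \<otimes> a)" using LIMSEQ_unique[OF l] r by simp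
  qed
  have xw: "{x, w} \<subseteq> carrier A" by simp
  have "Z b \<and> Z (star A b)" if "b \<in> carrier A" for b
    using generated xw that
  proof (induction rule: cstar_generated_induct)
    case one
    then show ?case using ZJ[of "\<lambda>z. 1"] by (simp add: fc_one continuous_on_const)
  next
    case (lim s b)
    have "\<And>n. Z (s n)" "\<And>n. Z (star A (s n))" using lim(2) by simp_all
    then show ?case using Zlim[OF lim(1)] Zlim[OF conv_star[OF lim(1)]] by simp
  qed (use Zx Zsx Zw Zmult Zadd Zscal in \<open>auto simp: star_mult star_add star_smult\<close>)
  then have tr: "\<tau> (a \<otimes> b) = \<tau> (b \<otimes> a)" if "a \<in> carrier A" "b \<in> carrier A" for a b
    using that unfolding Z_def by blast
  have "bounded_tracial_functional A \<tau>"
    unfolding bounded_tracial_functional_def using \<tau>_add \<tau>_scal \<tau>_bound tr by blast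
  then show ?thesis by (simp add: \<tau>_def[abs_def])
qed

lemma mon_w:
  assumes "mon n a"
  shows "\<exists>c. a \<otimes> w = c \<odot> (w \<otimes> a) \<and> (n \<noteq> 0 \<longrightarrow> c \<noteq> 1)"
proof -
  have xk: "x [^] k \<otimes> w = q ^ k \<odot> (w \<otimes> x [^] k)" for k :: nat
  proof (induction k)
    case (Suc k)
    have "x [^] Suc k \<otimes> w = x [^] k \<otimes> (x \<otimes> w)" by (simp add: m_assoc)
    also have "\<dots> = q \<odot> (x [^] k \<otimes> w \<otimes> x)" by (simp add: x_w mult_smult_right m_assoc m_closed)
    also have "\<dots> = q ^ Suc k \<odot> (w \<otimes> x [^] Suc k)"
      by (simp add: Suc mult_smult_left scalar_mult m_assoc m_closed)
    finally show ?case .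
  qed (simp add: l_one r_one)
  have sxw: "star A x \<otimes> w = cnj q \<odot> (w \<otimes> star A x)"
    using star_x_J[of "\<lambda>z. z"] fc_scalar[OF unitary_w continuous_on_id, of "cnj q"]
    by (simp add: fc_ident continuous_on_id mult_smult_left)
  have sxk: "star A x [^] k \<otimes> w = cnj q ^ k \<odot> (w \<otimes> star A x [^] k)" for k :: nat
  proof (induction k)
    case (Suc k)
    have "star A x [^] Suc k \<otimes> w = star A x [^] k \<otimes> (star A x \<otimes> w)" by (simp add: m_assoc)
    also have "\<dots> = cnj q \<odot> (star A x [^] k \<otimes> w \<otimes> star A x)" by (simp add: sxw mult_smult_right m_assoc m_closed)
    also have "\<dots> = cnj q ^ Suc k \<odot> (w \<otimes> star A x [^] Suc k)"
      by (simp add: Suc mult_smult_left scalar_mult m_assoc m_closed)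
    finally show ?case .
  qed (simp add: l_one r_one)
  have wJ: "w \<otimes> J f = J f \<otimes> w" if "continuous_on circle f" for f
    using fc_mult[OF unitary_w that continuous_on_id] fc_mult[OF unitary_w continuous_on_id that]
    by (simp add: fc_ident mult.commute)
  \<comment> \<open>Otherwise \<open>\<theta> * real k\<close> would be an integer.\<close>
  have q1: "q ^ k \<noteq> 1" if "k > 0" for k
  proof
    assume "q ^ k = 1"
    then have "cis (real k * (- 2 * pi * \<theta>)) = 1" unfolding q_def rot_cis Complex.DeMoivre .
    then have "exp (\<i> * of_real (real k * (- 2 * pi * \<theta>))) = 1" by (simp only: cis_conv_exp)
    then obtain n :: int where "real k * (- 2 * pi * \<theta>) = of_int (2 * n) * pi"
      unfolding exp_eq_1 by auto
    then have "pi * (- (\<theta> * real k)) = pi * of_int n" by (simp add: algebra_simps)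
    then have "- (\<theta> * real k) = of_int n" by (simp only: mult_cancel_left) simp
    then have "\<theta> = - of_int n / of_nat k" using that by (simp add: field_simps)
    then have "\<theta> \<in> \<rat>" by simp
    then show False using irrational by blast
  qed
  from assms show ?thesis
  proof (cases rule: mon_cases)
    case (1 f k)
    have "a \<otimes> w = q ^ k \<odot> (w \<otimes> a)"
      using 1 by (simp add: m_assoc xk mult_smult_right wJ flip: m_assoc[of w])
    then show ?thesis using q1[of k] 1 by auto
  next
    case (2 f k)
    define y where "y = star A x [^] Suc k"
    have y: "y \<in> carrier A" "y \<otimes> w = cnj q ^ Suc k \<odot> (w \<otimes> y)"
      unfolding y_def by (rule nat_pow_closed', simp) (rule sxk)
    have a: "a = J f \<otimes> y" using 2(3) by (simp only: y_def)
    have "a \<otimes> w = cnj q ^ Suc k \<odot> (J f \<otimes> (w \<otimes> y))"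
      unfolding a using 2(1) y by (simp add: m_assoc mult_smult_right m_closed del: power_Suc)
    also have "J f \<otimes> (w \<otimes> y) = w \<otimes> a"
      unfolding a using 2(1) y(1) wJ[OF 2(1)] by (simp flip: m_assoc)
    finally have eq: "a \<otimes> w = cnj q ^ Suc k \<odot> (w \<otimes> a)" .
    have "cnj (q ^ Suc k) \<noteq> 1"
      using q1[of "Suc k"] by (simp only: complex_cnj_one_iff) simp
    then have "cnj q ^ Suc k \<noteq> 1" by (simp only: complex_cnj_power not_False_eq_True)
    with eq show ?thesis by (intro exI[of _ "cnj q ^ Suc k"] conjI impI)
  qed
qed

theorem bounded_tracial_factor:
  assumes \<psi>: "bounded_tracial_functional A \<psi>"
  defines "\<sigma> \<equiv> \<lambda>f. \<psi> (J f)"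
  shows "bounded_functional \<sigma>" "invariant \<sigma>" "\<And>a. a \<in> carrier A \<Longrightarrow> \<psi> a = \<sigma> (T a)"
proof -
  have add: "\<psi> (a \<oplus> b) = \<psi> a + \<psi> b" if "a \<in> carrier A" "b \<in> carrier A" for a b
    using \<psi> that unfolding bounded_tracial_functional_def by blast
  have scal: "\<psi> (c \<odot> a) = c * \<psi> a" if "a \<in> carrier A" for a c
    using \<psi> that unfolding bounded_tracial_functional_def by blast
  have tr: "\<psi> (a \<otimes> b) = \<psi> (b \<otimes> a)" if "a \<in> carrier A" "b \<in> carrier A" for a b
    using \<psi> that unfolding bounded_tracial_functional_def by blast
  obtain C0 where C0: "\<And>a. a \<in> carrier A \<Longrightarrow> cmod (\<psi> a) \<le> C0 * nrm A a"
    using \<psi> unfolding bounded_tracial_functional_def by blast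
  define C where "C = max C0 0"
  have C: "C \<ge> 0" "\<And>a. a \<in> carrier A \<Longrightarrow> cmod (\<psi> a) \<le> C * nrm A a"
  proof -
    fix a assume a: "a \<in> carrier A"
    have "C0 * nrm A a \<le> C * nrm A a"
      using nrm_nonneg[OF a] by (intro mult_right_mono) (auto simp: C_def)
    then show "cmod (\<psi> a) \<le> C * nrm A a" using C0[OF a] by simp
  qed (simp add: C_def)
  have bound: "cmod (\<sigma> f) \<le> C * M" if "continuous_on circle f" "\<And>z. z \<in> circle \<Longrightarrow> cmod (f z) \<le> M" for f M
  proof -
    have "cmod (\<sigma> f) \<le> C * nrm A (J f)" unfolding \<sigma>_def using that by (intro C) auto
    also have "\<dots> \<le> C * M" using that C by (intro mult_left_mono fc_nrm_le) auto
    finally show ?thesis .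
  qed
  have \<sigma>_add: "\<sigma> (\<lambda>z. f z + g z) = \<sigma> f + \<sigma> g" if "continuous_on circle f" "continuous_on circle g" for f g
    unfolding \<sigma>_def using that by (simp add: fc_add add)
  have \<sigma>_scal: "\<sigma> (\<lambda>z. c * f z) = c * \<sigma> f" if "continuous_on circle f" for c f
    unfolding \<sigma>_def using that by (simp add: fc_scalar scal)
  show "bounded_functional \<sigma>"
    unfolding bounded_functional_def
  proof (intro conjI allI impI exI[of _ C])
    show "cmod (\<sigma> f) \<le> C * M" if "continuous_on circle f" "\<forall>z\<in>circle. cmod (f z) \<le> M" for f M
      using that by (intro bound) auto
  qed (use \<sigma>_add \<sigma>_scal in auto)
  have conv: "(\<lambda>n. \<psi> (s n)) \<longlonglongrightarrow> \<psi> a" if s: "conv s a" for s a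
  proof -
    note sc = convD(1,2)[OF s]
    have "norm (\<psi> (s n) - \<psi> a) \<le> C * nrm A (s n \<ominus> a)" for n
    proof -
      have "\<psi> (s n) - \<psi> a = \<psi> (s n \<ominus> a)" using sc by (simp add: minus_eq_scalar add scal)
      then show ?thesis using C(2)[of "s n \<ominus> a"] sc by simp
    qed
    moreover have "(\<lambda>n. C * nrm A (s n \<ominus> a)) \<longlonglongrightarrow> 0"
      using tendsto_mult[OF tendsto_const convD(3)[OF s], of C] by simp
    ultimately have "(\<lambda>n. \<psi> (s n) - \<psi> a) \<longlonglongrightarrow> 0"
      by (rule Lim_null_comparison[OF always_eventually, OF allI])
    then show ?thesis by (rule LIM_zero_cancel)
  qed
  have zero: "\<psi> \<zero> = 0" using scal[OF zero_closed, of 0] by simp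
  have mon0: "\<psi> a = 0" if a: "mon n a" "n \<noteq> 0" for n a
  proof -
    note ac = mon_closed[OF a(1)] and wc = unitaryD[OF unitary_w]
    obtain c where c: "a \<otimes> w = c \<odot> (w \<otimes> a)" "c \<noteq> 1" using mon_w[OF a(1)] a(2) by blast
    have "a = (a \<otimes> w) \<otimes> star A w" using ac wc by (simp add: m_assoc r_one)
    then have "\<psi> a = \<psi> (c \<odot> ((w \<otimes> a) \<otimes> star A w))"
      using ac by (simp add: c(1) mult_smult_left m_closed)
    also have "\<dots> = c * \<psi> (star A w \<otimes> (w \<otimes> a))"
      using ac by (simp add: scal m_closed tr[of "w \<otimes> a" "star A w"])
    also have "star A w \<otimes> (w \<otimes> a) = a" using ac wc by (simp add: l_one flip: m_assoc)
    finally have "(1 - c) * \<psi> a = 0" by (simp add: algebra_simps)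
    then show ?thesis using c(2) by simp
  qed
  show "\<psi> a = \<sigma> (T a)" if "a \<in> carrier A" for a
    unfolding \<sigma>_def using that
  proof (induction rule: homogeneous_induct)
    case (homogeneous n a)
    note ac = mon_closed[OF homogeneous]
    have "J (T a) = (if n = 0 then a else \<zero>)"
      by (rule CE_unique[OF ac T_props(2)[OF ac] CE_mon[OF homogeneous]])
    then show ?case using mon0[OF homogeneous] zero by simp
  next
    case (add a b)
    have "J (T (a \<oplus> b)) = J (T a) \<oplus> J (T b)"
      using add T_props by (intro CE_unique[of "a \<oplus> b"] CE_add) (auto simp: a_closed)
    then show ?case using add T_props(1) by (simp add: \<open>\<And>a b. \<lbrakk>a \<in> carrier A; b \<in> carrier A\<rbrakk> \<Longrightarrow> \<psi> (a \<oplus> b) = \<psi> a + \<psi> b\<close>)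
  next
    case (lim s a)
    note sc = convD(1,2)[OF lim(1)]
    \<comment> \<open>As \<open>J (T a)\<close> is the average of \<open>a\<close>, it depends
      contractively on \<open>a\<close>.\<close>
    have "conv (\<lambda>n. J (T (s n))) (J (T a))"
      by (rule convI_bound[OF _ _ _ convD(3)[OF lim(1)]])
        (use sc T_props in \<open>auto intro!: CE_nrm_le CE_minus\<close>)
    from conv[OF this] conv[OF lim(1)] lim(2) show ?case using LIMSEQ_unique by simp
  qed
  \<comment> \<open>Traciality for the factors \<open>J h \<otimes> star A x\<close> and
    \<open>x\<close>: one order of the product gives \<open>h\<close> times \<gamma>, the other
    order its rotation.\<close>
  have inv_mult: "\<sigma> (\<lambda>z. h (q * z) * of_real (\<gamma> (q * z))) = \<sigma> (\<lambda>z. h z * of_real (\<gamma> z))"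
    if h: "continuous_on circle h" for h
  proof -
    have hq: "continuous_on circle (\<lambda>z. h (q * z))" by (rule continuous_on_rotate[OF norm_q h])
    have "\<sigma> (\<lambda>z. h z * of_real (\<gamma> z)) = \<psi> ((J h \<otimes> star A x) \<otimes> x)"
      unfolding \<sigma>_def using h gamma_cont' by (simp add: fc_mult m_assoc star_x_x)
    also have "\<dots> = \<psi> (x \<otimes> (J h \<otimes> star A x))" using h by (intro tr) (auto intro: m_closed)
    also have "x \<otimes> (J h \<otimes> star A x) = (x \<otimes> J h) \<otimes> star A x" using h by (simp add: m_assoc)
    also have "\<dots> = J (\<lambda>z. h (q * z) * of_real (\<gamma> (q * z)))"
      using h hq gamma_rot_cont by (simp add: x_J m_assoc x_star_x fc_mult)
    finally show ?thesis unfolding \<sigma>_def by simp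
  qed
  show "invariant \<sigma>"
    unfolding invariant_def
  proof (intro allI impI)
    fix f :: "complex \<Rightarrow> complex"
    assume f: "continuous_on circle f" and z0: "\<forall>z\<in>circle. \<gamma> z = 0 \<longrightarrow> f z = 0"
    have fq: "continuous_on circle (\<lambda>z. f (q * z))" by (rule continuous_on_rotate[OF norm_q f])
    have "cmod (\<sigma> (\<lambda>z. f (q * z)) - \<sigma> f) \<le> 0 + e" if "e > 0" for e
    proof -
      \<comment> \<open>Approximating \<open>f\<close> by a multiple of \<gamma> leaves one error at
        \<open>f\<close> and one at its rotation, each at most \<open>C\<close> times the uniform
        distance; the added 1 covers \<open>C = 0\<close>.\<close>
      have "e / (2 * C + 1) > 0" using that C by simp
      from approx_multiple[OF f gamma_cont gamma_nonneg _ this] z0 obtain h where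
        h: "continuous_on circle h" "\<forall>z\<in>circle. cmod (f z - h z * of_real (\<gamma> z)) \<le> e / (2 * C + 1)" by blast
      let ?d = "\<lambda>z. f z + (-1) * (h z * of_real (\<gamma> z))"
      have hg: "continuous_on circle (\<lambda>z. h z * of_real (\<gamma> z))" by (rule continuous_on_mult[OF h(1) gamma_cont'])
      have d: "continuous_on circle ?d" by (intro continuous_on_add continuous_on_mult_left f hg)
      have dq: "continuous_on circle (\<lambda>z. ?d (q * z))" by (rule continuous_on_rotate[OF norm_q d])
      have hgq: "continuous_on circle (\<lambda>z. h (q * z) * of_real (\<gamma> (q * z)))"
        by (rule continuous_on_rotate[OF norm_q hg])
      have "\<sigma> ?d = \<sigma> f - \<sigma> (\<lambda>z. h z * of_real (\<gamma> z))"
        using \<sigma>_add[OF f continuous_on_mult_left[OF hg, of "-1"]] \<sigma>_scal[OF hg, of "-1"] by simp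
      moreover have "\<sigma> (\<lambda>z. ?d (q * z)) = \<sigma> (\<lambda>z. f (q * z)) - \<sigma> (\<lambda>z. h z * of_real (\<gamma> z))"
        using \<sigma>_add[OF fq continuous_on_mult_left[OF hgq, of "-1"]] \<sigma>_scal[OF hgq, of "-1"] inv_mult[OF h(1)]
        by simp
      ultimately have "cmod (\<sigma> (\<lambda>z. f (q * z)) - \<sigma> f) \<le> cmod (\<sigma> (\<lambda>z. ?d (q * z))) + cmod (\<sigma> ?d)"
        using norm_triangle_ineq4[of "\<sigma> (\<lambda>z. ?d (q * z))" "\<sigma> ?d"] by simp
      also have "\<dots> \<le> C * (e / (2 * C + 1)) + C * (e / (2 * C + 1))"
        using h(2) by (intro add_mono bound d dq) (auto simp: norm_mult)
      also have "\<dots> = 2 * C * (e / (2 * C + 1))" by simp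
      also have "\<dots> \<le> (2 * C + 1) * (e / (2 * C + 1))"
        using that C(1) by (intro mult_right_mono) auto
      also have "\<dots> = e" using C(1) by simp
      finally show ?thesis by simp
    qed
    then have "cmod (\<sigma> (\<lambda>z. f (q * z)) - \<sigma> f) \<le> 0" by (rule field_le_epsilon)
    then show "\<sigma> (\<lambda>z. f (q * z)) = \<sigma> f" by simp
  qed
qed

end

section \<open>Measures on the circle\<close>

definition signed_measure :: "'s measure \<Rightarrow> ('s set \<Rightarrow> real) \<Rightarrow> bool" where
  "signed_measure M \<nu> \<longleftrightarrow>
     (\<forall>F :: nat \<Rightarrow> 's set. range F \<subseteq> sets M \<and> disjoint_family F \<longrightarrow>
        (\<lambda>n. \<nu> (F n)) sums \<nu> (\<Union>n. F n))"

lemma signed_measureD: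
  "signed_measure M \<nu> \<Longrightarrow> (\<And>n. F n \<in> sets M) \<Longrightarrow> disjoint_family F \<Longrightarrow> (\<lambda>n. \<nu> (F n)) sums \<nu> (\<Union>n. F n)"
  unfolding signed_measure_def by blast

lemma signed_measure_uminus: "signed_measure M \<nu> \<Longrightarrow> signed_measure M (\<lambda>E. - \<nu> E)"
  unfolding signed_measure_def by (auto intro: sums_minus)

lemma signed_measure_empty:
  assumes "signed_measure M \<nu>"
  shows "\<nu> {} = 0"
proof -
  have "(\<lambda>n. \<nu> {}) sums \<nu> (\<Union>n::nat. {})"
    by (rule signed_measureD[OF assms]) (auto simp: disjoint_family_on_def)
  then have "summable (\<lambda>n::nat. \<nu> {})" by (rule sums_summable)
  then show ?thesis by (simp add: summable_const_iff)
qed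

lemma signed_measure_union:
  assumes \<nu>: "signed_measure M \<nu>" and A: "A \<in> sets M" and B: "B \<in> sets M" and "A \<inter> B = {}"
  shows "\<nu> (A \<union> B) = \<nu> A + \<nu> B"
proof -
  have "(\<lambda>n. \<nu> (binaryset A B n)) sums \<nu> (\<Union>n. binaryset A B n)"
  proof (rule signed_measureD[OF \<nu>])
    show "binaryset A B n \<in> sets M" for n using A B by (simp add: binaryset_def)
    show "disjoint_family (binaryset A B)"
      using assms(4) by (auto simp: disjoint_family_on_def binaryset_def)
  qed
  moreover have "(\<lambda>n. \<nu> (binaryset A B n)) sums (\<Sum>n\<in>{0, 1}. \<nu> (binaryset A B n))"
    by (rule sums_finite) (auto simp: binaryset_def signed_measure_empty[OF \<nu>])
  ultimately have "\<nu> (\<Union>n. binaryset A B n) = (\<Sum>n\<in>{0, 1}. \<nu> (binaryset A B n))"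
    by (rule sums_unique2)
  then show ?thesis by (simp add: UN_binaryset_eq) (simp add: binaryset_def)
qed

lemma signed_measure_diff:
  assumes "signed_measure M \<nu>" "A \<in> sets M" "B \<in> sets M" "B \<subseteq> A"
  shows "\<nu> (A - B) = \<nu> A - \<nu> B"
  using signed_measure_union[OF assms(1,3), of "A - B"] assms by (simp add: Un_absorb1)

text \<open>If \<open>\<nu>\<close> is unbounded on the subsets of \<open>E\<close>, split off a subset \<open>B\<close> with \<open>\<bar>\<nu> B\<bar> \<ge> \<bar>\<nu> E\<bar> + 1\<close>: both
  \<open>B\<close> and its complement have values of modulus at least one, and \<open>\<nu>\<close> is unbounded on one of them.
  Iteration yields disjoint sets whose values do not tend to zero.\<close>

lemma signed_measure_bounded:
  assumes \<nu>: "signed_measure M \<nu>"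
  shows "\<exists>K. \<forall>E\<in>sets M. \<bar>\<nu> E\<bar> \<le> K"
proof (rule ccontr)
  define bad where "bad E \<longleftrightarrow> E \<in> sets M \<and> (\<forall>K. \<exists>B\<in>sets M. B \<subseteq> E \<and> \<bar>\<nu> B\<bar> > K)" for E
  assume "\<not> ?thesis"
  then have "bad (space M)" unfolding bad_def
    by (simp add: not_le) (meson sets.sets_into_space)
  have split: "\<exists>E'. bad E' \<and> E' \<subseteq> E \<and> \<bar>\<nu> (E - E')\<bar> \<ge> 1" if badE: "bad E" for E
  proof -
    have E: "E \<in> sets M" using badE by (simp add: bad_def)
    obtain B where B: "B \<in> sets M" "B \<subseteq> E" "\<bar>\<nu> B\<bar> > \<bar>\<nu> E\<bar> + 1"
      using badE[unfolded bad_def, THEN conjunct2, rule_format, of "\<bar>\<nu> E\<bar> + 1"] by blast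
    have EB: "\<nu> (E - B) = \<nu> E - \<nu> B" by (rule signed_measure_diff[OF \<nu> E B(1,2)])
    have "bad B \<or> bad (E - B)"
    proof (rule ccontr)
      assume "\<not> (bad B \<or> bad (E - B))"
      then have nb: "\<not> bad B" "\<not> bad (E - B)" by auto
      have ex: "\<exists>K. \<forall>C\<in>sets M. C \<subseteq> S \<longrightarrow> \<bar>\<nu> C\<bar> \<le> K" if "\<not> bad S" "S \<in> sets M" for S
        using that by (simp add: bad_def not_less)
      obtain K where K: "\<forall>C\<in>sets M. C \<subseteq> B \<longrightarrow> \<bar>\<nu> C\<bar> \<le> K"
        using ex[OF nb(1) B(1)] ..
      obtain K' where K': "\<forall>C\<in>sets M. C \<subseteq> E - B \<longrightarrow> \<bar>\<nu> C\<bar> \<le> K'"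
        using ex[OF nb(2) sets.Diff[OF E B(1)]] ..
      obtain C where C: "C \<in> sets M" "C \<subseteq> E" "\<bar>\<nu> C\<bar> > K + K'"
        using badE[unfolded bad_def, THEN conjunct2, rule_format, of "K + K'"] by blast
      have "\<nu> ((C \<inter> B) \<union> (C - B)) = \<nu> (C \<inter> B) + \<nu> (C - B)"
        using B C by (intro signed_measure_union[OF \<nu>]) auto
      then have "\<nu> C = \<nu> (C \<inter> B) + \<nu> (C - B)" by (simp add: Int_Diff_Un)
      moreover have "\<bar>\<nu> (C \<inter> B)\<bar> \<le> K" using B C by (intro K[rule_format]) auto
      moreover have "\<bar>\<nu> (C - B)\<bar> \<le> K'" using B C by (intro K'[rule_format]) auto
      ultimately show False using C(3) by linarith
    qed
    then show ?thesis
    proof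
      assume "bad B"
      then show ?thesis using B EB by (intro exI[of _ B]) auto
    next
      assume b: "bad (E - B)"
      have "E - (E - B) = B" using B(2) by blast
      then show ?thesis using b B by (intro exI[of _ "E - B"]) auto
    qed
  qed
  define next_set where "next_set E = (SOME E'. bad E' \<and> E' \<subseteq> E \<and> \<bar>\<nu> (E - E')\<bar> \<ge> 1)" for E
  define E where "E n = (next_set ^^ n) (space M)" for n
  have nx: "bad (next_set S) \<and> next_set S \<subseteq> S \<and> \<bar>\<nu> (S - next_set S)\<bar> \<ge> 1" if "bad S" for S
    unfolding next_set_def by (rule someI_ex[OF split[OF that]])
  have E_bad: "bad (E n)" for n
    by (induction n) (use \<open>bad (space M)\<close> nx in \<open>auto simp: E_def\<close>)
  have E_step: "E (Suc n) \<subseteq> E n" "\<bar>\<nu> (E n - E (Suc n))\<bar> \<ge> 1" for n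
    using nx[OF E_bad[of n]] by (auto simp: E_def)
  have dec: "decseq E" by (rule decseq_SucI) (rule E_step)
  have "(\<lambda>n. \<nu> (E n - E (Suc n))) sums \<nu> (\<Union>n. E n - E (Suc n))"
  proof (rule signed_measureD[OF \<nu>])
    show "E n - E (Suc n) \<in> sets M" for n using E_bad by (auto simp: bad_def)
    have "(E m - E (Suc m)) \<inter> (E n - E (Suc n)) = {}" if "m < n" for m n
      using decseqD[OF dec, of "Suc m" n] that by auto
    then show "disjoint_family (\<lambda>n. E n - E (Suc n))"
      unfolding disjoint_family_on_def by (metis Int_commute linorder_neqE_nat)
  qed
  then have "(\<lambda>n. \<nu> (E n - E (Suc n))) \<longlonglongrightarrow> 0" by (intro summable_LIMSEQ_zero sums_summable)
  then have "\<forall>\<^sub>F n in sequentially. \<bar>\<nu> (E n - E (Suc n))\<bar> < 1"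
    by (intro order_tendstoD(2)[OF tendsto_rabs]) auto
  then show False using E_step(2) by (auto simp: eventually_sequentially not_less dest: leD)
qed

lemma ennreal_add_le: "ennreal (a + b) \<le> ennreal a + ennreal b"
proof -
  have "ennreal (a + b) \<le> ennreal (max 0 a + max 0 b)" by (rule ennreal_leI) auto
  also have "\<dots> = ennreal a + ennreal b" by (simp add: ennreal_plus)
  finally show ?thesis .
qed

text \<open>\<open>measure_of\<close> returns the supremum only if it is countably additive.
  Monotonicity and superadditivity on disjoint sets give one inequality; cutting a competitor
  \<open>B\<close> along the sequence \<open>F\<close> gives the other.\<close>

lemma jordan_pos_emeasure:
  assumes \<nu>: "signed_measure M \<nu>" and E: "E \<in> sets M"
  shows "emeasure (jordan_pos M \<nu>) E = (SUP B \<in> {B \<in> sets M. B \<subseteq> E}. ennreal (\<nu> B))"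
proof -
  define S where "S E = (SUP B \<in> {B \<in> sets M. B \<subseteq> E}. ennreal (\<nu> B))" for E
  have upper: "ennreal (\<nu> B) \<le> S E" if "B \<in> sets M" "B \<subseteq> E" for B E
    unfolding S_def using that by (intro SUP_upper) auto
  have S_mono: "S A \<le> S B" if "A \<subseteq> B" for A B
    unfolding S_def using that by (intro SUP_subset_mono) auto
  have S_add: "S A + S B \<le> S (A \<union> B)" if A: "A \<in> sets M" and B: "B \<in> sets M" and AB: "A \<inter> B = {}" for A B
  proof -
    have nA: "{C \<in> sets M. C \<subseteq> A} \<noteq> {}" and nB: "{C \<in> sets M. C \<subseteq> B} \<noteq> {}" by auto
    have "S A + S B = (SUP C \<in> {C \<in> sets M. C \<subseteq> A}. ennreal (\<nu> C) + S B)"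
      unfolding S_def[of A] by (rule ennreal_SUP_add_left[OF nA, symmetric])
    also have "\<dots> \<le> S (A \<union> B)"
    proof (rule SUP_least)
      fix C assume C: "C \<in> {C \<in> sets M. C \<subseteq> A}"
      have "ennreal (\<nu> C) + S B = (SUP D \<in> {D \<in> sets M. D \<subseteq> B}. ennreal (\<nu> D) + ennreal (\<nu> C))"
        unfolding S_def[of B] by (subst add.commute) (rule ennreal_SUP_add_left[OF nB, symmetric])
      also have "\<dots> \<le> S (A \<union> B)"
      proof (rule SUP_least)
        fix D assume D: "D \<in> {D \<in> sets M. D \<subseteq> B}"
        show "ennreal (\<nu> D) + ennreal (\<nu> C) \<le> S (A \<union> B)"
        \<comment> \<open>\<open>ennreal\<close> maps negative values to 0. If one value is not
          positive, it drops out and the other set alone is a competitor; otherwise the union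
          is.\<close>
        proof (cases "\<nu> D \<le> 0 \<or> \<nu> C \<le> 0")
          case True
          moreover have "C \<subseteq> A \<union> B" "D \<subseteq> A \<union> B" using C D by auto
          ultimately show ?thesis using upper[of C "A \<union> B"] upper[of D "A \<union> B"] C D
            by (auto simp: ennreal_neg)
        next
          case False
          have "\<nu> (D \<union> C) = \<nu> D + \<nu> C" using C D AB by (intro signed_measure_union[OF \<nu>]) auto
          then have "ennreal (\<nu> D) + ennreal (\<nu> C) = ennreal (\<nu> (D \<union> C))" using False by simp
          also have "\<dots> \<le> S (A \<union> B)" using C D by (intro upper) auto
          finally show ?thesis .
        qed
      qed
      finally show "ennreal (\<nu> C) + S B \<le> S (A \<union> B)" .
    qed
    finally show ?thesis .
  qed
  have ca: "countably_additive (sets M) S"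
    unfolding countably_additive_def
  proof (intro allI impI antisym)
    fix F :: "nat \<Rightarrow> _" assume F: "range F \<subseteq> sets M" "disjoint_family F" "\<Union> (range F) \<in> sets M"
    then have Fm: "F n \<in> sets M" for n by auto
    show "(\<Sum>n. S (F n)) \<le> S (\<Union> (range F))"
    proof (rule suminf_le_const)
      fix n
      have "(\<Sum>i<n. S (F i)) \<le> S (\<Union>i<n. F i)"
      proof (induction n)
        case (Suc n)
        have disj: "(\<Union>i<n. F i) \<inter> F n = {}"
          using F(2) unfolding disjoint_family_on_def by (auto, metis IntI empty_iff less_irrefl)
        have "(\<Sum>i<Suc n. S (F i)) \<le> S (\<Union>i<n. F i) + S (F n)" using Suc by (simp add: add_right_mono)
        also have "\<dots> \<le> S ((\<Union>i<n. F i) \<union> F n)" using Fm disj by (intro S_add) auto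
        finally show ?case by (simp add: lessThan_Suc Un_commute)
      qed simp
      also have "\<dots> \<le> S (\<Union> (range F))" by (rule S_mono) auto
      finally show "(\<Sum>i<n. S (F i)) \<le> S (\<Union> (range F))" .
    qed simp
    show "S (\<Union> (range F)) \<le> (\<Sum>n. S (F n))"
      unfolding S_def[of "\<Union> (range F)"]
    proof (rule SUP_least)
      fix B assume B: "B \<in> {B \<in> sets M. B \<subseteq> \<Union> (range F)}"
      have "(\<lambda>n. \<nu> (B \<inter> F n)) sums \<nu> (\<Union>n. B \<inter> F n)"
        using B Fm F(2) by (intro signed_measureD[OF \<nu>]) (auto simp: disjoint_family_on_def)
      moreover have "(\<Union>n. B \<inter> F n) = B" using B by auto
      ultimately have "(\<lambda>n. ennreal (\<Sum>i<n. \<nu> (B \<inter> F i))) \<longlonglongrightarrow> ennreal (\<nu> B)"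
        unfolding sums_def by (intro tendsto_ennrealI) simp
      then show "ennreal (\<nu> B) \<le> (\<Sum>n. S (F n))"
      proof (rule LIMSEQ_le_const2, intro exI allI impI)
        fix n
        have "ennreal (\<Sum>i<n. \<nu> (B \<inter> F i)) \<le> (\<Sum>i<n. ennreal (\<nu> (B \<inter> F i)))"
        proof (induction n)
          case (Suc n)
          have "ennreal (\<Sum>i<Suc n. \<nu> (B \<inter> F i)) \<le> ennreal (\<Sum>i<n. \<nu> (B \<inter> F i)) + ennreal (\<nu> (B \<inter> F n))"
            using ennreal_add_le[of "\<Sum>i<n. \<nu> (B \<inter> F i)" "\<nu> (B \<inter> F n)"] by simp
          then show ?case using Suc by (simp add: add_right_mono order_trans)
        qed simp
        also have "\<dots> \<le> (\<Sum>i<n. S (F i))" using B Fm by (intro sum_mono upper) auto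
        also have "\<dots> \<le> (\<Sum>n. S (F n))" by (intro sum_le_suminf) auto
        finally show "ennreal (\<Sum>i<n. \<nu> (B \<inter> F i)) \<le> (\<Sum>n. S (F n))" .
      qed
    qed
  qed
  have "positive (sets M) S"
  proof -
    have "S {} \<le> ennreal (\<nu> {})" unfolding S_def by (rule SUP_least) auto
    then show ?thesis by (simp add: positive_def signed_measure_empty[OF \<nu>])
  qed
  then have "emeasure (measure_of (space M) (sets M) S) E = S E"
    using ca E sets.sigma_algebra_axioms[of M] by (intro emeasure_measure_of_sigma) auto
  then show ?thesis by (simp add: jordan_pos_def S_def[abs_def])
qed

lemma sets_jordan_pos [simp, measurable_cong]: "sets (jordan_pos M \<nu>) = sets M"
  and space_jordan_pos [simp]: "space (jordan_pos M \<nu>) = space M"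
  by (simp_all add: jordan_pos_def)

lemma finite_jordan_pos:
  assumes \<nu>: "signed_measure M \<nu>"
  shows "finite_measure (jordan_pos M \<nu>)"
proof
  obtain K where K: "\<forall>E\<in>sets M. \<bar>\<nu> E\<bar> \<le> K" using signed_measure_bounded[OF \<nu>] by blast
  have "emeasure (jordan_pos M \<nu>) (space M) \<le> ennreal K"
    unfolding jordan_pos_emeasure[OF \<nu> sets.top]
    using K by (intro SUP_least ennreal_leI) (auto intro: order_trans[OF abs_ge_self])
  then show "emeasure (jordan_pos M \<nu>) (space (jordan_pos M \<nu>)) \<noteq> \<infinity>"
    by (simp add: top_unique) (metis ennreal_less_top infinity_ennreal_def leD)
qed

text \<open>For \<open>B \<subseteq> E\<close>, additivity gives
  \<open>\<nu> B = \<nu> E - \<nu> (E - B)\<close>, which is at most \<open>\<nu> E\<close> plus the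
  negative part of \<open>E\<close>. The supremum over \<open>B\<close> bounds the positive part,
  and the same for \<open>- \<nu>\<close> gives the reverse inequality. No Hahn decomposition
  enters.\<close>

lemma jordan_decomposition:
  assumes \<nu>: "signed_measure M \<nu>" and E: "E \<in> sets M"
  shows "\<nu> E = measure (jordan_pos M \<nu>) E - measure (jordan_pos M (\<lambda>E. - \<nu> E)) E"
proof -
  have ge: "\<mu> B \<le> measure (jordan_pos M \<mu>) E" if "signed_measure M \<mu>" "B \<in> sets M" "B \<subseteq> E" for \<mu> B
  proof -
    interpret finite_measure "jordan_pos M \<mu>" by (rule finite_jordan_pos[OF that(1)])
    have "ennreal (\<mu> B) \<le> ennreal (measure (jordan_pos M \<mu>) E)"
      unfolding emeasure_eq_measure[symmetric] jordan_pos_emeasure[OF that(1) E]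
      using that by (intro SUP_upper) auto
    then show ?thesis by (simp add: ennreal_le_iff)
  qed
  have le: "measure (jordan_pos M \<mu>) E \<le> \<mu> E + measure (jordan_pos M (\<lambda>E. - \<mu> E)) E"
    if \<mu>: "signed_measure M \<mu>" for \<mu>
  proof -
    interpret finite_measure "jordan_pos M \<mu>" by (rule finite_jordan_pos[OF \<mu>])
    let ?c = "\<mu> E + measure (jordan_pos M (\<lambda>E. - \<mu> E)) E"
    have c0: "0 \<le> ?c" using ge[OF signed_measure_uminus[OF \<mu>] E] by simp
    have "ennreal (measure (jordan_pos M \<mu>) E) \<le> ennreal ?c"
      unfolding emeasure_eq_measure[symmetric] jordan_pos_emeasure[OF \<mu> E]
    proof (rule SUP_least, rule ennreal_leI)
      fix B assume B: "B \<in> {B \<in> sets M. B \<subseteq> E}"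
      have "- \<mu> (E - B) \<le> measure (jordan_pos M (\<lambda>E. - \<mu> E)) E"
        using B E by (intro ge[OF signed_measure_uminus[OF \<mu>]]) auto
      then show "\<mu> B \<le> ?c" using signed_measure_diff[OF \<mu> E, of B] B by simp
    qed
    then show ?thesis using c0 by (simp add: ennreal_le_iff)
  qed
  show ?thesis using le[OF \<nu>] le[OF signed_measure_uminus[OF \<nu>]] by simp
qed

subsection \<open>Linear combinations of integrals\<close>

lemma integrable_bounded:
  fixes f :: "'s \<Rightarrow> 'b::{banach, second_countable_topology}"
  assumes "finite_measure M" "f \<in> borel_measurable M" "\<And>x. x \<in> space M \<Longrightarrow> norm (f x) \<le> B"
  shows "integrable M f"
  by (rule finite_measure.integrable_const_bound[OF assms(1), of _ B]) (use assms in auto)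

text \<open>Lets integrals against different representations of one set function be compared, with
  no appeal to minimality of the Jordan decomposition. Because of the signs, the limit step of the
  usual induction rests on dominated convergence.\<close>

lemma combination_integral_zero_nonneg:
  fixes m :: "'j \<Rightarrow> 's measure" and r :: "'j \<Rightarrow> real"
  assumes J: "finite J" and fin: "\<And>j. j \<in> J \<Longrightarrow> finite_measure (m j)"
    and sets: "\<And>j. j \<in> J \<Longrightarrow> sets (m j) = sets M"
    and zero: "\<And>E. E \<in> sets M \<Longrightarrow> (\<Sum>j\<in>J. r j * measure (m j) E) = 0"
    and f: "f \<in> borel_measurable M" "\<And>x. 0 \<le> f x" "\<And>x. x \<in> space M \<Longrightarrow> f x \<le> B"
  shows "(\<Sum>j\<in>J. r j * integral\<^sup>L (m j) f) = 0"
proof -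
  have sp: "space (m j) = space M" if "j \<in> J" for j using sets[OF that] by (rule sets_eq_imp_space_eq)
  have bm: "g \<in> borel_measurable M \<Longrightarrow> g \<in> borel_measurable (m j)" if "j \<in> J" for j and g :: "'s \<Rightarrow> real"
    using measurable_cong_sets[OF sets[OF that] refl] by blast
  have int: "integrable (m j) g" if "j \<in> J" "g \<in> borel_measurable M" "\<And>x. 0 \<le> g x"
    "\<And>x. x \<in> space M \<Longrightarrow> g x \<le> B" for j and g :: "'s \<Rightarrow> real" and B
    by (rule integrable_bounded[OF fin[OF that(1)] bm[OF that(1,2)], of B]) (use that sp in auto)
  \<comment> \<open>The bound is quantified inside the claim, since the constituents of
    \<open>f\<close> have bounds of their own.\<close>
  have "\<forall>B. (\<forall>x\<in>space M. f x \<le> B) \<longrightarrow> (\<Sum>j\<in>J. r j * integral\<^sup>L (m j) f) = 0"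
    using f(1,2)
  proof (induction rule: borel_measurable_induct_real)
    case (set A)
    have "integral\<^sup>L (m j) (indicator A) = measure (m j) A" if "j \<in> J" for j
      using set sets[OF that] by (simp add: sets.Int_space_eq2)
    then show ?case using zero[OF set] by simp
  next
    case (mult u c)
    show ?case
    proof (cases "c = 0")
      case False
      have "u x \<le> B / c" if "\<forall>x\<in>space M. c * u x \<le> B" "x \<in> space M" for B x
        using that False mult.hyps(1) by (simp add: pos_le_divide_eq mult.commute)
      then have *: "(\<Sum>j\<in>J. r j * integral\<^sup>L (m j) u) = 0" if "\<forall>x\<in>space M. c * u x \<le> B" for B
        using mult.IH that by blast
      have "(\<Sum>j\<in>J. r j * integral\<^sup>L (m j) (\<lambda>x. c * u x)) = c * (\<Sum>j\<in>J. r j * integral\<^sup>L (m j) u)"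
        by (simp add: sum_distrib_left mult_ac)
      then show ?thesis using * by auto
    qed simp
  next
    case (add u v)
    show ?case
    proof (intro allI impI)
      fix B assume B: "\<forall>x\<in>space M. v x + u x \<le> B"
      have ub: "u x \<le> B" "v x \<le> B" if "x \<in> space M" for x
        using B[rule_format, OF that] add.hyps(2)[of x] add.hyps(4)[of x] by linarith+
      have "(\<Sum>j\<in>J. r j * integral\<^sup>L (m j) (\<lambda>x. v x + u x)) =
          (\<Sum>j\<in>J. r j * integral\<^sup>L (m j) v) + (\<Sum>j\<in>J. r j * integral\<^sup>L (m j) u)"
        unfolding sum.distrib[symmetric]
        by (intro sum.cong refl) (simp add: int[OF _ add.hyps(1,2) ub(1)] int[OF _ add.hyps(3,4) ub(2)] distrib_left)
      then show "(\<Sum>j\<in>J. r j * integral\<^sup>L (m j) (\<lambda>x. v x + u x)) = 0"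
        using add.IH(1)[rule_format, of B] add.IH(2)[rule_format, of B] ub by simp
    qed
  next
    case (seq U)
    show ?case
    proof (intro allI impI)
      fix B assume B: "\<forall>x\<in>space M. f x \<le> B"
      have Uu: "U i x \<le> f x" if "x \<in> space M" for i x
        using incseq_le[OF _ seq.hyps(4)[OF that]] seq.hyps(3) by (simp add: incseq_def le_fun_def)
      then have UB: "U i x \<le> B" if "x \<in> space M" for i x using B that order_trans by blast
      have f_meas: "f \<in> borel_measurable M"
        by (rule borel_measurable_LIMSEQ_real[OF seq.hyps(4) seq.hyps(1)])
      have lim: "(\<lambda>i. integral\<^sup>L (m j) (U i)) \<longlonglongrightarrow> integral\<^sup>L (m j) f" if j: "j \<in> J" for j
      proof (rule integral_dominated_convergence[where w = "\<lambda>_. B"])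
        interpret finite_measure "m j" by (rule fin[OF j])
        show "integrable (m j) (\<lambda>_. B)" by simp
        show "f \<in> borel_measurable (m j)" by (rule bm[OF j f_meas])
        show "U i \<in> borel_measurable (m j)" for i by (rule bm[OF j seq.hyps(1)])
        show "AE x in m j. (\<lambda>i. U i x) \<longlonglongrightarrow> f x" by (rule AE_I2) (simp add: seq.hyps(4) sp[OF j])
        show "AE x in m j. norm (U i x) \<le> B" for i by (rule AE_I2) (simp add: UB seq.hyps(2) sp[OF j])
      qed
      have "(\<lambda>i. \<Sum>j\<in>J. r j * integral\<^sup>L (m j) (U i)) \<longlonglongrightarrow> (\<Sum>j\<in>J. r j * integral\<^sup>L (m j) f)"
        by (intro tendsto_intros lim)
      moreover have "(\<Sum>j\<in>J. r j * integral\<^sup>L (m j) (U i)) = 0" for i using seq.IH[of i] UB by blast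
      ultimately show "(\<Sum>j\<in>J. r j * integral\<^sup>L (m j) f) = 0" by (simp add: LIMSEQ_const_iff)
    qed
  qed
  then show ?thesis using f(3) by blast
qed

lemma combination_integral_zero:
  fixes m :: "'j \<Rightarrow> 's measure" and r :: "'j \<Rightarrow> real" and f :: "'s \<Rightarrow> complex"
  assumes J: "finite J" and fin: "\<And>j. j \<in> J \<Longrightarrow> finite_measure (m j)"
    and sets: "\<And>j. j \<in> J \<Longrightarrow> sets (m j) = sets M"
    and zero: "\<And>E. E \<in> sets M \<Longrightarrow> (\<Sum>j\<in>J. r j * measure (m j) E) = 0"
    and f: "f \<in> borel_measurable M" "\<And>x. x \<in> space M \<Longrightarrow> cmod (f x) \<le> B"
  shows "(\<Sum>j\<in>J. complex_of_real (r j) * integral\<^sup>L (m j) f) = 0"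
proof -
  have sp: "space (m j) = space M" if "j \<in> J" for j using sets[OF that] by (rule sets_eq_imp_space_eq)
  have bm: "f \<in> borel_measurable (m j)" if "j \<in> J" for j
    using measurable_cong_sets[OF sets[OF that] refl] f(1) by blast
  have int: "integrable (m j) f" if "j \<in> J" for j
    by (rule integrable_bounded[OF fin[OF that] bm[OF that], of B]) (use f sp[OF that] in auto)
  have real: "(\<Sum>j\<in>J. r j * integral\<^sup>L (m j) g) = 0"
    if g: "g \<in> borel_measurable M" "\<And>x. x \<in> space M \<Longrightarrow> \<bar>g x\<bar> \<le> B" for g :: "'s \<Rightarrow> real"
  proof -
    let ?p = "\<lambda>x. max 0 (g x)" and ?n = "\<lambda>x. max 0 (- g x)"
    have pn: "?p \<in> borel_measurable M" "?n \<in> borel_measurable M" using g(1) by auto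
    have b: "?p x \<le> B" "?n x \<le> B" if "x \<in> space M" for x using g(2)[OF that] by auto
    have "integral\<^sup>L (m j) g = integral\<^sup>L (m j) ?p - integral\<^sup>L (m j) ?n" if j: "j \<in> J" for j
    proof -
      have "integrable (m j) ?p" "integrable (m j) ?n"
        using measurable_cong_sets[OF sets[OF j] refl] pn b sp[OF j]
        by (auto intro!: integrable_bounded[OF fin[OF j], of _ B])
      then have "integral\<^sup>L (m j) ?p - integral\<^sup>L (m j) ?n = integral\<^sup>L (m j) (\<lambda>x. ?p x - ?n x)" by simp
      also have "(\<lambda>x. ?p x - ?n x) = g" by (auto simp: fun_eq_iff)
      finally show ?thesis by simp
    qed
    then have "(\<Sum>j\<in>J. r j * integral\<^sup>L (m j) g) =
        (\<Sum>j\<in>J. r j * integral\<^sup>L (m j) ?p) - (\<Sum>j\<in>J. r j * integral\<^sup>L (m j) ?n)"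
      by (simp add: right_diff_distrib sum_subtractf)
    then show ?thesis
      using combination_integral_zero_nonneg[OF J fin sets zero pn(1) _ b(1)]
        combination_integral_zero_nonneg[OF J fin sets zero pn(2) _ b(2)] by simp
  qed
  show ?thesis
  proof (rule complex_eqI)
    have "Re (\<Sum>j\<in>J. complex_of_real (r j) * integral\<^sup>L (m j) f) = (\<Sum>j\<in>J. r j * integral\<^sup>L (m j) (\<lambda>x. Re (f x)))"
      using int by (simp add: integral_Re)
    also have "\<dots> = 0" using f by (intro real) (auto intro: order_trans[OF abs_Re_le_cmod])
    finally show "Re (\<Sum>j\<in>J. complex_of_real (r j) * integral\<^sup>L (m j) f) = Re 0" by simp
    have "Im (\<Sum>j\<in>J. complex_of_real (r j) * integral\<^sup>L (m j) f) = (\<Sum>j\<in>J. r j * integral\<^sup>L (m j) (\<lambda>x. Im (f x)))"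
      using int by (simp add: integral_Im)
    also have "\<dots> = 0" using f by (intro real) (auto intro: order_trans[OF abs_Im_le_cmod])
    finally show "Im (\<Sum>j\<in>J. complex_of_real (r j) * integral\<^sup>L (m j) f) = Im 0" by simp
  qed
qed

subsection \<open>Integrals against complex measures\<close>

lemma complex_measure_Re: "complex_measure M \<mu> \<Longrightarrow> signed_measure M (\<lambda>E. Re (\<mu> E))"
  and complex_measure_Im: "complex_measure M \<mu> \<Longrightarrow> signed_measure M (\<lambda>E. Im (\<mu> E))"
  unfolding complex_measure_def signed_measure_def by (auto intro: sums_Re sums_Im)

text \<open>The measures \<open>m j\<close> together with both Jordan parts form a combination that
  vanishes on all sets, hence on \<open>f\<close>.\<close>

lemma signed_integral_combination:
  fixes m :: "'j \<Rightarrow> 's measure" and r :: "'j \<Rightarrow> real" and f :: "'s \<Rightarrow> complex"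
  assumes J: "finite J" and fin: "\<And>j. j \<in> J \<Longrightarrow> finite_measure (m j)"
    and sets: "\<And>j. j \<in> J \<Longrightarrow> sets (m j) = sets M"
    and \<nu>: "signed_measure M \<nu>" "\<And>E. E \<in> sets M \<Longrightarrow> \<nu> E = (\<Sum>j\<in>J. r j * measure (m j) E)"
    and f: "f \<in> borel_measurable M" "\<And>x. x \<in> space M \<Longrightarrow> cmod (f x) \<le> B"
  shows "integral\<^sup>L (jordan_pos M \<nu>) f - integral\<^sup>L (jordan_pos M (\<lambda>E. - \<nu> E)) f =
    (\<Sum>j\<in>J. complex_of_real (r j) * integral\<^sup>L (m j) f)"
proof -
  \<comment> \<open>The boolean summand adds the Jordan parts to the family, \<open>True\<close>
    standing for the positive part, which gets the sign -1 in \<open>r'\<close>.\<close>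
  define m' where "m' = case_sum m (\<lambda>b. jordan_pos M (if b then \<nu> else (\<lambda>E. - \<nu> E)))"
  define r' where "r' = case_sum r (\<lambda>b. if b then - 1 else 1)"
  have zero: "(\<Sum>j\<in>J <+> (UNIV :: bool set). complex_of_real (r' j) * integral\<^sup>L (m' j) f) = 0"
  proof (rule combination_integral_zero[where M = M and B = B])
    show "finite (J <+> (UNIV :: bool set))" using J by simp
    show "finite_measure (m' j)" if "j \<in> J <+> (UNIV :: bool set)" for j
      using that fin finite_jordan_pos[OF \<nu>(1)] finite_jordan_pos[OF signed_measure_uminus[OF \<nu>(1)]]
      by (auto simp: m'_def)
    show "sets (m' j) = sets M" if "j \<in> J <+> (UNIV :: bool set)" for j
      using that sets by (auto simp: m'_def)
    show "(\<Sum>j\<in>J <+> (UNIV :: bool set). r' j * measure (m' j) E) = 0" if "E \<in> sets M" for E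
      using J jordan_decomposition[OF \<nu>(1) that] \<nu>(2)[OF that]
      by (simp add: sum.Plus UNIV_bool m'_def r'_def)
  qed (use f in auto)
  have "(\<Sum>j\<in>J <+> (UNIV :: bool set). complex_of_real (r' j) * integral\<^sup>L (m' j) f) =
      (\<Sum>j\<in>J. complex_of_real (r j) * integral\<^sup>L (m j) f) +
      (integral\<^sup>L (jordan_pos M (\<lambda>E. - \<nu> E)) f - integral\<^sup>L (jordan_pos M \<nu>) f)"
    using J by (simp add: sum.Plus UNIV_bool m'_def r'_def)
  then show ?thesis using zero by (simp add: algebra_simps)
qed

lemma complex_measure_combination:
  fixes m :: "'j \<Rightarrow> 's measure" and c :: "'j \<Rightarrow> complex"
  assumes fin: "\<And>j. j \<in> J \<Longrightarrow> finite_measure (m j)"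
    and sets: "\<And>j. j \<in> J \<Longrightarrow> sets (m j) = sets M"
  shows "complex_measure M (\<lambda>E. \<Sum>j\<in>J. c j * complex_of_real (measure (m j) E))"
  unfolding complex_measure_def
proof (intro allI impI)
  fix F :: "nat \<Rightarrow> 's set" assume F: "range F \<subseteq> sets M \<and> disjoint_family F"
  show "(\<lambda>n. \<Sum>j\<in>J. c j * complex_of_real (measure (m j) (F n))) sums
      (\<Sum>j\<in>J. c j * complex_of_real (measure (m j) (\<Union>n. F n)))"
  proof (intro sums_sum sums_mult sums_of_real)
    fix j assume j: "j \<in> J"
    show "(\<lambda>n. measure (m j) (F n)) sums measure (m j) (\<Union>n. F n)"
      by (rule finite_measure.finite_measure_UNION[OF fin[OF j]]) (use F sets[OF j] in auto)
  qed
qed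

text \<open>Makes \<open>complex_integral\<close> computable: the Jordan parts in its definition are
  replaced by any given representation by finite measures.\<close>

lemma complex_integral_combination:
  fixes m :: "'j \<Rightarrow> 's measure" and c :: "'j \<Rightarrow> complex" and f :: "'s \<Rightarrow> complex"
  assumes J: "finite J" and fin: "\<And>j. j \<in> J \<Longrightarrow> finite_measure (m j)"
    and sets: "\<And>j. j \<in> J \<Longrightarrow> sets (m j) = sets M"
    and f: "f \<in> borel_measurable M" "\<And>x. x \<in> space M \<Longrightarrow> cmod (f x) \<le> B"
  shows "complex_integral M (\<lambda>E. \<Sum>j\<in>J. c j * complex_of_real (measure (m j) E)) f =
    (\<Sum>j\<in>J. c j * integral\<^sup>L (m j) f)"
proof -
  let ?\<mu> = "\<lambda>E. \<Sum>j\<in>J. c j * complex_of_real (measure (m j) E)"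
  have cm: "complex_measure M ?\<mu>" by (rule complex_measure_combination[OF fin sets])
  have "complex_integral M ?\<mu> f = (\<Sum>j\<in>J. complex_of_real (Re (c j)) * integral\<^sup>L (m j) f) +
      \<i> * (\<Sum>j\<in>J. complex_of_real (Im (c j)) * integral\<^sup>L (m j) f)"
    unfolding complex_integral_def
    by (subst (1 2) signed_integral_combination[OF J fin sets _ _ f])
      (use complex_measure_Re[OF cm] complex_measure_Im[OF cm] in auto)
  also have "\<dots> = (\<Sum>j\<in>J. (complex_of_real (Re (c j)) + \<i> * complex_of_real (Im (c j))) * integral\<^sup>L (m j) f)"
    by (simp add: sum_distrib_left sum.distrib distrib_right mult.assoc)
  also have "\<dots> = (\<Sum>j\<in>J. c j * integral\<^sup>L (m j) f)" by (simp add: complex_eq[symmetric])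
  finally show ?thesis .
qed

subsection \<open>Regularity\<close>

text \<open>The sum \<nu> of the four Jordan parts, taken as a set function, dominates the moduli of
  real and imaginary part. \<open>jordan_pos\<close> turns it into an object of type
  \<open>measure\<close> that is at least \<nu> on every set.\<close>

lemma complex_measure_dominated:
  assumes \<mu>: "complex_measure M \<mu>"
  obtains P where "finite_measure P" "sets P = sets M"
    "\<And>E. E \<in> sets M \<Longrightarrow> ennreal (cmod (\<mu> E)) \<le> emeasure P E"
proof -
  note sgn = complex_measure_Re[OF \<mu>] complex_measure_Im[OF \<mu>]
  define m where "m = jordan_pos M"
  define \<nu> where "\<nu> E = measure (m (\<lambda>E. Re (\<mu> E))) E + measure (m (\<lambda>E. - Re (\<mu> E))) E +
    (measure (m (\<lambda>E. Im (\<mu> E))) E + measure (m (\<lambda>E. - Im (\<mu> E))) E)" for E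
  have meas: "signed_measure M (measure (m \<eta>))" if "signed_measure M \<eta>" for \<eta>
    unfolding signed_measure_def m_def
    using finite_measure.finite_measure_UNION[OF finite_jordan_pos[OF that]] by simp
  have plus: "signed_measure M (\<lambda>E. \<alpha> E + \<beta> E)" if "signed_measure M \<alpha>" "signed_measure M \<beta>" for \<alpha> \<beta>
    using that unfolding signed_measure_def by (auto intro: sums_add)
  have \<nu>: "signed_measure M \<nu>"
    unfolding \<nu>_def[abs_def]
    by (intro plus meas sgn sgn[THEN signed_measure_uminus])
  show thesis
  proof (rule that[of "jordan_pos M \<nu>"])
    fix E assume E: "E \<in> sets M"
    have "cmod (\<mu> E) \<le> \<bar>Re (\<mu> E)\<bar> + \<bar>Im (\<mu> E)\<bar>" by (rule cmod_le)
    also have "\<dots> \<le> \<nu> E"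

      using sgn[THEN jordan_decomposition, OF E]
        measure_nonneg[of "m (\<lambda>E. Re (\<mu> E))" E] measure_nonneg[of "m (\<lambda>E. - Re (\<mu> E))" E]
        measure_nonneg[of "m (\<lambda>E. Im (\<mu> E))" E] measure_nonneg[of "m (\<lambda>E. - Im (\<mu> E))" E]
      unfolding \<nu>_def m_def by linarith
    finally have "ennreal (cmod (\<mu> E)) \<le> ennreal (\<nu> E)" by (rule ennreal_leI)
    also have "\<dots> \<le> emeasure (jordan_pos M \<nu>) E"
      unfolding jordan_pos_emeasure[OF \<nu> E] using E by (intro SUP_upper) auto
    finally show "ennreal (cmod (\<mu> E)) \<le> emeasure (jordan_pos M \<nu>) E" .
  qed (use finite_jordan_pos[OF \<nu>] in auto)
qed

lemma total_variation_le:
  assumes "\<And>E. E \<in> sets M \<Longrightarrow> ennreal (cmod (\<mu> E)) \<le> emeasure P E" "sets P = sets M"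
  shows "total_variation M \<mu> E \<le> emeasure P E"
  unfolding total_variation_def
proof (rule SUP_least)
  fix F :: "nat \<Rightarrow> 'a set"
  assume F: "F \<in> {F. range F \<subseteq> sets M \<and> disjoint_family F \<and> \<Union> (range F) = E}"
  have "(\<Sum>n. ennreal (cmod (\<mu> (F n)))) \<le> (\<Sum>n. emeasure P (F n))"
    using F assms(1) by (intro suminf_le) auto
  also have "\<dots> = emeasure P E" using F assms(2) by (subst suminf_emeasure) auto
  finally show "(\<Sum>n. ennreal (cmod (\<mu> (F n)))) \<le> emeasure P E" .
qed

text \<open>A partition of \<open>A\<close> becomes one of \<open>B\<close> by prepending
  \<open>B - A\<close>, which only adds a term.\<close>

lemma total_variation_mono:
  assumes "A \<in> sets M" "B \<in> sets M" "A \<subseteq> B"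
  shows "total_variation M \<mu> A \<le> total_variation M \<mu> B"
  unfolding total_variation_def[of M \<mu> A]
proof (rule SUP_least)
  fix F :: "nat \<Rightarrow> 'a set"
  assume F: "F \<in> {F. range F \<subseteq> sets M \<and> disjoint_family F \<and> \<Union> (range F) = A}"
  define G where "G = case_nat (B - A) F"
  have FA: "F n \<subseteq> A" for n using F by auto
  have "G n \<in> sets M" for n using F assms by (auto simp: G_def split: nat.split)
  moreover have "disjoint_family G"
    unfolding disjoint_family_on_def
  proof (intro ballI impI)
    fix i j :: nat assume "i \<noteq> j"
    then show "G i \<inter> G j = {}"
      using F FA[of "i - 1"] FA[of "j - 1"] unfolding disjoint_family_on_def
      by (auto simp: G_def split: nat.splits)
  qed
  moreover have "\<Union> (range G) = B"
  proof
    have "G n \<subseteq> B" for n using FA assms(3) by (auto simp: G_def split: nat.splits)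
    then show "\<Union> (range G) \<subseteq> B" by blast
    show "B \<subseteq> \<Union> (range G)"
    proof
      fix y assume y: "y \<in> B"
      show "y \<in> \<Union> (range G)"
      proof (cases "y \<in> A")
        case True
        then obtain n where "y \<in> F n" using F by auto
        then have "y \<in> G (Suc n)" by (simp add: G_def)
        then show ?thesis by blast
      next
        case False
        then have "y \<in> G 0" using y by (simp add: G_def)
        then show ?thesis by blast
      qed
    qed
  qed
  ultimately have "(\<Sum>n. ennreal (cmod (\<mu> (G n)))) \<le> total_variation M \<mu> B"
    unfolding total_variation_def by (intro SUP_upper) auto
  moreover have "(\<Sum>n. ennreal (cmod (\<mu> (F n)))) \<le> (\<Sum>n. ennreal (cmod (\<mu> (G n))))"
  proof (rule suminf_le_const)
    fix n
    have "(\<Sum>i<n. ennreal (cmod (\<mu> (F i)))) \<le> (\<Sum>i<Suc n. ennreal (cmod (\<mu> (G i))))"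
      by (simp add: sum.lessThan_Suc_shift G_def del: sum.lessThan_Suc)
    also have "\<dots> \<le> (\<Sum>n. ennreal (cmod (\<mu> (G n))))" by (intro sum_le_suminf) auto
    finally show "(\<Sum>i<n. ennreal (cmod (\<mu> (F i)))) \<le> (\<Sum>n. ennreal (cmod (\<mu> (G n))))" .
  qed simp
  ultimately show "(\<Sum>n. ennreal (cmod (\<mu> (F n)))) \<le> total_variation M \<mu> B" by (rule order_trans[rotated])
qed

lemma complex_measure_union:
  assumes \<mu>: "complex_measure M \<mu>" and "A \<in> sets M" "B \<in> sets M" "A \<inter> B = {}"
  shows "\<mu> (A \<union> B) = \<mu> A + \<mu> B"
  using signed_measure_union[OF complex_measure_Re[OF \<mu>] assms(2-4)]
    signed_measure_union[OF complex_measure_Im[OF \<mu>] assms(2-4)]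
  by (simp add: complex_eq_iff)

text \<open>A partition of the union is cut into a partition of \<open>A\<close> and one of
  \<open>B\<close>.\<close>

lemma total_variation_union_le:
  assumes \<mu>: "complex_measure M \<mu>" and A: "A \<in> sets M" and B: "B \<in> sets M" and AB: "A \<inter> B = {}"
  shows "total_variation M \<mu> (A \<union> B) \<le> total_variation M \<mu> A + total_variation M \<mu> B"
  unfolding total_variation_def[of M \<mu> "A \<union> B"]
proof (rule SUP_least)
  fix F :: "nat \<Rightarrow> 'a set"
  assume F: "F \<in> {F. range F \<subseteq> sets M \<and> disjoint_family F \<and> \<Union> (range F) = A \<union> B}"
  have part: "(\<Sum>n. ennreal (cmod (\<mu> (F n \<inter> C)))) \<le> total_variation M \<mu> C"
    if "C \<in> sets M" "C \<subseteq> A \<union> B" for C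
    unfolding total_variation_def
  proof (rule SUP_upper)
    have "(F m \<inter> C) \<inter> (F n \<inter> C) = {}" if "m \<noteq> n" for m n
    proof -
      have "F m \<inter> F n = {}" using F \<open>m \<noteq> n\<close> by (simp add: disjoint_family_on_def)
      then show ?thesis by blast
    qed
    then have "disjoint_family (\<lambda>n. F n \<inter> C)" by (simp add: disjoint_family_on_def)
    moreover have "range (\<lambda>n. F n \<inter> C) \<subseteq> sets M" using F that by auto
    moreover have "(\<Union>n. F n \<inter> C) = C" using F that by auto
    ultimately show "(\<lambda>n. F n \<inter> C) \<in> {F. range F \<subseteq> sets M \<and> disjoint_family F \<and> \<Union> (range F) = C}"
      by simp
  qed
  have "ennreal (cmod (\<mu> (F n))) \<le> ennreal (cmod (\<mu> (F n \<inter> A))) + ennreal (cmod (\<mu> (F n \<inter> B)))" for n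
  proof -
    have "F n = (F n \<inter> A) \<union> (F n \<inter> B)" using F by auto
    then have "\<mu> (F n) = \<mu> ((F n \<inter> A) \<union> (F n \<inter> B))" by (rule arg_cong)
    also have "\<dots> = \<mu> (F n \<inter> A) + \<mu> (F n \<inter> B)"
      using F A B AB by (intro complex_measure_union[OF \<mu>]) auto
    finally have "cmod (\<mu> (F n)) \<le> cmod (\<mu> (F n \<inter> A)) + cmod (\<mu> (F n \<inter> B))" by (simp add: norm_triangle_ineq)
    then show ?thesis by (metis ennreal_leI ennreal_plus norm_ge_zero)
  qed
  then have "(\<Sum>n. ennreal (cmod (\<mu> (F n)))) \<le>
      (\<Sum>n. ennreal (cmod (\<mu> (F n \<inter> A))) + ennreal (cmod (\<mu> (F n \<inter> B))))"
    by (intro suminf_le) auto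
  also have "\<dots> = (\<Sum>n. ennreal (cmod (\<mu> (F n \<inter> A)))) + (\<Sum>n. ennreal (cmod (\<mu> (F n \<inter> B))))"
    by (rule suminf_add[symmetric]) auto
  also have "\<dots> \<le> total_variation M \<mu> A + total_variation M \<mu> B"
    using A B by (intro add_mono part) auto
  finally show "(\<Sum>n. ennreal (cmod (\<mu> (F n)))) \<le> total_variation M \<mu> A + total_variation M \<mu> B" .
qed

lemma sets_circle_borel: "E \<in> sets circle_borel \<longleftrightarrow> E \<in> sets borel \<and> E \<subseteq> circle"
  by (auto simp: sets_restrict_space_iff)

text \<open>Outer and inner approximation of \<open>E\<close> with respect to a finite measure that dominates \<open>\<mu>\<close>.\<close>

lemma regular_complex_measureI:
  assumes \<mu>: "complex_measure circle_borel \<mu>"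
  shows "regular_complex_measure \<mu>"
proof -
  let ?TV = "total_variation circle_borel \<mu>"
  obtain P where P: "finite_measure P" and setsP: "sets P = sets circle_borel"
    and dom: "\<And>E. E \<in> sets circle_borel \<Longrightarrow> ennreal (cmod (\<mu> E)) \<le> emeasure P E"
    by (rule complex_measure_dominated[OF \<mu>]) blast
  interpret P: finite_measure P by (rule P)
  have spP: "space P = circle" using sets_eq_imp_space_eq[OF setsP] by (simp add: space_restrict_space)
  have TV_P: "?TV E \<le> emeasure P E" for E
    by (rule total_variation_le[OF dom setsP])
  \<comment> \<open>Pushed forward to the plane, where finite Borel measures are inner and outer
    regular.\<close>
  define Q where "Q = distr P borel (\<lambda>z. z)"
  have id: "(\<lambda>z. z) \<in> measurable P borel"
    unfolding measurable_cong_sets[OF setsP refl] by (intro measurable_restrict_space1) simp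
  have Q: "emeasure Q E = emeasure P (E \<inter> circle)" if "E \<in> sets borel" for E
    unfolding Q_def using that id by (simp add: emeasure_distr spP vimage_def Int_def)
  have Qfin: "emeasure Q (space Q) \<noteq> \<infinity>" using Q[of UNIV] P.emeasure_finite by (simp add: Q_def)
  have setsQ: "sets Q = sets borel" by (simp add: Q_def)
  \<comment> \<open>Enlarging a set by little \<open>P\<close>-measure enlarges the total variation
    by little, so approximations for \<open>P\<close> carry over.\<close>
  have split: "?TV B \<le> ?TV A + ennreal e"
    if "A \<in> sets circle_borel" "B \<in> sets circle_borel" "A \<subseteq> B" "emeasure P B \<le> emeasure P A + ennreal e" for A B e
  proof -
    have "?TV (A \<union> (B - A)) \<le> ?TV A + ?TV (B - A)"
      using that by (intro total_variation_union_le[OF \<mu>]) auto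
    moreover have "A \<union> (B - A) = B" using that by auto
    moreover have "emeasure P (B - A) \<le> ennreal e"
      using that P.emeasure_finite[of A] setsP
      by (subst emeasure_Diff) (auto simp: ennreal_minus_le_iff top_unique)
    ultimately show ?thesis using TV_P[of "B - A"] by (metis add_left_mono order_trans)
  qed
  have "?TV E = (INF U\<in>{U. openin (top_of_set circle) U \<and> E \<subseteq> U}. ?TV U) \<and>
      ?TV E = (SUP K\<in>{K. compact K \<and> K \<subseteq> E}. ?TV K)" if E: "E \<in> sets circle_borel" for E
  proof -
    have Eb: "E \<in> sets borel" "E \<subseteq> circle" using E by (auto simp: sets_circle_borel)
    then have QE: "emeasure Q E = emeasure P E" using Q by (simp add: Int_absorb2)
    have fin: "emeasure Q E \<noteq> \<infinity>" using QE P.emeasure_finite by simp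
    have outer: "?TV E = (INF U\<in>{U. openin (top_of_set circle) U \<and> E \<subseteq> U}. ?TV U)"
    proof (rule antisym)
      show "?TV E \<le> (INF U\<in>{U. openin (top_of_set circle) U \<and> E \<subseteq> U}. ?TV U)"
      proof (rule INF_greatest)
        fix U assume U: "U \<in> {U. openin (top_of_set circle) U \<and> E \<subseteq> U}"
        then obtain V where "open V" "U = circle \<inter> V" by (auto simp: openin_open)
        then show "?TV E \<le> ?TV U" using U E by (intro total_variation_mono) (auto simp: sets_circle_borel)
      qed
      show "(INF U\<in>{U. openin (top_of_set circle) U \<and> E \<subseteq> U}. ?TV U) \<le> ?TV E"
      proof (rule ennreal_le_epsilon)
        fix e :: real assume e: "0 < e"
        have "(INF U\<in>{U. E \<subseteq> U \<and> open U}. emeasure Q U) < emeasure Q E + ennreal e"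
          unfolding outer_regular[OF setsQ Qfin Eb(1), symmetric]
          using fin e by (simp add: ennreal_add_less_top less_top)
        then obtain V where V: "E \<subseteq> V" "open V" "emeasure Q V < emeasure Q E + ennreal e"
          unfolding INF_less_iff by blast
        have VQ: "emeasure Q V = emeasure P (V \<inter> circle)" using V by (intro Q) simp
        have "(INF U\<in>{U. openin (top_of_set circle) U \<and> E \<subseteq> U}. ?TV U) \<le> ?TV (V \<inter> circle)"
          using V Eb by (intro INF_lower) (auto simp: openin_open)
        also have "\<dots> \<le> ?TV E + ennreal e"
          using V E Eb QE VQ by (intro split) (auto simp: sets_circle_borel)
        finally show "(INF U\<in>{U. openin (top_of_set circle) U \<and> E \<subseteq> U}. ?TV U) \<le> ?TV E + ennreal e" .
      qed
    qed
    have inner: "?TV E = (SUP K\<in>{K. compact K \<and> K \<subseteq> E}. ?TV K)"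
    proof (rule antisym)
      show "(SUP K\<in>{K. compact K \<and> K \<subseteq> E}. ?TV K) \<le> ?TV E"
        using E Eb by (intro SUP_least total_variation_mono)
          (auto simp: sets_circle_borel intro!: borel_compact)
      show "?TV E \<le> (SUP K\<in>{K. compact K \<and> K \<subseteq> E}. ?TV K)"
      proof (rule ennreal_le_epsilon)
        fix e :: real assume e: "0 < e"
        have "\<exists>K\<in>{K. K \<subseteq> E \<and> compact K}. emeasure Q E \<le> emeasure Q K + ennreal e"
        proof (rule ccontr)
          assume "\<not> ?thesis"
          then have "emeasure Q K + ennreal e \<le> emeasure Q E" if "K \<in> {K. K \<subseteq> E \<and> compact K}" for K
            using that by (auto simp: not_le intro: less_imp_le)
          then have "(SUP K\<in>{K. K \<subseteq> E \<and> compact K}. emeasure Q K + ennreal e) \<le> emeasure Q E"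
            by (rule SUP_least)
          then have "(SUP K\<in>{K. K \<subseteq> E \<and> compact K}. emeasure Q K) + ennreal e \<le> emeasure Q E"
            by (subst ennreal_SUP_add_left[symmetric]) auto
          then have "emeasure Q E + ennreal e \<le> emeasure Q E"
            using inner_regular[OF setsQ Qfin Eb(1)] by simp
          moreover have "emeasure Q E < emeasure Q E + ennreal e"
            using fin e by (simp add: ennreal_add_less_top less_top)
          ultimately show False by simp
        qed
        then obtain K where K: "K \<subseteq> E" "compact K" "emeasure Q E \<le> emeasure Q K + ennreal e" by blast
        have Kb: "K \<in> sets borel" using K by (intro borel_compact)
        have "emeasure Q K = emeasure P K" using Q[OF Kb] K Eb by (simp add: Int_absorb2)
        then have "?TV E \<le> ?TV K + ennreal e"
          using K E Eb Kb QE by (intro split) (auto simp: sets_circle_borel)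
        also have "?TV K \<le> (SUP K\<in>{K. compact K \<and> K \<subseteq> E}. ?TV K)" using K by (intro SUP_upper) auto
        finally show "?TV E \<le> (SUP K\<in>{K. compact K \<and> K \<subseteq> E}. ?TV K) + ennreal e" by (simp add: add_right_mono)
      qed
    qed
    show ?thesis using outer inner by blast
  qed
  then show ?thesis using \<mu> unfolding regular_complex_measure_def by blast
qed

subsection \<open>Functionals on the continuous functions on the circle\<close>

lemma integrable_continuous_circle:
  fixes f :: "complex \<Rightarrow> complex"
  assumes "finite_measure P" and P: "sets P = sets circle_borel" and f: "continuous_on circle f"
  shows "integrable P f"
proof -
  obtain B where "\<forall>z\<in>circle. cmod (f z) \<le> B" using circle_bound[OF f] ..
  moreover have "f \<in> borel_measurable P"
    unfolding measurable_cong_sets[OF P refl] by (rule borel_measurable_continuous_on_restrict[OF f])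
  ultimately show ?thesis
    using sets_eq_imp_space_eq[OF P]
    by (intro integrable_bounded[OF assms(1), of _ B]) (auto simp: space_restrict_space)
qed

lemma norm_integral_circle_le:
  fixes f :: "complex \<Rightarrow> complex"
  assumes P: "finite_measure P" "sets P = sets circle_borel" and f: "continuous_on circle f"
    and M: "\<And>z. z \<in> circle \<Longrightarrow> cmod (f z) \<le> M"
  shows "cmod (integral\<^sup>L P f) \<le> measure P (space P) * M"
proof -
  interpret finite_measure P by (rule P)
  have "cmod (integral\<^sup>L P f) \<le> integral\<^sup>L P (\<lambda>z. cmod (f z))" by (rule integral_norm_bound)
  also have "\<dots> \<le> integral\<^sup>L P (\<lambda>_. M)"
    using M sets_eq_imp_space_eq[OF P(2)] integrable_continuous_circle[OF P f]
    by (intro integral_mono) (auto simp: space_restrict_space)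
  also have "\<dots> = measure P (space P) * M" by simp
  finally show ?thesis .
qed

lemma bounded_functional_complex_integral:
  assumes \<mu>: "complex_measure circle_borel \<mu>"
  shows "bounded_functional (complex_integral circle_borel \<mu>)"
proof -
  note sgn = complex_measure_Re[OF \<mu>] complex_measure_Im[OF \<mu>]
  define P where "P = jordan_pos circle_borel (\<lambda>E. Re (\<mu> E))"
  define Q where "Q = jordan_pos circle_borel (\<lambda>E. - Re (\<mu> E))"
  define R where "R = jordan_pos circle_borel (\<lambda>E. Im (\<mu> E))"
  define S where "S = jordan_pos circle_borel (\<lambda>E. - Im (\<mu> E))"
  have eq: "complex_integral circle_borel \<mu> f =
      (integral\<^sup>L P f - integral\<^sup>L Q f) + \<i> * (integral\<^sup>L R f - integral\<^sup>L S f)" for f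
    by (simp add: complex_integral_def P_def Q_def R_def S_def)
  have fin: "finite_measure P" "finite_measure Q" "finite_measure R" "finite_measure S"
    using sgn[THEN finite_jordan_pos] sgn[THEN signed_measure_uminus, THEN finite_jordan_pos]
    by (simp_all add: P_def Q_def R_def S_def)
  have sets: "sets P = sets circle_borel" "sets Q = sets circle_borel"
      "sets R = sets circle_borel" "sets S = sets circle_borel"
    by (simp_all add: P_def Q_def R_def S_def)
  note int = integrable_continuous_circle[OF fin(1) sets(1)] integrable_continuous_circle[OF fin(2) sets(2)]
    integrable_continuous_circle[OF fin(3) sets(3)] integrable_continuous_circle[OF fin(4) sets(4)]
  note le = norm_integral_circle_le[OF fin(1) sets(1)] norm_integral_circle_le[OF fin(2) sets(2)]
    norm_integral_circle_le[OF fin(3) sets(3)] norm_integral_circle_le[OF fin(4) sets(4)]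
  define C where "C = (measure P (space P) + measure Q (space Q)) + (measure R (space R) + measure S (space S))"
  have "cmod (complex_integral circle_borel \<mu> f) \<le> C * M"
    if f: "continuous_on circle f" "\<forall>z\<in>circle. cmod (f z) \<le> M" for f M
  proof -
    have "cmod (complex_integral circle_borel \<mu> f) \<le>
        (cmod (integral\<^sup>L P f) + cmod (integral\<^sup>L Q f)) + (cmod (integral\<^sup>L R f) + cmod (integral\<^sup>L S f))"
      unfolding eq
      by (intro order_trans[OF norm_triangle_ineq] add_mono norm_triangle_ineq4)
        (simp add: norm_mult norm_triangle_ineq4)
    also have "\<dots> \<le> (measure P (space P) * M + measure Q (space Q) * M) +
        (measure R (space R) * M + measure S (space S) * M)"
      using f(2) by (intro add_mono le[OF f(1)]) auto
    also have "\<dots> = C * M" by (simp add: C_def algebra_simps)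
    finally show ?thesis .
  qed
  then have "\<exists>C. \<forall>f M. continuous_on circle f \<longrightarrow> (\<forall>z\<in>circle. cmod (f z) \<le> M) \<longrightarrow>
      cmod (complex_integral circle_borel \<mu> f) \<le> C * M" by blast
  then show ?thesis
    unfolding bounded_functional_def using int by (simp add: eq algebra_simps)
qed

lemma cmod_cis_diff_le: "cmod (cis a - cis b) \<le> \<bar>a - b\<bar>"
proof -
  have "cis a - cis b = cis b * (exp (\<i> * of_real (a - b)) - 1)"
    by (simp only: cis_conv_exp[symmetric] right_diff_distrib cis_mult) simp
  then have "cmod (cis a - cis b) = 2 * \<bar>sin ((a - b) / 2)\<bar>" by (simp only: norm_mult norm_cis dist_exp_i_1)
  also have "\<dots> \<le> 2 * \<bar>(a - b) / 2\<bar>" by (intro mult_left_mono abs_sin_x_le_abs_x) simp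
  finally show ?thesis by simp
qed

text \<open>The factor 8 exceeds \<open>2 * pi\<close>, so the bumps around the \<open>N\<close>-th roots of unity cover the circle.\<close>

lemma circle_partition_of_unity:
  assumes N: "0 < N"
  obtains \<phi> :: "nat \<Rightarrow> complex \<Rightarrow> real" where
    "\<And>k. continuous_on circle (\<phi> k)" "\<And>k z. z \<in> circle \<Longrightarrow> 0 \<le> \<phi> k z"
    "\<And>z. z \<in> circle \<Longrightarrow> (\<Sum>k<N. \<phi> k z) = 1"
    "\<And>k z. \<phi> k z \<noteq> 0 \<Longrightarrow> cmod (z - cis (2 * pi * (real k / real N))) < 8 / real N"
proof -
  \<comment> \<open>A tent of radius \<open>8 / real N\<close> around the \<open>k\<close>-th root
    of unity; division by the sum \<open>S\<close> normalises the tents.\<close>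
  define b where "b k z = max 0 (8 / real N - cmod (z - cis (2 * pi * (real k / real N))))" for k z
  define S where "S z = (\<Sum>k<N. b k z)" for z
  have b_cont: "continuous_on circle (b k)" for k
    unfolding b_def by (intro continuous_intros)
  have b_nonneg: "0 \<le> b k z" for k z by (simp add: b_def)
  have S_pos: "0 < S z" if z: "z \<in> circle" for z
  proof -
    define t where "t = Arg2pi z / (2 * pi)"
    have "0 \<le> Arg2pi z" "Arg2pi z < 2 * pi" "is_Arg z (Arg2pi z)" using Arg2pi[of z] by auto
    then have t: "0 \<le> t" "t < 1" "z = cis (2 * pi * t)"
      using z by (auto simp: t_def is_Arg_def cis_conv_exp)
    \<comment> \<open>The root of unity that \<open>z\<close> has reached or passed last; the arc
      between them is at most \<open>2 * pi / real N\<close>.\<close>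
    define k where "k = nat \<lfloor>t * real N\<rfloor>"
    have k0: "0 \<le> \<lfloor>t * real N\<rfloor>" using t by simp
    have k: "real k \<le> t * real N" "t * real N < real k + 1"
      using k0 unfolding k_def by (simp_all add: of_nat_nat)
    have "t * real N < 1 * real N" using t N by (intro mult_strict_right_mono) auto
    then have "real k < real N" using k by linarith
    then have kN: "k < N" by simp
    have "cmod (z - cis (2 * pi * (real k / real N))) \<le> \<bar>2 * pi * t - 2 * pi * (real k / real N)\<bar>"
      unfolding t(3) by (rule cmod_cis_diff_le)
    also have "\<dots> = 2 * pi * \<bar>t * real N - real k\<bar> / real N"
    proof -
      have "2 * pi * t - 2 * pi * (real k / real N) = 2 * pi * (t * real N - real k) / real N"
        using N by (simp add: field_simps)
      then show ?thesis by (simp only: abs_mult abs_divide) simp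
    qed
    also have "\<dots> \<le> 2 * pi * 1 / real N" using k by (intro divide_right_mono mult_left_mono) auto
    also have "\<dots> < 8 / real N" using N pi_less_4 by (intro divide_strict_right_mono) auto
    finally have "0 < b k z" by (simp add: b_def)
    also have "b k z \<le> S z" unfolding S_def using kN b_nonneg by (intro member_le_sum) auto
    finally show ?thesis .
  qed
  show thesis
  proof (rule that[of "\<lambda>k z. b k z / S z"])
    show "continuous_on circle (\<lambda>z. b k z / S z)" for k
      unfolding S_def using S_pos b_cont
      by (intro continuous_intros) (auto simp: S_def less_imp_neq[symmetric] intro: less_imp_neq[symmetric])
    show "0 \<le> b k z / S z" if "z \<in> circle" for k z using S_pos[OF that] b_nonneg[of k z] by simp
    show "(\<Sum>k<N. b k z / S z) = 1" if "z \<in> circle" for z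
      using S_pos[OF that] by (simp add: sum_divide_distrib[symmetric] S_def)
    show "cmod (z - cis (2 * pi * (real k / real N))) < 8 / real N" if "b k z / S z \<noteq> 0" for k z
      using that by (auto simp: b_def max_def split: if_splits)
  qed
qed

context
  fixes \<sigma> :: "(complex \<Rightarrow> complex) \<Rightarrow> complex" and C :: real
  assumes \<sigma>: "bounded_functional \<sigma>"
    and \<sigma>_bound: "\<And>f M. continuous_on circle f \<Longrightarrow> (\<forall>z\<in>circle. cmod (f z) \<le> M) \<Longrightarrow> cmod (\<sigma> f) \<le> C * M"
begin

lemma functional_add: "continuous_on circle f \<Longrightarrow> continuous_on circle g \<Longrightarrow> \<sigma> (\<lambda>z. f z + g z) = \<sigma> f + \<sigma> g"
  and functional_scale: "continuous_on circle f \<Longrightarrow> \<sigma> (\<lambda>z. c * f z) = c * \<sigma> f"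
  using \<sigma> unfolding bounded_functional_def by blast+

lemma functional_diff:
  assumes f: "continuous_on circle f" and g: "continuous_on circle g"
  shows "\<sigma> (\<lambda>z. f z - g z) = \<sigma> f - \<sigma> g"
  using functional_add[OF f, of "\<lambda>z. - 1 * g z"] functional_scale[OF g, of "- 1"] g
  by (simp add: continuous_on_minus)

lemma functional_sum:
  assumes "finite I" "\<And>i. i \<in> I \<Longrightarrow> continuous_on circle (f i)"
  shows "\<sigma> (\<lambda>z. \<Sum>i\<in>I. c i * f i z) = (\<Sum>i\<in>I. c i * \<sigma> (f i))"
  using assms
proof (induction I rule: finite_induct)
  case empty
  show ?case using functional_scale[of "\<lambda>_. 0" 0] by simp
next
  case (insert i I)
  have "\<sigma> (\<lambda>z. c i * f i z + (\<Sum>i\<in>I. c i * f i z)) = \<sigma> (\<lambda>z. c i * f i z) + \<sigma> (\<lambda>z. \<Sum>i\<in>I. c i * f i z)"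
    using insert.prems by (intro functional_add continuous_intros) auto
  then show ?case using insert functional_scale[of "f i" "c i"] by simp
qed

lemma functional_cong:
  assumes "continuous_on circle f" "continuous_on circle g" "\<And>z. z \<in> circle \<Longrightarrow> f z = g z"
  shows "\<sigma> f = \<sigma> g"
  using \<sigma>_bound[of "\<lambda>z. f z - g z" 0] functional_diff[OF assms(1,2)] assms
  by (simp add: continuous_on_diff)

text \<open>Conjugate signs rotate the weights to their moduli, and the corresponding combination of
  the \<open>\<phi> k\<close> has modulus at most 1 on the circle.\<close>

lemma functional_weights_bound:
  fixes \<phi> :: "nat \<Rightarrow> complex \<Rightarrow> real"
  assumes \<phi>: "\<And>k. continuous_on circle (\<phi> k)" "\<And>k z. z \<in> circle \<Longrightarrow> 0 \<le> \<phi> k z"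
    "\<And>z. z \<in> circle \<Longrightarrow> (\<Sum>k<N. \<phi> k z) = 1"
  shows "(\<Sum>k<N. cmod (\<sigma> (\<lambda>z. of_real (\<phi> k z)))) \<le> C"
proof -
  let ?a = "\<lambda>k. \<sigma> (\<lambda>z. of_real (\<phi> k z))"
  let ?f = "\<lambda>z. \<Sum>k<N. cnj (sgn (?a k)) * of_real (\<phi> k z)"
  have cont: "continuous_on circle (\<lambda>z. complex_of_real (\<phi> k z))" for k
    by (intro continuous_intros \<phi>)
  have cnj_sgn: "cnj (sgn a) * a = of_real (cmod a)" for a :: complex
    by (cases "a = 0") (auto simp: sgn_div_norm complex_norm_square[symmetric] scaleR_conv_of_real mult.commute power2_eq_square field_simps)
  have "of_real (\<Sum>k<N. cmod (?a k)) = (\<Sum>k<N. cnj (sgn (?a k)) * ?a k)"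
    unfolding of_real_sum by (rule sum.cong[OF refl]) (rule cnj_sgn[symmetric])
  also have "\<dots> = \<sigma> ?f" by (rule functional_sum[symmetric]) (use cont in auto)
  finally have eq: "of_real (\<Sum>k<N. cmod (?a k)) = \<sigma> ?f" .
  have "cmod (\<sigma> ?f) \<le> C * 1"
  proof (rule \<sigma>_bound)
    show "continuous_on circle ?f" by (intro continuous_intros cont)
    show "\<forall>z\<in>circle. cmod (?f z) \<le> 1"
    proof
      fix z :: complex assume z: "z \<in> circle"
      have "cmod (?f z) \<le> (\<Sum>k<N. cmod (cnj (sgn (?a k)) * of_real (\<phi> k z)))" by (rule norm_sum)
      also have "\<dots> \<le> (\<Sum>k<N. \<phi> k z)"
        using \<phi>(2)[OF z] by (intro sum_mono) (auto simp: norm_mult norm_sgn)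
      finally show "cmod (?f z) \<le> 1" by (simp add: \<phi>(3)[OF z])
    qed
  qed
  moreover have "cmod (\<sigma> ?f) = (\<Sum>k<N. cmod (?a k))"
    unfolding eq[symmetric] norm_of_real by (rule abs_of_nonneg) (rule sum_nonneg, simp)
  ultimately show ?thesis by simp
qed

text \<open>Each \<open>\<phi> n k\<close> lives close to its root of unity, so by uniform
  continuity the combinations with the values of \<open>f\<close> at the roots tend to
  \<open>f\<close> uniformly. \<open>Suc n\<close> avoids an empty partition.\<close>

lemma functional_riemann_sums:
  fixes \<phi> :: "nat \<Rightarrow> nat \<Rightarrow> complex \<Rightarrow> real"
  assumes \<phi>: "\<And>n k. continuous_on circle (\<phi> n k)" "\<And>n k z. z \<in> circle \<Longrightarrow> 0 \<le> \<phi> n k z"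
    "\<And>n z. z \<in> circle \<Longrightarrow> (\<Sum>k<Suc n. \<phi> n k z) = 1"
    "\<And>n k z. \<phi> n k z \<noteq> 0 \<Longrightarrow> cmod (z - cis (2 * pi * (real k / real (Suc n)))) < 8 / real (Suc n)"
    and f: "continuous_on circle f"
  shows "(\<lambda>n. \<Sum>k<Suc n. f (cis (2 * pi * (real k / real (Suc n)))) * \<sigma> (\<lambda>z. of_real (\<phi> n k z))) \<longlonglongrightarrow> \<sigma> f"
proof -
  let ?z = "\<lambda>n k. cis (2 * pi * (real k / real (Suc n)))"
  let ?g = "\<lambda>n z. \<Sum>k<Suc n. f (?z n k) * of_real (\<phi> n k z)"
  have C0: "0 \<le> C" using order_trans[OF norm_ge_zero \<sigma>_bound[of "\<lambda>_. 0" 1]] by simp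
  have cont: "continuous_on circle (\<lambda>z. complex_of_real (\<phi> n k z))" for n k
    by (intro continuous_intros \<phi>)
  have g_cont: "continuous_on circle (?g n)" for n by (intro continuous_intros cont)
  have g: "\<sigma> (?g n) = (\<Sum>k<Suc n. f (?z n k) * \<sigma> (\<lambda>z. of_real (\<phi> n k z)))" for n
    by (rule functional_sum) (use cont in auto)
  have uc: "uniformly_continuous_on circle f"
    by (rule compact_uniformly_continuous[OF f]) simp
  have "(\<lambda>n. \<sigma> (?g n)) \<longlonglongrightarrow> \<sigma> f"
    unfolding lim_sequentially
  proof (intro allI impI)
    fix e :: real assume e: "0 < e"
    define e' where "e' = e / (C + 1)"
    have e': "0 < e'" using e C0 by (simp add: e'_def)
    obtain d where d: "0 < d" "\<forall>u\<in>circle. \<forall>v\<in>circle. dist v u < d \<longrightarrow> dist (f v) (f u) < e'"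
      using uc e' unfolding uniformly_continuous_on_def by meson
    obtain n0 where n0: "8 / d < real n0" using reals_Archimedean2 by blast
    show "\<exists>n0. \<forall>n\<ge>n0. dist (\<sigma> (?g n)) (\<sigma> f) < e"
    proof (intro exI allI impI)
      fix n assume n: "n0 \<le> n"
      have "8 / d < real (Suc n)" using n n0 by linarith
      then have small: "8 / real (Suc n) < d" using d(1) by (simp add: field_simps)
      have "cmod (\<sigma> (\<lambda>z. ?g n z - f z)) \<le> C * e'"
      proof (rule \<sigma>_bound)
        show "continuous_on circle (\<lambda>z. ?g n z - f z)" by (intro continuous_on_diff g_cont f)
        show "\<forall>z\<in>circle. cmod (?g n z - f z) \<le> e'"
        proof
          fix z :: complex assume z: "z \<in> circle"
          have "?g n z - f z = ?g n z - f z * of_real (\<Sum>k<Suc n. \<phi> n k z)" by (simp only: \<phi>(3)[OF z]) simp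
          also have "\<dots> = (\<Sum>k<Suc n. (f (?z n k) - f z) * of_real (\<phi> n k z))"
            unfolding of_real_sum sum_distrib_left left_diff_distrib sum_subtractf ..
          finally have "cmod (?g n z - f z) \<le> (\<Sum>k<Suc n. cmod ((f (?z n k) - f z) * of_real (\<phi> n k z)))"
            by (simp only: norm_sum)
          also have "\<dots> \<le> (\<Sum>k<Suc n. e' * \<phi> n k z)"
          proof (rule sum_mono)
            fix k
            show "cmod ((f (?z n k) - f z) * of_real (\<phi> n k z)) \<le> e' * \<phi> n k z"
            proof (cases "\<phi> n k z = 0")
              case False
              have "dist (?z n k) z < d" using \<phi>(4)[OF False] small by (simp add: dist_norm norm_minus_commute)
              then have "cmod (f (?z n k) - f z) \<le> e'" using d(2) z by (auto simp: dist_norm intro: less_imp_le)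
              then show ?thesis using \<phi>(2)[OF z] by (simp add: norm_mult mult_right_mono)
            qed simp
          qed
          also have "\<dots> = e'" unfolding sum_distrib_left[symmetric] \<phi>(3)[OF z] by simp
          finally show "cmod (?g n z - f z) \<le> e'" .
        qed
      qed
      also have "C * e' < e" using e C0 by (simp add: e'_def field_simps)
      finally show "dist (\<sigma> (?g n)) (\<sigma> f) < e"
        unfolding dist_norm using functional_diff[OF g_cont f, of n] by simp
    qed
  qed
  then show ?thesis unfolding g .
qed

end

subsection \<open>The Riesz representation theorem on the circle\<close>

text \<open>The mass missing to 1 is put at 0, which \<open>cis (2 * pi * t)\<close> sends to the
  point 1 of the circle, so that selection theorems for probability measures apply. The half-open
  interval has the shape used by \<open>tight\<close> and begins at -1 in order to contain
  0.\<close>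

lemma discrete_distribution:
  fixes v :: "nat \<Rightarrow> real" and t :: "nat \<Rightarrow> real"
  assumes v: "\<And>k. k < N \<Longrightarrow> 0 \<le> v k" "(\<Sum>k<N. v k) \<le> 1"
    and t: "\<And>k. k < N \<Longrightarrow> 0 \<le> t k \<and> t k \<le> 1"
  obtains p where "real_distribution p" "measure p {- 1<..1} = 1"
    "\<And>g :: real \<Rightarrow> complex. g \<in> borel_measurable borel \<Longrightarrow>
      integral\<^sup>L p g = (\<Sum>k<N. of_real (v k) * g (t k)) + of_real (1 - (\<Sum>k<N. v k)) * g 0"
proof -
  define v' where "v' k = (if k < N then v k else 1 - (\<Sum>k<N. v k))" for k
  define t' where "t' k = (if k < N then t k else 0)" for k
  have v': "0 \<le> v' k" for k using v by (simp add: v'_def)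
  have sum_v': "(\<Sum>k\<le>N. v' k) = 1"
    by (simp add: lessThan_Suc_atMost[symmetric] v'_def)
  define P where "P = point_measure {..N} (\<lambda>k. ennreal (v' k))"
  have meas: "t' \<in> measurable P borel" by (simp add: P_def measurable_point_measure_eq1)
  have spP: "space P = {..N}" by (simp add: P_def space_point_measure)
  have total: "emeasure P {..N} = 1"
    unfolding P_def using v' by (simp add: emeasure_point_measure_finite sum_ennreal sum_v')
  have "prob_space P" by (rule prob_spaceI) (simp add: spP total)
  then have prob: "prob_space (distr P borel t')" by (rule prob_space.prob_space_distr) (rule meas)
  show thesis
  proof (rule that[of "distr P borel t'"])
    show "real_distribution (distr P borel t')"
      using prob by (simp add: real_distribution_def real_distribution_axioms_def)
    have "t' -` {- 1<..1} \<inter> {..N} = {..N}" using t by (auto simp: t'_def) (smt (verit, best) t)+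
    then have "emeasure (distr P borel t') {- 1<..1} = 1"
      by (simp add: emeasure_distr[OF meas] spP total)
    then show "measure (distr P borel t') {- 1<..1} = 1" by (simp add: measure_def)
    fix g :: "real \<Rightarrow> complex" assume g: "g \<in> borel_measurable borel"
    have "integral\<^sup>L (distr P borel t') g = integral\<^sup>L P (\<lambda>k. g (t' k))" by (rule integral_distr[OF meas g])
    also have "\<dots> = (\<Sum>k\<le>N. v' k *\<^sub>R g (t' k))"
      unfolding P_def using v' by (intro lebesgue_integral_point_measure_finite) auto
    also have "\<dots> = (\<Sum>k<N. of_real (v k) * g (t k)) + of_real (1 - (\<Sum>k<N. v k)) * g 0"
      by (simp add: lessThan_Suc_atMost[symmetric] v'_def t'_def scaleR_conv_of_real)
    finally show "integral\<^sup>L (distr P borel t') g =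
      (\<Sum>k<N. of_real (v k) * g (t k)) + of_real (1 - (\<Sum>k<N. v k)) * g 0" .
  qed
qed

lemma weak_conv_m_subseq: "weak_conv_m X M \<Longrightarrow> strict_mono r \<Longrightarrow> weak_conv_m (X \<circ> r) M"
  unfolding weak_conv_m_def weak_conv_def
  using LIMSEQ_subseq_LIMSEQ[of "\<lambda>n. cdf (X n) _" _ r] by (simp add: comp_def)

text \<open>Subsequences of convergent sequences keep their limits, so the finitely many sequences
  can be treated one after another.\<close>

lemma common_weakly_convergent_subsequence:
  fixes p :: "nat \<Rightarrow> nat \<Rightarrow> real measure"
  assumes tight: "\<And>j. j < k \<Longrightarrow> tight (p j)"
  shows "\<exists>r M. strict_mono (r :: nat \<Rightarrow> nat) \<and> (\<forall>j<k. real_distribution (M j) \<and> weak_conv_m (p j \<circ> r) (M j))"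
  using tight
proof (induction k)
  case 0
  show ?case by (intro exI[of _ id]) (simp add: strict_mono_id)
next
  case (Suc k)
  then obtain r M where r: "strict_mono (r :: nat \<Rightarrow> nat)"
    and M: "\<forall>j<k. real_distribution (M j) \<and> weak_conv_m (p j \<circ> r) (M j)" by fastforce
  obtain r' N where r': "strict_mono (r' :: nat \<Rightarrow> nat)"
    and N: "real_distribution N" "weak_conv_m (p k \<circ> r \<circ> r') N"
    using tight_imp_convergent_subsubsequence[OF Suc.prems[of k] r] by auto
  show ?case
  proof (intro exI[of _ "r \<circ> r'"] exI[of _ "M(k := N)"] conjI allI impI)
    show "strict_mono (r \<circ> r')" by (rule strict_mono_o[OF r r'])
    fix j assume j: "j < Suc k"
    show "real_distribution ((M(k := N)) j)" using M N j by (auto simp: less_Suc_eq)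
    show "weak_conv_m (p j \<circ> (r \<circ> r')) ((M(k := N)) j)"
    proof (cases "j = k")
      case True
      then show ?thesis using N by (simp add: comp_assoc)
    next
      case False
      then have "j < k" using j by simp
      then show ?thesis using weak_conv_m_subseq[OF _ r'] M False by (simp add: comp_assoc[symmetric])
    qed
  qed
qed

text \<open>For \<open>j = 0, 1, 2, 3\<close> these are the positive parts of \<open>Re a\<close>,
  \<open>Im a\<close>, \<open>- Re a\<close> and \<open>- Im a\<close>.\<close>

definition half_axis_part :: "nat \<Rightarrow> complex \<Rightarrow> real" where
  "half_axis_part j a = max 0 (Re (a * cnj (\<i> ^ j)))"

lemma half_axis_part_nonneg: "0 \<le> half_axis_part j a"
  by (simp add: half_axis_part_def)

lemma half_axis_part_le: "half_axis_part j a \<le> cmod a"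
proof -
  have "Re (a * cnj (\<i> ^ j)) \<le> cmod (a * cnj (\<i> ^ j))" by (rule complex_Re_le_cmod)
  also have "\<dots> = cmod a" by (simp add: norm_mult norm_power)
  finally show ?thesis by (simp add: half_axis_part_def)
qed

lemma lessThan_4: "{..<4::nat} = {0, 1, 2, 3}"
  by auto

lemma half_axis_decomposition: "(\<Sum>j<4. \<i> ^ j * of_real (half_axis_part j a)) = a"
  unfolding lessThan_4
  by (simp add: half_axis_part_def power3_eq_cube complex_eq_iff max_def)

lemma sum_i_powers: "(\<Sum>j<4::nat. \<i> ^ j) = 0"
  unfolding lessThan_4 by (simp add: power3_eq_cube)

text \<open>A functional is the limit of its Riemann sums over the roots of unity.  Along the half-axes these
  are integrals against measures of bounded mass, completed to probability measures by point masses at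
  1 that cancel up to \<open>\<sigma> 1\<close>; Helly selection yields the limit measures.\<close>

lemma riesz_representation_circle:
  assumes \<sigma>: "bounded_functional \<sigma>"
  shows "\<exists>\<mu>. complex_measure circle_borel \<mu> \<and>
    (\<forall>f. continuous_on circle f \<longrightarrow> complex_integral circle_borel \<mu> f = \<sigma> f)"
proof -
  obtain C0 where C0: "\<And>f M. continuous_on circle f \<Longrightarrow> (\<forall>z\<in>circle. cmod (f z) \<le> M) \<Longrightarrow> cmod (\<sigma> f) \<le> C0 * M"
    using \<sigma> unfolding bounded_functional_def by blast
  \<comment> \<open>Positive, so that the weights can be divided by it.\<close>
  define C where "C = max C0 1"
  have C: "0 < C" by (simp add: C_def)
  let ?\<zeta> = "\<lambda>n k. cis (2 * pi * (real k / real (Suc n)))"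
  have "\<exists>\<phi> :: nat \<Rightarrow> complex \<Rightarrow> real. (\<forall>k. continuous_on circle (\<phi> k)) \<and> (\<forall>k. \<forall>z\<in>circle. 0 \<le> \<phi> k z) \<and>
      (\<forall>z\<in>circle. (\<Sum>k<Suc n. \<phi> k z) = 1) \<and>
      (\<forall>k z. \<phi> k z \<noteq> 0 \<longrightarrow> cmod (z - ?\<zeta> n k) < 8 / real (Suc n))" for n
    using circle_partition_of_unity[of "Suc n"] by (metis zero_less_Suc)
  then obtain \<phi> :: "nat \<Rightarrow> nat \<Rightarrow> complex \<Rightarrow> real" where
    \<phi>: "\<forall>n. (\<forall>k. continuous_on circle (\<phi> n k)) \<and> (\<forall>k. \<forall>z\<in>circle. 0 \<le> \<phi> n k z) \<and>
      (\<forall>z\<in>circle. (\<Sum>k<Suc n. \<phi> n k z) = 1) \<and>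
      (\<forall>k z. \<phi> n k z \<noteq> 0 \<longrightarrow> cmod (z - ?\<zeta> n k) < 8 / real (Suc n))"
    using choice[of "\<lambda>n \<phi>. (\<forall>k. continuous_on circle (\<phi> k)) \<and> (\<forall>k. \<forall>z\<in>circle. 0 \<le> \<phi> k z) \<and>
      (\<forall>z\<in>circle. (\<Sum>k<Suc n. \<phi> k z) = 1) \<and>
      (\<forall>k z. \<phi> k z \<noteq> 0 \<longrightarrow> cmod (z - ?\<zeta> n k) < 8 / real (Suc n))"] by blast
  then have \<phi>1: "continuous_on circle (\<phi> n k)" and \<phi>2: "z \<in> circle \<Longrightarrow> 0 \<le> \<phi> n k z"
    and \<phi>3: "z \<in> circle \<Longrightarrow> (\<Sum>k<Suc n. \<phi> n k z) = 1"
    and \<phi>4: "\<phi> n k z \<noteq> 0 \<Longrightarrow> cmod (z - ?\<zeta> n k) < 8 / real (Suc n)" for n k z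
    by blast+
  define a where "a n k = \<sigma> (\<lambda>z. of_real (\<phi> n k z))" for n k
  define s where "s = \<sigma> (\<lambda>z. 1)"
  have cont: "continuous_on circle (\<lambda>z. complex_of_real (\<phi> n k z))" for n k
    by (intro continuous_intros \<phi>1)
  have a_bound: "(\<Sum>k<Suc n. cmod (a n k)) \<le> C" for n
    using functional_weights_bound[OF \<sigma> C0, of "\<phi> n" "Suc n"] \<phi>1 \<phi>2 \<phi>3 by (simp add: a_def C_def)
  have a_sum: "(\<Sum>k<Suc n. a n k) = s" for n
  proof -
    have "(\<Sum>k<Suc n. 1 * a n k) = \<sigma> (\<lambda>z. \<Sum>k<Suc n. 1 * of_real (\<phi> n k z))"
      unfolding a_def by (rule functional_sum[OF \<sigma> C0, symmetric]) (use cont in auto)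
    also have "\<dots> = s"
      unfolding s_def
    proof (rule functional_cong[OF \<sigma> C0])
      show "continuous_on circle (\<lambda>z. \<Sum>k<Suc n. 1 * complex_of_real (\<phi> n k z))"
        by (intro continuous_intros \<phi>1)
      show "(\<Sum>k<Suc n. 1 * complex_of_real (\<phi> n k z)) = 1" if "z \<in> circle" for z
        using \<phi>3[OF that, of n] by (metis (no_types, lifting) mult_1 of_real_1 of_real_sum sum.cong)
    qed auto
    finally show ?thesis by simp
  qed
  \<comment> \<open>Non-negative weights of total mass at most 1; the factor
    \<open>C * \<i> ^ j\<close> restores their share of \<open>a n k\<close>.\<close>
  define v where "v j n k = half_axis_part j (a n k) / C" for j n k
  have v_nonneg: "0 \<le> v j n k" for j n k using C by (simp add: v_def half_axis_part_nonneg)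
  have v_sum: "(\<Sum>k<Suc n. v j n k) \<le> 1" for j n
  proof -
    have "(\<Sum>k<Suc n. half_axis_part j (a n k)) \<le> C"
      using a_bound[of n] sum_mono[of "{..<Suc n}" "\<lambda>k. half_axis_part j (a n k)" "\<lambda>k. cmod (a n k)"]
        half_axis_part_le by force
    then show ?thesis unfolding v_def sum_divide_distrib[symmetric] using C by simp
  qed
  define approx where "approx j n p \<longleftrightarrow> real_distribution p \<and> measure p {- 1<..1} = 1 \<and>
    (\<forall>g :: real \<Rightarrow> complex. g \<in> borel_measurable borel \<longrightarrow>
      integral\<^sup>L p g = (\<Sum>k<Suc n. of_real (v j n k) * g (real k / real (Suc n))) +
        of_real (1 - (\<Sum>k<Suc n. v j n k)) * g 0)" for j n p
  have ex: "\<exists>p. approx j n p" for j n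
  proof -
    have t: "0 \<le> real k / real (Suc n) \<and> real k / real (Suc n) \<le> 1" if "k < Suc n" for k
      using that by simp
    show ?thesis
    proof (rule discrete_distribution[OF v_nonneg[of j n] v_sum[of j n] t])
      fix q
      assume "real_distribution q" "measure q {- 1<..1} = 1"
        "\<And>g :: real \<Rightarrow> complex. g \<in> borel_measurable borel \<Longrightarrow>
          integral\<^sup>L q g = (\<Sum>k<Suc n. of_real (v j n k) * g (real k / real (Suc n))) +
            of_real (1 - (\<Sum>k<Suc n. v j n k)) * g 0"
      then have "approx j n q" unfolding approx_def by simp
      then show ?thesis ..
    qed
  qed
  define p where "p j n = (SOME p. approx j n p)" for j n
  have "approx j n (p j n)" for j n unfolding p_def by (rule someI_ex[OF ex])
  then have p: "real_distribution (p j n)" "measure (p j n) {- 1<..1} = 1"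
    and p_int: "g \<in> borel_measurable borel \<Longrightarrow> integral\<^sup>L (p j n) (g :: real \<Rightarrow> complex) =
      (\<Sum>k<Suc n. of_real (v j n k) * g (real k / real (Suc n))) + of_real (1 - (\<Sum>k<Suc n. v j n k)) * g 0"
    for j n g
    unfolding approx_def by simp_all
  have "tight (p j)" for j
    unfolding tight_def
  proof (intro conjI allI impI p(1))
    fix e :: real assume "0 < e"
    then show "\<exists>a b. a < b \<and> (\<forall>n. 1 - e < measure (p j n) {a<..b})"
      by (intro exI[of _ "- 1"] exI[of _ 1]) (simp add: p(2))
  qed
  then obtain r M where r: "strict_mono (r :: nat \<Rightarrow> nat)"
    and M: "\<forall>j<4. real_distribution (M j) \<and> weak_conv_m (p j \<circ> r) (M j)"
    using common_weakly_convergent_subsequence[of 4 p] by blast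
  have \<sigma>_eq: "\<sigma> f = (\<Sum>j<4. of_real C * \<i> ^ j * integral\<^sup>L (M j) (\<lambda>t. f (cis (2 * pi * t)))) + s * f 1"
    if f: "continuous_on circle f" for f
  proof -
    define g where "g t = f (cis (2 * pi * t))" for t
    have g_cont: "continuous_on UNIV g"
      unfolding g_def by (rule continuous_on_compose2[OF f]) (auto intro!: continuous_intros)
    have g_meas: "g \<in> borel_measurable borel" by (rule borel_measurable_continuous_onI[OF g_cont])
    obtain B where "\<forall>z\<in>circle. cmod (f z) \<le> B" using circle_bound[OF f] ..
    then have B: "cmod (g t) \<le> B" for t by (simp add: g_def)
    have sums: "(\<Sum>k<Suc n. f (?\<zeta> n k) * a n k) =
        (\<Sum>j<4. of_real C * \<i> ^ j * integral\<^sup>L (p j n) g) + s * f 1" for n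
    proof -
      have a_v: "a n k = (\<Sum>j<4. of_real C * \<i> ^ j * of_real (v j n k))" for k
        using half_axis_decomposition[of "a n k"] C by (simp add: v_def)
      have "(\<Sum>j<4. of_real C * \<i> ^ j * integral\<^sup>L (p j n) g) =
          (\<Sum>j<4. \<Sum>k<Suc n. of_real C * \<i> ^ j * (of_real (v j n k) * g (real k / real (Suc n)))) +
          (\<Sum>j<4. of_real C * \<i> ^ j * of_real (1 - (\<Sum>k<Suc n. v j n k)) * g 0)"
        unfolding p_int[OF g_meas] distrib_left sum.distrib sum_distrib_left by (simp only: mult.assoc)
      also have "(\<Sum>j<4. \<Sum>k<Suc n. of_real C * \<i> ^ j * (of_real (v j n k) * g (real k / real (Suc n)))) =
          (\<Sum>k<Suc n. \<Sum>j<4. of_real C * \<i> ^ j * (of_real (v j n k) * g (real k / real (Suc n))))"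
        by (rule sum.swap)
      also have "\<dots> = (\<Sum>k<Suc n. f (?\<zeta> n k) * a n k)"
        unfolding a_v sum_distrib_left g_def by (intro sum.cong refl) (simp only: mult_ac)
      \<comment> \<open>The completing masses all sit at 0, that is, at the point 1 of the circle.
        As the four powers of \<open>\<i>\<close> sum to 0, they contribute
        \<open>- s * f 1\<close>, which the added \<open>s * f 1\<close> compensates.\<close>
      also have "(\<Sum>j<4. of_real C * \<i> ^ j * of_real (1 - (\<Sum>k<Suc n. v j n k)) * g 0) = - s * f 1"
      proof -
        have "(\<Sum>j<4. of_real C * \<i> ^ j * of_real (1 - (\<Sum>k<Suc n. v j n k))) =
            of_real C * (\<Sum>j<4::nat. \<i> ^ j) - (\<Sum>j<4. \<Sum>k<Suc n. of_real C * \<i> ^ j * of_real (v j n k))"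
          by (simp only: of_real_diff of_real_1 of_real_sum right_diff_distrib mult_1_right sum_subtractf sum_distrib_left)
        also have "(\<Sum>j<4. \<Sum>k<Suc n. of_real C * \<i> ^ j * of_real (v j n k)) =
            (\<Sum>k<Suc n. \<Sum>j<4. of_real C * \<i> ^ j * of_real (v j n k))" by (rule sum.swap)
        also have "\<dots> = s" unfolding a_v[symmetric] by (rule a_sum)
        finally show ?thesis by (simp only: sum_distrib_right[symmetric] sum_i_powers g_def) simp
      qed
      finally show ?thesis by simp
    qed
    have "(\<lambda>n. \<Sum>k<Suc n. f (?\<zeta> n k) * a n k) \<longlonglongrightarrow> \<sigma> f"
      unfolding a_def by (rule functional_riemann_sums[OF \<sigma> C0 \<phi>1 \<phi>2 \<phi>3 \<phi>4 f])
    then have "(\<lambda>n. (\<Sum>j<4. of_real C * \<i> ^ j * integral\<^sup>L (p j (r n)) g) + s * f 1) \<longlonglongrightarrow> \<sigma> f"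
      unfolding sums using LIMSEQ_subseq_LIMSEQ[OF _ r] by (simp add: comp_def)
    moreover have "(\<lambda>n. (\<Sum>j<4. of_real C * \<i> ^ j * integral\<^sup>L (p j (r n)) g) + s * f 1)
        \<longlonglongrightarrow> (\<Sum>j<4. of_real C * \<i> ^ j * integral\<^sup>L (M j) g) + s * f 1"
    proof (intro tendsto_intros)
      fix j :: nat assume "j \<in> {..<4}"
      then have Mj: "real_distribution (M j)" "weak_conv_m (p j \<circ> r) (M j)" using M by auto
      have "(\<lambda>n. integral\<^sup>L ((p j \<circ> r) n) g) \<longlonglongrightarrow> integral\<^sup>L (M j) g"
        by (rule weak_conv_imp_integral_bdd_continuous_conv[OF _ Mj])
          (use p(1) g_cont B in \<open>auto simp: continuous_on_eq_continuous_at\<close>)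
      then show "(\<lambda>n. integral\<^sup>L (p j (r n)) g) \<longlonglongrightarrow> integral\<^sup>L (M j) g" by simp
    qed
    ultimately show ?thesis unfolding g_def by (rule LIMSEQ_unique)
  qed
  \<comment> \<open>The four limit measures are pushed to the circle; the fifth is the point mass at
    1, which carries the correction \<open>s * f 1\<close>.\<close>
  define m where "m j = (if j < 4 then distr (M j) circle_borel (\<lambda>t. cis (2 * pi * t)) else return circle_borel 1)"
    for j :: nat
  define c where "c j = (if j < 4 then of_real C * \<i> ^ j else s)" for j :: nat
  have cis_meas: "(\<lambda>t. cis (2 * pi * t)) \<in> measurable (M j) circle_borel" if "j < 4" for j
  proof -
    have "(\<lambda>t. cis (2 * pi * t)) \<in> borel_measurable borel"
      by (intro borel_measurable_continuous_onI continuous_intros)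
    moreover have "sets (M j) = sets borel" using M that by (simp add: real_distribution.events_eq_borel)
    ultimately show ?thesis
      by (intro measurable_restrict_space2) (auto cong: measurable_cong_sets)
  qed
  have one: "1 \<in> space circle_borel" by (simp add: space_restrict_space)
  have sets: "sets (m j) = sets circle_borel" for j by (simp add: m_def)
  have fin: "finite_measure (m j)" for j
  proof (cases "j < 4")
    case True
    then have "prob_space (M j)" using M by (simp add: real_distribution_def)
    then have "prob_space (m j)" using True cis_meas by (simp add: m_def prob_space.prob_space_distr)
    then show ?thesis by (simp add: prob_space.finite_measure)
  next
    case False
    then show ?thesis using prob_space_return[OF one] by (simp add: m_def prob_space.finite_measure)
  qed
  have "complex_integral circle_borel (\<lambda>E. \<Sum>j<5. c j * of_real (measure (m j) E)) f = \<sigma> f"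
    if f: "continuous_on circle f" for f
  proof -
    obtain B where B: "\<forall>z\<in>circle. cmod (f z) \<le> B" using circle_bound[OF f] ..
    have f_meas: "f \<in> borel_measurable circle_borel" by (rule borel_measurable_continuous_on_restrict[OF f])
    have five: "{..<5::nat} = insert 4 {..<4}" by auto
    have "complex_integral circle_borel (\<lambda>E. \<Sum>j<5. c j * of_real (measure (m j) E)) f =
        (\<Sum>j<5. c j * integral\<^sup>L (m j) f)"
      by (rule complex_integral_combination[OF _ fin sets f_meas, of _ B])
        (use B in \<open>auto simp: space_restrict_space\<close>)
    also have "\<dots> = (\<Sum>j<4. c j * integral\<^sup>L (m j) f) + c 4 * integral\<^sup>L (m 4) f"
      unfolding five by simp
    also have "(\<Sum>j<4. c j * integral\<^sup>L (m j) f) =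
        (\<Sum>j<4. of_real C * \<i> ^ j * integral\<^sup>L (M j) (\<lambda>t. f (cis (2 * pi * t))))"
      using cis_meas f_meas by (intro sum.cong refl) (simp add: c_def m_def integral_distr)
    also have "c 4 * integral\<^sup>L (m 4) f = s * f 1"
      using integral_return[OF one f_meas] by (simp add: c_def m_def)
    finally show ?thesis unfolding \<sigma>_eq[OF f] .
  qed
  moreover have "complex_measure circle_borel (\<lambda>E. \<Sum>j<5. c j * of_real (measure (m j) E))"
    by (rule complex_measure_combination[OF fin sets])
  ultimately show ?thesis by blast
qed

section \<open>Invariance of measures and of their functionals\<close>

lemma bounded_functional_cong:
  assumes \<tau>: "bounded_functional \<tau>" and eq: "\<And>f. continuous_on circle f \<Longrightarrow> \<sigma> f = \<tau> f"
  shows "bounded_functional \<sigma>"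
  using \<tau> eq unfolding bounded_functional_def
  by (simp add: continuous_on_add continuous_on_mult_left)

text \<open>The unitization adds only constants to the functions that vanish with \<gamma>, and
  every rotation fixes constants.\<close>

lemma (in universal_rotation_algebra) invariant_iff_on_unitization:
  assumes \<mu>: "complex_measure circle_borel \<mu>"
    and eq: "\<And>f. continuous_on circle f \<Longrightarrow> \<sigma> f = complex_integral circle_borel \<mu> f"
  shows "invariant \<sigma> \<longleftrightarrow> invariant_on_unitization \<theta> {z \<in> circle. \<gamma> z = 0} \<mu>"
proof -
  let ?\<tau> = "complex_integral circle_borel \<mu>"
  have add: "?\<tau> (\<lambda>z. f z + g z) = ?\<tau> f + ?\<tau> g" if "continuous_on circle f" "continuous_on circle g" for f g
    using bounded_functional_complex_integral[OF \<mu>] that unfolding bounded_functional_def by blast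
  have rotate: "continuous_on circle (\<lambda>z. f (q * z))" if "continuous_on circle f" for f :: "complex \<Rightarrow> complex"
    by (rule continuous_on_rotate[OF norm_q that])
  show ?thesis
    unfolding invariant_def invariant_on_unitization_def q_def[symmetric]
  proof (intro iffI ballI allI impI)
    fix f
    assume inv: "\<forall>f. continuous_on circle f \<longrightarrow> (\<forall>z\<in>circle. \<gamma> z = 0 \<longrightarrow> f z = 0) \<longrightarrow> \<sigma> (\<lambda>z. f (q * z)) = \<sigma> f"
      and "f \<in> C0_unitization {z \<in> circle. \<gamma> z = 0}"
    then obtain g c where g: "continuous_on circle g" "\<forall>z\<in>circle. \<gamma> z = 0 \<longrightarrow> g z = 0" and f: "f = (\<lambda>z. g z + c)"
      by (auto simp: C0_unitization_def)
    have "?\<tau> (\<lambda>z. g (q * z)) = ?\<tau> g"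
      using inv[rule_format, OF g(1)] g(2) eq[OF g(1)] eq[OF rotate[OF g(1)]] by simp
    then show "?\<tau> (\<lambda>z. f (q * z)) = ?\<tau> f"
      unfolding f by (simp add: add rotate g(1))
  next
    fix f :: "complex \<Rightarrow> complex"
    assume inv: "\<forall>f\<in>C0_unitization {z \<in> circle. \<gamma> z = 0}. ?\<tau> (\<lambda>z. f (q * z)) = ?\<tau> f"
      and f: "continuous_on circle f" "\<forall>z\<in>circle. \<gamma> z = 0 \<longrightarrow> f z = 0"
    have "(\<lambda>z. f z + 0) \<in> C0_unitization {z \<in> circle. \<gamma> z = 0}"
      unfolding C0_unitization_def using f by blast
    then have "?\<tau> (\<lambda>z. f (q * z)) = ?\<tau> f" using inv by simp
    then show "\<sigma> (\<lambda>z. f (q * z)) = \<sigma> f" using eq[OF f(1)] eq[OF rotate[OF f(1)]] by simp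
  qed
qed

theorem proposition3p1:
  fixes \<theta> :: real and \<gamma> :: "complex \<Rightarrow> real" and Y :: "complex set"
    and A :: "'a cstar" and x w :: 'a
  assumes "\<theta> \<notin> \<rat>"
    and "continuous_on circle \<gamma>" and "\<forall>z\<in>circle. 0 \<le> \<gamma> z"
    and "Y = {z \<in> circle. \<gamma> z = 0}"
    and "is_A \<theta> \<gamma> A x w"
  shows "(\<forall>\<mu> \<sigma>. regular_complex_measure \<mu> \<and> invariant_on_unitization \<theta> Y \<mu> \<and>
             (\<forall>f. continuous_on circle f \<longrightarrow> \<sigma> f = complex_integral circle_borel \<mu> f) \<longrightarrow>
             bounded_tracial_functional A (\<lambda>a. \<sigma> (to_function A w (cond_exp A x w a)))) \<and>
         (\<forall>\<psi>. bounded_tracial_functional A \<psi> \<longrightarrow>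
             (\<exists>\<mu> \<sigma>. regular_complex_measure \<mu> \<and> invariant_on_unitization \<theta> Y \<mu> \<and>
                (\<forall>f. continuous_on circle f \<longrightarrow> \<sigma> f = complex_integral circle_borel \<mu> f) \<and>
                (\<forall>a\<in>carrier A. \<psi> a = \<sigma> (to_function A w (cond_exp A x w a)))))"
proof -
  interpret unital_cstar_algebra A using assms(5) by (simp add: is_A_def)
  interpret universal_rotation_algebra A \<theta> \<gamma> x w by unfold_locales (use assms in auto)
  \<comment> \<open>The hypotheses tie \<sigma> to the integral on continuous functions only, so its
    properties are inherited and not obtained from an equality of functionals.\<close>
  have integral: "bounded_functional \<sigma> \<and> (invariant \<sigma> \<longleftrightarrow> invariant_on_unitization \<theta> Y \<mu>)"
    if "complex_measure circle_borel \<mu>"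
      "\<forall>f. continuous_on circle f \<longrightarrow> \<sigma> f = complex_integral circle_borel \<mu> f" for \<mu> \<sigma>
    using bounded_functional_cong[OF bounded_functional_complex_integral[OF that(1)], of \<sigma>]
      invariant_iff_on_unitization[OF that(1), of \<sigma>] that(2) assms(4) by simp
  show ?thesis
  proof (intro conjI allI impI)
    fix \<mu> \<sigma>
    assume \<mu>: "regular_complex_measure \<mu> \<and> invariant_on_unitization \<theta> Y \<mu> \<and>
      (\<forall>f. continuous_on circle f \<longrightarrow> \<sigma> f = complex_integral circle_borel \<mu> f)"
    then have "complex_measure circle_borel \<mu>" by (simp add: regular_complex_measure_def)
    then show "bounded_tracial_functional A (\<lambda>a. \<sigma> (to_function A w (cond_exp A x w a)))"
      using integral[of \<mu> \<sigma>] \<mu> bounded_tracial_of_invariant[of \<sigma>] unfolding T_def by simp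
  next
    fix \<psi> assume \<psi>: "bounded_tracial_functional A \<psi>"
    \<comment> \<open>Chosen as \<psi> after \<open>J\<close> and not as the integral; the two agree
      on continuous functions, and the factorisation through \<open>T\<close> is then
      immediate.\<close>
    let ?\<sigma> = "\<lambda>f. \<psi> (J f)"
    note \<sigma> = bounded_tracial_factor[OF \<psi>]
    obtain \<mu> where \<mu>: "complex_measure circle_borel \<mu>"
      "\<forall>f. continuous_on circle f \<longrightarrow> complex_integral circle_borel \<mu> f = ?\<sigma> f"
      using riesz_representation_circle[OF \<sigma>(1)] by blast
    show "\<exists>\<mu> \<sigma>. regular_complex_measure \<mu> \<and> invariant_on_unitization \<theta> Y \<mu> \<and>
        (\<forall>f. continuous_on circle f \<longrightarrow> \<sigma> f = complex_integral circle_borel \<mu> f) \<and>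
        (\<forall>a\<in>carrier A. \<psi> a = \<sigma> (to_function A w (cond_exp A x w a)))"
    proof (intro exI[of _ \<mu>] exI[of _ ?\<sigma>] conjI)
      show "regular_complex_measure \<mu>" by (rule regular_complex_measureI[OF \<mu>(1)])
      show eq: "\<forall>f. continuous_on circle f \<longrightarrow> ?\<sigma> f = complex_integral circle_borel \<mu> f" using \<mu>(2) by simp
      show "invariant_on_unitization \<theta> Y \<mu>" using integral[OF \<mu>(1) eq] \<sigma>(2) by blast
      show "\<forall>a\<in>carrier A. \<psi> a = ?\<sigma> (to_function A w (cond_exp A x w a))"
        using \<sigma>(3) unfolding T_def by blast
    qed
  qed
qed

end
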